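(* Let $M$ be a manifold with corners, with sheaf of smooth functions $C^\infty_M$, and let $(N,\mathscr{B})$ be a local $C^\infty$-ringed space. Then a map $(f,f_\#):(M,C^\infty_M)\to(N,\mathscr{B})$ of $C^\infty$-ringed spaces induces a map of commutative differential graded algebras $$f^*:\mathbf{\Omega}^\bullet_{\mathscr{B}}(N)\to\mathbf{\Omega}^\bullet_{dR,M}(M)$$ over the $C^\infty$-ring $\mathscr{B}(N)$.
   Context: Manifolds (with corners) are Hausdorff and second countable. A $C^\infty$-ring is a nonempty set $\mathscr{C}$ with, for every $m\ge 0$ and every $g\in C^\infty(\mathbb{R}^m)$, an operation $g_{\mathscr{C}}:\mathscr{C}^m\to\mathscr{C}$, such that coordinate functions act as projections and the operations are compatible with composition of smooth functions; maps of $C^\infty$-rings preserve all operations. Rings of smooth functions are $C^\infty$-rings via composition, as is $\mathbb{R}$ via evaluation. Modules over a $C^\infty$-ring are modules over its underlying commutative unital $\mathbb{R}$-algebra. An $\mathbb{R}$-point of $\mathscr{C}$ is a nonzero map of $C^\infty$-rings $\mathscr{C}\to\mathbb{R}$; $\mathscr{C}$ is local if it has exactly one $\mathbb{R}$-point. A local $C^\infty$-ringed space $(N,\mathscr{B})$ is a topological space with a sheaf of $C^\infty$-rings whose stalks are local. A map $(f,f_\#):(M,\mathscr{A})\to(N,\mathscr{B})$ is a continuous map $f:M\to N$ with a map $f_\#:\mathscr{B}\to f_*\mathscr{A}$ of sheaves of $C^\infty$-rings, where $(f_*\mathscr{S})(U)=\mathscr{S}(f^{-1}(U))$. A $C^\infty$-derivation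 of $\mathscr{C}$ with values in a $\mathscr{C}$-module $\mathscr{M}$ is a map $X:\mathscr{C}\to\mathscr{M}$ with $X(h_{\mathscr{C}}(a_1,\ldots,a_n))=\sum_{i}(\partial_i h)_{\mathscr{C}}(a_1,\ldots,a_n)\cdot X(a_i)$ for all $n>0$, $h\in C^\infty(\mathbb{R}^n)$, $a_i\in\mathscr{C}$. $d_{\mathscr{C}}:\mathscr{C}\to\Omega^1_{\mathscr{C}}$ is the universal $C^\infty$-derivation: every $C^\infty$-derivation $X:\mathscr{C}\to\mathscr{N}$ factors as $\varphi_X\circ d_{\mathscr{C}}$ for a unique $\mathscr{C}$-linear $\varphi_X$. $\Lambda^\bullet\Omega^1_{\mathscr{C}}=\{\Lambda^k\Omega^1_{\mathscr{C}}\}_{k\in\mathbb{Z}}$ is the exterior algebra over $\mathscr{C}$ ($\Lambda^0=\mathscr{C}$, $\Lambda^k=0$ for $k<0$) with the unique degree $+1$ graded derivation $d$ extending $d_{\mathscr{C}}$ with $d\circ d=0$; it is functorial in $\mathscr{C}$. For $(N,\mathscr{B})$, $\mathbf{\Omega}^\bullet_{\mathscr{B}}$ is the sheaf of commutative differential graded algebras (CDGAs) over $\mathscr{B}$ obtained by degreewise sheafifying the presheaf $U\mapsto\Lambda^\bullet\Omega^1_{\mathscr{B}(U)}$ together with its product and differential, and $\mathbf{\Omega}^\bullet_{\mathscr{B}}(N)$ is its CDGA of global sections. $\mathbf{\Omega}^\bullet_{dR,M}$ is the sheaf of CDGAs of ordinary differential forms on $M$ (sections of $\Lambda^\bullet T^*M$)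 with the usual wedge product and exterior derivative, so $\mathbf{\Omega}^\bullet_{dR,M}(M)$ is the algebra of ordinary global differential forms on $M$. Here a CDGA over a $C^\infty$-ring is a sequence of modules over it, indexed by $\mathbb{Z}$, with an associative graded-commutative bilinear product and an $\mathbb{R}$-linear degree $+1$ graded derivation of square zero. A map of CDGAs is linear over the given map of $C^\infty$-rings, preserves products and commutes with the differentials; "over $\mathscr{B}(N)$" means that $\mathbf{\Omega}^\bullet_{dR,M}(M)$ is a $\mathscr{B}(N)$-module via $f_\#:\mathscr{B}(N)\to C^\infty(M)$. *)

theory Defs
  imports "HOL-Analysis.Analysis" "HOL-Algebra.Module" "HOL-Algebra.AbelCoset"
begin

section \<open>Smooth functions on $\mathbb{R}^n$ and on subsets of it\<close>

text \<open>$\mathbb{R}^n$ is the library space \<^term>\<open>Euclidean_space n\<close>, whose points are the sequences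
  vanishing from index \<open>n\<close> on.\<close>

abbreviation Rn :: "nat \<Rightarrow> (nat \<Rightarrow> real) set"
  where "Rn n \<equiv> topspace (Euclidean_space n)"

text \<open>The \<open>i\<close>-th partial derivative of \<open>g\<close> at \<open>x\<close>, taken within \<open>A\<close>: it is two-sided if \<open>A\<close> is open
  in $\mathbb{R}^n$, and one-sided where \<open>x\<close> lies on a boundary face \<open>x i = 0\<close> of a corner.\<close>

definition pd :: "(nat \<Rightarrow> real) set \<Rightarrow> nat \<Rightarrow> ((nat \<Rightarrow> real) \<Rightarrow> real) \<Rightarrow> (nat \<Rightarrow> real) \<Rightarrow> real"
  where "pd A i g x =
    vector_derivative (\<lambda>t. g (x(i := t))) (at (x i) within {t. x(i := t) \<in> A})"

text \<open>\<open>Ck_on k n U\<close> is meant for \<open>U\<close> open in $\mathbb{R}^n$.\<close>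

primrec Ck_on :: "nat \<Rightarrow> nat \<Rightarrow> (nat \<Rightarrow> real) set \<Rightarrow> ((nat \<Rightarrow> real) \<Rightarrow> real) \<Rightarrow> bool"
  where
    "Ck_on 0 n U g \<longleftrightarrow> continuous_map (subtopology (Euclidean_space n) U) euclideanreal g"
  | "Ck_on (Suc k) n U g \<longleftrightarrow>
       continuous_map (subtopology (Euclidean_space n) U) euclideanreal g \<and>
       (\<forall>i<n. (\<forall>x\<in>U. (\<lambda>t. g (x(i := t))) differentiable (at (x i))) \<and> Ck_on k n U (pd U i g))"

text \<open>$C^\infty(\mathbb{R}^m)$. Since HOL functions are total, its elements are represented by functions
  whose values off $\mathbb{R}^m$ are irrelevant.\<close>

definition Cinf :: "nat \<Rightarrow> ((nat \<Rightarrow> real) \<Rightarrow> real) set"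
  where "Cinf m = {g. \<forall>k. Ck_on k m (Rn m) g}"

text \<open>Smoothness on an arbitrary subset: local extendability to smooth functions on open sets.\<close>

definition smooth_on_Rn :: "nat \<Rightarrow> (nat \<Rightarrow> real) set \<Rightarrow> ((nat \<Rightarrow> real) \<Rightarrow> real) \<Rightarrow> bool"
  where "smooth_on_Rn n A g \<longleftrightarrow>
    (\<forall>x\<in>A. \<exists>W h. openin (Euclidean_space n) W \<and> x \<in> W \<and> (\<forall>k. Ck_on k n W h) \<and>
       (\<forall>y\<in>W \<inter> A. g y = h y))"


section \<open>$C^\infty$-rings\<close>

text \<open>The arity \<open>m\<close> of an operation is the length of the list of its arguments, so that \<open>cop C g as\<close>
  is $g_{C}(a_1,\dots,a_m)$ for \<open>g \<in> Cinf (length as)\<close>.\<close>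

record 'c cinf_ring = "'c partial_object" +
  cop :: "((nat \<Rightarrow> real) \<Rightarrow> real) \<Rightarrow> 'c list \<Rightarrow> 'c"

definition is_cinf_ring :: "'c cinf_ring \<Rightarrow> bool"
  where "is_cinf_ring C \<longleftrightarrow>
    carrier C \<noteq> {} \<and>
    (\<forall>as g. set as \<subseteq> carrier C \<longrightarrow> g \<in> Cinf (length as) \<longrightarrow> cop C g as \<in> carrier C) \<and>
    (\<forall>as g h. set as \<subseteq> carrier C \<longrightarrow> g \<in> Cinf (length as) \<longrightarrow> h \<in> Cinf (length as) \<longrightarrow>
       (\<forall>x\<in>Rn (length as). g x = h x) \<longrightarrow> cop C g as = cop C h as) \<and>
    (\<forall>as i. set as \<subseteq> carrier C \<longrightarrow> i < length as \<longrightarrow> cop C (\<lambda>x. x i) as = as ! i) \<and>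
    (\<forall>as g hs. set as \<subseteq> carrier C \<longrightarrow> g \<in> Cinf (length hs) \<longrightarrow> set hs \<subseteq> Cinf (length as) \<longrightarrow>
       cop C (\<lambda>x. g (nth_default 0 (map (\<lambda>h. h x) hs))) as = cop C g (map (\<lambda>h. cop C h as) hs))"

definition cinf_map :: "'c cinf_ring \<Rightarrow> 'd cinf_ring \<Rightarrow> ('c \<Rightarrow> 'd) \<Rightarrow> bool"
  where "cinf_map C D \<phi> \<longleftrightarrow>
    \<phi> \<in> carrier C \<rightarrow> carrier D \<and>
    (\<forall>as g. set as \<subseteq> carrier C \<longrightarrow> g \<in> Cinf (length as) \<longrightarrow>
       \<phi> (cop C g as) = cop D g (map \<phi> as))"

definition real_cinf :: "real cinf_ring"
  where "real_cinf = \<lparr>carrier = UNIV, cop = (\<lambda>g as. g (nth_default 0 as))\<rparr>"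

definition R_point :: "'c cinf_ring \<Rightarrow> ('c \<Rightarrow> real) \<Rightarrow> bool"
  where "R_point C \<phi> \<longleftrightarrow>
    \<phi> \<in> extensional (carrier C) \<and> cinf_map C real_cinf \<phi> \<and> (\<exists>a\<in>carrier C. \<phi> a \<noteq> 0)"

definition local_cinf_ring :: "'c cinf_ring \<Rightarrow> bool"
  where "local_cinf_ring C \<longleftrightarrow> is_cinf_ring C \<and> (\<exists>!\<phi>. R_point C \<phi>)"

text \<open>The underlying commutative unital ring; its $\mathbb{R}$-algebra structure is given by the
  constants \<open>cconst C r\<close>, the nullary operations.\<close>

definition alg :: "'c cinf_ring \<Rightarrow> 'c ring"
  where "alg C = \<lparr>carrier = carrier C,
    mult = (\<lambda>a b. cop C (\<lambda>x. x 0 * x 1) [a, b]), one = cop C (\<lambda>x. 1) [],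
    zero = cop C (\<lambda>x. 0) [], add = (\<lambda>a b. cop C (\<lambda>x. x 0 + x 1) [a, b])\<rparr>"

definition cconst :: "'c cinf_ring \<Rightarrow> real \<Rightarrow> 'c"
  where "cconst C r = cop C (\<lambda>x. r) []"

definition cinf_derivation :: "'c cinf_ring \<Rightarrow> ('c, 'm) module \<Rightarrow> ('c \<Rightarrow> 'm) \<Rightarrow> bool"
  where "cinf_derivation C N X \<longleftrightarrow>
    X \<in> carrier C \<rightarrow> carrier N \<and>
    (\<forall>as h. as \<noteq> [] \<longrightarrow> set as \<subseteq> carrier C \<longrightarrow> h \<in> Cinf (length as) \<longrightarrow>
       X (cop C h as) =
         (\<Oplus>\<^bsub>N\<^esub>i\<in>{..<length as}. cop C (pd (Rn (length as)) i h) as \<odot>\<^bsub>N\<^esub> X (as ! i)))"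


section \<open>Free modules and quotient modules\<close>

text \<open>Modules are the records of \<^theory>\<open>HOL-Algebra.Module\<close>, whose ring fields \<open>mult\<close> and \<open>one\<close> carry no
  meaning for a module.\<close>

definition free_module :: "'r ring \<Rightarrow> 's set \<Rightarrow> ('r, 's \<Rightarrow> 'r) module"
  where "free_module R S = \<lparr>
    carrier = {p. (\<forall>s. p s \<in> carrier R) \<and> (\<forall>s. s \<notin> S \<longrightarrow> p s = \<zero>\<^bsub>R\<^esub>) \<and> finite {s. p s \<noteq> \<zero>\<^bsub>R\<^esub>}},
    mult = undefined, one = undefined,
    zero = (\<lambda>s. \<zero>\<^bsub>R\<^esub>), add = (\<lambda>p q s. p s \<oplus>\<^bsub>R\<^esub> q s), smult = (\<lambda>r p s. r \<otimes>\<^bsub>R\<^esub> p s)\<rparr>"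

definition free_gen :: "'r ring \<Rightarrow> 's \<Rightarrow> 's \<Rightarrow> 'r"
  where "free_gen R s = (\<lambda>t. if t = s then \<one>\<^bsub>R\<^esub> else \<zero>\<^bsub>R\<^esub>)"

definition span_module :: "'r ring \<Rightarrow> ('r, 'm) module \<Rightarrow> 'm set \<Rightarrow> 'm set"
  where "span_module R N S = (\<lambda>H. submodule H R N) hull S"

text \<open>For \<open>r = 0\<close> the set of all \<open>r \<odot> x\<close> with \<open>x\<close> in a coset need not be a whole coset; hence the union.\<close>

definition quot_module :: "('r, 'm) module \<Rightarrow> 'm set \<Rightarrow> ('r, 'm set) module"
  where "quot_module N H = \<lparr>
    carrier = a_rcosets\<^bsub>N\<^esub> H, mult = undefined, one = undefined,
    zero = H, add = (\<lambda>X Y. X <+>\<^bsub>N\<^esub> Y), smult = (\<lambda>r X. \<Union>x\<in>X. H +>\<^bsub>N\<^esub> (r \<odot>\<^bsub>N\<^esub> x))\<rparr>"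

text \<open>The map of free modules that is \<open>\<phi>\<close> on coefficients and \<open>p\<close> on generators.\<close>

definition free_push :: "'d ring \<Rightarrow> 'r ring \<Rightarrow> ('r \<Rightarrow> 'd) \<Rightarrow> ('s \<Rightarrow> 't) \<Rightarrow> ('s \<Rightarrow> 'r) \<Rightarrow> 't \<Rightarrow> 'd"
  where "free_push S R \<phi> p q = (\<lambda>t. \<Oplus>\<^bsub>S\<^esub>s\<in>{s. q s \<noteq> \<zero>\<^bsub>R\<^esub> \<and> p s = t}. \<phi> (q s))"


section \<open>The universal $C^\infty$-derivation\<close>

definition kaehler_rel :: "'c cinf_ring \<Rightarrow> ('c \<Rightarrow> 'c) set"
  where "kaehler_rel C = span_module (alg C) (free_module (alg C) (carrier C))
    {free_gen (alg C) (cop C h as) \<ominus>\<^bsub>free_module (alg C) (carrier C)\<^esub>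
       (\<Oplus>\<^bsub>free_module (alg C) (carrier C)\<^esub>i\<in>{..<length as}.
          cop C (pd (Rn (length as)) i h) as \<odot>\<^bsub>free_module (alg C) (carrier C)\<^esub> free_gen (alg C) (as ! i))
     | h as. as \<noteq> [] \<and> set as \<subseteq> carrier C \<and> h \<in> Cinf (length as)}"

definition kaehler :: "'c cinf_ring \<Rightarrow> ('c, ('c \<Rightarrow> 'c) set) module"
  where "kaehler C = quot_module (free_module (alg C) (carrier C)) (kaehler_rel C)"

definition kaehler_d :: "'c cinf_ring \<Rightarrow> 'c \<Rightarrow> ('c \<Rightarrow> 'c) set"
  where "kaehler_d C a = kaehler_rel C +>\<^bsub>free_module (alg C) (carrier C)\<^esub> free_gen (alg C) a"

definition kaehler_map ::
    "'c cinf_ring \<Rightarrow> 'd cinf_ring \<Rightarrow> ('c \<Rightarrow> 'd) \<Rightarrow> ('c \<Rightarrow> 'c) set \<Rightarrow> ('d \<Rightarrow> 'd) set"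
  where "kaehler_map C D \<phi> X =
    (\<Union>p\<in>X. kaehler_rel D +>\<^bsub>free_module (alg D) (carrier D)\<^esub> free_push (alg D) (alg C) \<phi> \<phi> p)"


subsection \<open>Smooth functions and the underlying ring of a $C^\infty$-ring\<close>

lemma Rn_upd [simp]: "x \<in> Rn n \<Longrightarrow> i < n \<Longrightarrow> x(i := t) \<in> Rn n"
  by (auto simp: topspace_Euclidean_space)

lemma nth_default_Rn [simp]: "nth_default 0 xs \<in> Rn (length xs)"
  by (auto simp: topspace_Euclidean_space nth_default_def)

lemma pd_cong:
  assumes "\<And>y. y \<in> A \<Longrightarrow> g y = h y" "x \<in> A"
  shows "pd A i g x = pd A i h x"
proof -
  have "((\<lambda>t. g (x(i := t))) has_vector_derivative D) (at (x i) within {t. x(i := t) \<in> A}) \<longleftrightarrow>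
        ((\<lambda>t. h (x(i := t))) has_vector_derivative D) (at (x i) within {t. x(i := t) \<in> A})" for D
    by (rule iffI; erule has_vector_derivative_transform[rotated 2]) (use assms in auto)
  then show ?thesis by (simp add: pd_def vector_derivative_def)
qed

lemma pd_Rn: "x \<in> Rn n \<Longrightarrow> i < n \<Longrightarrow> pd (Rn n) i g x = vector_derivative (\<lambda>t. g (x(i := t))) (at (x i))"
  by (simp add: pd_def)

lemma pd_RnI:
  "x \<in> Rn n \<Longrightarrow> i < n \<Longrightarrow> ((\<lambda>t. g (x(i := t))) has_vector_derivative D) (at (x i)) \<Longrightarrow> pd (Rn n) i g x = D"
  by (simp add: pd_Rn vector_derivative_at)

lemma Ck_on_cong:
  "(\<And>y. y \<in> Rn n \<Longrightarrow> g y = h y) \<Longrightarrow> Ck_on k n (Rn n) g \<Longrightarrow> Ck_on k n (Rn n) h"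
proof (induction k arbitrary: g h)
  case 0
  then show ?case by (simp, elim continuous_map_eq) simp
next
  case (Suc k)
  have 1: "Ck_on k n (Rn n) (pd (Rn n) i h)" if "i < n" for i
  proof (rule Suc.IH)
    show "pd (Rn n) i g y = pd (Rn n) i h y" if "y \<in> Rn n" for y
      using Suc.prems(1) that by (rule pd_cong)
    show "Ck_on k n (Rn n) (pd (Rn n) i g)" using Suc.prems(2) that by simp
  qed
  have 2: "(\<lambda>t. h (x(i := t))) = (\<lambda>t. g (x(i := t)))" if "i < n" "x \<in> Rn n" for i x
    by (rule ext) (rule Suc.prems(1)[OF Rn_upd[OF that(2,1)], symmetric])
  have 3: "continuous_map (subtopology (Euclidean_space n) (Rn n)) euclideanreal h"
    by (rule continuous_map_eq[of _ _ g]) (use Suc.prems in simp_all)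
  show ?case using 1 2 3 Suc.prems(2) by simp
qed

lemma Ck_on_Suc: "Ck_on (Suc k) n U g \<Longrightarrow> Ck_on k n U g"
  by (induction k arbitrary: g) auto

lemma Ck_on_const: "Ck_on k n (Rn n) (\<lambda>x. c)"
proof (induction k arbitrary: c)
  case (Suc k)
  have "Ck_on k n (Rn n) (pd (Rn n) i (\<lambda>x. c))" if "i < n" for i
    by (rule Ck_on_cong[OF _ Suc.IH[of 0]]) (simp add: pd_Rn that)
  then show ?case by simp
qed simp

lemma continuous_map_coord: "continuous_map (Euclidean_space n) euclideanreal (\<lambda>x. x i)"
  unfolding Euclidean_space_def
  by (rule continuous_map_from_subtopology) (metis UNIV_I continuous_map_product_coordinates)

lemma Ck_on_coord: "Ck_on k n (Rn n) (\<lambda>x. x j)"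
proof (cases k)
  case (Suc k')
  have "((\<lambda>t. (x(i := t)) j) has_vector_derivative (if i = j then 1 else 0)) (at (x i))" for x :: "nat \<Rightarrow> real" and i
    by (cases "i = j") (auto intro!: derivative_eq_intros simp: has_vector_derivative_id[unfolded id_def])
  then have "pd (Rn n) i (\<lambda>x. x j) x = (if i = j then 1 else 0)" if "x \<in> Rn n" "i < n" for i x
    using that by (intro pd_RnI)
  then have "Ck_on k' n (Rn n) (pd (Rn n) i (\<lambda>x. x j))" if "i < n" for i
    by (intro Ck_on_cong[OF _ Ck_on_const[of k' n "if i = j then 1 else 0"]]) (simp add: that)
  moreover have "(\<lambda>t. (x(i := t)) j) differentiable at (x i)" for x :: "nat \<Rightarrow> real" and i
    by (cases "i = j") auto
  ultimately show ?thesis by (simp add: Suc continuous_map_coord)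
qed (simp add: continuous_map_coord)

lemma Ck_on_add: "Ck_on k n (Rn n) g \<Longrightarrow> Ck_on k n (Rn n) h \<Longrightarrow> Ck_on k n (Rn n) (\<lambda>x. g x + h x)"
proof (induction k arbitrary: g h)
  case (Suc k)
  have "Ck_on k n (Rn n) (pd (Rn n) i (\<lambda>x. g x + h x))" if "i < n" for i
  proof (rule Ck_on_cong[rotated])
    show "Ck_on k n (Rn n) (\<lambda>x. pd (Rn n) i g x + pd (Rn n) i h x)"
      using Suc that by simp
    show "pd (Rn n) i g x + pd (Rn n) i h x = pd (Rn n) i (\<lambda>x. g x + h x) x" if "x \<in> Rn n" for x
      using that \<open>i < n\<close> Suc.prems
      by (intro pd_RnI[symmetric]) (auto simp: pd_Rn vector_derivative_works intro!: has_vector_derivative_add)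
  qed
  then show ?case using Suc.prems by (auto intro: continuous_map_add)
qed (auto intro: continuous_map_add)

lemma Ck_on_mult: "Ck_on k n (Rn n) g \<Longrightarrow> Ck_on k n (Rn n) h \<Longrightarrow> Ck_on k n (Rn n) (\<lambda>x. g x * h x)"
proof (induction k arbitrary: g h)
  case (Suc k)
  have "Ck_on k n (Rn n) (pd (Rn n) i (\<lambda>x. g x * h x))" if "i < n" for i
  proof (rule Ck_on_cong[rotated])
    show "Ck_on k n (Rn n) (\<lambda>x. g x * pd (Rn n) i h x + pd (Rn n) i g x * h x)"
      using Suc that Ck_on_Suc[OF Suc.prems(1)] Ck_on_Suc[OF Suc.prems(2)] by (intro Ck_on_add Suc.IH) auto
    show "g x * pd (Rn n) i h x + pd (Rn n) i g x * h x = pd (Rn n) i (\<lambda>x. g x * h x) x" if "x \<in> Rn n" for x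
    proof -
      have "((\<lambda>t. g (x(i := t)) * h (x(i := t))) has_vector_derivative
          (g (x(i := x i)) * pd (Rn n) i h x + pd (Rn n) i g x * h (x(i := x i)))) (at (x i))"
        using that \<open>i < n\<close> Suc.prems
        by (intro has_vector_derivative_mult) (auto simp: pd_Rn vector_derivative_works)
      then show ?thesis using that \<open>i < n\<close> by (intro pd_RnI[symmetric]) auto
    qed
  qed
  moreover have "(\<lambda>t. g (x(i := t)) * h (x(i := t))) differentiable at (x i)" if "x \<in> Rn n" "i < n" for x i
    using Suc.prems that by (intro differentiable_mult) auto
  ultimately show ?case using Suc.prems by (auto intro: continuous_map_real_mult)
qed (auto intro: continuous_map_real_mult)

lemma Cinf_const [simp, intro]: "(\<lambda>x. c) \<in> Cinf m"
  and Cinf_coord [simp, intro]: "(\<lambda>x. x j) \<in> Cinf m"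
  and Cinf_add [intro]: "g \<in> Cinf m \<Longrightarrow> h \<in> Cinf m \<Longrightarrow> (\<lambda>x. g x + h x) \<in> Cinf m"
  and Cinf_mult [intro]: "g \<in> Cinf m \<Longrightarrow> h \<in> Cinf m \<Longrightarrow> (\<lambda>x. g x * h x) \<in> Cinf m"
  by (simp_all add: Cinf_def Ck_on_const Ck_on_coord Ck_on_add Ck_on_mult)

lemma Cinf_pd: "g \<in> Cinf m \<Longrightarrow> i < m \<Longrightarrow> pd (Rn m) i g \<in> Cinf m"
  unfolding Cinf_def mem_Collect_eq by (metis Ck_on.simps(2))

lemma alg_simps [simp]:
  "carrier (alg C) = carrier C" "a \<otimes>\<^bsub>alg C\<^esub> b = cop C (\<lambda>x. x 0 * x 1) [a, b]"
  "a \<oplus>\<^bsub>alg C\<^esub> b = cop C (\<lambda>x. x 0 + x 1) [a, b]" "\<one>\<^bsub>alg C\<^esub> = cop C (\<lambda>x. 1) []"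
  "\<zero>\<^bsub>alg C\<^esub> = cop C (\<lambda>x. 0) []"
  by (simp_all add: alg_def)

lemma
  assumes C: "is_cinf_ring C" and as: "set as \<subseteq> carrier C"
  shows cop_closed: "g \<in> Cinf (length as) \<Longrightarrow> cop C g as \<in> carrier C"
    and cop_cong: "g \<in> Cinf (length as) \<Longrightarrow> h \<in> Cinf (length as) \<Longrightarrow>
      (\<And>x. x \<in> Rn (length as) \<Longrightarrow> g x = h x) \<Longrightarrow> cop C g as = cop C h as"
    and cop_proj: "i < length as \<Longrightarrow> cop C (\<lambda>x. x i) as = as ! i"
    and cop_comp: "g \<in> Cinf (length hs) \<Longrightarrow> set hs \<subseteq> Cinf (length as) \<Longrightarrow>
       cop C (\<lambda>x. g (nth_default 0 (map (\<lambda>h. h x) hs))) as = cop C g (map (\<lambda>h. cop C h as) hs)"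
proof -
  note c = C[unfolded is_cinf_ring_def]
  show "g \<in> Cinf (length as) \<Longrightarrow> cop C g as \<in> carrier C"
    using c[THEN conjunct2, THEN conjunct1] as by simp
  show "g \<in> Cinf (length as) \<Longrightarrow> h \<in> Cinf (length as) \<Longrightarrow>
      (\<And>x. x \<in> Rn (length as) \<Longrightarrow> g x = h x) \<Longrightarrow> cop C g as = cop C h as"
    using c[THEN conjunct2, THEN conjunct2, THEN conjunct1, rule_format, OF as] by blast
  show "i < length as \<Longrightarrow> cop C (\<lambda>x. x i) as = as ! i"
    using c[THEN conjunct2, THEN conjunct2, THEN conjunct2, THEN conjunct1] as by simp
  show "g \<in> Cinf (length hs) \<Longrightarrow> set hs \<subseteq> Cinf (length as) \<Longrightarrow>
       cop C (\<lambda>x. g (nth_default 0 (map (\<lambda>h. h x) hs))) as = cop C g (map (\<lambda>h. cop C h as) hs)"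
    using c[THEN conjunct2, THEN conjunct2, THEN conjunct2, THEN conjunct2] as by simp
qed

lemma
  assumes C: "is_cinf_ring C" and as: "set as \<subseteq> carrier C"
  shows cop_const: "cop C (\<lambda>x. r) [] = cop C (\<lambda>x. r) as"
    and cop_add: "g \<in> Cinf (length as) \<Longrightarrow> h \<in> Cinf (length as) \<Longrightarrow>
      cop C (\<lambda>x. x 0 + x 1) [cop C g as, cop C h as] = cop C (\<lambda>x. g x + h x) as"
    and cop_mult: "g \<in> Cinf (length as) \<Longrightarrow> h \<in> Cinf (length as) \<Longrightarrow>
      cop C (\<lambda>x. x 0 * x 1) [cop C g as, cop C h as] = cop C (\<lambda>x. g x * h x) as"
  using cop_comp[OF assms, of "\<lambda>x. r" "[]"]
    cop_comp[OF assms, of "\<lambda>x. x 0 + x 1" "[g, h]"] cop_comp[OF assms, of "\<lambda>x. x 0 * x 1" "[g, h]"]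
  by (auto simp: Cinf_add Cinf_mult nth_default_Cons)

lemma cring_alg:
  assumes C: "is_cinf_ring C"
  shows "cring (alg C)"
proof -
  have closed: "cop C (\<lambda>x. x 0 * x 1) [a, b] \<in> carrier C" "cop C (\<lambda>x. x 0 + x 1) [a, b] \<in> carrier C"
     "cop C (\<lambda>x. r) [] \<in> carrier C" if "a \<in> carrier C" "b \<in> carrier C" for a b r
    using that by (auto intro!: cop_closed[OF C] Cinf_add Cinf_mult)
  have c0: "cop C (\<lambda>x. r) [] \<in> carrier C" for r
    by (auto intro!: cop_closed[OF C])
  have X: "\<exists>as. set as \<subseteq> carrier C \<and> length as = 3 \<and> a = cop C (\<lambda>x. x 0) as \<and> b = cop C (\<lambda>x. x 1) as \<and> c = cop C (\<lambda>x. x 2) as"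
    if "a \<in> carrier C" "b \<in> carrier C" "c \<in> carrier C" for a b c
    using that by (intro exI[of _ "[a, b, c]"]) (simp add: cop_proj[OF C])
  note cc = cop_add[OF C] cop_mult[OF C] Cinf_add Cinf_mult
  show ?thesis
  proof (intro cringI abelian_groupI comm_monoidI, goal_cases)
    case (3 x y z)
    then obtain as where "set as \<subseteq> carrier C" "length as = 3" "x = cop C (\<lambda>x. x 0) as" "y = cop C (\<lambda>x. x 1) as" "z = cop C (\<lambda>x. x 2) as"
      using X[of x y z] by auto
    then show ?case by (simp add: cc del: One_nat_def; simp add: algebra_simps)
  next
    case (4 x y)
    then obtain as where "set as \<subseteq> carrier C" "length as = 3" "x = cop C (\<lambda>x. x 0) as" "y = cop C (\<lambda>x. x 1) as"
      using X[of x y y] by auto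
    then show ?case by (simp add: cc del: One_nat_def; simp add: algebra_simps)
  next
    case (5 x)
    then show ?case using cop_add[OF C, of "[x]" "\<lambda>x. 0" "\<lambda>x. x 0"] by (simp add: cop_const[OF C, of "[x]"] cop_proj[OF C])
  next
    case (6 x)
    have i: "(\<lambda>x. (-1) * x 0) \<in> Cinf (length [x])" by (intro Cinf_mult Cinf_const Cinf_coord)
    have "cop C (\<lambda>x. (-1) * x 0) [x] \<in> carrier C" by (rule cop_closed[OF C _ i]) (use 6 in simp)
    moreover have "cop C (\<lambda>x. x 0 + x 1) [cop C (\<lambda>x. (-1) * x 0) [x], cop C (\<lambda>x. x 0) [x]] = cop C (\<lambda>x. (-1) * x 0 + x 0) [x]"
      by (rule cop_add[OF C _ i]) (use 6 in simp_all)
    moreover have "cop C (\<lambda>x. x 0) [x] = x" using 6 by (simp add: cop_proj[OF C])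
    ultimately show ?case using 6 by (intro bexI[of _ "cop C (\<lambda>x. (-1) * x 0) [x]"]) (simp_all add: cop_const[OF C, of "[x]"])
  next
    case (9 x y z)
    then obtain as where "set as \<subseteq> carrier C" "length as = 3" "x = cop C (\<lambda>x. x 0) as" "y = cop C (\<lambda>x. x 1) as" "z = cop C (\<lambda>x. x 2) as"
      using X[of x y z] by auto
    then show ?case by (simp add: cc del: One_nat_def; simp add: algebra_simps)
  next
    case (10 x)
    then show ?case using cop_mult[OF C, of "[x]" "\<lambda>x. 1" "\<lambda>x. x 0"] by (simp add: cop_const[OF C, of "[x]"] cop_proj[OF C])
  next
    case (11 x y)
    then obtain as where "set as \<subseteq> carrier C" "length as = 3" "x = cop C (\<lambda>x. x 0) as" "y = cop C (\<lambda>x. x 1) as"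
      using X[of x y y] by auto
    then show ?case by (simp add: cc del: One_nat_def; simp add: algebra_simps)
  next
    case (12 x y z)
    then obtain as where "set as \<subseteq> carrier C" "length as = 3" "x = cop C (\<lambda>x. x 0) as" "y = cop C (\<lambda>x. x 1) as" "z = cop C (\<lambda>x. x 2) as"
      using X[of x y z] by auto
    then show ?case by (simp add: cc del: One_nat_def; simp add: algebra_simps)
  qed (simp_all add: closed[unfolded One_nat_def] c0)
qed

subsection \<open>Linear maps, free modules and quotient modules\<close>

definition linear_map :: "'r ring \<Rightarrow> ('r, 'm) module \<Rightarrow> ('r, 'n) module \<Rightarrow> ('m \<Rightarrow> 'n) \<Rightarrow> bool"
  where "linear_map R N N' \<phi> \<longleftrightarrow> \<phi> \<in> carrier N \<rightarrow> carrier N' \<and>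
    (\<forall>x\<in>carrier N. \<forall>y\<in>carrier N. \<phi> (x \<oplus>\<^bsub>N\<^esub> y) = \<phi> x \<oplus>\<^bsub>N'\<^esub> \<phi> y) \<and>
    (\<forall>r\<in>carrier R. \<forall>x\<in>carrier N. \<phi> (r \<odot>\<^bsub>N\<^esub> x) = r \<odot>\<^bsub>N'\<^esub> \<phi> x)"

lemma linear_map_simps:
  assumes "linear_map R N N' \<phi>"
  shows "x \<in> carrier N \<Longrightarrow> \<phi> x \<in> carrier N'"
    and "x \<in> carrier N \<Longrightarrow> y \<in> carrier N \<Longrightarrow> \<phi> (x \<oplus>\<^bsub>N\<^esub> y) = \<phi> x \<oplus>\<^bsub>N'\<^esub> \<phi> y"
    and "r \<in> carrier R \<Longrightarrow> x \<in> carrier N \<Longrightarrow> \<phi> (r \<odot>\<^bsub>N\<^esub> x) = r \<odot>\<^bsub>N'\<^esub> \<phi> x"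
  using assms unfolding linear_map_def by (blast+)

lemma linear_map_zero:
  assumes "Module.module R N" "Module.module R N'" "linear_map R N N' \<phi>"
  shows "\<phi> \<zero>\<^bsub>N\<^esub> = \<zero>\<^bsub>N'\<^esub>"
proof -
  interpret N: Module.module R N by fact
  interpret N': Module.module R N' by fact
  have "\<phi> (\<zero>\<^bsub>R\<^esub> \<odot>\<^bsub>N\<^esub> \<zero>\<^bsub>N\<^esub>) = \<zero>\<^bsub>R\<^esub> \<odot>\<^bsub>N'\<^esub> \<phi> \<zero>\<^bsub>N\<^esub>"
    by (rule linear_map_simps(3)[OF assms(3)]) auto
  then show ?thesis using linear_map_simps(1)[OF assms(3), of "\<zero>\<^bsub>N\<^esub>"] by simp
qed

lemma linear_map_minus:
  assumes "Module.module R N" "Module.module R N'" "linear_map R N N' \<phi>" "x \<in> carrier N" "y \<in> carrier N"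
  shows "\<phi> (x \<ominus>\<^bsub>N\<^esub> y) = \<phi> x \<ominus>\<^bsub>N'\<^esub> \<phi> y"
proof -
  interpret N: Module.module R N by fact
  interpret N': Module.module R N' by fact
  have "\<phi> (\<ominus>\<^bsub>N\<^esub> y) \<oplus>\<^bsub>N'\<^esub> \<phi> y = \<zero>\<^bsub>N'\<^esub>"
    using linear_map_simps(2)[OF assms(3), of "\<ominus>\<^bsub>N\<^esub> y" y] assms linear_map_zero[OF assms(1-3)]
    by (simp add: N.M.l_neg)
  then have "\<phi> (\<ominus>\<^bsub>N\<^esub> y) = \<ominus>\<^bsub>N'\<^esub> \<phi> y"
    using linear_map_simps(1)[OF assms(3)] assms(5) by (intro N'.M.minus_equality[symmetric]) auto
  then show ?thesis
    using assms linear_map_simps(2)[OF assms(3), of x "\<ominus>\<^bsub>N\<^esub> y"] by (simp add: a_minus_def)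
qed

lemma linear_map_finsum:
  assumes "Module.module R N" "Module.module R N'" "linear_map R N N' \<phi>"
    and "finite A" "u \<in> A \<rightarrow> carrier N"
  shows "\<phi> (\<Oplus>\<^bsub>N\<^esub>i\<in>A. u i) = (\<Oplus>\<^bsub>N'\<^esub>i\<in>A. \<phi> (u i))"
proof -
  interpret N: Module.module R N by fact
  interpret N': Module.module R N' by fact
  show ?thesis using assms(4,5)
  proof (induction A)
    case empty
    then show ?case using linear_map_zero[OF assms(1-3)] by simp
  next
    case (insert a A)
    then have u: "u a \<in> carrier N" "u \<in> A \<rightarrow> carrier N" by auto
    then have "(\<Oplus>\<^bsub>N\<^esub>i\<in>A. u i) \<in> carrier N" by simp
    moreover have "(\<lambda>i. \<phi> (u i)) \<in> A \<rightarrow> carrier N'" "\<phi> (u a) \<in> carrier N'"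
      using u linear_map_simps(1)[OF assms(3)] by auto
    ultimately show ?case
      using insert u by (simp add: linear_map_simps(2)[OF assms(3)])
  qed
qed

lemma linear_map_comp:
  "linear_map R N N' \<phi> \<Longrightarrow> linear_map R N' N'' \<psi> \<Longrightarrow> linear_map R N N'' (\<lambda>x. \<psi> (\<phi> x))"
  unfolding linear_map_def by (auto simp: Pi_iff)

lemma linear_map_equalizer:
  assumes "Module.module R N" "Module.module R N'" "linear_map R N N' \<phi>" "linear_map R N N' \<psi>"
  shows "submodule {x \<in> carrier N. \<phi> x = \<psi> x} R N"
proof -
  interpret N: Module.module R N by fact
  interpret N': Module.module R N' by fact
  have inv: "\<phi> (\<ominus>\<^bsub>N\<^esub> x) = \<psi> (\<ominus>\<^bsub>N\<^esub> x)" if "x \<in> carrier N" "\<phi> x = \<psi> x" for x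
    using that linear_map_minus[OF assms(1-3) N.M.zero_closed that(1)]
      linear_map_minus[OF assms(1,2,4) N.M.zero_closed that(1)]
      linear_map_zero[OF assms(1-3)] linear_map_zero[OF assms(1,2,4)]
    by (simp add: a_minus_def)
  show ?thesis
    by (rule N.submoduleI)
      (use inv linear_map_zero[OF assms(1-3)] linear_map_zero[OF assms(1,2,4)]
        linear_map_simps[OF assms(3)] linear_map_simps[OF assms(4)] in auto)
qed

lemma span_module_submodule:
  assumes "Module.module R N" "S \<subseteq> carrier N"
  shows "submodule (span_module R N S) R N"
proof -
  interpret N: Module.module R N by fact
  have c: "span_module R N S \<subseteq> carrier N"
    unfolding span_module_def by (rule hull_minimal) (use assms(2) N.carrier_is_submodule in auto)
  note E = N.submoduleE
  show ?thesis
  proof (rule N.submoduleI[OF c])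
    show "\<zero>\<^bsub>N\<^esub> \<in> span_module R N S"
      unfolding span_module_def hull_def
      using submodule.axioms(1)[THEN subgroup.one_closed] by fastforce
  qed (use E(3-5) in \<open>auto simp: span_module_def hull_def\<close>)
qed

lemma span_module_incl: "S \<subseteq> span_module R N S"
  unfolding span_module_def by (rule hull_subset)

lemma span_module_minimal: "submodule H R N \<Longrightarrow> S \<subseteq> H \<Longrightarrow> span_module R N S \<subseteq> H"
  unfolding span_module_def by (rule hull_minimal)

lemma free_module_simps [simp]:
  "p \<in> carrier (free_module R S) \<longleftrightarrow>
     (\<forall>s. p s \<in> carrier R) \<and> (\<forall>s. s \<notin> S \<longrightarrow> p s = \<zero>\<^bsub>R\<^esub>) \<and> finite {s. p s \<noteq> \<zero>\<^bsub>R\<^esub>}"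
  "\<zero>\<^bsub>free_module R S\<^esub> = (\<lambda>s. \<zero>\<^bsub>R\<^esub>)"
  "p \<oplus>\<^bsub>free_module R S\<^esub> q = (\<lambda>s. p s \<oplus>\<^bsub>R\<^esub> q s)"
  "r \<odot>\<^bsub>free_module R S\<^esub> p = (\<lambda>s. r \<otimes>\<^bsub>R\<^esub> p s)"
  by (simp_all add: free_module_def)

lemma module_free_module:
  assumes "cring R"
  shows "Module.module R (free_module R S)"
proof -
  interpret R: cring R by fact
  have fin: "finite {s. p s \<oplus>\<^bsub>R\<^esub> q s \<noteq> \<zero>\<^bsub>R\<^esub>}"
    if "finite {s. p s \<noteq> \<zero>\<^bsub>R\<^esub>}" "finite {s. q s \<noteq> \<zero>\<^bsub>R\<^esub>}" for p q :: "'b \<Rightarrow> 'a"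
    by (rule finite_subset[OF _ finite_UnI[OF that]]) auto
  have fin': "finite {s. r \<otimes>\<^bsub>R\<^esub> p s \<noteq> \<zero>\<^bsub>R\<^esub>}" if "finite {s. p s \<noteq> \<zero>\<^bsub>R\<^esub>}" "r \<in> carrier R" for r and p :: "'b \<Rightarrow> 'a"
    by (rule finite_subset[OF _ that(1)]) (use that(2) in auto)
  show ?thesis
  proof (intro moduleI abelian_groupI, goal_cases)
    case (7 p)
    then show ?case
      by (intro bexI[of _ "\<lambda>s. \<ominus>\<^bsub>R\<^esub> p s"])
        (auto simp: R.l_neg elim!: rev_finite_subset)
  qed (auto simp: fin fin' R.a_ac R.l_distr R.r_distr R.m_assoc assms intro!: ext)
qed

lemma free_gen_closed: "cring R \<Longrightarrow> s \<in> S \<Longrightarrow> free_gen R s \<in> carrier (free_module R S)"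
proof -
  assume "cring R" "s \<in> S"
  interpret R: cring R by fact
  show ?thesis using \<open>s \<in> S\<close>
    by (auto simp: free_gen_def intro: finite_subset[of _ "{s}"])
qed

lemma free_module_induct:
  assumes R: "cring R" and K: "submodule K R (free_module R S)" and gen: "\<And>s. s \<in> S \<Longrightarrow> free_gen R s \<in> K"
  shows "carrier (free_module R S) \<subseteq> K"
proof -
  interpret R: cring R by fact
  interpret F: Module.module R "free_module R S" by (rule module_free_module[OF R])
  note E = F.submoduleE[OF K]
  have "p \<in> K" if "finite T" "p \<in> carrier (free_module R S)" "{s. p s \<noteq> \<zero>\<^bsub>R\<^esub>} \<subseteq> T" for T p
    using that
  proof (induction T arbitrary: p)
    case empty
    then have "p = \<zero>\<^bsub>free_module R S\<^esub>" by auto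
    then show ?case using submodule.axioms(1)[OF K, THEN subgroup.one_closed] by simp
  next
    case (insert t T)
    show ?case
    proof (cases "t \<in> S")
      case True
      let ?q = "p(t := \<zero>\<^bsub>R\<^esub>)"
      have q: "?q \<in> carrier (free_module R S)"
        using insert.prems by (auto elim!: rev_finite_subset)
      have "?q \<in> K" by (rule insert.IH[OF q]) (use insert.prems in auto)
      moreover have "p t \<odot>\<^bsub>free_module R S\<^esub> free_gen R t \<in> K"
        using insert.prems by (intro E(4) gen True) auto
      ultimately have "?q \<oplus>\<^bsub>free_module R S\<^esub> (p t \<odot>\<^bsub>free_module R S\<^esub> free_gen R t) \<in> K"
        by (rule E(5))
      also have "?q \<oplus>\<^bsub>free_module R S\<^esub> (p t \<odot>\<^bsub>free_module R S\<^esub> free_gen R t) = p"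
        using insert.prems by (auto simp: free_gen_def)
      finally show ?thesis .
    next
      case False
      then have "{s. p s \<noteq> \<zero>\<^bsub>R\<^esub>} \<subseteq> T" using insert.prems by auto
      then show ?thesis using insert by blast
    qed
  qed
  then show ?thesis by auto
qed

lemma free_module_lift:
  assumes R: "cring R" and N: "Module.module R N" and X: "X \<in> S \<rightarrow> carrier N"
  shows "\<exists>L. linear_map R (free_module R S) N L \<and> (\<forall>s\<in>S. L (free_gen R s) = X s)"
proof -
  interpret R: cring R by fact
  interpret N: Module.module R N by fact
  interpret F: Module.module R "free_module R S" by (rule module_free_module[OF R])
  define L where "L p = (\<Oplus>\<^bsub>N\<^esub>s\<in>{s. p s \<noteq> \<zero>\<^bsub>R\<^esub>}. p s \<odot>\<^bsub>N\<^esub> X s)" for p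
  have L: "L p = (\<Oplus>\<^bsub>N\<^esub>s\<in>T. p s \<odot>\<^bsub>N\<^esub> X s)"
    if "p \<in> carrier (free_module R S)" "finite T" "T \<subseteq> S" "{s. p s \<noteq> \<zero>\<^bsub>R\<^esub>} \<subseteq> T" for p T
    unfolding L_def
    by (rule N.M.add.finprod_mono_neutral_cong_left) (use that X in \<open>auto simp: Pi_iff subset_iff\<close>)
  have sub: "{s. p s \<noteq> \<zero>\<^bsub>R\<^esub>} \<subseteq> S" if "p \<in> carrier (free_module R S)" for p
    using that by auto
  have closed: "L p \<in> carrier N" if "p \<in> carrier (free_module R S)" for p
    unfolding L_def by (rule N.M.finsum_closed) (use that X in \<open>auto simp: Pi_iff\<close>)
  have add: "L (p \<oplus>\<^bsub>free_module R S\<^esub> q) = L p \<oplus>\<^bsub>N\<^esub> L q"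
    if "p \<in> carrier (free_module R S)" "q \<in> carrier (free_module R S)" for p q
  proof -
    let ?T = "{s. p s \<noteq> \<zero>\<^bsub>R\<^esub>} \<union> {s. q s \<noteq> \<zero>\<^bsub>R\<^esub>}"
    have T: "finite ?T" "?T \<subseteq> S" using that by auto
    have "L (p \<oplus>\<^bsub>free_module R S\<^esub> q) = (\<Oplus>\<^bsub>N\<^esub>s\<in>?T. (p \<oplus>\<^bsub>free_module R S\<^esub> q) s \<odot>\<^bsub>N\<^esub> X s)"
      using that by (intro L F.M.a_closed T) auto
    also have "\<dots> = (\<Oplus>\<^bsub>N\<^esub>s\<in>?T. p s \<odot>\<^bsub>N\<^esub> X s \<oplus>\<^bsub>N\<^esub> q s \<odot>\<^bsub>N\<^esub> X s)"
      using that T X by (intro N.M.finsum_cong') (auto simp: Pi_iff N.smult_l_distr subset_iff)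
    also have "\<dots> = (\<Oplus>\<^bsub>N\<^esub>s\<in>?T. p s \<odot>\<^bsub>N\<^esub> X s) \<oplus>\<^bsub>N\<^esub> (\<Oplus>\<^bsub>N\<^esub>s\<in>?T. q s \<odot>\<^bsub>N\<^esub> X s)"
      using that T X by (intro N.M.finsum_addf) (auto simp: Pi_iff subset_iff)
    also have "\<dots> = L p \<oplus>\<^bsub>N\<^esub> L q"
      using L[OF that(1) T] L[OF that(2) T] by simp
    finally show ?thesis .
  qed
  have smult: "L (r \<odot>\<^bsub>free_module R S\<^esub> p) = r \<odot>\<^bsub>N\<^esub> L p"
    if "p \<in> carrier (free_module R S)" "r \<in> carrier R" for p r
  proof -
    let ?T = "{s. p s \<noteq> \<zero>\<^bsub>R\<^esub>}"
    have T: "finite ?T" "?T \<subseteq> S" using that by auto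
    have "L (r \<odot>\<^bsub>free_module R S\<^esub> p) = (\<Oplus>\<^bsub>N\<^esub>s\<in>?T. (r \<odot>\<^bsub>free_module R S\<^esub> p) s \<odot>\<^bsub>N\<^esub> X s)"
      using that by (intro L F.smult_closed T) auto
    also have "\<dots> = (\<Oplus>\<^bsub>N\<^esub>s\<in>?T. r \<odot>\<^bsub>N\<^esub> (p s \<odot>\<^bsub>N\<^esub> X s))"
      using that T X by (intro N.M.finsum_cong') (auto simp: Pi_iff N.smult_assoc1 subset_iff)
    also have "\<dots> = r \<odot>\<^bsub>N\<^esub> L p"
      unfolding L_def using that T X
      by (intro N.finsum_smult_ldistr[symmetric]) (auto simp: Pi_iff subset_iff)
    finally show ?thesis .
  qed
  have gen: "L (free_gen R s) = X s" if "s \<in> S" for s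
  proof -
    have "L (free_gen R s) = (\<Oplus>\<^bsub>N\<^esub>t\<in>{s}. free_gen R s t \<odot>\<^bsub>N\<^esub> X t)"
      using that by (intro L free_gen_closed R) (auto simp: free_gen_def)
    then show ?thesis using that X by (simp add: free_gen_def Pi_iff)
  qed
  show ?thesis
    using closed add smult gen by (intro exI[of _ L]) (auto simp: linear_map_def simp del: free_module_simps)
qed

lemma
  assumes N: "Module.module R N" and H: "submodule H R N"
  shows module_quot_module: "Module.module R (quot_module N H)"
    and linear_map_quot: "linear_map R N (quot_module N H) (\<lambda>x. H +>\<^bsub>N\<^esub> x)"
    and quot_carrier: "carrier (quot_module N H) = (\<lambda>x. H +>\<^bsub>N\<^esub> x) ` carrier N"
    and quot_eq_iff: "x \<in> carrier N \<Longrightarrow> y \<in> carrier N \<Longrightarrow> H +>\<^bsub>N\<^esub> x = H +>\<^bsub>N\<^esub> y \<longleftrightarrow> x \<ominus>\<^bsub>N\<^esub> y \<in> H"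
proof -
  interpret N: Module.module R N by fact
  interpret H: abelian_subgroup H N
    by (rule abelian_subgroupI3[OF additive_subgroup.intro])
      (use H submodule.axioms(1) N.M.abelian_group_axioms in auto)
  note Hs = H.a_subset
  have smultH: "r \<odot>\<^bsub>N\<^esub> h \<in> H" if "r \<in> carrier R" "h \<in> H" for r h
    using N.submoduleE(4)[OF H that] .
  show car: "carrier (quot_module N H) = (\<lambda>x. H +>\<^bsub>N\<^esub> x) ` carrier N"
    by (auto simp: quot_module_def A_RCOSETS_def')
  show eq: "H +>\<^bsub>N\<^esub> x = H +>\<^bsub>N\<^esub> y \<longleftrightarrow> x \<ominus>\<^bsub>N\<^esub> y \<in> H"
    if "x \<in> carrier N" "y \<in> carrier N" for x y
  proof -
    have "H +>\<^bsub>N\<^esub> x = H +>\<^bsub>N\<^esub> y \<longleftrightarrow> x \<in> H +>\<^bsub>N\<^esub> y"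
      using that by (metis H.a_repr_independence' H.a_rcos_self)
    also have "\<dots> \<longleftrightarrow> x \<ominus>\<^bsub>N\<^esub> y \<in> H"
      using H.a_rcos_module[OF that(2,1)] by (simp add: a_minus_def)
    finally show ?thesis .
  qed
  have addc: "(H +>\<^bsub>N\<^esub> x) \<oplus>\<^bsub>quot_module N H\<^esub> (H +>\<^bsub>N\<^esub> y) = H +>\<^bsub>N\<^esub> (x \<oplus>\<^bsub>N\<^esub> y)"
    if "x \<in> carrier N" "y \<in> carrier N" for x y
    using H.a_rcos_sum[OF that] by (simp add: quot_module_def)
  have smc: "r \<odot>\<^bsub>quot_module N H\<^esub> (H +>\<^bsub>N\<^esub> x) = H +>\<^bsub>N\<^esub> (r \<odot>\<^bsub>N\<^esub> x)"
    if rx: "r \<in> carrier R" "x \<in> carrier N" for r x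
  proof -
    have "H +>\<^bsub>N\<^esub> (r \<odot>\<^bsub>N\<^esub> y) = H +>\<^bsub>N\<^esub> (r \<odot>\<^bsub>N\<^esub> x)" if y: "y \<in> H +>\<^bsub>N\<^esub> x" for y
    proof -
      obtain h where h: "h \<in> H" "y = h \<oplus>\<^bsub>N\<^esub> x" using y by (auto simp: a_r_coset_def')
      then have hc: "h \<in> carrier N" using Hs by auto
      have "r \<odot>\<^bsub>N\<^esub> y = r \<odot>\<^bsub>N\<^esub> h \<oplus>\<^bsub>N\<^esub> r \<odot>\<^bsub>N\<^esub> x"
        using h hc rx by (simp add: N.smult_r_distr)
      then have "r \<odot>\<^bsub>N\<^esub> y \<in> H +>\<^bsub>N\<^esub> (r \<odot>\<^bsub>N\<^esub> x)"
        using smultH[OF \<open>r \<in> carrier R\<close> h(1)] by (auto simp: a_r_coset_def')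
      then show ?thesis
        using rx by (metis H.a_repr_independence' N.smult_closed)
    qed
    note m = this
    have "x \<in> H +>\<^bsub>N\<^esub> x" using rx(2) by (rule H.a_rcos_self)
    then have "H +>\<^bsub>N\<^esub> x \<noteq> {}" by blast
    then have "(\<Union>y\<in>H +>\<^bsub>N\<^esub> x. H +>\<^bsub>N\<^esub> (r \<odot>\<^bsub>N\<^esub> y)) = H +>\<^bsub>N\<^esub> (r \<odot>\<^bsub>N\<^esub> x)"
      by (rule SUP_eq_const) (rule m)
    then show ?thesis by (simp add: quot_module_def)
  qed
  have z: "\<zero>\<^bsub>quot_module N H\<^esub> = H +>\<^bsub>N\<^esub> \<zero>\<^bsub>N\<^esub>"
    using Hs by (simp add: quot_module_def)
  show lin: "linear_map R N (quot_module N H) (\<lambda>x. H +>\<^bsub>N\<^esub> x)"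
    by (auto simp: linear_map_def car addc smc)
  show "Module.module R (quot_module N H)"
  proof (intro moduleI abelian_groupI, goal_cases)
    case 7
    then show ?case
      by (auto simp: car z addc N.M.l_neg intro!: bexI[of _ "\<ominus>\<^bsub>N\<^esub> _"])
  qed (auto simp: car z addc smc N.M.a_ac N.smult_l_distr N.smult_r_distr N.smult_assoc1 N.R.cring_axioms)
qed

lemma quot_module_lift:
  assumes N: "Module.module R N" and H: "submodule H R N" and N': "Module.module R N'"
    and L: "linear_map R N N' L" and 0: "\<And>x. x \<in> H \<Longrightarrow> L x = \<zero>\<^bsub>N'\<^esub>"
  shows "\<exists>\<phi>. linear_map R (quot_module N H) N' \<phi> \<and> (\<forall>x\<in>carrier N. \<phi> (H +>\<^bsub>N\<^esub> x) = L x)"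
proof -
  interpret N: Module.module R N by fact
  interpret N': Module.module R N' by fact
  define \<phi> where "\<phi> Z = L (SOME x. x \<in> carrier N \<and> Z = H +>\<^bsub>N\<^esub> x)" for Z
  have \<phi>: "\<phi> (H +>\<^bsub>N\<^esub> x) = L x" if x: "x \<in> carrier N" for x
  proof -
    define y where "y = (SOME y. y \<in> carrier N \<and> H +>\<^bsub>N\<^esub> x = H +>\<^bsub>N\<^esub> y)"
    have y: "y \<in> carrier N" "H +>\<^bsub>N\<^esub> x = H +>\<^bsub>N\<^esub> y"
      using someI[of "\<lambda>y. y \<in> carrier N \<and> H +>\<^bsub>N\<^esub> x = H +>\<^bsub>N\<^esub> y" x] x unfolding y_def by auto
    then have "L (x \<ominus>\<^bsub>N\<^esub> y) = \<zero>\<^bsub>N'\<^esub>" using quot_eq_iff[OF N H x y(1)] 0 by simp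
    then have "L x \<ominus>\<^bsub>N'\<^esub> L y = \<zero>\<^bsub>N'\<^esub>" using linear_map_minus[OF N N' L x y(1)] by simp
    then show ?thesis
      unfolding \<phi>_def y_def[symmetric]
      using linear_map_simps(1)[OF L x] linear_map_simps(1)[OF L y(1)]
        N'.M.minus_equality[of "L x" "\<ominus>\<^bsub>N'\<^esub> L y"] by (simp add: a_minus_def)
  qed
  have "linear_map R (quot_module N H) N' \<phi>"
    using linear_map_simps[OF L] linear_map_simps(2,3)[OF linear_map_quot[OF N H], symmetric]
    by (auto simp: linear_map_def quot_carrier[OF N H] \<phi> Pi_iff)
  then show ?thesis using \<phi> by blast
qed

subsection \<open>The universal property of \<open>kaehler_d\<close>\<close>

declare alg_simps [simp del] free_module_simps [simp del]

lemma
  assumes C: "is_cinf_ring C"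
  shows kaehler_rel_submodule: "submodule (kaehler_rel C) (alg C) (free_module (alg C) (carrier C))"
    and module_kaehler: "Module.module (alg C) (kaehler C)"
    and kaehler_d_derivation: "cinf_derivation C (kaehler C) (kaehler_d C)"
    and kaehler_universal: "\<And>N X. Module.module (alg C) N \<Longrightarrow> cinf_derivation C N X \<Longrightarrow>
      \<exists>!\<phi>. \<phi> \<in> extensional (carrier (kaehler C)) \<and> linear_map (alg C) (kaehler C) N \<phi> \<and>
           (\<forall>a\<in>carrier C. \<phi> (kaehler_d C a) = X a)"
proof -
  let ?F = "free_module (alg C) (carrier C)" and ?g = "free_gen (alg C)" and ?H = "kaehler_rel C"
  let ?s = "\<lambda>h as. \<Oplus>\<^bsub>?F\<^esub>i\<in>{..<length as}. cop C (pd (Rn (length as)) i h) as \<odot>\<^bsub>?F\<^esub> ?g (as ! i)"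
  let ?S = "{?g (cop C h as) \<ominus>\<^bsub>?F\<^esub> ?s h as | h as. as \<noteq> [] \<and> set as \<subseteq> carrier C \<and> h \<in> Cinf (length as)}"
  have R: "cring (alg C)" by (rule cring_alg[OF C])
  have F: "Module.module (alg C) ?F" by (rule module_free_module[OF R])
  interpret F: Module.module "alg C" ?F by (rule F)
  have g: "?g a \<in> carrier ?F" if "a \<in> carrier C" for a
    by (rule free_gen_closed[OF R that])
  have cA: "carrier (alg C) = carrier C" by (rule alg_simps(1))
  have c: "cop C (pd (Rn (length as)) i h) as \<in> carrier (alg C)"
    if "set as \<subseteq> carrier C" "h \<in> Cinf (length as)" "i < length as" for h as i
    unfolding cA by (rule cop_closed[OF C that(1) Cinf_pd[OF that(2,3)]])
  have n: "as ! i \<in> carrier C" if "set as \<subseteq> carrier C" "i < length as" for as i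
    using that by auto
  have t: "cop C (pd (Rn (length as)) i h) as \<odot>\<^bsub>?F\<^esub> ?g (as ! i) \<in> carrier ?F"
    if "set as \<subseteq> carrier C" "h \<in> Cinf (length as)" "i < length as" for h as i
    by (rule F.smult_closed[OF c[OF that] g[OF n[OF that(1,3)]]])
  have s: "?s h as \<in> carrier ?F" if "set as \<subseteq> carrier C" "h \<in> Cinf (length as)" for h as
    by (rule F.M.finsum_closed) (use t that in simp)
  have gh: "?g (cop C h as) \<in> carrier ?F" if "set as \<subseteq> carrier C" "h \<in> Cinf (length as)" for h as
    by (rule g) (rule cop_closed[OF C that])
  have S: "?S \<subseteq> carrier ?F" using F.M.minus_closed[OF gh s] by blast
  have H_eq: "?H = span_module (alg C) ?F ?S" by (simp only: kaehler_rel_def)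
  show H: "submodule ?H (alg C) ?F"
    unfolding H_eq by (rule span_module_submodule[OF F S])
  show K: "Module.module (alg C) (kaehler C)"
    unfolding kaehler_def by (rule module_quot_module[OF F H])
  interpret K: Module.module "alg C" "kaehler C" by (rule K)
  have q: "linear_map (alg C) ?F (kaehler C) (\<lambda>x. ?H +>\<^bsub>?F\<^esub> x)"
    unfolding kaehler_def by (rule linear_map_quot[OF F H])
  have cK: "carrier (kaehler C) = (\<lambda>x. ?H +>\<^bsub>?F\<^esub> x) ` carrier ?F"
    unfolding kaehler_def by (rule quot_carrier[OF F H])
  have sum: "\<phi> (?s h as) = (\<Oplus>\<^bsub>N\<^esub>i\<in>{..<length as}. cop C (pd (Rn (length as)) i h) as \<odot>\<^bsub>N\<^esub> \<phi> (?g (as ! i)))"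
    if as: "set as \<subseteq> carrier C" "h \<in> Cinf (length as)"
      and N: "Module.module (alg C) N" and \<phi>: "linear_map (alg C) ?F N \<phi>" for h as and N :: "('a, 'z) module" and \<phi>
  proof -
    interpret N: Module.module "alg C" N by (rule N)
    note 1 = c[OF as] and 2 = g[OF n[OF as(1)]]
    have "\<phi> (?s h as) = (\<Oplus>\<^bsub>N\<^esub>i\<in>{..<length as}. \<phi> (cop C (pd (Rn (length as)) i h) as \<odot>\<^bsub>?F\<^esub> ?g (as ! i)))"
      by (rule linear_map_finsum[OF F N \<phi>]) (use t[OF as] in auto)
    also have "\<dots> = (\<Oplus>\<^bsub>N\<^esub>i\<in>{..<length as}. cop C (pd (Rn (length as)) i h) as \<odot>\<^bsub>N\<^esub> \<phi> (?g (as ! i)))"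
      by (rule N.M.finsum_cong') (use 1 2 linear_map_simps[OF \<phi>] in auto)
    finally show ?thesis .
  qed
  show "cinf_derivation C (kaehler C) (kaehler_d C)"
    unfolding cinf_derivation_def
  proof (intro conjI allI impI)
    show "kaehler_d C \<in> carrier C \<rightarrow> carrier (kaehler C)"
      using g linear_map_simps(1)[OF q] by (auto simp: kaehler_d_def)
    fix as h assume as: "as \<noteq> []" "set as \<subseteq> carrier C" "h \<in> Cinf (length as)"
    have "?g (cop C h as) \<ominus>\<^bsub>?F\<^esub> ?s h as \<in> ?H"
      unfolding H_eq by (rule subsetD[OF span_module_incl]) (use as in blast)
    then have "kaehler_d C (cop C h as) = ?H +>\<^bsub>?F\<^esub> ?s h as"
      unfolding kaehler_d_def using quot_eq_iff[OF F H gh s] as by blast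
    then show "kaehler_d C (cop C h as) =
       (\<Oplus>\<^bsub>kaehler C\<^esub>i\<in>{..<length as}. cop C (pd (Rn (length as)) i h) as \<odot>\<^bsub>kaehler C\<^esub> kaehler_d C (as ! i))"
      using sum[OF as(2,3) K q] by (simp only: kaehler_d_def)
  qed
  fix N :: "('a, 'z) module" and X
  assume N: "Module.module (alg C) N" and X: "cinf_derivation C N X"
  interpret N: Module.module "alg C" N by (rule N)
  have Xc: "X \<in> carrier C \<rightarrow> carrier N" using X by (simp add: cinf_derivation_def)
  obtain L where L: "linear_map (alg C) ?F N L" "\<forall>a\<in>carrier C. L (?g a) = X a"
    using free_module_lift[OF R N Xc] by blast
  have const: "linear_map (alg C) ?F N (\<lambda>x. \<zero>\<^bsub>N\<^esub>)" by (auto simp: linear_map_def)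
  have ker: "?H \<subseteq> {x \<in> carrier ?F. L x = \<zero>\<^bsub>N\<^esub>}"
    unfolding H_eq
  proof (rule span_module_minimal[OF linear_map_equalizer[OF F N L(1) const]], rule subsetI)
    fix z assume "z \<in> ?S"
    then obtain h as where as: "as \<noteq> []" "set as \<subseteq> carrier C" "h \<in> Cinf (length as)"
      and z: "z = ?g (cop C h as) \<ominus>\<^bsub>?F\<^esub> ?s h as" by blast
    have "L (?g (cop C h as)) = X (cop C h as)"
      using L(2) cop_closed[OF C as(2,3)] by blast
    also have "\<dots> = (\<Oplus>\<^bsub>N\<^esub>i\<in>{..<length as}. cop C (pd (Rn (length as)) i h) as \<odot>\<^bsub>N\<^esub> X (as ! i))"
      using X as by (simp add: cinf_derivation_def)
    also have "\<dots> = (\<Oplus>\<^bsub>N\<^esub>i\<in>{..<length as}. cop C (pd (Rn (length as)) i h) as \<odot>\<^bsub>N\<^esub> L (?g (as ! i)))"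
    proof (rule N.M.finsum_cong')
      have LX: "L (?g (as ! i)) = X (as ! i)" "X (as ! i) \<in> carrier N" if "i < length as" for i
        using n[OF as(2) that] L(2) Xc by auto
      show "(\<lambda>i. cop C (pd (Rn (length as)) i h) as \<odot>\<^bsub>N\<^esub> L (?g (as ! i))) \<in> {..<length as} \<rightarrow> carrier N"
        using c[OF as(2,3)] LX by auto
      show "cop C (pd (Rn (length as)) i h) as \<odot>\<^bsub>N\<^esub> X (as ! i) = cop C (pd (Rn (length as)) i h) as \<odot>\<^bsub>N\<^esub> L (?g (as ! i))"
        if "i \<in> {..<length as}" for i using LX that by simp
    qed simp
    also have "\<dots> = L (?s h as)" by (rule sum[OF as(2,3) N L(1), symmetric])
    finally have "L (?g (cop C h as)) = L (?s h as)" .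
    then have "L z = \<zero>\<^bsub>N\<^esub>"
      using linear_map_minus[OF F N L(1) gh s, OF as(2,3) as(2,3)] linear_map_simps(1)[OF L(1) s[OF as(2,3)]]
      by (simp only: z a_minus_def N.M.r_neg)
    then show "z \<in> {x \<in> carrier ?F. L x = \<zero>\<^bsub>N\<^esub>}" using S \<open>z \<in> ?S\<close> by blast
  qed
  have Lz: "L x = \<zero>\<^bsub>N\<^esub>" if "x \<in> ?H" for x using subsetD[OF ker that] by simp
  have "\<exists>\<phi>. linear_map (alg C) (kaehler C) N \<phi> \<and> (\<forall>x\<in>carrier ?F. \<phi> (?H +>\<^bsub>?F\<^esub> x) = L x)"
    unfolding kaehler_def by (rule quot_module_lift[OF F H N L(1) Lz])
  then obtain \<psi> where \<psi>: "linear_map (alg C) (kaehler C) N \<psi>"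
    "\<And>x. x \<in> carrier ?F \<Longrightarrow> \<psi> (?H +>\<^bsub>?F\<^esub> x) = L x" by (elim exE conjE) simp
  show "\<exists>!\<phi>. \<phi> \<in> extensional (carrier (kaehler C)) \<and> linear_map (alg C) (kaehler C) N \<phi> \<and>
           (\<forall>a\<in>carrier C. \<phi> (kaehler_d C a) = X a)"
  proof (rule ex1I[of _ "restrict \<psi> (carrier (kaehler C))"], intro conjI ballI)
    show "linear_map (alg C) (kaehler C) N (restrict \<psi> (carrier (kaehler C)))"
      using \<psi>(1) by (auto simp: linear_map_def Pi_iff)
    fix a assume a: "a \<in> carrier C"
    have "kaehler_d C a \<in> carrier (kaehler C)"
      using g[OF a] unfolding cK kaehler_d_def by blast
    then show "restrict \<psi> (carrier (kaehler C)) (kaehler_d C a) = X a"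
      using \<psi>(2)[OF g[OF a]] L(2) a by (simp add: kaehler_d_def)
  next
    fix \<phi> assume \<phi>: "\<phi> \<in> extensional (carrier (kaehler C)) \<and> linear_map (alg C) (kaehler C) N \<phi> \<and>
           (\<forall>a\<in>carrier C. \<phi> (kaehler_d C a) = X a)"
    have l: "linear_map (alg C) ?F N (\<lambda>x. \<phi> (?H +>\<^bsub>?F\<^esub> x))"
      using linear_map_comp[OF q] \<phi> by blast
    have "carrier ?F \<subseteq> {x \<in> carrier ?F. \<phi> (?H +>\<^bsub>?F\<^esub> x) = L x}"
    proof (rule free_module_induct[OF R linear_map_equalizer[OF F N l L(1)]])
      fix a assume a: "a \<in> carrier C"
      show "?g a \<in> {x \<in> carrier ?F. \<phi> (?H +>\<^bsub>?F\<^esub> x) = L x}"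
        using g[OF a] \<phi> L(2) a by (simp add: kaehler_d_def)
    qed
    then have e: "\<phi> z = \<psi> z" if "z \<in> carrier (kaehler C)" for z
      using that \<psi>(2) unfolding cK by fastforce
    show "\<phi> = restrict \<psi> (carrier (kaehler C))"
      by (rule extensionalityI[of _ "carrier (kaehler C)"]) (use \<phi> e in auto)
  qed simp
qed


section \<open>Commutative differential graded algebras over a $C^\infty$-ring\<close>

record ('c, 'e) graded =
  gmod :: "int \<Rightarrow> ('c, 'e) module"
  gmult :: "int \<Rightarrow> int \<Rightarrow> 'e \<Rightarrow> 'e \<Rightarrow> 'e"

record ('c, 'e) cdga = "('c, 'e) graded" +
  gdiff :: "int \<Rightarrow> 'e \<Rightarrow> 'e"

definition gsign :: "('c, 'e) module \<Rightarrow> int \<Rightarrow> 'e \<Rightarrow> 'e"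
  where "gsign N k x = (if even k then x else \<ominus>\<^bsub>N\<^esub> x)"

definition cga :: "'c cinf_ring \<Rightarrow> ('c, 'e, 'z) graded_scheme \<Rightarrow> bool"
  where "cga C A \<longleftrightarrow>
    (\<forall>k. Module.module (alg C) (gmod A k)) \<and>
    (\<forall>k l. \<forall>x\<in>carrier (gmod A k). \<forall>y\<in>carrier (gmod A l).
       gmult A k l x y \<in> carrier (gmod A (k + l)) \<and>
       gmult A k l x y = gsign (gmod A (k + l)) (k * l) (gmult A l k y x)) \<and>
    (\<forall>k l. \<forall>x\<in>carrier (gmod A k). \<forall>x'\<in>carrier (gmod A k). \<forall>y\<in>carrier (gmod A l).
       gmult A k l (x \<oplus>\<^bsub>gmod A k\<^esub> x') y = gmult A k l x y \<oplus>\<^bsub>gmod A (k + l)\<^esub> gmult A k l x' y) \<and>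
    (\<forall>k l. \<forall>x\<in>carrier (gmod A k). \<forall>y\<in>carrier (gmod A l). \<forall>y'\<in>carrier (gmod A l).
       gmult A k l x (y \<oplus>\<^bsub>gmod A l\<^esub> y') = gmult A k l x y \<oplus>\<^bsub>gmod A (k + l)\<^esub> gmult A k l x y') \<and>
    (\<forall>k l. \<forall>a\<in>carrier C. \<forall>x\<in>carrier (gmod A k). \<forall>y\<in>carrier (gmod A l).
       gmult A k l (a \<odot>\<^bsub>gmod A k\<^esub> x) y = a \<odot>\<^bsub>gmod A (k + l)\<^esub> gmult A k l x y \<and>
       gmult A k l x (a \<odot>\<^bsub>gmod A l\<^esub> y) = a \<odot>\<^bsub>gmod A (k + l)\<^esub> gmult A k l x y) \<and>
    (\<forall>k l m. \<forall>x\<in>carrier (gmod A k). \<forall>y\<in>carrier (gmod A l). \<forall>z\<in>carrier (gmod A m).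
       gmult A (k + l) m (gmult A k l x y) z = gmult A k (l + m) x (gmult A l m y z))"

definition differential :: "'c cinf_ring \<Rightarrow> ('c, 'e, 'z) graded_scheme \<Rightarrow> (int \<Rightarrow> 'e \<Rightarrow> 'e) \<Rightarrow> bool"
  where "differential C A d \<longleftrightarrow>
    (\<forall>k. d k \<in> carrier (gmod A k) \<rightarrow> carrier (gmod A (k + 1))) \<and>
    (\<forall>k. \<forall>x\<in>carrier (gmod A k). \<forall>y\<in>carrier (gmod A k).
       d k (x \<oplus>\<^bsub>gmod A k\<^esub> y) = d k x \<oplus>\<^bsub>gmod A (k + 1)\<^esub> d k y) \<and>
    (\<forall>k r. \<forall>x\<in>carrier (gmod A k).
       d k (cconst C r \<odot>\<^bsub>gmod A k\<^esub> x) = cconst C r \<odot>\<^bsub>gmod A (k + 1)\<^esub> d k x) \<and>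
    (\<forall>k l. \<forall>x\<in>carrier (gmod A k). \<forall>y\<in>carrier (gmod A l).
       d (k + l) (gmult A k l x y) =
         gmult A (k + 1) l (d k x) y \<oplus>\<^bsub>gmod A (k + l + 1)\<^esub>
         gsign (gmod A (k + l + 1)) k (gmult A k (l + 1) x (d l y))) \<and>
    (\<forall>k. \<forall>x\<in>carrier (gmod A k). d (k + 1) (d k x) = \<zero>\<^bsub>gmod A (k + 2)\<^esub>)"

definition is_cdga :: "'c cinf_ring \<Rightarrow> ('c, 'e) cdga \<Rightarrow> bool"
  where "is_cdga C A \<longleftrightarrow> cga C A \<and> differential C A (gdiff A)"

definition cdga_map ::
    "'c cinf_ring \<Rightarrow> ('c, 'e) cdga \<Rightarrow> ('c, 'f) cdga \<Rightarrow> (int \<Rightarrow> 'e \<Rightarrow> 'f) \<Rightarrow> bool"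
  where "cdga_map C A A' F \<longleftrightarrow>
    is_cdga C A \<and> is_cdga C A' \<and>
    (\<forall>k. F k \<in> carrier (gmod A k) \<rightarrow> carrier (gmod A' k)) \<and>
    (\<forall>k. \<forall>x\<in>carrier (gmod A k). \<forall>y\<in>carrier (gmod A k).
       F k (x \<oplus>\<^bsub>gmod A k\<^esub> y) = F k x \<oplus>\<^bsub>gmod A' k\<^esub> F k y) \<and>
    (\<forall>k. \<forall>a\<in>carrier C. \<forall>x\<in>carrier (gmod A k).
       F k (a \<odot>\<^bsub>gmod A k\<^esub> x) = a \<odot>\<^bsub>gmod A' k\<^esub> F k x) \<and>
    (\<forall>k l. \<forall>x\<in>carrier (gmod A k). \<forall>y\<in>carrier (gmod A l).
       F (k + l) (gmult A k l x y) = gmult A' k l (F k x) (F l y)) \<and>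
    (\<forall>k. \<forall>x\<in>carrier (gmod A k). F (k + 1) (gdiff A k x) = gdiff A' k (F k x))"

definition restrict_scalars :: "('b \<Rightarrow> 'c) \<Rightarrow> ('c, 'e) cdga \<Rightarrow> ('b, 'e) cdga"
  where "restrict_scalars \<phi> A = \<lparr>
    gmod = (\<lambda>k. \<lparr>carrier = carrier (gmod A k), mult = undefined, one = undefined,
      zero = zero (gmod A k), add = add (gmod A k), smult = (\<lambda>b. smult (gmod A k) (\<phi> b))\<rparr>),
    gmult = gmult A, gdiff = gdiff A\<rparr>"


section \<open>The exterior algebra of a module, and $\Lambda^\bullet\Omega^1_C$\<close>

text \<open>The degree \<open>k\<close> part is generated by the words $m_1 \wedge \dots \wedge m_k$, represented by lists of length
  \<open>k\<close>, modulo multilinearity and $u \wedge m \wedge m \wedge v = 0$. There are no words of negative length, so it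
  vanishes for \<open>k < 0\<close>; for \<open>k = 0\<close> it is free on the empty word, i.e. a copy of the ring.\<close>

definition ext_free :: "'r ring \<Rightarrow> ('r, 'm) module \<Rightarrow> int \<Rightarrow> ('r, 'm list \<Rightarrow> 'r) module"
  where "ext_free R N k = free_module R {w \<in> lists (carrier N). int (length w) = k}"

definition ext_rel :: "'r ring \<Rightarrow> ('r, 'm) module \<Rightarrow> int \<Rightarrow> ('m list \<Rightarrow> 'r) set"
  where "ext_rel R N k = span_module R (ext_free R N k)
    ({free_gen R (u @ [x \<oplus>\<^bsub>N\<^esub> y] @ v) \<ominus>\<^bsub>ext_free R N k\<^esub>
        (free_gen R (u @ [x] @ v) \<oplus>\<^bsub>ext_free R N k\<^esub> free_gen R (u @ [y] @ v))
      | u v x y. {x, y} \<union> set u \<union> set v \<subseteq> carrier N \<and> int (length (u @ [x] @ v)) = k} \<union>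
     {free_gen R (u @ [r \<odot>\<^bsub>N\<^esub> x] @ v) \<ominus>\<^bsub>ext_free R N k\<^esub>
        (r \<odot>\<^bsub>ext_free R N k\<^esub> free_gen R (u @ [x] @ v))
      | u v r x. r \<in> carrier R \<and> {x} \<union> set u \<union> set v \<subseteq> carrier N \<and> int (length (u @ [x] @ v)) = k} \<union>
     {free_gen R (u @ [x, x] @ v)
      | u v x. {x} \<union> set u \<union> set v \<subseteq> carrier N \<and> int (length (u @ [x, x] @ v)) = k})"

text \<open>On the free modules the product of degrees \<open>k\<close> and \<open>l\<close> is induced by concatenation of words: the
  coefficient of a word of length \<open>k + l\<close> comes from its only splitting into lengths \<open>k\<close> and \<open>l\<close>.\<close>

definition ext_algebra :: "'r ring \<Rightarrow> ('r, 'm) module \<Rightarrow> ('r, ('m list \<Rightarrow> 'r) set) graded"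
  where "ext_algebra R N = \<lparr>
    gmod = (\<lambda>k. quot_module (ext_free R N k) (ext_rel R N k)),
    gmult = (\<lambda>k l X Y. \<Union>p\<in>X. \<Union>q\<in>Y. ext_rel R N (k + l) +>\<^bsub>ext_free R N (k + l)\<^esub>
      (\<lambda>w. p (take (nat k) w) \<otimes>\<^bsub>R\<^esub> q (drop (nat k) w)))\<rparr>"

type_synonym 'c kform = "(('c \<Rightarrow> 'c) set list \<Rightarrow> 'c) set"

text \<open>The identification of \<open>C\<close> with the degree-0 part, and of $\Omega^1_C$ with the degree-1 part.\<close>

definition form0 :: "'c cinf_ring \<Rightarrow> 'c \<Rightarrow> 'c kform"
  where "form0 C a = ext_rel (alg C) (kaehler C) 0 +>\<^bsub>ext_free (alg C) (kaehler C) 0\<^esub>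
    (a \<odot>\<^bsub>ext_free (alg C) (kaehler C) 0\<^esub> free_gen (alg C) [])"

definition form1 :: "'c cinf_ring \<Rightarrow> ('c \<Rightarrow> 'c) set \<Rightarrow> 'c kform"
  where "form1 C m = ext_rel (alg C) (kaehler C) 1 +>\<^bsub>ext_free (alg C) (kaehler C) 1\<^esub> free_gen (alg C) [m]"

definition form_d :: "'c cinf_ring \<Rightarrow> int \<Rightarrow> 'c kform \<Rightarrow> 'c kform"
  where "form_d C = (THE d.
    (\<forall>k. d k \<in> extensional (carrier (gmod (ext_algebra (alg C) (kaehler C)) k))) \<and>
    differential C (ext_algebra (alg C) (kaehler C)) d \<and>
    (\<forall>a\<in>carrier C. d 0 (form0 C a) = form1 C (kaehler_d C a)))"

definition forms :: "'c cinf_ring \<Rightarrow> ('c, 'c kform) cdga"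
  where "forms C = \<lparr>gmod = gmod (ext_algebra (alg C) (kaehler C)),
    gmult = gmult (ext_algebra (alg C) (kaehler C)), gdiff = form_d C\<rparr>"

definition forms_map ::
    "'c cinf_ring \<Rightarrow> 'd cinf_ring \<Rightarrow> ('c \<Rightarrow> 'd) \<Rightarrow> int \<Rightarrow> 'c kform \<Rightarrow> 'd kform"
  where "forms_map C D \<phi> k X =
    (\<Union>p\<in>X. ext_rel (alg D) (kaehler D) k +>\<^bsub>ext_free (alg D) (kaehler D) k\<^esub>
       free_push (alg D) (alg C) \<phi> (map (kaehler_map C D \<phi>)) p)"


section \<open>Sheaves, stalks and sheafification\<close>

record ('x, 'p) presheaf =
  secs :: "'x set \<Rightarrow> 'p set"
  restr :: "'x set \<Rightarrow> 'x set \<Rightarrow> 'p \<Rightarrow> 'p"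

definition is_presheaf :: "'x topology \<Rightarrow> ('x, 'p) presheaf \<Rightarrow> bool"
  where "is_presheaf X P \<longleftrightarrow>
    (\<forall>U V. openin X U \<longrightarrow> openin X V \<longrightarrow> V \<subseteq> U \<longrightarrow> restr P U V \<in> secs P U \<rightarrow> secs P V) \<and>
    (\<forall>U. \<forall>s\<in>secs P U. openin X U \<longrightarrow> restr P U U s = s) \<and>
    (\<forall>U V W. \<forall>s\<in>secs P U. openin X U \<longrightarrow> openin X V \<longrightarrow> openin X W \<longrightarrow> W \<subseteq> V \<longrightarrow> V \<subseteq> U \<longrightarrow>
       restr P V W (restr P U V s) = restr P U W s)"

definition is_sheaf :: "'x topology \<Rightarrow> ('x, 'p) presheaf \<Rightarrow> bool"
  where "is_sheaf X P \<longleftrightarrow> is_presheaf X P \<and>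
    (\<forall>\<U> s. (\<forall>U\<in>\<U>. openin X U \<and> s U \<in> secs P U) \<longrightarrow>
       (\<forall>U\<in>\<U>. \<forall>V\<in>\<U>. restr P U (U \<inter> V) (s U) = restr P V (U \<inter> V) (s V)) \<longrightarrow>
       (\<exists>!t. t \<in> secs P (\<Union>\<U>) \<and> (\<forall>U\<in>\<U>. restr P (\<Union>\<U>) U t = s U)))"

definition germ :: "'x topology \<Rightarrow> ('x, 'p) presheaf \<Rightarrow> 'x \<Rightarrow> 'x set \<Rightarrow> 'p \<Rightarrow> ('x set \<times> 'p) set"
  where "germ X P x U s = {(V, t). openin X V \<and> x \<in> V \<and> t \<in> secs P V \<and>
    (\<exists>W. openin X W \<and> x \<in> W \<and> W \<subseteq> U \<inter> V \<and> restr P U W s = restr P V W t)}"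

definition stalk :: "'x topology \<Rightarrow> ('x, 'p) presheaf \<Rightarrow> 'x \<Rightarrow> ('x set \<times> 'p) set set"
  where "stalk X P x = {germ X P x U s | U s. openin X U \<and> x \<in> U \<and> s \<in> secs P U}"

text \<open>The sections over \<open>V\<close> of the sheafification: families of germs that locally come from sections.\<close>

definition sheafified_secs ::
    "'x topology \<Rightarrow> ('x, 'p) presheaf \<Rightarrow> 'x set \<Rightarrow> ('x \<Rightarrow> ('x set \<times> 'p) set) set"
  where "sheafified_secs X P V = {\<sigma> \<in> extensional V. \<forall>x\<in>V. \<exists>U s. openin X U \<and> x \<in> U \<and> U \<subseteq> V \<and>
    s \<in> secs P U \<and> (\<forall>y\<in>U. \<sigma> y = germ X P y U s)}"

record ('x, 'c) cinf_presheaf =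
  rings :: "'x set \<Rightarrow> 'c cinf_ring"
  rres :: "'x set \<Rightarrow> 'x set \<Rightarrow> 'c \<Rightarrow> 'c"

definition set_presheaf :: "('x, 'c) cinf_presheaf \<Rightarrow> ('x, 'c) presheaf"
  where "set_presheaf B = \<lparr>secs = (\<lambda>U. carrier (rings B U)), restr = rres B\<rparr>"

definition is_cinf_sheaf :: "'x topology \<Rightarrow> ('x, 'c) cinf_presheaf \<Rightarrow> bool"
  where "is_cinf_sheaf X B \<longleftrightarrow> is_sheaf X (set_presheaf B) \<and>
    (\<forall>U. openin X U \<longrightarrow> is_cinf_ring (rings B U)) \<and>
    (\<forall>U V. openin X U \<longrightarrow> openin X V \<longrightarrow> V \<subseteq> U \<longrightarrow> cinf_map (rings B U) (rings B V) (rres B U V))"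

definition stalk_ring :: "'x topology \<Rightarrow> ('x, 'c) cinf_presheaf \<Rightarrow> 'x \<Rightarrow> ('x set \<times> 'c) set cinf_ring"
  where "stalk_ring X B x = \<lparr>carrier = stalk X (set_presheaf B) x,
    cop = (\<lambda>g Zs. \<Union>{germ X (set_presheaf B) x U (cop (rings B U) g as) | U as.
      openin X U \<and> x \<in> U \<and> list_all2 (\<lambda>a Z. (U, a) \<in> Z) as Zs})\<rparr>"

definition local_cinf_ringed_space :: "'x topology \<Rightarrow> ('x, 'c) cinf_presheaf \<Rightarrow> bool"
  where "local_cinf_ringed_space X B \<longleftrightarrow> is_cinf_sheaf X B \<and>
    (\<forall>x\<in>topspace X. local_cinf_ring (stalk_ring X B x))"

definition preimage :: "'m topology \<Rightarrow> ('m \<Rightarrow> 'x) \<Rightarrow> 'x set \<Rightarrow> 'm set"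
  where "preimage T f U = {x \<in> topspace T. f x \<in> U}"

definition cinf_ringed_space_map ::
    "'m topology \<Rightarrow> ('m, 'a) cinf_presheaf \<Rightarrow> 'x topology \<Rightarrow> ('x, 'b) cinf_presheaf \<Rightarrow>
     ('m \<Rightarrow> 'x) \<Rightarrow> ('x set \<Rightarrow> 'b \<Rightarrow> 'a) \<Rightarrow> bool"
  where "cinf_ringed_space_map T A X B f fs \<longleftrightarrow>
    continuous_map T X f \<and>
    (\<forall>U. openin X U \<longrightarrow> cinf_map (rings B U) (rings A (preimage T f U)) (fs U)) \<and>
    (\<forall>U V. \<forall>b\<in>carrier (rings B U). openin X U \<longrightarrow> openin X V \<longrightarrow> V \<subseteq> U \<longrightarrow>
       fs V (rres B U V b) = rres A (preimage T f U) (preimage T f V) (fs U b))"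

record ('x, 'c, 'e) cdga_presheaf =
  algs :: "'x set \<Rightarrow> ('c, 'e) cdga"
  ares :: "'x set \<Rightarrow> 'x set \<Rightarrow> int \<Rightarrow> 'e \<Rightarrow> 'e"

definition degree_presheaf :: "('x, 'c, 'e) cdga_presheaf \<Rightarrow> int \<Rightarrow> ('x, 'e) presheaf"
  where "degree_presheaf A k =
    \<lparr>secs = (\<lambda>U. carrier (gmod (algs A U) k)), restr = (\<lambda>U V. ares A U V k)\<rparr>"

text \<open>All operations on the sheafification are computed on germs: operands are represented by sections
  over a common open set (inside \<open>V\<close>, where a section \<open>b\<close> of \<open>B\<close> over \<open>V\<close> acts), and the union below is a
  union of equal germs.\<close>

definition sheafify ::
    "'x topology \<Rightarrow> ('x, 'c) cinf_presheaf \<Rightarrow> ('x, 'c, 'e) cdga_presheaf \<Rightarrow>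
     ('x, 'c, 'x \<Rightarrow> ('x set \<times> 'e) set) cdga_presheaf"
  where "sheafify X B A = \<lparr>
    algs = (\<lambda>V. \<lparr>
      gmod = (\<lambda>k. \<lparr>
        carrier = sheafified_secs X (degree_presheaf A k) V,
        mult = undefined, one = undefined,
        zero = (\<lambda>x\<in>V. germ X (degree_presheaf A k) x V \<zero>\<^bsub>gmod (algs A V) k\<^esub>),
        add = (\<lambda>\<sigma> \<tau>. \<lambda>x\<in>V. \<Union>{germ X (degree_presheaf A k) x U (s \<oplus>\<^bsub>gmod (algs A U) k\<^esub> t)
          | U s t. (U, s) \<in> \<sigma> x \<and> (U, t) \<in> \<tau> x}),
        smult = (\<lambda>b \<sigma>. \<lambda>x\<in>V. \<Union>{germ X (degree_presheaf A k) x U (rres B V U b \<odot>\<^bsub>gmod (algs A U) k\<^esub> s)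
          | U s. (U, s) \<in> \<sigma> x \<and> U \<subseteq> V})\<rparr>),
      gmult = (\<lambda>k l \<sigma> \<tau>. \<lambda>x\<in>V. \<Union>{germ X (degree_presheaf A (k + l)) x U (gmult (algs A U) k l s t)
          | U s t. (U, s) \<in> \<sigma> x \<and> (U, t) \<in> \<tau> x}),
      gdiff = (\<lambda>k \<sigma>. \<lambda>x\<in>V. \<Union>{germ X (degree_presheaf A (k + 1)) x U (gdiff (algs A U) k s)
          | U s. (U, s) \<in> \<sigma> x})\<rparr>),
    ares = (\<lambda>U V k \<sigma>. restrict \<sigma> V)\<rparr>"

definition forms_presheaf :: "('x, 'c) cinf_presheaf \<Rightarrow> ('x, 'c, 'c kform) cdga_presheaf"
  where "forms_presheaf B = \<lparr>algs = (\<lambda>U. forms (rings B U)),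
    ares = (\<lambda>U V. forms_map (rings B U) (rings B V) (rres B U V))\<rparr>"

text \<open>The sheaf of CDGAs $\mathbf{\Omega}^\bullet_B$.\<close>

definition Omega ::
    "'x topology \<Rightarrow> ('x, 'c) cinf_presheaf \<Rightarrow> ('x, 'c, 'x \<Rightarrow> ('x set \<times> 'c kform) set) cdga_presheaf"
  where "Omega X B = sheafify X B (forms_presheaf B)"

text \<open>The canonical map from \<open>B(U)\<close> to the degree-0 sections of $\mathbf{\Omega}^\bullet_B$ over \<open>U\<close>.\<close>

definition Omega_fun ::
    "'x topology \<Rightarrow> ('x, 'c) cinf_presheaf \<Rightarrow> 'x set \<Rightarrow> 'c \<Rightarrow> 'x \<Rightarrow> ('x set \<times> 'c kform) set"
  where "Omega_fun X B U b =
    (\<lambda>x\<in>U. germ X (degree_presheaf (forms_presheaf B) 0) x U (form0 (rings B U) b))"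


section \<open>Manifolds with corners\<close>

type_synonym 'm chart = "'m set \<times> ('m \<Rightarrow> nat \<Rightarrow> real)"

record 'm mfd =
  mtop :: "'m topology"
  mdim :: nat
  atlas :: "'m chart set"

definition corner :: "nat \<Rightarrow> nat \<Rightarrow> (nat \<Rightarrow> real) set"
  where "corner n k = {x \<in> Rn n. \<forall>i<k. 0 \<le> x i}"

definition is_chart :: "'m topology \<Rightarrow> nat \<Rightarrow> 'm chart \<Rightarrow> bool"
  where "is_chart T n c \<longleftrightarrow> openin T (fst c) \<and>
    (\<exists>k\<le>n. openin (subtopology (Euclidean_space n) (corner n k)) (snd c ` fst c)) \<and>
    homeomorphic_map (subtopology T (fst c)) (subtopology (Euclidean_space n) (snd c ` fst c)) (snd c)"

abbreviation chart_inv :: "'m chart \<Rightarrow> (nat \<Rightarrow> real) \<Rightarrow> 'm"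
  where "chart_inv c \<equiv> inv_into (fst c) (snd c)"

text \<open>The atlas need not be maximal; smooth functions and forms defined by it are those of the maximal
  atlas that it generates.\<close>

definition manifold_with_corners :: "'m mfd \<Rightarrow> bool"
  where "manifold_with_corners M \<longleftrightarrow>
    Hausdorff_space (mtop M) \<and> second_countable (mtop M) \<and>
    (\<forall>c\<in>atlas M. is_chart (mtop M) (mdim M) c) \<and>
    (\<Union>c\<in>atlas M. fst c) = topspace (mtop M) \<and>
    (\<forall>c\<in>atlas M. \<forall>c'\<in>atlas M. \<forall>i<mdim M.
       smooth_on_Rn (mdim M) (snd c ` (fst c \<inter> fst c')) (\<lambda>y. snd c' (chart_inv c y) i))"

definition smooth_functions :: "'m mfd \<Rightarrow> ('m, 'm \<Rightarrow> real) cinf_presheaf"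
  where "smooth_functions M = \<lparr>
    rings = (\<lambda>V. \<lparr>
      carrier = {u \<in> extensional V. \<forall>c\<in>atlas M.
        smooth_on_Rn (mdim M) (snd c ` (fst c \<inter> V)) (\<lambda>y. u (chart_inv c y))},
      cop = (\<lambda>g us. \<lambda>x\<in>V. g (nth_default 0 (map (\<lambda>u. u x) us)))\<rparr>),
    rres = (\<lambda>U V u. restrict u V)\<rparr>"


section \<open>Tangent vectors and differential forms\<close>

definition charts_at :: "'m mfd \<Rightarrow> 'm \<Rightarrow> 'm chart set"
  where "charts_at M x = {c \<in> atlas M. x \<in> fst c}"

definition jacobian :: "'m chart \<Rightarrow> 'm chart \<Rightarrow> 'm \<Rightarrow> nat \<Rightarrow> nat \<Rightarrow> real"
  where "jacobian c c' x i j =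
    pd (snd c ` (fst c \<inter> fst c')) j (\<lambda>y. snd c' (chart_inv c y) i) (snd c x)"

text \<open>A tangent vector at \<open>x\<close> is the family of its coordinate vectors in all the charts around \<open>x\<close>.\<close>

type_synonym 'm tvec = "'m chart \<Rightarrow> nat \<Rightarrow> real"

definition tangent_space :: "'m mfd \<Rightarrow> 'm \<Rightarrow> 'm tvec set"
  where "tangent_space M x = {v.
    (\<forall>c\<in>charts_at M x. v c \<in> Rn (mdim M)) \<and>
    (\<forall>c. c \<notin> charts_at M x \<longrightarrow> v c = (\<lambda>i. 0)) \<and>
    (\<forall>c\<in>charts_at M x. \<forall>c'\<in>charts_at M x. \<forall>i<mdim M.
       v c' i = (\<Sum>j<mdim M. jacobian c c' x i j * v c j))}"

text \<open>The tangent vector at \<open>x\<close> with coordinates \<open>\<xi>\<close> in the chart \<open>c\<close>.\<close>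

definition chart_vec :: "'m mfd \<Rightarrow> 'm chart \<Rightarrow> 'm \<Rightarrow> (nat \<Rightarrow> real) \<Rightarrow> 'm tvec"
  where "chart_vec M c x \<xi> = (\<lambda>c' i. if c' \<in> charts_at M x \<and> i < mdim M
     then \<Sum>j<mdim M. jacobian c c' x i j * \<xi> j else 0)"

definition coord_vec :: "'m mfd \<Rightarrow> 'm chart \<Rightarrow> 'm \<Rightarrow> nat \<Rightarrow> 'm tvec"
  where "coord_vec M c x j = chart_vec M c x (\<lambda>i. if i = j then 1 else 0)"

definition tvec_tuples :: "'m mfd \<Rightarrow> 'm \<Rightarrow> int \<Rightarrow> 'm tvec list set"
  where "tvec_tuples M x k = {vs. set vs \<subseteq> tangent_space M x \<and> int (length vs) = k}"

text \<open>$\Lambda^k T^*_x M$, as the space of alternating \<open>k\<close>-linear functions on the tangent space. For \<open>k < 0\<close>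
  there are no \<open>k\<close>-tuples and the space has a single element.\<close>

definition alt_forms :: "'m mfd \<Rightarrow> 'm \<Rightarrow> int \<Rightarrow> ('m tvec list \<Rightarrow> real) set"
  where "alt_forms M x k = {\<alpha> \<in> extensional (tvec_tuples M x k).
    (\<forall>us ws v w a b. us @ [v] @ ws \<in> tvec_tuples M x k \<longrightarrow> us @ [w] @ ws \<in> tvec_tuples M x k \<longrightarrow>
       \<alpha> (us @ [\<lambda>c i. a * v c i + b * w c i] @ ws) = a * \<alpha> (us @ [v] @ ws) + b * \<alpha> (us @ [w] @ ws)) \<and>
    (\<forall>vs\<in>tvec_tuples M x k. \<not> distinct vs \<longrightarrow> \<alpha> vs = 0)}"

text \<open>$(\alpha \wedge \beta)(v_1,\dots,v_{k+l}) = \frac{1}{k!\,l!} \sum_\sigma \mathrm{sgn}(\sigma)\,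
  \alpha(v_{\sigma(1)},\dots,v_{\sigma(k)})\,\beta(v_{\sigma(k+1)},\dots,v_{\sigma(k+l)})$.\<close>

definition wedge ::
    "'m mfd \<Rightarrow> 'm \<Rightarrow> int \<Rightarrow> int \<Rightarrow> ('m tvec list \<Rightarrow> real) \<Rightarrow> ('m tvec list \<Rightarrow> real) \<Rightarrow> 'm tvec list \<Rightarrow> real"
  where "wedge M x k l \<alpha> \<beta> = (\<lambda>vs\<in>tvec_tuples M x (k + l).
    if k < 0 \<or> l < 0 then 0 else
      (\<Sum>\<sigma> | \<sigma> permutes {..<length vs}. of_int (sign \<sigma>) *
         \<alpha> (map (\<lambda>i. vs ! \<sigma> i) [0..<nat k]) * \<beta> (map (\<lambda>i. vs ! \<sigma> i) [nat k..<length vs]))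
      / (fact (nat k) * fact (nat l)))"

definition dR_forms :: "'m mfd \<Rightarrow> 'm set \<Rightarrow> int \<Rightarrow> ('m \<Rightarrow> 'm tvec list \<Rightarrow> real) set"
  where "dR_forms M V k = {\<omega> \<in> extensional V.
    (\<forall>x\<in>V. \<omega> x \<in> alt_forms M x k) \<and>
    (\<forall>c\<in>atlas M. \<forall>js. int (length js) = k \<longrightarrow> set js \<subseteq> {..<mdim M} \<longrightarrow>
       smooth_on_Rn (mdim M) (snd c ` (fst c \<inter> V))
         (\<lambda>y. \<omega> (chart_inv c y) (map (coord_vec M c (chart_inv c y)) js)))}"

text \<open>The exterior derivative, by the coordinate formula
  $d\omega(v_0,\dots,v_k) = \sum_j (-1)^j \, \partial_{v_j} (\omega(v_0,\dots,\widehat{v_j},\dots,v_k))$ in a chart, where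
  the $v_i$ are extended to vector fields with constant coordinates. The value does not depend on the
  chart.\<close>

definition dR_diff ::
    "'m mfd \<Rightarrow> 'm set \<Rightarrow> int \<Rightarrow> ('m \<Rightarrow> 'm tvec list \<Rightarrow> real) \<Rightarrow> 'm \<Rightarrow> 'm tvec list \<Rightarrow> real"
  where "dR_diff M V k \<omega> = (\<lambda>x\<in>V. \<lambda>vs\<in>tvec_tuples M x (k + 1).
    let c = (SOME c. c \<in> charts_at M x) in
      \<Sum>j<length vs. (-1) ^ j * (\<Sum>i<mdim M. (vs ! j) c i *
        pd (snd c ` (fst c \<inter> V)) i
          (\<lambda>y. \<omega> (chart_inv c y)
             (map (\<lambda>v. chart_vec M c (chart_inv c y) (v c)) (take j vs @ drop (Suc j) vs)))
          (snd c x)))"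

text \<open>The sheaf of CDGAs $\mathbf{\Omega}^\bullet_{dR,M}$.\<close>

definition deRham :: "'m mfd \<Rightarrow> ('m, 'm \<Rightarrow> real, 'm \<Rightarrow> 'm tvec list \<Rightarrow> real) cdga_presheaf"
  where "deRham M = \<lparr>
    algs = (\<lambda>V. \<lparr>
      gmod = (\<lambda>k. \<lparr>carrier = dR_forms M V k, mult = undefined, one = undefined,
        zero = (\<lambda>x\<in>V. \<lambda>vs\<in>tvec_tuples M x k. 0),
        add = (\<lambda>\<omega> \<eta>. \<lambda>x\<in>V. \<lambda>vs\<in>tvec_tuples M x k. \<omega> x vs + \<eta> x vs),
        smult = (\<lambda>u \<omega>. \<lambda>x\<in>V. \<lambda>vs\<in>tvec_tuples M x k. u x * \<omega> x vs)\<rparr>),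
      gmult = (\<lambda>k l \<omega> \<eta>. \<lambda>x\<in>V. wedge M x k l (\<omega> x) (\<eta> x)),
      gdiff = dR_diff M V\<rparr>),
    ares = (\<lambda>U V k \<omega>. restrict \<omega> V)\<rparr>"

text \<open>A smooth function on \<open>V\<close>, as a differential form of degree 0.\<close>

definition dR_fun :: "'m mfd \<Rightarrow> 'm set \<Rightarrow> ('m \<Rightarrow> real) \<Rightarrow> 'm \<Rightarrow> 'm tvec list \<Rightarrow> real"
  where "dR_fun M V u = (\<lambda>x\<in>V. \<lambda>vs\<in>tvec_tuples M x 0. u x)"


section \<open>The induced map on differential forms\<close>

definition cdga_presheaf_map ::
    "'x topology \<Rightarrow> ('x, 'c) cinf_presheaf \<Rightarrow> ('x, 'c, 'e) cdga_presheaf \<Rightarrow> ('x, 'c, 'f) cdga_presheaf \<Rightarrow>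
     ('x set \<Rightarrow> int \<Rightarrow> 'e \<Rightarrow> 'f) \<Rightarrow> bool"
  where "cdga_presheaf_map X B A A' F \<longleftrightarrow>
    (\<forall>U. openin X U \<longrightarrow> cdga_map (rings B U) (algs A U) (algs A' U) (F U)) \<and>
    (\<forall>U V k. \<forall>\<omega>\<in>carrier (gmod (algs A U) k). openin X U \<longrightarrow> openin X V \<longrightarrow> V \<subseteq> U \<longrightarrow>
       F V k (ares A U V k \<omega>) = ares A' U V k (F U k \<omega>))"

text \<open>The push-forward $f_*$ of a sheaf of CDGAs, with scalars restricted along $f_\#$.\<close>

definition push_cdga ::
    "'m topology \<Rightarrow> ('m \<Rightarrow> 'x) \<Rightarrow> ('x set \<Rightarrow> 'b \<Rightarrow> 'a) \<Rightarrow> ('m, 'a, 'e) cdga_presheaf \<Rightarrow>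
     ('x, 'b, 'e) cdga_presheaf"
  where "push_cdga T f fs A = \<lparr>
    algs = (\<lambda>U. restrict_scalars (fs U) (algs A (preimage T f U))),
    ares = (\<lambda>U V. ares A (preimage T f U) (preimage T f V))\<rparr>"

text \<open>\<open>fstar\<close> is induced by $(f,f_\#)$ if it is the global component of a map
  $\mathbf{\Omega}^\bullet_B \to f_*\mathbf{\Omega}^\bullet_{dR,M}$ of sheaves of CDGAs that is $f_\#$ on functions. Such a map sends
  $b_0\,db_1 \wedge \dots \wedge db_k$ over each open \<open>U\<close> to
  $f_\#(b_0)\,d f_\#(b_1) \wedge \dots \wedge d f_\#(b_k)$, so it is determined by $f_\#$.\<close>

definition induced_on_forms ::
    "'m mfd \<Rightarrow> 'x topology \<Rightarrow> ('x, 'b) cinf_presheaf \<Rightarrow> ('m \<Rightarrow> 'x) \<Rightarrow> ('x set \<Rightarrow> 'b \<Rightarrow> 'm \<Rightarrow> real) \<Rightarrow>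
     (int \<Rightarrow> ('x \<Rightarrow> ('x set \<times> 'b kform) set) \<Rightarrow> ('m \<Rightarrow> 'm tvec list \<Rightarrow> real)) \<Rightarrow> bool"
  where "induced_on_forms M X B f fs fstar \<longleftrightarrow>
    (\<exists>F. cdga_presheaf_map X B (Omega X B) (push_cdga (mtop M) f fs (deRham M)) F \<and>
       (\<forall>U. \<forall>b\<in>carrier (rings B U). openin X U \<longrightarrow>
          F U 0 (Omega_fun X B U b) = dR_fun M (preimage (mtop M) f U) (fs U b)) \<and>
       fstar = F (topspace X))"

end

theory Submission
  imports Defs
begin

text \<open>Over an open \<open>U\<close> of \<open>N\<close>, the map $b \mapsto d(f_\#b)$ is a $C^\infty$-derivation of $B(U)$ with values in the
  1-forms on $f^{-1}(U)$, so the universal properties of $\Omega^1_{B(U)}$ and of its exterior algebra extend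
  $f_\#$ to forms. The extension commutes with the differentials and is natural in \<open>U\<close> because
  $\Lambda^\bullet\Omega^1_{B(U)}$ is generated by the elements $b$ and $db$; hence it passes to germs and to the
  sheafification.

  The differential of $\Lambda^\bullet\Omega^1_C$ is the $\epsilon$-part of a map of $\Lambda^\bullet\Omega^1_C$ into its own
  algebra of dual numbers. On a manifold, in a chart $u$, the exterior derivative is
  $\sum_i du^i \wedge \partial_i$, whose square vanishes by the symmetry of second derivatives, and it does not
  depend on the chart by induction on the degree:
  $(k+1)\,\omega = \sum_i du^i \wedge \iota_i\omega$ for every $(k+1)$-form $\omega$.\<close>

section \<open>Linear maps and cosets\<close>

text \<open>A differential is linear over constants only, so the universal property of the exterior
  algebra, which yields linear maps, cannot produce it directly. Twisting the scalars of the dual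
  numbers, with \<open>a\<close> acting as a + \<epsilon> da, makes x \<mapsto> x + \<epsilon> dx
  linear; that (da, 0) is a derivation for the twisted scalars is the symmetry of second partial
  derivatives.

  On a manifold with corners partial derivatives at a boundary face are one-sided and smoothness
  means local extendability, so calculus is done on open sets of R^n and carried over through
  extensions. A direct comparison of the coordinate formulas for the exterior derivative in two
  charts would involve second derivatives of the transition maps; the induction on the degree uses
  the chain rule for functions only.

  Degrees are integers, and in each negative degree there is exactly one form, so identities on the
  manifold are proved for natural degrees and checked separately below 0. Operations on cosets and
  germs are unions over representatives; each has to be shown first to be a union of equal
  sets.\<close>

lemma linear_mapI:
  "\<lbrakk>\<And>x. x \<in> carrier N \<Longrightarrow> f x \<in> carrier N';
    \<And>x y. x \<in> carrier N \<Longrightarrow> y \<in> carrier N \<Longrightarrow> f (x \<oplus>\<^bsub>N\<^esub> y) = f x \<oplus>\<^bsub>N'\<^esub> f y;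
    \<And>r x. r \<in> carrier R \<Longrightarrow> x \<in> carrier N \<Longrightarrow> f (r \<odot>\<^bsub>N\<^esub> x) = r \<odot>\<^bsub>N'\<^esub> f x\<rbrakk> \<Longrightarrow> linear_map R N N' f"
  by (auto simp: linear_map_def)

lemma linear_map_uminus:
  assumes "Module.module R N" "Module.module R N'" "linear_map R N N' f" "x \<in> carrier N"
  shows "f (\<ominus>\<^bsub>N\<^esub> x) = \<ominus>\<^bsub>N'\<^esub> f x"
proof -
  interpret N: Module.module R N by fact
  interpret N': Module.module R N' by fact
  show ?thesis
    using linear_map_minus[OF assms(1-3) N.M.zero_closed assms(4)] linear_map_zero[OF assms(1-3)] assms
      linear_map_simps(1)[OF assms(3)] by (simp add: a_minus_def)
qed

lemma submodule_zero: "submodule H R N \<Longrightarrow> \<zero>\<^bsub>N\<^esub> \<in> H"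
  using submodule.axioms(1)[THEN subgroup.one_closed] by fastforce

text \<open>Membership of images in a submodule can thus be checked on generators: the preimage is a
  submodule, and the induction rules for free modules and spans apply to it.\<close>

lemma linear_map_preimage:
  assumes N: "Module.module R N" and N': "Module.module R N'" and f: "linear_map R N N' f" and H: "submodule H R N'"
  shows "submodule {x \<in> carrier N. f x \<in> H} R N"
proof -
  interpret N: Module.module R N by fact
  interpret N': Module.module R N' by fact
  show ?thesis
    by (rule N.submoduleI)
      (use N'.submoduleE[OF H] submodule_zero[OF H] linear_map_simps[OF f] linear_map_zero[OF N N' f]
        linear_map_uminus[OF N N' f] in auto)
qed

lemma
  assumes N: "Module.module R N" and H: "submodule H R N" and x: "x \<in> carrier N"
  shows coset_self: "x \<in> H +>\<^bsub>N\<^esub> x"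
    and coset_mem: "y \<in> H +>\<^bsub>N\<^esub> x \<Longrightarrow> y \<in> carrier N \<and> H +>\<^bsub>N\<^esub> y = H +>\<^bsub>N\<^esub> x"
proof -
  interpret N: Module.module R N by fact
  interpret H: abelian_subgroup H N
    by (rule abelian_subgroupI3[OF additive_subgroup.intro])
      (use H submodule.axioms(1) N.M.abelian_group_axioms in auto)
  show "x \<in> H +>\<^bsub>N\<^esub> x" using x by (rule H.a_rcos_self)
  show "y \<in> carrier N \<and> H +>\<^bsub>N\<^esub> y = H +>\<^bsub>N\<^esub> x" if "y \<in> H +>\<^bsub>N\<^esub> x"
    using that x H.a_repr_independence'[OF that x] H.a_elemrcos_carrier[OF x that] by simp
qed

text \<open>Operations on quotients are defined as unions over the elements of a coset; such a union
  collapses to one value once every representative gives the same value.\<close>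

lemma coset_UN:
  assumes N: "Module.module R N" and H: "submodule H R N" and x: "x \<in> carrier N"
    and "\<And>y. y \<in> carrier N \<Longrightarrow> H +>\<^bsub>N\<^esub> y = H +>\<^bsub>N\<^esub> x \<Longrightarrow> f y = f x"
  shows "(\<Union>y\<in>H +>\<^bsub>N\<^esub> x. f y) = f x"
proof (rule SUP_eq_const)
  show "H +>\<^bsub>N\<^esub> x \<noteq> {}" using coset_self[OF N H x] by blast
  show "f y = f x" if "y \<in> H +>\<^bsub>N\<^esub> x" for y
    using coset_mem[OF N H x that] assms(4) by blast
qed

lemma gsign_closed: "Module.module R N \<Longrightarrow> x \<in> carrier N \<Longrightarrow> gsign N k x \<in> carrier N"
  by (simp add: gsign_def Module.module_def abelian_group.a_inv_closed)

lemma gsign_gsign: "Module.module R N \<Longrightarrow> x \<in> carrier N \<Longrightarrow> gsign N k (gsign N l x) = gsign N (k + l) x"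
  by (auto simp: gsign_def Module.module_def abelian_group.a_inv_closed abelian_group.minus_minus)

lemma linear_map_gsign:
  assumes N: "Module.module R N"
  shows "linear_map R N N (gsign N k)"
proof -
  interpret N: Module.module R N by fact
  show ?thesis by (auto simp: linear_map_def gsign_def N.M.minus_add N.smult_r_minus)
qed

lemma linear_map_gsign_commute:
  assumes "Module.module R N" "Module.module R N'" "linear_map R N N' f" "x \<in> carrier N"
  shows "f (gsign N k x) = gsign N' k (f x)"
  using linear_map_uminus[OF assms] by (simp add: gsign_def)

lemma linear_map_id: "linear_map R N N (\<lambda>x. x)"
  by (simp add: linear_map_def)

section \<open>Graded algebras\<close>

text \<open>Graded commutativity and a unit are kept apart from these axioms, so that the dual
  numbers, which serve as a target of \<open>ext_universal\<close>, qualify as soon as bilinearity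
  and associativity are known.\<close>

locale graded_algebra =
  fixes R :: "'c ring" and A :: "('c, 'e, 'z) graded_scheme"
  assumes gmod_module: "\<And>k. Module.module R (gmod A k)"
    and gmult_closed: "\<And>k l x y. x \<in> carrier (gmod A k) \<Longrightarrow> y \<in> carrier (gmod A l) \<Longrightarrow>
      gmult A k l x y \<in> carrier (gmod A (k + l))"
    and gmult_add_l: "\<And>k l x x' y. x \<in> carrier (gmod A k) \<Longrightarrow> x' \<in> carrier (gmod A k) \<Longrightarrow>
      y \<in> carrier (gmod A l) \<Longrightarrow>
      gmult A k l (x \<oplus>\<^bsub>gmod A k\<^esub> x') y = gmult A k l x y \<oplus>\<^bsub>gmod A (k + l)\<^esub> gmult A k l x' y"
    and gmult_add_r: "\<And>k l x y y'. x \<in> carrier (gmod A k) \<Longrightarrow> y \<in> carrier (gmod A l) \<Longrightarrow>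
      y' \<in> carrier (gmod A l) \<Longrightarrow>
      gmult A k l x (y \<oplus>\<^bsub>gmod A l\<^esub> y') = gmult A k l x y \<oplus>\<^bsub>gmod A (k + l)\<^esub> gmult A k l x y'"
    and gmult_smult_l: "\<And>k l a x y. a \<in> carrier R \<Longrightarrow> x \<in> carrier (gmod A k) \<Longrightarrow>
      y \<in> carrier (gmod A l) \<Longrightarrow> gmult A k l (a \<odot>\<^bsub>gmod A k\<^esub> x) y = a \<odot>\<^bsub>gmod A (k + l)\<^esub> gmult A k l x y"
    and gmult_smult_r: "\<And>k l a x y. a \<in> carrier R \<Longrightarrow> x \<in> carrier (gmod A k) \<Longrightarrow>
      y \<in> carrier (gmod A l) \<Longrightarrow> gmult A k l x (a \<odot>\<^bsub>gmod A l\<^esub> y) = a \<odot>\<^bsub>gmod A (k + l)\<^esub> gmult A k l x y"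
    and gmult_assoc: "\<And>k l m x y z. x \<in> carrier (gmod A k) \<Longrightarrow> y \<in> carrier (gmod A l) \<Longrightarrow>
      z \<in> carrier (gmod A m) \<Longrightarrow>
      gmult A (k + l) m (gmult A k l x y) z = gmult A k (l + m) x (gmult A l m y z)"
begin

lemma gmult_closed': "x \<in> carrier (gmod A k) \<Longrightarrow> y \<in> carrier (gmod A l) \<Longrightarrow> m = k + l \<Longrightarrow>
      gmult A k l x y \<in> carrier (gmod A m)"
  by (simp add: gmult_closed)

lemma gmult_linear_l: "y \<in> carrier (gmod A l) \<Longrightarrow>
    linear_map R (gmod A k) (gmod A (k + l)) (\<lambda>x. gmult A k l x y)"
  by (intro linear_mapI gmult_closed gmult_add_l gmult_smult_l)

lemma gmult_linear_r: "x \<in> carrier (gmod A k) \<Longrightarrow>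
    linear_map R (gmod A l) (gmod A (k + l)) (\<lambda>y. gmult A k l x y)"
  by (intro linear_mapI gmult_closed gmult_add_r gmult_smult_r)

lemma gmult_zero_l: "y \<in> carrier (gmod A l) \<Longrightarrow> gmult A k l \<zero>\<^bsub>gmod A k\<^esub> y = \<zero>\<^bsub>gmod A (k + l)\<^esub>"
  using linear_map_zero[OF gmod_module gmod_module gmult_linear_l] .

lemma gmult_zero_r: "x \<in> carrier (gmod A k) \<Longrightarrow> gmult A k l x \<zero>\<^bsub>gmod A l\<^esub> = \<zero>\<^bsub>gmod A (k + l)\<^esub>"
  using linear_map_zero[OF gmod_module gmod_module gmult_linear_r] .

lemma gmult_gsign_l: "x \<in> carrier (gmod A k) \<Longrightarrow> y \<in> carrier (gmod A l) \<Longrightarrow>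
    gmult A k l (gsign (gmod A k) m x) y = gsign (gmod A (k + l)) m (gmult A k l x y)"
  using linear_map_gsign_commute[OF gmod_module gmod_module gmult_linear_l] .

lemma gmult_gsign_r: "x \<in> carrier (gmod A k) \<Longrightarrow> y \<in> carrier (gmod A l) \<Longrightarrow>
    gmult A k l x (gsign (gmod A l) m y) = gsign (gmod A (k + l)) m (gmult A k l x y)"
  using linear_map_gsign_commute[OF gmod_module gmod_module gmult_linear_r] .

end

lemma cga_iff: "cga C A \<longleftrightarrow> graded_algebra (alg C) A \<and>
    (\<forall>k l. \<forall>x\<in>carrier (gmod A k). \<forall>y\<in>carrier (gmod A l).
       gmult A k l x y = gsign (gmod A (k + l)) (k * l) (gmult A l k y x))"
  unfolding cga_def graded_algebra_def by (simp only: alg_simps) meson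

section \<open>The exterior algebra\<close>

definition ext_word :: "'r ring \<Rightarrow> ('r, 'm) module \<Rightarrow> int \<Rightarrow> 'm list \<Rightarrow> ('m list \<Rightarrow> 'r) set"
  where "ext_word R N k w = ext_rel R N k +>\<^bsub>ext_free R N k\<^esub> free_gen R w"

definition ext_words :: "('r, 'm) module \<Rightarrow> int \<Rightarrow> 'm list set"
  where "ext_words N k = {w \<in> lists (carrier N). int (length w) = k}"

text \<open>The function under the unions in the product of \<open>ext_algebra\<close>, isolated so
  that bilinearity and compatibility with the relations can be stated on free modules.\<close>

definition ext_conc :: "'r ring \<Rightarrow> int \<Rightarrow> ('m list \<Rightarrow> 'r) \<Rightarrow> ('m list \<Rightarrow> 'r) \<Rightarrow> 'm list \<Rightarrow> 'r"
  where "ext_conc R k p q = (\<lambda>w. p (take (nat k) w) \<otimes>\<^bsub>R\<^esub> q (drop (nat k) w))"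

locale exterior =
  fixes R :: "'r ring" and N :: "('r, 'm) module"
  assumes base_module: "Module.module R N"
begin

sublocale N: Module.module R N by (rule base_module)

section \<open>Words, relations and the graded pieces of the exterior algebra\<close>

abbreviation "Fr k \<equiv> ext_free R N k"
abbreviation "Rl k \<equiv> ext_rel R N k"
abbreviation "Lam k \<equiv> gmod (ext_algebra R N) k"

lemma cring_R: "cring R" by (rule N.R.cring_axioms)

lemma Fr_eq: "Fr k = free_module R (ext_words N k)"
  by (simp add: ext_free_def ext_words_def)

lemma Fr_module: "Module.module R (Fr k)"
  by (simp add: Fr_eq module_free_module cring_R)

lemma gen_closed: "w \<in> ext_words N k \<Longrightarrow> free_gen R w \<in> carrier (Fr k)"
  by (simp add: Fr_eq free_gen_closed cring_R)

lemma ext_words_app: "u @ v \<in> ext_words N k \<longleftrightarrow>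
    set u \<subseteq> carrier N \<and> set v \<subseteq> carrier N \<and> int (length u) + int (length v) = k"
  by (auto simp: ext_words_def)

lemma ext_words_Cons: "x # v \<in> ext_words N k \<longleftrightarrow>
    x \<in> carrier N \<and> set v \<subseteq> carrier N \<and> 1 + int (length v) = k"
  by (auto simp: ext_words_def)

lemmas ext_words_simps = ext_words_app ext_words_Cons

lemma Fr_closed:
  "p \<in> carrier (Fr k) \<Longrightarrow> q \<in> carrier (Fr k) \<Longrightarrow> p \<ominus>\<^bsub>Fr k\<^esub> q \<in> carrier (Fr k)"
  "p \<in> carrier (Fr k) \<Longrightarrow> q \<in> carrier (Fr k) \<Longrightarrow> p \<oplus>\<^bsub>Fr k\<^esub> q \<in> carrier (Fr k)"
  "r \<in> carrier R \<Longrightarrow> p \<in> carrier (Fr k) \<Longrightarrow> r \<odot>\<^bsub>Fr k\<^esub> p \<in> carrier (Fr k)"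
proof -
  interpret F: Module.module R "Fr k" by (rule Fr_module)
  show "p \<in> carrier (Fr k) \<Longrightarrow> q \<in> carrier (Fr k) \<Longrightarrow> p \<ominus>\<^bsub>Fr k\<^esub> q \<in> carrier (Fr k)"
    "p \<in> carrier (Fr k) \<Longrightarrow> q \<in> carrier (Fr k) \<Longrightarrow> p \<oplus>\<^bsub>Fr k\<^esub> q \<in> carrier (Fr k)"
    "r \<in> carrier R \<Longrightarrow> p \<in> carrier (Fr k) \<Longrightarrow> r \<odot>\<^bsub>Fr k\<^esub> p \<in> carrier (Fr k)" by auto
qed

lemma Rl_submodule: "submodule (Rl k) R (Fr k)"
  unfolding ext_rel_def
  by (rule span_module_submodule[OF Fr_module])
    (auto intro!: Fr_closed gen_closed simp: ext_words_simps)

lemma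
  shows rel_add: "u @ [x] @ v \<in> ext_words N k \<Longrightarrow> y \<in> carrier N \<Longrightarrow>
      free_gen R (u @ [x \<oplus>\<^bsub>N\<^esub> y] @ v) \<ominus>\<^bsub>Fr k\<^esub>
        (free_gen R (u @ [x] @ v) \<oplus>\<^bsub>Fr k\<^esub> free_gen R (u @ [y] @ v)) \<in> Rl k"
    and rel_smult: "u @ [x] @ v \<in> ext_words N k \<Longrightarrow> r \<in> carrier R \<Longrightarrow>
      free_gen R (u @ [r \<odot>\<^bsub>N\<^esub> x] @ v) \<ominus>\<^bsub>Fr k\<^esub> (r \<odot>\<^bsub>Fr k\<^esub> free_gen R (u @ [x] @ v)) \<in> Rl k"
    and rel_alt: "u @ [x, x] @ v \<in> ext_words N k \<Longrightarrow> free_gen R (u @ [x, x] @ v) \<in> Rl k"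
  unfolding ext_rel_def
  by (rule subsetD[OF span_module_incl], rule UnI1, rule UnI1, fastforce simp: ext_words_simps)
     (rule subsetD[OF span_module_incl], rule UnI1, rule UnI2, fastforce simp: ext_words_simps,
      rule subsetD[OF span_module_incl], rule UnI2, fastforce simp: ext_words_simps)

text \<open>The three cases are the three families of generators of \<open>ext_rel\<close>; the
  relations are a hull, so a submodule containing the families contains all of
  \<open>Rl k\<close>.\<close>

lemma rel_induct:
  assumes K: "submodule K R (Fr k)"
    and "\<And>u v x y. u @ [x] @ v \<in> ext_words N k \<Longrightarrow> y \<in> carrier N \<Longrightarrow>
      free_gen R (u @ [x \<oplus>\<^bsub>N\<^esub> y] @ v) \<ominus>\<^bsub>Fr k\<^esub>
        (free_gen R (u @ [x] @ v) \<oplus>\<^bsub>Fr k\<^esub> free_gen R (u @ [y] @ v)) \<in> K"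
    and "\<And>u v x r. u @ [x] @ v \<in> ext_words N k \<Longrightarrow> r \<in> carrier R \<Longrightarrow>
      free_gen R (u @ [r \<odot>\<^bsub>N\<^esub> x] @ v) \<ominus>\<^bsub>Fr k\<^esub> (r \<odot>\<^bsub>Fr k\<^esub> free_gen R (u @ [x] @ v)) \<in> K"
    and "\<And>u v x. u @ [x, x] @ v \<in> ext_words N k \<Longrightarrow> free_gen R (u @ [x, x] @ v) \<in> K"
  shows "Rl k \<subseteq> K"
  unfolding ext_rel_def
proof (rule span_module_minimal[OF K], intro Un_least subsetI, goal_cases)
  case (1 z)
  then obtain u v x y where z: "z = free_gen R (u @ [x \<oplus>\<^bsub>N\<^esub> y] @ v) \<ominus>\<^bsub>Fr k\<^esub>
        (free_gen R (u @ [x] @ v) \<oplus>\<^bsub>Fr k\<^esub> free_gen R (u @ [y] @ v))"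
    "{x, y} \<union> set u \<union> set v \<subseteq> carrier N \<and> int (length (u @ [x] @ v)) = k" by blast
  then show ?case unfolding z(1) by (intro assms(2)) (auto simp: ext_words_simps)
next
  case (2 z)
  then obtain u v r x where z: "z = free_gen R (u @ [r \<odot>\<^bsub>N\<^esub> x] @ v) \<ominus>\<^bsub>Fr k\<^esub> (r \<odot>\<^bsub>Fr k\<^esub> free_gen R (u @ [x] @ v))"
    "r \<in> carrier R \<and> {x} \<union> set u \<union> set v \<subseteq> carrier N \<and> int (length (u @ [x] @ v)) = k" by blast
  then show ?case unfolding z(1) by (intro assms(3)) (auto simp: ext_words_simps)
next
  case (3 z)
  then obtain u v x where z: "z = free_gen R (u @ [x, x] @ v)"
    "{x} \<union> set u \<union> set v \<subseteq> carrier N \<and> int (length (u @ [x, x] @ v)) = k" by blast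
  then show ?case unfolding z(1) by (intro assms(4)) (auto simp: ext_words_simps)
qed

lemma Lam_eq: "Lam k = quot_module (Fr k) (Rl k)"
  by (simp add: ext_algebra_def)

lemma Lam_module: "Module.module R (Lam k)"
  by (simp add: Lam_eq module_quot_module Fr_module Rl_submodule)

lemma proj_linear: "linear_map R (Fr k) (Lam k) (\<lambda>p. Rl k +>\<^bsub>Fr k\<^esub> p)"
  by (simp add: Lam_eq linear_map_quot Fr_module Rl_submodule)

lemma Lam_carrier: "carrier (Lam k) = (\<lambda>p. Rl k +>\<^bsub>Fr k\<^esub> p) ` carrier (Fr k)"
  unfolding Lam_eq by (rule quot_carrier[OF Fr_module Rl_submodule])

lemma proj_eq_iff: "p \<in> carrier (Fr k) \<Longrightarrow> q \<in> carrier (Fr k) \<Longrightarrow>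
    Rl k +>\<^bsub>Fr k\<^esub> p = Rl k +>\<^bsub>Fr k\<^esub> q \<longleftrightarrow> p \<ominus>\<^bsub>Fr k\<^esub> q \<in> Rl k"
  by (rule quot_eq_iff[OF Fr_module Rl_submodule])

lemma ext_word_closed: "w \<in> ext_words N k \<Longrightarrow> ext_word R N k w \<in> carrier (Lam k)"
  unfolding ext_word_def by (rule linear_map_simps(1)[OF proj_linear gen_closed])

lemma ext_word_add:
  assumes "u @ [x] @ v \<in> ext_words N k" "y \<in> carrier N"
  shows "ext_word R N k (u @ [x \<oplus>\<^bsub>N\<^esub> y] @ v) =
     ext_word R N k (u @ [x] @ v) \<oplus>\<^bsub>Lam k\<^esub> ext_word R N k (u @ [y] @ v)"
proof -
  interpret F: Module.module R "Fr k" by (rule Fr_module)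
  have "u @ [x \<oplus>\<^bsub>N\<^esub> y] @ v \<in> ext_words N k" "u @ [y] @ v \<in> ext_words N k"
    using assms by (auto simp: ext_words_simps)
  then show ?thesis
    using proj_eq_iff rel_add[OF assms] assms(1) unfolding ext_word_def
    by (subst linear_map_simps(2)[OF proj_linear, symmetric]) (simp_all add: gen_closed)
qed

lemma ext_word_smult:
  assumes "u @ [x] @ v \<in> ext_words N k" "r \<in> carrier R"
  shows "ext_word R N k (u @ [r \<odot>\<^bsub>N\<^esub> x] @ v) = r \<odot>\<^bsub>Lam k\<^esub> ext_word R N k (u @ [x] @ v)"
proof -
  interpret F: Module.module R "Fr k" by (rule Fr_module)
  have "u @ [r \<odot>\<^bsub>N\<^esub> x] @ v \<in> ext_words N k"
    using assms by (auto simp: ext_words_simps)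
  then show ?thesis
    using proj_eq_iff rel_smult[OF assms] assms unfolding ext_word_def
    by (subst linear_map_simps(3)[OF proj_linear, symmetric]) (simp_all add: gen_closed)
qed

lemma ext_word_alt:
  assumes "u @ [x, x] @ v \<in> ext_words N k"
  shows "ext_word R N k (u @ [x, x] @ v) = \<zero>\<^bsub>Lam k\<^esub>"
proof -
  interpret F: Module.module R "Fr k" by (rule Fr_module)
  have "free_gen R (u @ [x, x] @ v) \<ominus>\<^bsub>Fr k\<^esub> \<zero>\<^bsub>Fr k\<^esub> = free_gen R (u @ [x, x] @ v)"
    using gen_closed[OF assms] by (simp add: a_minus_def)
  then have "ext_word R N k (u @ [x, x] @ v) = Rl k +>\<^bsub>Fr k\<^esub> \<zero>\<^bsub>Fr k\<^esub>"
    unfolding ext_word_def using gen_closed[OF assms] rel_alt[OF assms] by (subst proj_eq_iff) simp_all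
  then show ?thesis using linear_map_zero[OF Fr_module Lam_module proj_linear] by simp
qed

lemma Lam_induct:
  assumes K: "submodule K R (Lam k)" and w: "\<And>w. w \<in> ext_words N k \<Longrightarrow> ext_word R N k w \<in> K"
  shows "carrier (Lam k) \<subseteq> K"
proof -
  have "carrier (Fr k) \<subseteq> {p \<in> carrier (Fr k). Rl k +>\<^bsub>Fr k\<^esub> p \<in> K}"
    unfolding Fr_eq
    by (rule free_module_induct[OF cring_R])
      (use linear_map_preimage[OF Fr_module Lam_module proj_linear K] w gen_closed in \<open>auto simp: Fr_eq ext_word_def\<close>)
  then show ?thesis by (auto simp: Lam_carrier)
qed

lemma Lam_linear_eq:
  assumes "Module.module R N'" "linear_map R (Lam k) N' f" "linear_map R (Lam k) N' g"
    and "\<And>w. w \<in> ext_words N k \<Longrightarrow> f (ext_word R N k w) = g (ext_word R N k w)"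
    and "x \<in> carrier (Lam k)"
  shows "f x = g x"
  using Lam_induct[OF linear_map_equalizer[OF Lam_module assms(1-3)]] assms(4,5) ext_word_closed by blast

text \<open>The linear extension of \<open>X\<close> to the free module kills the three families of
  generating relations, one by each of the hypotheses on \<open>X\<close>, and so descends to the
  quotient.\<close>

lemma Lam_lift:
  assumes N': "Module.module R N'" and X: "\<And>w. w \<in> ext_words N k \<Longrightarrow> X w \<in> carrier N'"
    and add: "\<And>u v x y. u @ [x] @ v \<in> ext_words N k \<Longrightarrow> y \<in> carrier N \<Longrightarrow>
      X (u @ [x \<oplus>\<^bsub>N\<^esub> y] @ v) = X (u @ [x] @ v) \<oplus>\<^bsub>N'\<^esub> X (u @ [y] @ v)"
    and smult: "\<And>u v x r. u @ [x] @ v \<in> ext_words N k \<Longrightarrow> r \<in> carrier R \<Longrightarrow>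
      X (u @ [r \<odot>\<^bsub>N\<^esub> x] @ v) = r \<odot>\<^bsub>N'\<^esub> X (u @ [x] @ v)"
    and alt: "\<And>u v x. u @ [x, x] @ v \<in> ext_words N k \<Longrightarrow> X (u @ [x, x] @ v) = \<zero>\<^bsub>N'\<^esub>"
  shows "\<exists>F. linear_map R (Lam k) N' F \<and> (\<forall>w\<in>ext_words N k. F (ext_word R N k w) = X w)"
proof -
  interpret N': Module.module R N' by fact
  interpret F: Module.module R "Fr k" by (rule Fr_module)
  have "X \<in> ext_words N k \<rightarrow> carrier N'" using X by auto
  from free_module_lift[OF cring_R N' this] obtain G
    where G: "linear_map R (Fr k) N' G" "\<And>w. w \<in> ext_words N k \<Longrightarrow> G (free_gen R w) = X w"
    unfolding Fr_eq by blast
  have const: "linear_map R (Fr k) N' (\<lambda>x. \<zero>\<^bsub>N'\<^esub>)" by (auto simp: linear_map_def)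
  have "Rl k \<subseteq> {p \<in> carrier (Fr k). G p = \<zero>\<^bsub>N'\<^esub>}"
  proof (rule rel_induct[OF linear_map_equalizer[OF Fr_module N' G(1) const]], goal_cases)
    case (1 u v x y)
    then have w: "u @ [x \<oplus>\<^bsub>N\<^esub> y] @ v \<in> ext_words N k" "u @ [y] @ v \<in> ext_words N k"
      by (auto simp: ext_words_simps)
    note c = gen_closed[OF w(1)] gen_closed[OF 1(1)] gen_closed[OF w(2)]
    have "G (free_gen R (u @ [x \<oplus>\<^bsub>N\<^esub> y] @ v) \<ominus>\<^bsub>Fr k\<^esub> (free_gen R (u @ [x] @ v) \<oplus>\<^bsub>Fr k\<^esub> free_gen R (u @ [y] @ v)))
       = X (u @ [x \<oplus>\<^bsub>N\<^esub> y] @ v) \<ominus>\<^bsub>N'\<^esub> (X (u @ [x] @ v) \<oplus>\<^bsub>N'\<^esub> X (u @ [y] @ v))"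
      using c w 1 by (simp add: linear_map_minus[OF Fr_module N' G(1)] linear_map_simps[OF G(1)] G(2))
    also have "\<dots> = \<zero>\<^bsub>N'\<^esub>" using add[OF 1] X[OF 1(1)] X[OF w(2)] by (simp add: N'.M.r_neg a_minus_def)
    finally show ?case using c by simp
  next
    case (2 u v x r)
    then have w: "u @ [r \<odot>\<^bsub>N\<^esub> x] @ v \<in> ext_words N k"
      by (auto simp: ext_words_simps)
    note c = gen_closed[OF w(1)] gen_closed[OF 2(1)]
    have "G (free_gen R (u @ [r \<odot>\<^bsub>N\<^esub> x] @ v) \<ominus>\<^bsub>Fr k\<^esub> (r \<odot>\<^bsub>Fr k\<^esub> free_gen R (u @ [x] @ v)))
       = X (u @ [r \<odot>\<^bsub>N\<^esub> x] @ v) \<ominus>\<^bsub>N'\<^esub> (r \<odot>\<^bsub>N'\<^esub> X (u @ [x] @ v))"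
      using c w 2 by (simp add: linear_map_minus[OF Fr_module N' G(1)] linear_map_simps[OF G(1)] G(2))
    also have "\<dots> = \<zero>\<^bsub>N'\<^esub>" using smult[OF 2] X[OF 2(1)] 2 by (simp add: N'.M.r_neg a_minus_def)
    finally show ?case using c 2 by simp
  next
    case (3 u v x)
    then show ?case using alt gen_closed G(2) by simp
  qed
  then have "\<exists>\<phi>. linear_map R (Lam k) N' \<phi> \<and> (\<forall>x\<in>carrier (Fr k). \<phi> (Rl k +>\<^bsub>Fr k\<^esub> x) = G x)"
    unfolding Lam_eq by (intro quot_module_lift[OF Fr_module Rl_submodule N' G(1)]) auto
  then show ?thesis unfolding ext_word_def using gen_closed G(2) by metis
qed

subsection \<open>The product\<close>

lemma conc_closed:
  assumes "p \<in> carrier (Fr k)" "q \<in> carrier (Fr l)"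
  shows "ext_conc R k p q \<in> carrier (Fr (k + l))"
proof -
  let ?P = "{u. p u \<noteq> \<zero>\<^bsub>R\<^esub>}" and ?Q = "{v. q v \<noteq> \<zero>\<^bsub>R\<^esub>}"
  have P: "?P \<subseteq> ext_words N k" "finite ?P" "\<And>u. p u \<in> carrier R"
   and Q: "?Q \<subseteq> ext_words N l" "finite ?Q" "\<And>u. q u \<in> carrier R"
    using assms by (auto simp: Fr_eq free_module_simps)
  have nz: "take (nat k) w \<in> ?P \<and> drop (nat k) w \<in> ?Q" if "ext_conc R k p q w \<noteq> \<zero>\<^bsub>R\<^esub>" for w
    using that P Q by (auto simp: ext_conc_def)
  \<comment> \<open>A nonzero coefficient forces both pieces of the word into the supports, so the
    support is covered by the concatenations of finitely many pairs.\<close>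
  have "{w. ext_conc R k p q w \<noteq> \<zero>\<^bsub>R\<^esub>} \<subseteq> (\<lambda>(u, v). u @ v) ` (?P \<times> ?Q)"
  proof
    fix w assume "w \<in> {w. ext_conc R k p q w \<noteq> \<zero>\<^bsub>R\<^esub>}"
    then have "(take (nat k) w, drop (nat k) w) \<in> ?P \<times> ?Q" using nz by auto
    then show "w \<in> (\<lambda>(u, v). u @ v) ` (?P \<times> ?Q)" by (rule rev_image_eqI) simp
  qed
  then have fin: "finite {w. ext_conc R k p q w \<noteq> \<zero>\<^bsub>R\<^esub>}"
    by (rule finite_subset) (use P Q in auto)
  have "w \<in> ext_words N (k + l)" if "ext_conc R k p q w \<noteq> \<zero>\<^bsub>R\<^esub>" for w
  proof -
    have "take (nat k) w @ drop (nat k) w \<in> ext_words N (k + l)"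
      using nz[OF that] P(1) Q(1) unfolding ext_words_app by (fastforce simp: ext_words_def)
    then show ?thesis by simp
  qed
  then show ?thesis using fin P(3) Q(3) by (auto simp: Fr_eq free_module_simps ext_conc_def)
qed

lemma conc_linear_l: "q \<in> carrier (Fr l) \<Longrightarrow> linear_map R (Fr k) (Fr (k + l)) (\<lambda>p. ext_conc R k p q)"
  by (rule linear_mapI, erule (1) conc_closed)
    (auto simp: Fr_eq free_module_simps ext_conc_def fun_eq_iff N.R.l_distr N.R.m_assoc)

lemma conc_linear_r: "p \<in> carrier (Fr k) \<Longrightarrow> linear_map R (Fr l) (Fr (k + l)) (\<lambda>q. ext_conc R k p q)"
  by (rule linear_mapI, erule (1) conc_closed)
    (auto simp: Fr_eq free_module_simps ext_conc_def fun_eq_iff N.R.r_distr N.R.m_lcomm)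

lemma conc_gen:
  assumes "u \<in> ext_words N k" "v \<in> ext_words N l"
  shows "ext_conc R k (free_gen R u) (free_gen R v) = free_gen R (u @ v)"
proof
  fix w
  have "nat k = length u" using assms by (auto simp: ext_words_def)
  then have "w = u @ v \<longleftrightarrow> take (nat k) w = u \<and> drop (nat k) w = v"
    by (metis append_eq_conv_conj append_take_drop_id)
  then show "ext_conc R k (free_gen R u) (free_gen R v) w = free_gen R (u @ v) w"
    by (auto simp: ext_conc_def free_gen_def)
qed

text \<open>Multiplication by a word on the left or on the right only adds context to a relation.\<close>

lemma Rl_image:
  assumes f: "linear_map R (Fr k) (Fr m) f" and words: "set a \<subseteq> carrier N" "set b \<subseteq> carrier N" "int (length a + length b) + k = m"
    and gen: "\<And>w. w \<in> ext_words N k \<Longrightarrow> f (free_gen R w) = free_gen R (a @ w @ b)" and p: "p \<in> Rl k"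
  shows "f p \<in> Rl m"
proof -
  interpret F: Module.module R "Fr k" by (rule Fr_module)
  note minus = linear_map_minus[OF Fr_module Fr_module f] linear_map_simps[OF f]
  have "Rl k \<subseteq> {p \<in> carrier (Fr k). f p \<in> Rl m}"
  proof (rule rel_induct[OF linear_map_preimage[OF Fr_module Fr_module f Rl_submodule]], goal_cases)
    case (1 u v x y)
    then have w: "u @ [x \<oplus>\<^bsub>N\<^esub> y] @ v \<in> ext_words N k" "u @ [y] @ v \<in> ext_words N k" "(a @ u) @ [x] @ (v @ b) \<in> ext_words N m"
      using words by (auto simp: ext_words_simps ext_words_def)
    show ?case
      using rel_add[OF w(3) 1(2)] gen_closed[OF w(1)] gen_closed[OF 1(1)] gen_closed[OF w(2)] gen[OF w(1)] gen[OF w(2)] gen[OF 1(1)]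
      by (simp add: minus)
  next
    case (2 u v x r)
    then have w: "u @ [r \<odot>\<^bsub>N\<^esub> x] @ v \<in> ext_words N k" "(a @ u) @ [x] @ (v @ b) \<in> ext_words N m"
      using words by (auto simp: ext_words_simps ext_words_def)
    show ?case
      using rel_smult[OF w(2) 2(2)] gen_closed[OF w(1)] gen_closed[OF 2(1)] gen[OF w(1)] gen[OF 2(1)] 2(2) by (simp add: minus)
  next
    case (3 u v x)
    then have w: "(a @ u) @ [x, x] @ (v @ b) \<in> ext_words N m" using words by (auto simp: ext_words_simps ext_words_def)
    show ?case using rel_alt[OF w] gen_closed[OF 3] gen[OF 3] by simp
  qed
  then show ?thesis using p by auto
qed

text \<open>Linearity in \<open>q\<close> reduces to a single word \<open>v\<close>, and appending
  \<open>v\<close> carries each generating relation to one with a longer right context.\<close>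

lemma conc_rel_l:
  assumes p: "p \<in> Rl k" and q: "q \<in> carrier (Fr l)"
  shows "ext_conc R k p q \<in> Rl (k + l)"
proof -
  have gen: "ext_conc R k p (free_gen R v) \<in> Rl (k + l)" if v: "v \<in> ext_words N l" for v
    by (rule Rl_image[OF conc_linear_l[OF gen_closed[OF v]], of "[]" v]) (use v p conc_gen in \<open>auto simp: ext_words_def\<close>)
  have p': "p \<in> carrier (Fr k)" using p Module.module.submoduleE(1)[OF Fr_module Rl_submodule] by auto
  have "carrier (Fr l) \<subseteq> {q \<in> carrier (Fr l). ext_conc R k p q \<in> Rl (k + l)}"
    unfolding Fr_eq[of l]
    by (rule free_module_induct[OF cring_R])
      (use linear_map_preimage[OF Fr_module Fr_module conc_linear_r[OF p'] Rl_submodule] gen gen_closed in \<open>auto simp: Fr_eq\<close>)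
  then show ?thesis using q by auto
qed

lemma conc_rel_r:
  assumes p: "p \<in> carrier (Fr k)" and q: "q \<in> Rl l"
  shows "ext_conc R k p q \<in> Rl (k + l)"
proof -
  have gen: "ext_conc R k (free_gen R v) q \<in> Rl (k + l)" if v: "v \<in> ext_words N k" for v
    by (rule Rl_image[OF conc_linear_r[OF gen_closed[OF v]], of v "[]"]) (use v q conc_gen in \<open>auto simp: ext_words_def\<close>)
  have q': "q \<in> carrier (Fr l)" using q Module.module.submoduleE(1)[OF Fr_module Rl_submodule] by auto
  have "carrier (Fr k) \<subseteq> {p \<in> carrier (Fr k). ext_conc R k p q \<in> Rl (k + l)}"
    unfolding Fr_eq[of k]
    by (rule free_module_induct[OF cring_R])
      (use linear_map_preimage[OF Fr_module Fr_module conc_linear_l[OF q'] Rl_submodule] gen gen_closed in \<open>auto simp: Fr_eq\<close>)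
  then show ?thesis using p by auto
qed

abbreviation "wmult k l \<equiv> gmult (ext_algebra R N) k l"

text \<open>By \<open>conc_rel_l\<close> and \<open>conc_rel_r\<close> a change of representative
  alters the concatenation by a relation only, so all the cosets in the double union
  coincide.\<close>

lemma wmult_proj:
  assumes p: "p \<in> carrier (Fr k)" and q: "q \<in> carrier (Fr l)"
  shows "wmult k l (Rl k +>\<^bsub>Fr k\<^esub> p) (Rl l +>\<^bsub>Fr l\<^esub> q) = Rl (k + l) +>\<^bsub>Fr (k + l)\<^esub> ext_conc R k p q"
proof -
  let ?pr = "\<lambda>p q. Rl (k + l) +>\<^bsub>Fr (k + l)\<^esub> ext_conc R k p q"
  have 1: "?pr p' q' = ?pr p q'" if "p' \<in> carrier (Fr k)" "Rl k +>\<^bsub>Fr k\<^esub> p' = Rl k +>\<^bsub>Fr k\<^esub> p" "q' \<in> carrier (Fr l)" for p' q'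
    using that p conc_rel_l[of "p' \<ominus>\<^bsub>Fr k\<^esub> p" k q' l]
    by (simp add: proj_eq_iff conc_closed linear_map_minus[OF Fr_module Fr_module conc_linear_l, symmetric])
  have 2: "?pr p q' = ?pr p q" if "q' \<in> carrier (Fr l)" "Rl l +>\<^bsub>Fr l\<^esub> q' = Rl l +>\<^bsub>Fr l\<^esub> q" for q'
    using that p q conc_rel_r[of p k "q' \<ominus>\<^bsub>Fr l\<^esub> q" l]
    by (simp add: proj_eq_iff conc_closed linear_map_minus[OF Fr_module Fr_module conc_linear_r, symmetric])
  have "wmult k l (Rl k +>\<^bsub>Fr k\<^esub> p) (Rl l +>\<^bsub>Fr l\<^esub> q) = (\<Union>p'\<in>Rl k +>\<^bsub>Fr k\<^esub> p. \<Union>q'\<in>Rl l +>\<^bsub>Fr l\<^esub> q. ?pr p' q')"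
    by (simp add: ext_algebra_def ext_conc_def)
  also have "\<dots> = (\<Union>q'\<in>Rl l +>\<^bsub>Fr l\<^esub> q. ?pr p q')"
    by (rule coset_UN[OF Fr_module Rl_submodule p], rule SUP_cong[OF refl])
      (use 1 coset_mem[OF Fr_module Rl_submodule q] in blast)
  also have "\<dots> = ?pr p q"
    by (rule coset_UN[OF Fr_module Rl_submodule q, where f = "?pr p"]) (rule 2)
  finally show ?thesis .
qed

lemma wmult_word: "u \<in> ext_words N k \<Longrightarrow> v \<in> ext_words N l \<Longrightarrow>
    wmult k l (ext_word R N k u) (ext_word R N l v) = ext_word R N (k + l) (u @ v)"
  by (simp add: ext_word_def wmult_proj gen_closed conc_gen)

lemma wmult_closed: "x \<in> carrier (Lam k) \<Longrightarrow> y \<in> carrier (Lam l) \<Longrightarrow> wmult k l x y \<in> carrier (Lam (k + l))"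
  by (auto simp: Lam_carrier wmult_proj conc_closed)

lemma Lam_linearI:
  assumes f: "linear_map R (Fr k) (Fr m) f" and g: "\<And>p. p \<in> carrier (Fr k) \<Longrightarrow> g (Rl k +>\<^bsub>Fr k\<^esub> p) = Rl m +>\<^bsub>Fr m\<^esub> f p"
  shows "linear_map R (Lam k) (Lam m) g"
proof (rule linear_mapI, goal_cases)
  interpret F: Module.module R "Fr k" by (rule Fr_module)
  note s = linear_map_simps[OF f] linear_map_simps(2,3)[OF proj_linear, symmetric]
  { case (1 x) then show ?case using s by (auto simp: Lam_carrier g) }
  { case (2 x y) then show ?case by (auto simp: Lam_carrier g s) }
  { case (3 r x) then show ?case by (auto simp: Lam_carrier g s) }
qed

lemma wmult_linear_l:
  assumes "y \<in> carrier (Lam l)"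
  shows "linear_map R (Lam k) (Lam (k + l)) (\<lambda>x. wmult k l x y)"
proof -
  obtain q where q: "q \<in> carrier (Fr l)" "y = Rl l +>\<^bsub>Fr l\<^esub> q" using assms by (auto simp: Lam_carrier)
  show ?thesis by (rule Lam_linearI[OF conc_linear_l[OF q(1)]]) (simp add: q wmult_proj)
qed

lemma wmult_linear_r:
  assumes "y \<in> carrier (Lam k)"
  shows "linear_map R (Lam l) (Lam (k + l)) (\<lambda>x. wmult k l y x)"
proof -
  obtain q where q: "q \<in> carrier (Fr k)" "y = Rl k +>\<^bsub>Fr k\<^esub> q" using assms by (auto simp: Lam_carrier)
  show ?thesis by (rule Lam_linearI[OF conc_linear_r[OF q(1)]]) (simp add: q wmult_proj)
qed

text \<open>On words both bracketings are the same concatenation. Linearity then frees the third,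
  the second and the first argument in turn, each time by \<open>Lam_linear_eq\<close>.\<close>

lemma wmult_assoc:
  assumes x: "x \<in> carrier (Lam k)" and y: "y \<in> carrier (Lam l)" and z: "z \<in> carrier (Lam m)"
  shows "wmult (k + l) m (wmult k l x y) z = wmult k (l + m) x (wmult l m y z)"
proof -
  have www: "wmult (k + l) m (wmult k l (ext_word R N k u) (ext_word R N l v)) (ext_word R N m w) =
      wmult k (l + m) (ext_word R N k u) (wmult l m (ext_word R N l v) (ext_word R N m w))"
    if "u \<in> ext_words N k" "v \<in> ext_words N l" "w \<in> ext_words N m" for u v w
  proof -
    have "u @ v \<in> ext_words N (k + l)" "v @ w \<in> ext_words N (l + m)" using that by (auto simp: ext_words_def)
    then show ?thesis using that by (simp add: wmult_word add.assoc)
  qed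
  note l3 = linear_map_comp[OF wmult_linear_r wmult_linear_r, of _ l _ k m] and r3 = wmult_linear_r[of _ "k + l" m]
  have wwz: "wmult (k + l) m (wmult k l (ext_word R N k u) (ext_word R N l v)) z =
      wmult k (l + m) (ext_word R N k u) (wmult l m (ext_word R N l v) z)"
    if "u \<in> ext_words N k" "v \<in> ext_words N l" for u v
    by (rule Lam_linear_eq[OF Lam_module[of "k + l + m"], where k = m
         and f = "wmult (k + l) m (wmult k l (ext_word R N k u) (ext_word R N l v))"
         and g = "\<lambda>z. wmult k (l + m) (ext_word R N k u) (wmult l m (ext_word R N l v) z)"])
      (use www[OF that] z that r3 l3 in \<open>simp_all add: ext_word_closed wmult_closed add.assoc\<close>)
  have l2: "linear_map R (Lam l) (Lam (k + l + m)) (\<lambda>y. wmult (k + l) m (wmult k l x y) z)"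
    if "x \<in> carrier (Lam k)" for x
    by (rule linear_map_comp[OF wmult_linear_r[OF that] wmult_linear_l[OF z]])
  have r2: "linear_map R (Lam l) (Lam (k + l + m)) (\<lambda>y. wmult k (l + m) x (wmult l m y z))"
    if "x \<in> carrier (Lam k)" for x
    using linear_map_comp[OF wmult_linear_l[OF z] wmult_linear_r[OF that]] by (simp add: add.assoc)
  have wyz: "wmult (k + l) m (wmult k l (ext_word R N k u) y) z =
      wmult k (l + m) (ext_word R N k u) (wmult l m y z)" if "u \<in> ext_words N k" for u
    by (rule Lam_linear_eq[OF Lam_module l2 r2 wwz y]) (use that ext_word_closed in auto)
  show ?thesis
  proof (rule Lam_linear_eq[OF Lam_module[of "k + l + m"], where k = k
         and f = "\<lambda>x. wmult (k + l) m (wmult k l x y) z" and g = "\<lambda>x. wmult k (l + m) x (wmult l m y z)"])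
    show "linear_map R (Lam k) (Lam (k + l + m)) (\<lambda>x. wmult (k + l) m (wmult k l x y) z)"
      by (rule linear_map_comp[OF wmult_linear_l[OF y] wmult_linear_l[OF z]])
    show "linear_map R (Lam k) (Lam (k + l + m)) (\<lambda>x. wmult k (l + m) x (wmult l m y z))"
      using wmult_linear_l[OF wmult_closed[OF y z], of k] by (simp add: add.assoc)
  qed (use wyz x in auto)
qed

lemma graded_algebra_ext: "graded_algebra R (ext_algebra R N)"
  by (intro graded_algebra.intro Lam_module wmult_closed wmult_assoc)
    (auto simp: linear_map_simps[OF wmult_linear_l] linear_map_simps[OF wmult_linear_r])

sublocale graded_algebra R "ext_algebra R N" by (rule graded_algebra_ext)

text \<open>Polarization: expand the vanishing word with x + y in both places; the two words with
  repeated letters vanish as well.\<close>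

lemma ext_word_swap:
  assumes "u @ [x, y] @ v \<in> ext_words N k"
  shows "ext_word R N k (u @ [x, y] @ v) = \<ominus>\<^bsub>Lam k\<^esub> ext_word R N k (u @ [y, x] @ v)"
proof -
  interpret L: Module.module R "Lam k" by (rule Lam_module)
  let ?W = "\<lambda>x y. ext_word R N k (u @ [x, y] @ v)"
  from assms have xy: "x \<in> carrier N" "y \<in> carrier N" "x \<oplus>\<^bsub>N\<^esub> y \<in> carrier N"
    by (auto simp: ext_words_simps)
  from assms have w: "u @ [a] @ (b # v) \<in> ext_words N k" "(u @ [a]) @ [b] @ v \<in> ext_words N k" "u @ [a, b] @ v \<in> ext_words N k"
      if "a \<in> carrier N" "b \<in> carrier N" for a b
    using that assms by (auto simp: ext_words_simps)
  have c: "?W a b \<in> carrier (Lam k)" if "a \<in> carrier N" "b \<in> carrier N" for a b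
    using ext_word_closed[OF w(3)[OF that]] .
  have "\<zero>\<^bsub>Lam k\<^esub> = ?W (x \<oplus>\<^bsub>N\<^esub> y) (x \<oplus>\<^bsub>N\<^esub> y)"
    using ext_word_alt[OF w(3)[OF xy(3,3)]] by simp
  also have "\<dots> = ?W x (x \<oplus>\<^bsub>N\<^esub> y) \<oplus>\<^bsub>Lam k\<^esub> ?W y (x \<oplus>\<^bsub>N\<^esub> y)"
    using ext_word_add[OF w(1)[OF xy(1,3)] xy(2)] by simp
  also have "?W x (x \<oplus>\<^bsub>N\<^esub> y) = ?W x x \<oplus>\<^bsub>Lam k\<^esub> ?W x y"
    using ext_word_add[OF w(2)[OF xy(1,1)] xy(2)] by simp
  also have "?W y (x \<oplus>\<^bsub>N\<^esub> y) = ?W y x \<oplus>\<^bsub>Lam k\<^esub> ?W y y"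
    using ext_word_add[OF w(2)[OF xy(2,1)] xy(2)] by simp
  also have "?W x x = \<zero>\<^bsub>Lam k\<^esub>" by (rule ext_word_alt[OF w(3)[OF xy(1,1)]])
  also have "?W y y = \<zero>\<^bsub>Lam k\<^esub>" by (rule ext_word_alt[OF w(3)[OF xy(2,2)]])
  finally have "\<zero>\<^bsub>Lam k\<^esub> = ?W x y \<oplus>\<^bsub>Lam k\<^esub> ?W y x" using c xy by simp
  then show ?thesis using c xy by (simp add: L.M.minus_equality)
qed

lemma ext_word_move:
  "a @ u @ [x] @ v \<in> ext_words N k \<Longrightarrow>
    ext_word R N k (a @ u @ [x] @ v) = gsign (Lam k) (int (length u)) (ext_word R N k (a @ [x] @ u @ v))"
proof (induction u arbitrary: a)
  case Nil
  then show ?case by (simp add: gsign_def)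
next
  case (Cons y u)
  have w: "(a @ [y]) @ u @ [x] @ v \<in> ext_words N k" "a @ [x, y] @ (u @ v) \<in> ext_words N k"
    "a @ [y, x] @ (u @ v) \<in> ext_words N k"
    using Cons.prems by (auto simp: ext_words_simps)
  have "ext_word R N k (a @ (y # u) @ [x] @ v) = gsign (Lam k) (int (length u)) (ext_word R N k (a @ [y, x] @ u @ v))"
    using Cons.IH[OF w(1)] by simp
  also have "ext_word R N k (a @ [y, x] @ u @ v) = gsign (Lam k) 1 (ext_word R N k (a @ [x, y] @ u @ v))"
    using ext_word_swap[OF w(3)] by (simp add: gsign_def)
  finally show ?case using ext_word_closed[OF w(2)] by (simp add: gsign_gsign[OF Lam_module] add.commute)
qed

text \<open>Each letter of \<open>v\<close> crosses the whole of \<open>u\<close> at the price of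
  \<open>length u\<close> swaps, hence the product of the lengths. This is the origin of the sign in
  graded commutativity.\<close>

lemma ext_word_block:
  "a @ u @ v @ t \<in> ext_words N k \<Longrightarrow>
    ext_word R N k (a @ u @ v @ t) = gsign (Lam k) (int (length u) * int (length v)) (ext_word R N k (a @ v @ u @ t))"
proof (induction v arbitrary: a)
  case Nil
  then show ?case by (simp add: gsign_def)
next
  case (Cons x v)
  have w: "a @ u @ [x] @ (v @ t) \<in> ext_words N k" "(a @ [x]) @ u @ v @ t \<in> ext_words N k"
    "a @ (x # v) @ u @ t \<in> ext_words N k"
    using Cons.prems by (auto simp: ext_words_simps)
  show ?case
    using ext_word_move[OF w(1)] Cons.IH[OF w(2)] ext_word_closed[OF w(3)]
    by (simp add: gsign_gsign[OF Lam_module] algebra_simps)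
qed

text \<open>For words this is \<open>ext_word_block\<close>, and both sides are linear in each
  argument.\<close>

lemma wmult_comm:
  assumes x: "x \<in> carrier (Lam k)" and y: "y \<in> carrier (Lam l)"
  shows "wmult k l x y = gsign (Lam (k + l)) (k * l) (wmult l k y x)"
proof -
  have ww: "wmult k l (ext_word R N k u) (ext_word R N l v) =
      gsign (Lam (k + l)) (k * l) (wmult l k (ext_word R N l v) (ext_word R N k u))"
    if "u \<in> ext_words N k" "v \<in> ext_words N l" for u v
    using that ext_word_block[of "[]" u v "[]" "k + l"]
    by (simp add: wmult_word add.commute) (auto simp: ext_words_def)
  have r: "linear_map R (Lam l) (Lam (k + l)) (\<lambda>y. gsign (Lam (k + l)) (k * l) (wmult l k y x))"
    if "x \<in> carrier (Lam k)" for x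
    using linear_map_comp[OF wmult_linear_l[OF that, of l] linear_map_gsign[OF Lam_module]]
    by (simp add: add.commute)
  have wy: "wmult k l (ext_word R N k u) y = gsign (Lam (k + l)) (k * l) (wmult l k y (ext_word R N k u))"
    if "u \<in> ext_words N k" for u
    by (rule Lam_linear_eq[OF Lam_module wmult_linear_r r ww y]) (use that ext_word_closed in auto)
  have r': "linear_map R (Lam k) (Lam (k + l)) (\<lambda>x. gsign (Lam (k + l)) (k * l) (wmult l k y x))"
    using linear_map_comp[OF wmult_linear_r[OF y, of k] linear_map_gsign[OF Lam_module]]
    by (simp add: add.commute)
  show ?thesis by (rule Lam_linear_eq[OF Lam_module wmult_linear_l[OF y] r' wy x])
qed

end

subsection \<open>The universal property of the exterior algebra\<close>

text \<open>The product is nested to the right and ends in \<open>e\<close>. As \<open>e\<close>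
  will be known to be a unit on the left only, a single letter is sent to \<psi> m times
  \<open>e\<close> rather than to \<psi> m.\<close>

primrec word_prod :: "('c, 'e, 'z) graded_scheme \<Rightarrow> ('m \<Rightarrow> 'e) \<Rightarrow> 'e \<Rightarrow> 'm list \<Rightarrow> 'e"
  where "word_prod A \<psi> e [] = e"
  | "word_prod A \<psi> e (m # w) = gmult A 1 (int (length w)) (\<psi> m) (word_prod A \<psi> e w)"

text \<open>Words are sent to \<open>word_prod\<close>, which is multilinear because each letter
  sits in a factor of its own, and alternating because \<open>sq\<close> kills two equal neighbours.
  The left unit is what starts the induction behind \<open>app\<close>, that is, multiplicativity on
  words.\<close>

lemma (in exterior) ext_universal:
  assumes A: "graded_algebra R A" and e: "e \<in> carrier (gmod A 0)"
    and unit: "\<And>k x. x \<in> carrier (gmod A k) \<Longrightarrow> gmult A 0 k e x = x"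
    and \<psi>: "linear_map R N (gmod A 1) \<psi>"
    and sq: "\<And>m. m \<in> carrier N \<Longrightarrow> gmult A 1 1 (\<psi> m) (\<psi> m) = \<zero>\<^bsub>gmod A 2\<^esub>"
  obtains F where "\<And>k. linear_map R (Lam k) (gmod A k) (F k)"
    "\<And>k l x y. x \<in> carrier (Lam k) \<Longrightarrow> y \<in> carrier (Lam l) \<Longrightarrow> F (k + l) (wmult k l x y) = gmult A k l (F k x) (F l y)"
    "F 0 (ext_word R N 0 []) = e"
    "\<And>m. m \<in> carrier N \<Longrightarrow> F 1 (ext_word R N 1 [m]) = gmult A 1 0 (\<psi> m) e"
proof -
  interpret A: graded_algebra R A by fact
  let ?P = "word_prod A \<psi> e"
  note \<psi>c = linear_map_simps(1)[OF \<psi>]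
  have c: "?P w \<in> carrier (gmod A (int (length w)))" if "set w \<subseteq> carrier N" for w
    using that by (induction w) (auto intro!: A.gmult_closed' e \<psi>c)
  have c': "?P w \<in> carrier (gmod A k)" if "w \<in> ext_words N k" for w k
    using c[of w] that by (auto simp: ext_words_def)
  have app: "?P (u @ v) = gmult A (int (length u)) (int (length v)) (?P u) (?P v)"
    if "set u \<subseteq> carrier N" "set v \<subseteq> carrier N" for u v
    using that(1)
  proof (induction u)
    case Nil
    then show ?case using unit c[OF that(2)] by simp
  next
    case (Cons m u)
    then show ?case
      using A.gmult_assoc[OF \<psi>c[of m] c[of u] c[of v]] that(2) by simp
  qed
  \<comment> \<open>Isolates the letter \<open>x\<close> in its own factor, where linearity of
    \<psi> and bilinearity of the product act on it.\<close>
  have mid: "?P (u @ [x] @ v) = gmult A (int (length u)) (int (length v) + 1) (?P u) (gmult A 1 (int (length v)) (\<psi> x) (?P v))"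
    if "set u \<subseteq> carrier N" "set v \<subseteq> carrier N" "x \<in> carrier N" for u x v
    using app[of u "x # v"] that by (simp add: add.commute)
  have "\<exists>F. linear_map R (Lam k) (gmod A k) F \<and> (\<forall>w\<in>ext_words N k. F (ext_word R N k w) = ?P w)" for k
  proof (rule Lam_lift[OF A.gmod_module c'], assumption, goal_cases)
    case (1 u v x y)
    then have s: "set u \<subseteq> carrier N" "set v \<subseteq> carrier N" "x \<in> carrier N" "y \<in> carrier N" "x \<oplus>\<^bsub>N\<^esub> y \<in> carrier N"
      and k: "int (length u) + (int (length v) + 1) = k" by (auto simp: ext_words_simps)
    have d: "gmult A 1 (int (length v)) (\<psi> z) (?P v) \<in> carrier (gmod A (int (length v) + 1))" if "z \<in> carrier N" for z
      by (rule A.gmult_closed'[OF \<psi>c[OF that] c[OF s(2)]]) simp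
    show ?case
      using A.gmult_add_l[OF \<psi>c[OF s(3)] \<psi>c[OF s(4)] c[OF s(2)]] A.gmult_add_r[OF c[OF s(1)] d[OF s(3)] d[OF s(4)]]
      unfolding mid[OF s(1,2,5)] mid[OF s(1,2,3)] mid[OF s(1,2,4)] linear_map_simps(2)[OF \<psi> s(3,4)]
      by (simp add: k add.commute[of 1])
  next
    case (2 u v x r)
    then have s: "set u \<subseteq> carrier N" "set v \<subseteq> carrier N" "x \<in> carrier N" "r \<in> carrier R" "r \<odot>\<^bsub>N\<^esub> x \<in> carrier N"
      and k: "int (length u) + (int (length v) + 1) = k" by (auto simp: ext_words_simps)
    have d: "gmult A 1 (int (length v)) (\<psi> z) (?P v) \<in> carrier (gmod A (int (length v) + 1))" if "z \<in> carrier N" for z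
      by (rule A.gmult_closed'[OF \<psi>c[OF that] c[OF s(2)]]) simp
    show ?case
      using A.gmult_smult_l[OF s(4) \<psi>c[OF s(3)] c[OF s(2)]] A.gmult_smult_r[OF s(4) c[OF s(1)] d[OF s(3)]]
      unfolding mid[OF s(1,2,5)] mid[OF s(1,2,3)] linear_map_simps(3)[OF \<psi> s(4,3)]
      by (simp add: k add.commute[of 1])
  next
    case (3 u v x)
    then have s: "set u \<subseteq> carrier N" "set v \<subseteq> carrier N" "x \<in> carrier N" "set (x # v) \<subseteq> carrier N"
      and k: "int (length u) + (int (length v) + 2) = k" by (auto simp: ext_words_simps)
    \<comment> \<open>Associativity brings the two copies of \<psi> x together before
      \<open>?P v\<close> is multiplied in.\<close>
    have "gmult A 1 (int (length v) + 1) (\<psi> x) (?P (x # v)) = \<zero>\<^bsub>gmod A (int (length v) + 2)\<^esub>"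
      using A.gmult_assoc[OF \<psi>c[OF s(3)] \<psi>c[OF s(3)] c[OF s(2)]] sq[OF s(3)] A.gmult_zero_l[OF c[OF s(2)], of 2]
      by (simp add: add.commute)
    have e: "u @ [x, x] @ v = u @ [x] @ (x # v)" "int (length (x # v)) = int (length v) + 1"
      "int (length v) + 1 + 1 = int (length v) + 2" by auto
    show ?case
      unfolding e(1) mid[OF s(1,4,3)] e(2,3) \<open>gmult A 1 _ (\<psi> x) _ = _\<close>
      using A.gmult_zero_r[OF c[OF s(1)], of "int (length v) + 2"] k by simp
  qed
  then obtain F where F: "\<And>k. linear_map R (Lam k) (gmod A k) (F k)"
    "\<And>k w. w \<in> ext_words N k \<Longrightarrow> F k (ext_word R N k w) = ?P w" by metis
  show thesis
  proof (rule that[OF F(1)])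
    fix k l x y assume x: "x \<in> carrier (Lam k)" and y: "y \<in> carrier (Lam l)"
    have ww: "F (k + l) (wmult k l (ext_word R N k u) (ext_word R N l v)) = gmult A k l (F k (ext_word R N k u)) (F l (ext_word R N l v))"
      if "u \<in> ext_words N k" "v \<in> ext_words N l" for u v
    proof -
      have "set u \<subseteq> carrier N" "set v \<subseteq> carrier N" using that by (auto simp: ext_words_def)
      from app[OF this] show ?thesis
        using that wmult_word[OF that] F(2)[OF that(1)] F(2)[OF that(2)] F(2)[of "u @ v" "k + l"]
        by (simp add: ext_words_def)
    qed
    have wy: "F (k + l) (wmult k l (ext_word R N k u) y) = gmult A k l (F k (ext_word R N k u)) (F l y)"
      if "u \<in> ext_words N k" for u
      by (rule Lam_linear_eq[OF A.gmod_module linear_map_comp[OF wmult_linear_r F(1)] linear_map_comp[OF F(1) A.gmult_linear_r] ww y])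
        (use that ext_word_closed linear_map_simps(1)[OF F(1)] in auto)
    show "F (k + l) (wmult k l x y) = gmult A k l (F k x) (F l y)"
      by (rule Lam_linear_eq[OF A.gmod_module linear_map_comp[OF wmult_linear_l[OF y] F(1)]
         linear_map_comp[OF F(1) A.gmult_linear_l[OF linear_map_simps(1)[OF F(1) y]]] wy x])
  qed (auto simp: F ext_words_def)
qed

section \<open>Differentiable functions on open subsets of $\mathbb{R}^n$\<close>

abbreviation "open_Rn n \<equiv> openin (Euclidean_space n)"

lemma Rn_iff: "x \<in> Rn n \<longleftrightarrow> (\<forall>i\<ge>n. x i = 0)"
  by (simp add: topspace_Euclidean_space)

lemma openin_Rn_subset: "open_Rn n U \<Longrightarrow> U \<subseteq> Rn n"
  by (rule openin_subset)

text \<open>The topology is induced from a product over all natural indices, but points of R^n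
  vanish from index \<open>n\<close> on, so only the first \<open>n\<close> radii constrain anything
  and a positive minimum exists.\<close>

lemma openin_Rn_box:
  assumes "open_Rn n W" "x \<in> W"
  shows "\<exists>e>0. \<forall>y\<in>Rn n. (\<forall>i<n. \<bar>y i - x i\<bar> < e) \<longrightarrow> y \<in> W"
proof -
  obtain T where T: "openin (powertop_real UNIV) T" "W = T \<inter> {x. \<forall>i\<ge>n. x i = 0}"
    using assms(1) unfolding Euclidean_space_def openin_subtopology by auto
  moreover have "x \<in> T" using T(2) assms(2) by auto
  ultimately obtain X where X: "x \<in> (\<Pi>\<^sub>E i\<in>UNIV. X i)" "\<And>i. open (X i)" "(\<Pi>\<^sub>E i\<in>UNIV. X i) \<subseteq> T"
    using product_topology_open_contains_basis[OF T(1), of x] by (simp add: open_openin[symmetric] del: open_openin) (metis open_openin)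
  have "\<exists>e>0. \<forall>t. \<bar>t - x i\<bar> < e \<longrightarrow> t \<in> X i" for i
  proof -
    have "\<exists>e>0. ball (x i) e \<subseteq> X i" using X(1,2) by (auto simp: open_contains_ball)
    then show ?thesis by (auto simp: subset_iff dist_real_def abs_minus_commute)
  qed
  then obtain e where e: "\<And>i. e i > 0" "\<And>i t. \<bar>t - x i\<bar> < e i \<Longrightarrow> t \<in> X i" by metis
  \<comment> \<open>The 1 keeps the set nonempty when \<open>n\<close> is 0.\<close>
  define d where "d = Min (insert 1 (e ` {..<n}))"
  have d: "d > 0" "\<And>i. i < n \<Longrightarrow> d \<le> e i" using e(1) by (auto simp: d_def)
  have "y \<in> W" if y: "y \<in> Rn n" "\<forall>i<n. \<bar>y i - x i\<bar> < d" for y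
  proof -
    have "y i \<in> X i" for i
    proof (cases "i < n")
      case True
      then show ?thesis using y(2) d(2) e(2) by force
    next
      case False
      then have "y i = x i" using y(1) assms(2) T(2) by (auto simp: Rn_iff)
      then show ?thesis using X(1) by auto
    qed
    then have "y \<in> T" using X(3) by blast
    then show ?thesis using y(1) T(2) by (auto simp: Rn_iff)
  qed
  then show ?thesis using d(1) by blast
qed

lemma openin_Rn_slice:
  assumes "open_Rn n W" "x \<in> W" "i < n"
  shows "\<exists>e>0. \<forall>t. \<bar>t - x i\<bar> < e \<longrightarrow> x(i := t) \<in> W"
proof -
  obtain e where e: "e > 0" "\<And>y. y \<in> Rn n \<Longrightarrow> (\<forall>i<n. \<bar>y i - x i\<bar> < e) \<Longrightarrow> y \<in> W"
    using openin_Rn_box[OF assms(1,2)] by blast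
  have "x \<in> Rn n" using assms openin_Rn_subset by blast
  then show ?thesis using e assms(3) by (intro exI[of _ e]) auto
qed

text \<open>Inside an open set each coordinate line contains an interval around the point, so the
  restricted filter is the full one.\<close>

lemma pd_open:
  assumes "open_Rn n U" "x \<in> U" "i < n"
  shows "pd U i g x = vector_derivative (\<lambda>t. g (x(i := t))) (at (x i))"
proof -
  obtain e where e: "e > 0" "\<forall>t. \<bar>t - x i\<bar> < e \<longrightarrow> x(i := t) \<in> U"
    using openin_Rn_slice[OF assms] by blast
  have "at (x i) within {t. x(i := t) \<in> U} = at (x i)"
    by (rule at_within_nhd[of _ "ball (x i) e"]) (use e in \<open>auto simp: dist_real_def abs_minus_commute\<close>)
  then show ?thesis by (simp add: pd_def)
qed

lemma pd_openI:
  assumes "open_Rn n U" "x \<in> U" "i < n"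
    and "((\<lambda>t. g (x(i := t))) has_real_derivative D) (at (x i))"
  shows "pd U i g x = D"
  using assms(4) by (simp add: pd_open[OF assms(1-3)] vector_derivative_at has_real_derivative_iff_has_vector_derivative)

lemma Ck_on_continuous: "Ck_on k n U g \<Longrightarrow> continuous_map (subtopology (Euclidean_space n) U) euclideanreal g"
  by (cases k) auto

lemma Ck_on_has_derivative:
  assumes "open_Rn n U" "Ck_on (Suc k) n U g" "x \<in> U" "i < n"
  shows "((\<lambda>t. g (x(i := t))) has_real_derivative pd U i g x) (at (x i))"
  using assms by (auto simp: pd_open vector_derivative_works has_real_derivative_iff_has_vector_derivative)

lemma Ck_on_eq:
  assumes U: "open_Rn n U" and eq: "\<And>y. y \<in> U \<Longrightarrow> g y = h y"
  shows "Ck_on k n U g \<Longrightarrow> Ck_on k n U h"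
  using eq
proof (induction k arbitrary: g h)
  case 0
  then show ?case by (simp, elim continuous_map_eq) simp
next
  case (Suc k)
  have "Ck_on k n U (pd U i h)" if "i < n" for i
    using Suc.IH[of "pd U i g" "pd U i h"] Suc.prems pd_cong[of U g h] that by auto
  moreover have "(\<lambda>t. h (x(i := t))) differentiable at (x i)" if "x \<in> U" "i < n" for x i
  proof -
    obtain e where e: "e > 0" "\<forall>t. \<bar>t - x i\<bar> < e \<longrightarrow> x(i := t) \<in> U"
      using openin_Rn_slice[OF U \<open>x \<in> U\<close> \<open>i < n\<close>] by blast
    show ?thesis
      by (rule differentiable_transform_within[of "\<lambda>t. g (x(i := t))" _ _ e])
        (use Suc.prems that e in \<open>auto simp: dist_real_def\<close>)
  qed
  moreover have "continuous_map (subtopology (Euclidean_space n) U) euclideanreal h"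
    by (rule continuous_map_eq[of _ _ g]) (use Suc.prems in simp_all)
  ultimately show ?case by simp
qed

lemma Ck_on_mono:
  assumes "open_Rn n U" "open_Rn n U'" "U' \<subseteq> U"
  shows "Ck_on k n U g \<Longrightarrow> Ck_on k n U' g"
proof (induction k arbitrary: g)
  case 0
  then show ?case using assms(3) by (auto elim: continuous_map_from_subtopology_mono)
next
  case (Suc k)
  have "Ck_on k n U' (pd U' i g)" if "i < n" for i
    by (rule Ck_on_eq[OF assms(2), of "pd U i g"])
      (use assms that Suc in \<open>auto simp: pd_open[of n] subset_iff\<close>)
  then show ?case using Suc.prems assms(3) by (auto elim: continuous_map_from_subtopology_mono)
qed

text \<open>Smoothness of \<open>pd\<close> is inherited from any explicit family \<open>D\<close>
  of derivatives, since the two agree on \<open>U\<close>.\<close>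

lemma Ck_on_SucI:
  assumes U: "open_Rn n U"
    and "continuous_map (subtopology (Euclidean_space n) U) euclideanreal g"
    and D: "\<And>i x. i < n \<Longrightarrow> x \<in> U \<Longrightarrow> ((\<lambda>t. g (x(i := t))) has_real_derivative D i x) (at (x i))"
    and "\<And>i. i < n \<Longrightarrow> Ck_on k n U (D i)"
  shows "Ck_on (Suc k) n U g"
proof -
  have "Ck_on k n U (pd U i g)" if "i < n" for i
    by (rule Ck_on_eq[OF U, of "D i"]) (use assms that pd_openI[OF U _ that D[OF that]] in auto)
  moreover have "(\<lambda>t. g (x(i := t))) differentiable at (x i)" if "x \<in> U" "i < n" for x i
    using D[OF that(2,1)] real_differentiable_def by blast
  ultimately show ?thesis using assms(2) by simp
qed

lemma Ck_on_open_const: "open_Rn n U \<Longrightarrow> Ck_on k n U (\<lambda>x. c)"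
  using Ck_on_mono[OF _ _ openin_Rn_subset Ck_on_const] by auto

lemma Ck_on_open_add:
  assumes U: "open_Rn n U"
  shows "Ck_on k n U g \<Longrightarrow> Ck_on k n U h \<Longrightarrow> Ck_on k n U (\<lambda>x. g x + h x)"
proof (induction k arbitrary: g h)
  case 0
  then show ?case by (auto intro: continuous_map_add)
next
  case (Suc k)
  show ?case
  proof (rule Ck_on_SucI[OF U, of _ "\<lambda>i x. pd U i g x + pd U i h x"])
    fix i x assume "i < n" "x \<in> U"
    then show "((\<lambda>t. g (x(i := t)) + h (x(i := t))) has_real_derivative pd U i g x + pd U i h x) (at (x i))"
      by (intro DERIV_add Ck_on_has_derivative[OF U Suc.prems(1)] Ck_on_has_derivative[OF U Suc.prems(2)])
  qed (use Suc in \<open>auto intro: continuous_map_add\<close>)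
qed

lemma Ck_on_open_mult:
  assumes U: "open_Rn n U"
  shows "Ck_on k n U g \<Longrightarrow> Ck_on k n U h \<Longrightarrow> Ck_on k n U (\<lambda>x. g x * h x)"
proof (induction k arbitrary: g h)
  case 0
  then show ?case by (auto intro: continuous_map_real_mult)
next
  case (Suc k)
  show ?case
  proof (rule Ck_on_SucI[OF U, of _ "\<lambda>i x. pd U i g x * h x + pd U i h x * g x"])
    fix i x assume "i < n" "x \<in> U"
    then show "((\<lambda>t. g (x(i := t)) * h (x(i := t))) has_real_derivative pd U i g x * h x + pd U i h x * g x) (at (x i))"
      using DERIV_mult[OF Ck_on_has_derivative[OF U Suc.prems(1), of x i] Ck_on_has_derivative[OF U Suc.prems(2), of x i]]
      by (simp only: fun_upd_triv)
  next
    fix i assume "i < n"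
    then show "Ck_on k n U (\<lambda>x. pd U i g x * h x + pd U i h x * g x)"
      using Suc by (intro Ck_on_open_add[OF U] Suc.IH) (auto dest: Ck_on_Suc simp del: Ck_on.simps(2), auto)
  qed (use Suc.prems in \<open>auto intro: continuous_map_real_mult\<close>)
qed

lemma Ck_on_open_sum:
  assumes U: "open_Rn n U" and "\<And>i. i \<in> I \<Longrightarrow> Ck_on k n U (g i)"
  shows "Ck_on k n U (\<lambda>x. \<Sum>i\<in>I. g i x)"
  using assms(2) by (induction I rule: infinite_finite_induct) (auto intro: Ck_on_open_const Ck_on_open_add U)

subsection \<open>The chain rule\<close>

text \<open>Continuity of the partial derivatives gives total differentiability: x is changed into y
  one coordinate at a time, and the mean value inequality bounds the error of each change.\<close>

lemma C1_approx:
  assumes U: "open_Rn n U" and g: "Ck_on (Suc 0) n U g" and x: "x \<in> U" and "\<epsilon> > 0"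
  shows "\<exists>d>0. \<forall>y\<in>Rn n. (\<forall>i<n. \<bar>y i - x i\<bar> < d) \<longrightarrow>
    \<bar>g y - g x - (\<Sum>i<n. pd U i g x * (y i - x i))\<bar> \<le> \<epsilon> * (\<Sum>i<n. \<bar>y i - x i\<bar>)"
proof -
  have "open_Rn n {z \<in> U. \<bar>pd U i g z - pd U i g x\<bar> < \<epsilon>}" if "i < n" for i
  proof -
    have "continuous_map (subtopology (Euclidean_space n) U) euclideanreal (pd U i g)"
      using g that by simp
    then have "openin (subtopology (Euclidean_space n) U) {z \<in> topspace (subtopology (Euclidean_space n) U). pd U i g z \<in> ball (pd U i g x) \<epsilon>}"
      by (rule openin_continuous_map_preimage) auto
    moreover have "topspace (subtopology (Euclidean_space n) U) = U" using openin_Rn_subset[OF U] by auto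
    ultimately have "openin (subtopology (Euclidean_space n) U) {z \<in> U. pd U i g z \<in> ball (pd U i g x) \<epsilon>}"
      by (simp only:)
    then have "open_Rn n {z \<in> U. pd U i g z \<in> ball (pd U i g x) \<epsilon>}"
      by (rule openin_trans_full[OF _ U])
    then show ?thesis by (simp add: dist_real_def abs_minus_commute)
  qed
  then have "open_Rn n (U \<inter> \<Inter>((\<lambda>i. {z \<in> U. \<bar>pd U i g z - pd U i g x\<bar> < \<epsilon>}) ` {..<n}))"
    by (cases "n = 0") (use U in \<open>auto intro!: openin_Int openin_Inter\<close>)
  moreover have "x \<in> U \<inter> \<Inter>((\<lambda>i. {z \<in> U. \<bar>pd U i g z - pd U i g x\<bar> < \<epsilon>}) ` {..<n})" using x \<open>\<epsilon> > 0\<close> by auto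
  ultimately obtain d where d: "d > 0" "\<And>z. z \<in> Rn n \<Longrightarrow> (\<forall>i<n. \<bar>z i - x i\<bar> < d) \<Longrightarrow>
      z \<in> U \<and> (\<forall>i<n. \<bar>pd U i g z - pd U i g x\<bar> < \<epsilon>)"
    using openin_Rn_box[of n "U \<inter> \<Inter>((\<lambda>i. {z \<in> U. \<bar>pd U i g z - pd U i g x\<bar> < \<epsilon>}) ` {..<n})" x] by auto
  have xR: "x \<in> Rn n" using x openin_Rn_subset[OF U] by auto
  show ?thesis
  proof (intro exI[of _ d] conjI ballI impI d(1))
    fix y assume y: "y \<in> Rn n" "\<forall>i<n. \<bar>y i - x i\<bar> < d"
    \<comment> \<open>The corners of a path from x to y: below \<open>j\<close> the coordinates are
      those of y, from \<open>j\<close> on those of x.\<close>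
    define z where "z j = (\<lambda>i. if i < j then y i else x i)" for j :: nat
    have step: "\<bar>g (z (Suc j)) - g (z j) - pd U j g x * (y j - x j)\<bar> \<le> \<epsilon> * \<bar>y j - x j\<bar>" if "j < n" for j
    proof -
      have zt: "(z j)(j := t) \<in> Rn n \<and> (\<forall>i<n. \<bar>((z j)(j := t)) i - x i\<bar> < d)" if "\<bar>t - x j\<bar> < d" for t
        using xR y that \<open>j < n\<close> d(1) by (auto simp: z_def Rn_iff)
      have D: "((\<lambda>t. g ((z j)(j := t))) has_real_derivative pd U j g ((z j)(j := t))) (at t)" if "\<bar>t - x j\<bar> < d" for t
        using Ck_on_has_derivative[OF U g _ \<open>j < n\<close>, of "(z j)(j := t)"] zt[OF that] d(2)[of "(z j)(j := t)"] by simp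
      have zz: "z (Suc j) = (z j)(j := y j)" "z j = (z j)(j := x j)" by (auto simp: z_def)
      have yj: "\<bar>y j - x j\<bar> < d" using y \<open>j < n\<close> by auto
      \<comment> \<open>Subtracting the expected linear part leaves a function whose derivative is
        at most \<epsilon> in absolute value along the segment.\<close>
      define q where "q t = g ((z j)(j := t)) - pd U j g x * t" for t
      have "\<bar>q (y j) - q (x j)\<bar> \<le> \<epsilon> * \<bar>y j - x j\<bar>"
      proof -
        have dq: "(q has_real_derivative (pd U j g ((z j)(j := t)) - pd U j g x)) (at t within ball (x j) d)" if "t \<in> ball (x j) d" for t
          unfolding q_def by (rule has_field_derivative_at_within, auto intro!: derivative_eq_intros D)
            (use that in \<open>auto simp: dist_real_def abs_minus_commute\<close>)
        have "norm (q (y j) - q (x j)) \<le> \<epsilon> * norm (y j - x j)"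
        proof (rule field_differentiable_bound[OF convex_ball dq])
          fix t assume "t \<in> ball (x j) d"
          then have t: "\<bar>t - x j\<bar> < d" by (auto simp: dist_real_def abs_minus_commute)
          then show "norm (pd U j g ((z j)(j := t)) - pd U j g x) \<le> \<epsilon>"
            using d(2)[OF conjunct1[OF zt[OF t]] conjunct2[OF zt[OF t]]] \<open>j < n\<close> by (auto simp del: fun_upd_apply intro: less_imp_le)
        qed (use yj d in \<open>auto simp: dist_real_def abs_minus_commute\<close>)
        then show ?thesis by simp
      qed
      then show ?thesis using zz unfolding q_def by (simp add: algebra_simps)
    qed
    have "g y - g x = (\<Sum>j<n. g (z (Suc j)) - g (z j))"
    proof -
      have "z n = y" "z 0 = x" using y xR by (auto simp: z_def Rn_iff)
      then show ?thesis using sum_lessThan_telescope[of "\<lambda>j. g (z j)" n] by simp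
    qed
    then have "g y - g x - (\<Sum>i<n. pd U i g x * (y i - x i)) = (\<Sum>j<n. g (z (Suc j)) - g (z j) - pd U j g x * (y j - x j))"
      by (simp add: sum_subtractf)
    also have "\<bar>\<dots>\<bar> \<le> (\<Sum>j<n. \<epsilon> * \<bar>y j - x j\<bar>)"
      by (rule order_trans[OF sum_abs]) (rule sum_mono, use step in auto)
    finally show "\<bar>g y - g x - (\<Sum>i<n. pd U i g x * (y i - x i))\<bar> \<le> \<epsilon> * (\<Sum>i<n. \<bar>y i - x i\<bar>)"
      by (simp add: sum_distrib_left)
  qed
qed

text \<open>The set \<open>T\<close> of parameters is arbitrary, so that the rule also covers curves
  that exist on one side of \<open>s\<close> only, as they arise at a boundary face of a
  corner.\<close>

lemma C1_chain_curve:
  assumes U: "open_Rn n U" and g: "Ck_on (Suc 0) n U g" and x: "\<gamma> s \<in> U"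
    and \<gamma>: "\<And>t. t \<in> T \<Longrightarrow> \<gamma> t \<in> Rn n"
    and c: "\<And>i. i < n \<Longrightarrow> ((\<lambda>t. \<gamma> t i) has_real_derivative c i) (at s within T)"
  shows "((\<lambda>t. g (\<gamma> t)) has_real_derivative (\<Sum>i<n. pd U i g (\<gamma> s) * c i)) (at s within T)"
proof -
  let ?L = "\<lambda>t. \<Sum>i<n. pd U i g (\<gamma> s) * (\<gamma> t i - \<gamma> s i)"
  have L: "(?L has_real_derivative (\<Sum>i<n. pd U i g (\<gamma> s) * c i)) (at s within T)"
    by (rule DERIV_sum, rule DERIV_cmult) (use c in \<open>auto intro!: derivative_eq_intros\<close>)
  have "((\<lambda>t. g (\<gamma> t) - g (\<gamma> s) - ?L t) has_real_derivative 0) (at s within T)"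
    unfolding has_field_derivative_def has_derivative_within_alt
  proof (intro conjI allI impI)
    show "bounded_linear ((*) (0::real))" by (rule bounded_linear_mult_right)
    fix e :: real assume e: "e > 0"
    \<comment> \<open>Near \<open>s\<close> coordinate \<open>i\<close> of the curve moves by at
      most \<open>\<bar>c i\<bar> + 1\<close> times the elapsed parameter; \<open>C\<close> adds up
      these speeds.\<close>
    define C where "C = (\<Sum>i<n. \<bar>c i\<bar> + 1)"
    have C: "C \<ge> 0" unfolding C_def by (intro sum_nonneg) auto
    \<comment> \<open>The denominator is \<open>C + 1\<close> because \<open>C\<close> is 0 when
      \<open>n\<close> is 0.\<close>
    define \<epsilon> where "\<epsilon> = e / (C + 1)"
    have \<epsilon>: "\<epsilon> > 0" "\<epsilon> * C \<le> e" using e C by (auto simp: \<epsilon>_def field_simps)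
    obtain d where d: "d > 0" "\<And>y. y \<in> Rn n \<Longrightarrow> (\<forall>i<n. \<bar>y i - \<gamma> s i\<bar> < d) \<Longrightarrow>
       \<bar>g y - g (\<gamma> s) - (\<Sum>i<n. pd U i g (\<gamma> s) * (y i - \<gamma> s i))\<bar> \<le> \<epsilon> * (\<Sum>i<n. \<bar>y i - \<gamma> s i\<bar>)"
      using C1_approx[OF U g x \<epsilon>(1)] by blast
    have "\<exists>r>0. \<forall>t\<in>T. \<bar>t - s\<bar> < r \<longrightarrow> \<bar>\<gamma> t i - \<gamma> s i\<bar> \<le> (\<bar>c i\<bar> + 1) * \<bar>t - s\<bar>" if "i < n" for i
    proof -
      obtain r where r: "r > 0" "\<And>t. t \<in> T \<Longrightarrow> \<bar>t - s\<bar> < r \<Longrightarrow> \<bar>\<gamma> t i - \<gamma> s i - c i * (t - s)\<bar> \<le> 1 * \<bar>t - s\<bar>"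
        using c[OF \<open>i < n\<close>, unfolded has_field_derivative_def has_derivative_within_alt, THEN conjunct2, rule_format, of 1]
        by auto
      have "\<bar>\<gamma> t i - \<gamma> s i\<bar> \<le> (\<bar>c i\<bar> + 1) * \<bar>t - s\<bar>" if "t \<in> T" "\<bar>t - s\<bar> < r" for t
        using r(2)[OF that] abs_mult[of "c i" "t - s"] by (simp add: algebra_simps)
      then show ?thesis using r(1) by blast
    qed
    then obtain r where r: "\<And>i. i < n \<Longrightarrow> r i > 0" "\<And>i t. i < n \<Longrightarrow> t \<in> T \<Longrightarrow> \<bar>t - s\<bar> < r i \<Longrightarrow> \<bar>\<gamma> t i - \<gamma> s i\<bar> \<le> (\<bar>c i\<bar> + 1) * \<bar>t - s\<bar>"
      by metis
    \<comment> \<open>Besides the bounds \<open>r i\<close>, the radius d / (C + 1) keeps the curve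
      inside the box in which the linear approximation is valid.\<close>
    define \<delta> where "\<delta> = Min (insert (d / (C + 1)) (r ` {..<n}))"
    have \<delta>: "\<delta> > 0" "\<And>i. i < n \<Longrightarrow> \<delta> \<le> r i" "\<delta> \<le> d / (C + 1)"
      using r(1) d(1) C by (auto simp: \<delta>_def)
    show "\<exists>d>0. \<forall>t\<in>T. norm (t - s) < d \<longrightarrow>
        norm (g (\<gamma> t) - g (\<gamma> s) - ?L t - (g (\<gamma> s) - g (\<gamma> s) - ?L s) - 0 * (t - s)) \<le> e * norm (t - s)"
    proof (intro exI[of _ \<delta>] conjI ballI impI \<delta>(1))
      fix t assume t: "t \<in> T" "norm (t - s) < \<delta>"
      have b: "\<bar>\<gamma> t i - \<gamma> s i\<bar> \<le> (\<bar>c i\<bar> + 1) * \<bar>t - s\<bar>" if "i < n" for i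
        using r(2)[OF that t(1)] t(2) \<delta>(2)[OF that] by simp
      have sm: "(\<Sum>i<n. \<bar>\<gamma> t i - \<gamma> s i\<bar>) \<le> C * \<bar>t - s\<bar>"
        unfolding C_def sum_distrib_right by (rule sum_mono) (use b in auto)
      have "\<bar>\<gamma> t i - \<gamma> s i\<bar> < d" if "i < n" for i
      proof -
        have "\<bar>c i\<bar> + 1 \<le> C" unfolding C_def by (rule member_le_sum) (use that in auto)
        then have "\<bar>\<gamma> t i - \<gamma> s i\<bar> \<le> C * \<bar>t - s\<bar>"
          using b[OF that] by (meson abs_ge_zero mult_right_mono order_trans)
        also have "\<dots> \<le> C * (d / (C + 1))" using t(2) \<delta>(3) C by (intro mult_left_mono) auto
        also have "\<dots> < d" using C d(1) by (simp add: field_simps)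
        finally show ?thesis .
      qed
      then have "\<bar>g (\<gamma> t) - g (\<gamma> s) - ?L t\<bar> \<le> \<epsilon> * (\<Sum>i<n. \<bar>\<gamma> t i - \<gamma> s i\<bar>)"
        using d(2)[OF \<gamma>[OF t(1)]] by blast
      also have "\<dots> \<le> \<epsilon> * (C * \<bar>t - s\<bar>)" using sm \<epsilon>(1) by (intro mult_left_mono) auto
      also have "\<dots> \<le> e * \<bar>t - s\<bar>" using mult_right_mono[OF \<epsilon>(2), of "\<bar>t - s\<bar>"] by (simp add: mult.assoc)
      finally show "norm (g (\<gamma> t) - g (\<gamma> s) - ?L t - (g (\<gamma> s) - g (\<gamma> s) - ?L s) - 0 * (t - s)) \<le> e * norm (t - s)"
        by simp
    qed
  qed
  from DERIV_add[OF DERIV_add[OF this L] DERIV_const[of "g (\<gamma> s)"]]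
  show ?thesis by simp
qed

definition tuple :: "nat \<Rightarrow> (nat \<Rightarrow> 'a \<Rightarrow> real) \<Rightarrow> 'a \<Rightarrow> nat \<Rightarrow> real"
  where "tuple m h x = (\<lambda>i. if i < m then h i x else 0)"

lemma tuple_Rn [simp]: "tuple m h x \<in> Rn m"
  by (simp add: tuple_def Rn_iff)

lemma tuple_continuous:
  assumes "\<And>i. i < m \<Longrightarrow> continuous_map X euclideanreal (h i)"
  shows "continuous_map X (Euclidean_space m) (tuple m h)"
  using continuous_map_componentwise_Euclidean_space[of X m "\<lambda>x i. h i x"] assms by (simp add: tuple_def[abs_def])

text \<open>Induction on \<open>k\<close>: by the chain rule the partial derivatives of the
  composite are sums of products to which the induction hypothesis applies.\<close>

lemma Ck_on_comp:
  assumes U: "open_Rn n U" and V: "open_Rn m V"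
    and map: "\<And>x. x \<in> U \<Longrightarrow> tuple m h x \<in> V"
  shows "Ck_on k m V g \<Longrightarrow> (\<And>i. i < m \<Longrightarrow> Ck_on k n U (h i)) \<Longrightarrow> Ck_on k n U (\<lambda>x. g (tuple m h x))"
proof (induction k arbitrary: g)
  case 0
  have "continuous_map (subtopology (Euclidean_space n) U) (Euclidean_space m) (tuple m h)"
    by (rule tuple_continuous) (use 0 in simp)
  then have "continuous_map (subtopology (Euclidean_space n) U) (subtopology (Euclidean_space m) V) (tuple m h)"
    using map by (simp add: continuous_map_in_subtopology image_subset_iff)
  then show ?case using 0(1) continuous_map_compose[of _ _ "tuple m h" _ g] by (simp add: comp_def)
next
  case (Suc k)
  have c: "Ck_on k n U (h i)" if "i < m" for i using Suc.prems(2)[OF that] by (rule Ck_on_Suc)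
  show ?case
  proof (rule Ck_on_SucI[OF U, of _ "\<lambda>j x. \<Sum>i<m. pd V i g (tuple m h x) * pd U j (h i) x"])
    have "Ck_on 0 n U (\<lambda>x. g (tuple m h x))"
      using Suc.IH[OF Ck_on_Suc[OF Suc.prems(1)] c] Ck_on_continuous by simp
    then show "continuous_map (subtopology (Euclidean_space n) U) euclideanreal (\<lambda>x. g (tuple m h x))" by simp
    show "Ck_on k n U (\<lambda>x. \<Sum>i<m. pd V i g (tuple m h x) * pd U j (h i) x)" if "j < n" for j
      by (intro Ck_on_open_sum[OF U] Ck_on_open_mult[OF U] Suc.IH) (use Suc.prems that c in auto)
    fix j x assume j: "j < n" and x: "x \<in> U"
    have g1: "Ck_on (Suc 0) m V g"
      using Suc.prems(1) by (auto dest: Ck_on_continuous)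
    have "((\<lambda>t. g (tuple m h (x(j := t)))) has_real_derivative
       (\<Sum>i<m. pd V i g (tuple m h (x(j := x j))) * pd U j (h i) x)) (at (x j))"
    proof (rule C1_chain_curve[OF V g1])
      show "((\<lambda>t. tuple m h (x(j := t)) i) has_real_derivative pd U j (h i) x) (at (x j))" if "i < m" for i
        using Ck_on_has_derivative[OF U Suc.prems(2)[OF that] x j] that by (simp add: tuple_def fun_upd_def)
    qed (use map[OF x] in auto)
    then show "((\<lambda>t. g (tuple m h (x(j := t)))) has_real_derivative (\<Sum>i<m. pd V i g (tuple m h x) * pd U j (h i) x)) (at (x j))"
      by simp
  qed
qed

subsection \<open>Symmetry of the second partial derivatives\<close>

text \<open>The mean value theorem is applied in direction \<open>i\<close> to the increment in
  direction \<open>j\<close>, and then in direction \<open>j\<close> to the derivative that results.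
  The second difference of the square is thus its area times a mixed derivative at some
  point.\<close>

lemma pd_mixed_mvt:
  assumes U: "open_Rn n U" and g: "Ck_on 2 n U g" and ij: "i < n" "j < n" "i \<noteq> j"
    and h: "h > 0" and x: "x \<in> Rn n" and box: "\<And>y. y \<in> Rn n \<Longrightarrow> (\<forall>l<n. \<bar>y l - x l\<bar> \<le> h) \<Longrightarrow> y \<in> U"
  shows "\<exists>y\<in>U. (\<forall>l<n. \<bar>y l - x l\<bar> \<le> h) \<and>
    g (x(i := x i + h, j := x j + h)) - g (x(i := x i + h)) - g (x(j := x j + h)) + g x = h * h * pd U j (pd U i g) y"
proof -
  have mem: "x(i := s, j := t) \<in> U \<and> (\<forall>l<n. \<bar>(x(i := s, j := t)) l - x l\<bar> \<le> h)"
    if "x i \<le> s" "s \<le> x i + h" "x j \<le> t" "t \<le> x j + h" for s t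
  proof -
    have 1: "\<forall>l<n. \<bar>(x(i := s, j := t)) l - x l\<bar> \<le> h"
      using that ij h by (auto simp: abs_if)
    show ?thesis using 1 box[OF _ 1] x ij by (simp del: fun_upd_apply)
  qed
  have g2: "Ck_on (Suc (Suc 0)) n U g" using g by (simp only: numeral_2_eq_2)
  have gi: "Ck_on (Suc 0) n U (pd U i g)" using g2 ij by simp
  let ?p = "\<lambda>s. g (x(i := s, j := x j + h)) - g (x(i := s, j := x j))"
  have Di: "((\<lambda>s. g (x(i := s, j := t))) has_real_derivative pd U i g (x(i := s, j := t))) (at s)"
    if "x i \<le> s" "s \<le> x i + h" "x j \<le> t" "t \<le> x j + h" for s t
    using Ck_on_has_derivative[OF U g2 conjunct1[OF mem[OF that]] ij(1)] ij(3)
    by (simp add: fun_upd_twist)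
  have "\<exists>s>x i. s < x i + h \<and> ?p (x i + h) - ?p (x i) = (x i + h - x i) * (pd U i g (x(i := s, j := x j + h)) - pd U i g (x(i := s, j := x j)))"
    by (rule MVT2) (use h in \<open>auto intro!: DERIV_diff Di simp del: fun_upd_apply\<close>)
  then obtain s where s: "x i < s" "s < x i + h"
    "?p (x i + h) - ?p (x i) = h * (pd U i g (x(i := s, j := x j + h)) - pd U i g (x(i := s, j := x j)))" by auto
  have Dj: "((\<lambda>t. pd U i g (x(i := s, j := t))) has_real_derivative pd U j (pd U i g) (x(i := s, j := t))) (at t)"
    if "x j \<le> t" "t \<le> x j + h" for t
    using Ck_on_has_derivative[OF U gi conjunct1[OF mem[of s t]] ij(2)] s that by simp
  have "\<exists>t>x j. t < x j + h \<and> pd U i g (x(i := s, j := x j + h)) - pd U i g (x(i := s, j := x j)) = (x j + h - x j) * pd U j (pd U i g) (x(i := s, j := t))"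
    by (rule MVT2) (use h in \<open>auto intro!: Dj simp del: fun_upd_apply\<close>)
  then obtain t where t: "x j < t" "t < x j + h"
    "pd U i g (x(i := s, j := x j + h)) - pd U i g (x(i := s, j := x j)) = h * pd U j (pd U i g) (x(i := s, j := t))" by auto
  show ?thesis
    using mem[of s t] s t ij(3) by (intro bexI[of _ "x(i := s, j := t)"]) (auto simp: fun_upd_twist)
qed

text \<open>The second difference of a square does not depend on the order of the two directions. By
  \<open>pd_mixed_mvt\<close> it equals either mixed derivative at some point of the square, up to
  the area, and continuity lets the square shrink to x.\<close>

lemma pd_commute_open:
  assumes U: "open_Rn n U" and g: "Ck_on 2 n U g" and ij: "i < n" "j < n" and x: "x \<in> U"
  shows "pd U i (pd U j g) x = pd U j (pd U i g) x"
proof (cases "i = j")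
  case False
  have xR: "x \<in> Rn n" using x openin_Rn_subset[OF U] by auto
  have g2: "Ck_on (Suc (Suc 0)) n U g" using g by (simp only: numeral_2_eq_2)
  have cont: "\<exists>d>0. \<forall>y\<in>Rn n. (\<forall>l<n. \<bar>y l - x l\<bar> < d) \<longrightarrow> y \<in> U \<and> \<bar>q y - q x\<bar> < \<epsilon>"
    if q: "continuous_map (subtopology (Euclidean_space n) U) euclideanreal q" and "\<epsilon> > 0" for q :: "(nat \<Rightarrow> real) \<Rightarrow> real" and \<epsilon>
  proof -
    have "openin (subtopology (Euclidean_space n) U) {z \<in> topspace (subtopology (Euclidean_space n) U). q z \<in> ball (q x) \<epsilon>}"
      using q by (rule openin_continuous_map_preimage) auto
    moreover have "topspace (subtopology (Euclidean_space n) U) = U" using openin_Rn_subset[OF U] by auto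
    ultimately have "openin (subtopology (Euclidean_space n) U) {z \<in> U. q z \<in> ball (q x) \<epsilon>}"
      by (simp only:)
    then have "open_Rn n {z \<in> U. q z \<in> ball (q x) \<epsilon>}"
      by (rule openin_trans_full[OF _ U])
    from openin_Rn_box[OF this, of x] x \<open>\<epsilon> > 0\<close> show ?thesis
      by (auto simp: dist_real_def abs_minus_commute)
  qed
  have "\<bar>pd U i (pd U j g) x - pd U j (pd U i g) x\<bar> \<le> e" if e: "e > 0" for e
  proof -
    have "\<exists>d>0. \<forall>y\<in>Rn n. (\<forall>l<n. \<bar>y l - x l\<bar> < d) \<longrightarrow> y \<in> U \<and> \<bar>pd U i (pd U j g) y - pd U i (pd U j g) x\<bar> < e / 2"
      by (rule cont) (use g2 ij e in auto)
    moreover have "\<exists>d>0. \<forall>y\<in>Rn n. (\<forall>l<n. \<bar>y l - x l\<bar> < d) \<longrightarrow> y \<in> U \<and> \<bar>pd U j (pd U i g) y - pd U j (pd U i g) x\<bar> < e / 2"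
      by (rule cont) (use g2 ij e in auto)
    ultimately obtain d1 d2 where d: "d1 > 0" "d2 > 0"
      "\<And>y. y \<in> Rn n \<Longrightarrow> (\<forall>l<n. \<bar>y l - x l\<bar> < d1) \<Longrightarrow> y \<in> U \<and> \<bar>pd U i (pd U j g) y - pd U i (pd U j g) x\<bar> < e / 2"
      "\<And>y. y \<in> Rn n \<Longrightarrow> (\<forall>l<n. \<bar>y l - x l\<bar> < d2) \<Longrightarrow> y \<in> U \<and> \<bar>pd U j (pd U i g) y - pd U j (pd U i g) x\<bar> < e / 2"
      by blast
    \<comment> \<open>Half the smaller radius, so that even the closed box of radius
      \<open>h\<close> lies in both neighbourhoods.\<close>
    define h where "h = min d1 d2 / 2"
    have h: "h > 0" "h < d1" "h < d2" using d(1,2) by (auto simp: h_def min_def)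
    have box: "y \<in> U" if "y \<in> Rn n" "\<forall>l<n. \<bar>y l - x l\<bar> \<le> h" for y
      using d(3)[OF that(1)] that(2) h by (meson le_less_trans)
    obtain y where y: "y \<in> U" "\<forall>l<n. \<bar>y l - x l\<bar> \<le> h"
      "g (x(i := x i + h, j := x j + h)) - g (x(i := x i + h)) - g (x(j := x j + h)) + g x = h * h * pd U j (pd U i g) y"
      using pd_mixed_mvt[OF U g ij(1,2) False h(1) xR box] by blast
    obtain z where z: "z \<in> U" "\<forall>l<n. \<bar>z l - x l\<bar> \<le> h"
      "g (x(j := x j + h, i := x i + h)) - g (x(j := x j + h)) - g (x(i := x i + h)) + g x = h * h * pd U i (pd U j g) z"
      using pd_mixed_mvt[OF U g ij(2,1) False[symmetric] h(1) xR box] by blast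
    have "h * h * pd U j (pd U i g) y = h * h * pd U i (pd U j g) z"
      using y(3) z(3) unfolding fun_upd_twist[OF False, of x] by linarith
    then have "pd U j (pd U i g) y = pd U i (pd U j g) z" using h by simp
    moreover have "\<bar>pd U j (pd U i g) y - pd U j (pd U i g) x\<bar> < e / 2"
      using d(4)[of y] y(1,2) openin_Rn_subset[OF U] h by (meson le_less_trans subsetD)
    moreover have "\<bar>pd U i (pd U j g) z - pd U i (pd U j g) x\<bar> < e / 2"
      using d(3)[of z] z(1,2) openin_Rn_subset[OF U] h by (meson le_less_trans subsetD)
    ultimately show ?thesis by linarith
  qed
  then have "\<bar>pd U i (pd U j g) x - pd U j (pd U i g) x\<bar> \<le> 0" by (rule field_le_epsilon) simp
  then show ?thesis by simp
qed simp

section \<open>Smooth functions on open subsets of corners\<close>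

definition corner_open :: "nat \<Rightarrow> (nat \<Rightarrow> real) set \<Rightarrow> bool"
  where "corner_open n A \<longleftrightarrow> (\<exists>k\<le>n. openin (subtopology (Euclidean_space n) (corner n k)) A)"

lemma corner_open_Rn: "corner_open n (Rn n)"
  unfolding corner_open_def by (rule exI[of _ 0]) (simp add: corner_def)

lemma corner_open_subset: "corner_open n A \<Longrightarrow> A \<subseteq> Rn n"
  unfolding corner_open_def by (metis le_inf_iff openin_subset topspace_subtopology)

text \<open>Increasing one coordinate never leaves a corner, whatever its number of faces, so every
  coordinate line has room in the positive direction.\<close>

lemma corner_open_slice:
  assumes "corner_open n A" "y \<in> A" "i < n"
  shows "\<exists>e>0. \<forall>t. y i \<le> t \<and> t < y i + e \<longrightarrow> y(i := t) \<in> A"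
proof -
  obtain k T where k: "open_Rn n T" "A = T \<inter> corner n k"
    using assms(1) by (auto simp: corner_open_def openin_subtopology)
  then obtain e where e: "e > 0" "\<forall>t. \<bar>t - y i\<bar> < e \<longrightarrow> y(i := t) \<in> T"
    using openin_Rn_slice[OF k(1) _ assms(3)] assms(2) by blast
  have "y(i := t) \<in> A" if "y i \<le> t" "t < y i + e" for t
  proof -
    have "y(i := t) \<in> T" using e(2) that e(1) by auto
    moreover have "y(i := t) \<in> corner n k" using that assms(2,3) k(2) by (auto simp: corner_def Rn_iff)
    ultimately show ?thesis using k(2) by simp
  qed
  then show ?thesis using e(1) by blast
qed

text \<open>Makes one-sided derivatives unique, which is what allows \<open>pd\<close> to be
  computed at boundary points.\<close>

lemma corner_open_nontrivial:
  assumes "corner_open n A" "y \<in> A" "i < n"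
  shows "at (y i) within {t. y(i := t) \<in> A} \<noteq> bot"
proof -
  obtain e where e: "e > 0" "\<And>t. y i \<le> t \<Longrightarrow> t < y i + e \<Longrightarrow> y(i := t) \<in> A"
    using corner_open_slice[OF assms] by blast
  have "y i islimpt {t. y(i := t) \<in> A}"
    unfolding islimpt_approachable
  proof (intro allI impI)
    fix d :: real assume "d > 0"
    then show "\<exists>x'\<in>{t. y(i := t) \<in> A}. x' \<noteq> y i \<and> dist x' (y i) < d"
      using e by (intro bexI[of _ "y i + min d e / 2"]) (auto simp: dist_real_def min_def)
  qed
  then show ?thesis by (simp add: trivial_limit_within)
qed

lemma pd_unique:
  assumes "corner_open n A" "y \<in> A" "i < n"
    and "((\<lambda>t. g (y(i := t))) has_real_derivative D) (at (y i) within {t. y(i := t) \<in> A})"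
  shows "pd A i g y = D"
  unfolding pd_def using corner_open_nontrivial[OF assms(1-3)] assms(4)
  by (intro vector_derivative_within) (simp_all add: has_real_derivative_iff_has_vector_derivative)

text \<open>The derivative taken inside A is that of any smooth extension. Calculus on corners
  thereby reduces to open sets, and the value does not depend on the extension.\<close>

lemma
  assumes A: "corner_open n A" "y \<in> A" "i < n" and W: "open_Rn n W" "y \<in> W" "Ck_on (Suc 0) n W h"
    and eq: "\<And>z. z \<in> W \<inter> A \<Longrightarrow> g z = h z"
  shows pd_extension_deriv: "((\<lambda>t. g (y(i := t))) has_real_derivative pd W i h y) (at (y i) within {t. y(i := t) \<in> A})"
    and pd_extension: "pd A i g y = pd W i h y"
proof -
  obtain e where e: "e > 0" "\<forall>t. \<bar>t - y i\<bar> < e \<longrightarrow> y(i := t) \<in> W"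
    using openin_Rn_slice[OF W(1,2) A(3)] by blast
  show 1: "((\<lambda>t. g (y(i := t))) has_real_derivative pd W i h y) (at (y i) within {t. y(i := t) \<in> A})"
    by (rule has_field_derivative_transform_within[OF has_field_derivative_at_within[OF Ck_on_has_derivative[OF W(1,3,2) A(3)]] e(1)])
      (use e(2) A(2) eq in \<open>auto simp: dist_real_def\<close>)
  then show "pd A i g y = pd W i h y" by (rule pd_unique[OF A])
qed

lemma smooth_onE:
  assumes "smooth_on_Rn n A g" "y \<in> A"
  obtains W h where "open_Rn n W" "y \<in> W" "\<And>k. Ck_on k n W h" "\<And>z. z \<in> W \<inter> A \<Longrightarrow> g z = h z"
proof -
  from bspec[OF assms(1)[unfolded smooth_on_Rn_def] assms(2)]
  obtain W h where "open_Rn n W" "y \<in> W" "\<forall>k. Ck_on k n W h" "\<forall>z\<in>W \<inter> A. g z = h z"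
    by (elim exE conjE)
  then show thesis by (intro that[of W h]) auto
qed

lemma smooth_onI:
  assumes "\<And>y. y \<in> A \<Longrightarrow> \<exists>W h. open_Rn n W \<and> y \<in> W \<and> (\<forall>k. Ck_on k n W h) \<and> (\<forall>z\<in>W \<inter> A. g z = h z)"
  shows "smooth_on_Rn n A g"
  using assms unfolding smooth_on_Rn_def by blast

lemma smooth_on_has_pd:
  assumes "corner_open n A" "smooth_on_Rn n A g" "y \<in> A" "i < n"
  shows "((\<lambda>t. g (y(i := t))) has_real_derivative pd A i g y) (at (y i) within {t. y(i := t) \<in> A})"
proof -
  obtain W h where W: "open_Rn n W" "y \<in> W" "\<And>k. Ck_on k n W h" "\<And>z. z \<in> W \<inter> A \<Longrightarrow> g z = h z"
    using smooth_onE[OF assms(2,3)] by metis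
  show ?thesis
    using pd_extension_deriv[OF assms(1,3,4) W(1-4)] pd_extension[OF assms(1,3,4) W(1-4)] by simp
qed

lemma smooth_on_subset: "smooth_on_Rn n A g \<Longrightarrow> A' \<subseteq> A \<Longrightarrow> smooth_on_Rn n A' g"
proof (rule smooth_onI)
  fix y assume *: "smooth_on_Rn n A g" "A' \<subseteq> A" "y \<in> A'"
  then have "y \<in> A" by auto
  from smooth_onE[OF *(1) this] obtain W h where "open_Rn n W" "y \<in> W"
    "\<And>k. Ck_on k n W h" "\<And>z. z \<in> W \<inter> A \<Longrightarrow> g z = h z" by metis
  with *(2) show "\<exists>W h. open_Rn n W \<and> y \<in> W \<and> (\<forall>k. Ck_on k n W h) \<and> (\<forall>z\<in>W \<inter> A'. g z = h z)"
    by (intro exI[of _ W] exI[of _ h]) auto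
qed

lemma smooth_on_cong: "smooth_on_Rn n A g \<Longrightarrow> (\<And>y. y \<in> A \<Longrightarrow> g y = h y) \<Longrightarrow> smooth_on_Rn n A h"
proof (rule smooth_onI)
  fix y assume *: "smooth_on_Rn n A g" "\<And>y. y \<in> A \<Longrightarrow> g y = h y" "y \<in> A"
  from smooth_onE[OF *(1,3)] obtain W q where "open_Rn n W" "y \<in> W"
    "\<And>k. Ck_on k n W q" "\<And>z. z \<in> W \<inter> A \<Longrightarrow> g z = q z" by metis
  with *(2) show "\<exists>W h'. open_Rn n W \<and> y \<in> W \<and> (\<forall>k. Ck_on k n W h') \<and> (\<forall>z\<in>W \<inter> A. h z = h' z)"
    by (intro exI[of _ W] exI[of _ q]) auto
qed

lemma smooth_on_local:
  assumes A: "A \<subseteq> Rn n"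
    and "\<And>y. y \<in> A \<Longrightarrow> \<exists>W. open_Rn n W \<and> y \<in> W \<and> smooth_on_Rn n (W \<inter> A) g"
  shows "smooth_on_Rn n A g"
proof (rule smooth_onI)
  fix y assume y: "y \<in> A"
  then obtain W where W: "open_Rn n W" "y \<in> W" "smooth_on_Rn n (W \<inter> A) g" using assms by blast
  then obtain W' h where W': "open_Rn n W'" "y \<in> W'" "\<And>k. Ck_on k n W' h" "\<And>z. z \<in> W' \<inter> (W \<inter> A) \<Longrightarrow> g z = h z"
    using smooth_onE[OF W(3), of y] y by (metis IntI)
  then show "\<exists>W h. open_Rn n W \<and> y \<in> W \<and> (\<forall>k. Ck_on k n W h) \<and> (\<forall>z\<in>W \<inter> A. g z = h z)"
    using W by (intro exI[of _ "W' \<inter> W"] exI[of _ h]) (auto intro: Ck_on_mono[of n W'])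
qed

lemma smooth_on_Cinf: "g \<in> Cinf n \<Longrightarrow> A \<subseteq> Rn n \<Longrightarrow> smooth_on_Rn n A g"
  unfolding Cinf_def by (intro smooth_onI exI[of _ "Rn n"] exI[of _ g]) auto

lemma smooth_on_const: "A \<subseteq> Rn n \<Longrightarrow> smooth_on_Rn n A (\<lambda>x. c)"
  by (auto intro: smooth_on_Cinf)

text \<open>Extensions of \<open>g\<close> and of the \<open>h i\<close> compose to an extension of
  the composite, once the domain is cut down to where this makes sense.\<close>

lemma smooth_on_tuple_comp:
  assumes g: "smooth_on_Rn m B g" and h: "\<And>i. i < m \<Longrightarrow> smooth_on_Rn n A (h i)"
    and map: "\<And>x. x \<in> A \<Longrightarrow> tuple m h x \<in> B" and A: "A \<subseteq> Rn n"
  shows "smooth_on_Rn n A (\<lambda>x. g (tuple m h x))"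
proof (rule smooth_onI)
  fix y assume y: "y \<in> A"
  obtain V q where V: "open_Rn m V" "tuple m h y \<in> V" "\<And>k. Ck_on k m V q" "\<And>z. z \<in> V \<inter> B \<Longrightarrow> g z = q z"
    using smooth_onE[OF g map[OF y]] by metis
  have "\<exists>W p. open_Rn n W \<and> y \<in> W \<and> (\<forall>k. Ck_on k n W p) \<and> (\<forall>z\<in>W \<inter> A. h i z = p z)" if "i < m" for i
    using h[OF that] y unfolding smooth_on_Rn_def by blast
  then obtain W p where W: "\<And>i. i < m \<Longrightarrow> open_Rn n (W i)" "\<And>i. i < m \<Longrightarrow> y \<in> W i"
    "\<And>i k. i < m \<Longrightarrow> Ck_on k n (W i) (p i)" "\<And>i z. i < m \<Longrightarrow> z \<in> W i \<inter> A \<Longrightarrow> h i z = p i z"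
    by metis
  \<comment> \<open>The factor \<open>Rn n\<close> stands in for the empty intersection when
    \<open>m\<close> is 0.\<close>
  define W1 where "W1 = Rn n \<inter> \<Inter>(W ` {..<m})"
  have W1: "open_Rn n W1" unfolding W1_def
    by (cases "m = 0") (use W(1) in \<open>auto intro!: openin_Int openin_Inter\<close>)
  have W1s: "W1 \<subseteq> W i" if "i < m" for i using that by (auto simp: W1_def)
  have c1: "Ck_on k n W1 (p i)" if "i < m" for i k
    by (rule Ck_on_mono[OF W(1)[OF that] W1 W1s[OF that] W(3)[OF that]])
  have W1t: "topspace (subtopology (Euclidean_space n) W1) = W1" by (auto simp: W1_def)
  \<comment> \<open>Away from \<open>y\<close> the extensions \<open>p i\<close> may leave
    \<open>V\<close>, the set on which \<open>q\<close> is smooth; the preimage of \<open>V\<close>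
    is open by continuity.\<close>
  define W2 where "W2 = {z \<in> W1. tuple m p z \<in> V}"
  have "continuous_map (subtopology (Euclidean_space n) W1) (Euclidean_space m) (tuple m p)"
    by (rule tuple_continuous) (use c1[of _ 0] in simp)
  from openin_continuous_map_preimage[OF this V(1)]
  have W2: "open_Rn n W2"
    unfolding W2_def W1t using openin_trans_full[OF _ W1] by blast
  have eq: "tuple m h z = tuple m p z" if "z \<in> W1" "z \<in> A" for z
    using W(4) W1s that by (fastforce simp: tuple_def)
  have yW: "y \<in> W2" using W(2) y A V(2) eq[of y] by (auto simp: W2_def W1_def)
  have c2: "Ck_on k n W2 (p i)" if "i < m" for i k
    by (rule Ck_on_mono[OF W1 W2 _ c1[OF that]]) (auto simp: W2_def)
  have "Ck_on k n W2 (\<lambda>x. q (tuple m p x))" for k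
    by (rule Ck_on_comp[OF W2 V(1) _ V(3) c2]) (auto simp: W2_def)
  moreover have "g (tuple m h z) = q (tuple m p z)" if "z \<in> W2 \<inter> A" for z
    using that eq[of z] map[of z] V(4)[of "tuple m h z"] by (auto simp: W2_def)
  ultimately show "\<exists>W h'. open_Rn n W \<and> y \<in> W \<and> (\<forall>k. Ck_on k n W h') \<and> (\<forall>z\<in>W \<inter> A. g (tuple m h z) = h' z)"
    using W2 yW by blast
qed

text \<open>The chain rule for curves is applied to a smooth extension \<open>q\<close> of
  \<open>g\<close> along t \<mapsto> \<open>tuple m h (y(j := t))\<close>. The result is carried
  back to \<open>g\<close>, which agrees with \<open>q\<close> along the curve near the base
  parameter.\<close>

lemma pd_tuple_comp:
  assumes A: "corner_open n A" and B: "corner_open m B" and g: "smooth_on_Rn m B g"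
    and h: "\<And>i. i < m \<Longrightarrow> smooth_on_Rn n A (h i)"
    and map: "\<And>x. x \<in> A \<Longrightarrow> tuple m h x \<in> B" and y: "y \<in> A" "j < n"
  shows "pd A j (\<lambda>x. g (tuple m h x)) y = (\<Sum>i<m. pd B i g (tuple m h y) * pd A j (h i) y)"
proof (rule pd_unique[OF A y])
  let ?T = "{t. y(j := t) \<in> A}"
  obtain V q where V: "open_Rn m V" "tuple m h y \<in> V" "\<And>k. Ck_on k m V q" "\<And>z. z \<in> V \<inter> B \<Longrightarrow> g z = q z"
    using smooth_onE[OF g map[OF y(1)]] by metis
  have d: "((\<lambda>t. tuple m h (y(j := t)) i) has_real_derivative pd A j (h i) y) (at (y j) within ?T)" if "i < m" for i
    using smooth_on_has_pd[OF A h[OF that] y] that by (simp add: tuple_def)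
  have 1: "((\<lambda>t. q (tuple m h (y(j := t)))) has_real_derivative (\<Sum>i<m. pd V i q (tuple m h (y(j := y j))) * pd A j (h i) y)) (at (y j) within ?T)"
    by (rule C1_chain_curve[OF V(1) V(3)]) (use V(2) d in auto)
  obtain e where e: "e > 0" "\<And>z. z \<in> Rn m \<Longrightarrow> (\<forall>i<m. \<bar>z i - tuple m h y i\<bar> < e) \<Longrightarrow> z \<in> V"
    using openin_Rn_box[OF V(1,2)] by blast
  \<comment> \<open>Continuity keeps the curve, for nearby parameters, in the box around its base
    point that lies in \<open>V\<close>.\<close>
  have "\<forall>i<m. \<forall>\<^sub>F t in at (y j) within ?T. \<bar>tuple m h (y(j := t)) i - tuple m h y i\<bar> < e"
  proof (intro allI impI)
    fix i assume "i < m"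
    from has_field_derivative_imp_has_derivative[OF d[OF this], THEN has_derivative_continuous]
    have "((\<lambda>t. tuple m h (y(j := t)) i) \<longlongrightarrow> tuple m h y i) (at (y j) within ?T)"
      by (simp add: continuous_within)
    from tendstoD[OF this e(1)] show "\<forall>\<^sub>F t in at (y j) within ?T. \<bar>tuple m h (y(j := t)) i - tuple m h y i\<bar> < e"
      by (simp add: dist_real_def)
  qed
  then have "\<forall>\<^sub>F t in at (y j) within ?T. \<forall>i\<in>{..<m}. \<bar>tuple m h (y(j := t)) i - tuple m h y i\<bar> < e"
    by (intro eventually_ball_finite) auto
  then have ev: "\<forall>\<^sub>F t in at (y j) within ?T. q (tuple m h (y(j := t))) = g (tuple m h (y(j := t)))"
    using eventually_at_filter[of "\<lambda>t. t \<in> ?T" "y j" ?T, THEN iffD2, OF eventuallyI, simplified]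
  proof (rule eventually_elim2, goal_cases)
    case (1 t)
    then show ?case using e(2)[of "tuple m h (y(j := t))"] map[of "y(j := t)"] V(4) by auto
  qed
  have q0: "q (tuple m h (y(j := y j))) = g (tuple m h (y(j := y j)))"
    using V(2,4) map y(1) by auto
  have "((\<lambda>t. g (tuple m h (y(j := t)))) has_real_derivative (\<Sum>i<m. pd V i q (tuple m h (y(j := y j))) * pd A j (h i) y)) (at (y j) within ?T)"
    using 1 unfolding has_field_derivative_def
    by (rule has_derivative_transform_eventually[OF _ ev q0]) (use y in auto)
  moreover have "pd V i q (tuple m h y) = pd B i g (tuple m h y)" if "i < m" for i
    using pd_extension[OF B map[OF y(1)] that V(1,2) V(3) V(4)] by simp
  ultimately show "((\<lambda>t. g (tuple m h (y(j := t)))) has_real_derivative (\<Sum>i<m. pd B i g (tuple m h y) * pd A j (h i) y)) (at (y j) within ?T)"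
    by simp
qed

lemma smooth_on_add:
  assumes "smooth_on_Rn n A g" "smooth_on_Rn n A h"
  shows "smooth_on_Rn n A (\<lambda>x. g x + h x)"
proof (rule smooth_onI)
  fix y assume y: "y \<in> A"
  obtain W p where W: "open_Rn n W" "y \<in> W" "\<And>k. Ck_on k n W p" "\<And>z. z \<in> W \<inter> A \<Longrightarrow> g z = p z"
    using smooth_onE[OF assms(1) y] by metis
  obtain V q where V: "open_Rn n V" "y \<in> V" "\<And>k. Ck_on k n V q" "\<And>z. z \<in> V \<inter> A \<Longrightarrow> h z = q z"
    using smooth_onE[OF assms(2) y] by metis
  have o: "open_Rn n (W \<inter> V)" using W V by auto
  have "Ck_on k n (W \<inter> V) (\<lambda>x. p x + q x)" for k
    by (intro Ck_on_open_add[OF o] Ck_on_mono[OF W(1) o _ W(3)] Ck_on_mono[OF V(1) o _ V(3)]) auto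
  then show "\<exists>W h'. open_Rn n W \<and> y \<in> W \<and> (\<forall>k. Ck_on k n W h') \<and> (\<forall>z\<in>W \<inter> A. g z + h z = h' z)"
    using o W V by (intro exI[of _ "W \<inter> V"] exI[of _ "\<lambda>x. p x + q x"]) auto
qed

lemma smooth_on_mult:
  assumes "smooth_on_Rn n A g" "smooth_on_Rn n A h"
  shows "smooth_on_Rn n A (\<lambda>x. g x * h x)"
proof (rule smooth_onI)
  fix y assume y: "y \<in> A"
  obtain W p where W: "open_Rn n W" "y \<in> W" "\<And>k. Ck_on k n W p" "\<And>z. z \<in> W \<inter> A \<Longrightarrow> g z = p z"
    using smooth_onE[OF assms(1) y] by metis
  obtain V q where V: "open_Rn n V" "y \<in> V" "\<And>k. Ck_on k n V q" "\<And>z. z \<in> V \<inter> A \<Longrightarrow> h z = q z"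
    using smooth_onE[OF assms(2) y] by metis
  have o: "open_Rn n (W \<inter> V)" using W V by auto
  have "Ck_on k n (W \<inter> V) (\<lambda>x. p x * q x)" for k
    by (intro Ck_on_open_mult[OF o] Ck_on_mono[OF W(1) o _ W(3)] Ck_on_mono[OF V(1) o _ V(3)]) auto
  then show "\<exists>W h'. open_Rn n W \<and> y \<in> W \<and> (\<forall>k. Ck_on k n W h') \<and> (\<forall>z\<in>W \<inter> A. g z * h z = h' z)"
    using o W V by (intro exI[of _ "W \<inter> V"] exI[of _ "\<lambda>x. p x * q x"]) auto
qed

lemma smooth_on_sum:
  assumes "A \<subseteq> Rn n" "\<And>i. i \<in> I \<Longrightarrow> smooth_on_Rn n A (g i)"
  shows "smooth_on_Rn n A (\<lambda>x. \<Sum>i\<in>I. g i x)"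
  using assms(2) by (induction I rule: infinite_finite_induct) (auto intro!: smooth_on_const[OF assms(1)] smooth_on_add)

text \<open>The partial derivative of a local extension extends the partial derivative.\<close>

lemma smooth_on_pd:
  assumes A: "corner_open n A" and g: "smooth_on_Rn n A g" and i: "i < n"
  shows "smooth_on_Rn n A (pd A i g)"
proof (rule smooth_onI)
  fix y assume y: "y \<in> A"
  obtain W p where W: "open_Rn n W" "y \<in> W" "\<And>k. Ck_on k n W p" "\<And>z. z \<in> W \<inter> A \<Longrightarrow> g z = p z"
    using smooth_onE[OF g y] by metis
  have "Ck_on k n W (pd W i p)" for k using W(3)[of "Suc k"] i by simp
  moreover have "pd A i g z = pd W i p z" if "z \<in> W \<inter> A" for z
    using pd_extension[OF A _ i W(1) _ W(3) W(4)] that by auto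
  ultimately show "\<exists>W h'. open_Rn n W \<and> y \<in> W \<and> (\<forall>k. Ck_on k n W h') \<and> (\<forall>z\<in>W \<inter> A. pd A i g z = h' z)"
    using W by blast
qed

text \<open>Both iterated derivatives are those of one extension, to which
  \<open>pd_commute_open\<close> applies.\<close>

lemma pd_commute:
  assumes A: "corner_open n A" and g: "smooth_on_Rn n A g" and ij: "i < n" "j < n" and y: "y \<in> A"
  shows "pd A i (pd A j g) y = pd A j (pd A i g) y"
proof -
  obtain W p where W: "open_Rn n W" "y \<in> W" "\<And>k. Ck_on k n W p" "\<And>z. z \<in> W \<inter> A \<Longrightarrow> g z = p z"
    using smooth_onE[OF g y] by metis
  have c: "Ck_on k n W (pd W i p)" if "i < n" for k i using W(3)[of "Suc k"] that by simp
  have e: "pd A i g z = pd W i p z" if "z \<in> W \<inter> A" "i < n" for z i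
    using pd_extension[OF A _ that(2) W(1) _ W(3) W(4)] that by auto
  have "pd A i (pd A j g) y = pd W i (pd W j p) y" if "i < n" "j < n" for i j
    by (rule pd_extension[OF A y that(1) W(1,2) c[OF that(2)] e[OF _ that(2)]])
  then show ?thesis using pd_commute_open[OF W(1) W(3) ij W(2)] ij by simp
qed

lemma pd_mono:
  assumes A: "corner_open n A" "corner_open n A'" "A' \<subseteq> A" and g: "smooth_on_Rn n A g" and i: "i < n" and y: "y \<in> A'"
  shows "pd A' i g y = pd A i g y"
proof -
  have "y \<in> A" using A y by auto
  then obtain W p where W: "open_Rn n W" "y \<in> W" "\<And>k. Ck_on k n W p" "\<And>z. z \<in> W \<inter> A \<Longrightarrow> g z = p z"
    using smooth_onE[OF g] by metis
  show ?thesis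
    using pd_extension[OF A(1) \<open>y \<in> A\<close> i W(1,2) W(3) W(4)] pd_extension[OF A(2) y i W(1,2) W(3), of g] W(4) A(3) by auto
qed

lemma
  assumes A: "corner_open n A" "y \<in> A" "i < n" and g: "smooth_on_Rn n A g" and h: "smooth_on_Rn n A h"
  shows pd_add: "pd A i (\<lambda>x. g x + h x) y = pd A i g y + pd A i h y"
    and pd_mult: "pd A i (\<lambda>x. g x * h x) y = pd A i g y * h y + g y * pd A i h y"
  by (rule pd_unique[OF A], rule DERIV_add; rule smooth_on_has_pd[OF A(1) _ A(2,3)], fact)
     (rule pd_unique[OF A], rule DERIV_cong, rule DERIV_mult[OF smooth_on_has_pd[OF A(1) g A(2,3)] smooth_on_has_pd[OF A(1) h A(2,3)]], simp)

lemma pd_const: "corner_open n A \<Longrightarrow> y \<in> A \<Longrightarrow> i < n \<Longrightarrow> pd A i (\<lambda>x. c) y = 0"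
  by (rule pd_unique) auto

lemma pd_coord:
  assumes A: "corner_open n A" "y \<in> A" "i < n"
  shows "pd A i (\<lambda>x. x j) y = (if i = j then 1 else 0)"
  by (rule pd_unique[OF A]) (cases "i = j"; auto)

lemma pd_cmult:
  assumes A: "corner_open n A" "y \<in> A" "i < n" and g: "smooth_on_Rn n A g"
  shows "pd A i (\<lambda>x. c * g x) y = c * pd A i g y"
  using pd_mult[OF A smooth_on_const g, of c] pd_const[OF A] corner_open_subset[OF A(1)] by simp

lemma pd_sum:
  assumes A: "corner_open n A" "y \<in> A" "i < n" and "\<And>j. j \<in> I \<Longrightarrow> smooth_on_Rn n A (g j)"
  shows "pd A i (\<lambda>x. \<Sum>j\<in>I. g j x) y = (\<Sum>j\<in>I. pd A i (g j) y)"
  using assms(4)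
  by (induction I rule: infinite_finite_induct)
    (auto simp: pd_const[OF A] pd_add[OF A _ smooth_on_sum] corner_open_subset[OF A(1)])

section \<open>The differential on $\Lambda^\bullet\Omega^1_C$\<close>

text \<open>The defining rule of a derivation is applied to the sum and the product of two variables
  and to a constant function of one variable; only the partial derivatives of these have to be
  known.\<close>

lemma
  assumes N: "Module.module (alg C) N" and C: "is_cinf_ring C" and X: "cinf_derivation C N X"
  shows derivation_closed: "a \<in> carrier C \<Longrightarrow> X a \<in> carrier N"
    and derivation_add: "a \<in> carrier C \<Longrightarrow> b \<in> carrier C \<Longrightarrow> X (a \<oplus>\<^bsub>alg C\<^esub> b) = X a \<oplus>\<^bsub>N\<^esub> X b"
    and derivation_mult: "a \<in> carrier C \<Longrightarrow> b \<in> carrier C \<Longrightarrow>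
      X (a \<otimes>\<^bsub>alg C\<^esub> b) = a \<odot>\<^bsub>N\<^esub> X b \<oplus>\<^bsub>N\<^esub> b \<odot>\<^bsub>N\<^esub> X a"
    and derivation_const: "X (cconst C r) = \<zero>\<^bsub>N\<^esub>"
proof -
  interpret N: Module.module "alg C" N by fact
  have cA: "carrier (alg C) = carrier C" by (simp add: alg_simps)
  show cl: "X a \<in> carrier N" if "a \<in> carrier C" for a using X that by (auto simp: cinf_derivation_def)
  \<comment> \<open>The binary case with the partial derivatives given as \<open>p\<close> and
    \<open>q\<close>, which \<open>cop_cong\<close> substitutes for \<open>pd\<close>.\<close>
  have X2: "X (cop C h [a, b]) = cop C p [a, b] \<odot>\<^bsub>N\<^esub> X a \<oplus>\<^bsub>N\<^esub> cop C q [a, b] \<odot>\<^bsub>N\<^esub> X b"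
    if ab: "a \<in> carrier C" "b \<in> carrier C" and h: "h \<in> Cinf 2" "p \<in> Cinf 2" "q \<in> Cinf 2"
      and D: "\<And>x. x \<in> Rn 2 \<Longrightarrow> ((\<lambda>t. h (x(0 := t))) has_vector_derivative p x) (at (x 0))"
         "\<And>x. x \<in> Rn 2 \<Longrightarrow> ((\<lambda>t. h (x(1 := t))) has_vector_derivative q x) (at (x 1))" for a b h p q
  proof -
    have s: "set [a, b] \<subseteq> carrier C" "length [a, b] = 2" using ab by auto
    have l: "{..<length [a, b]} = {0, 1}" by auto
    have p: "cop C (pd (Rn 2) 0 h) [a, b] = cop C p [a, b]"
      by (rule cop_cong[OF C s(1), unfolded s(2)]) (use h D(1) in \<open>auto simp: Cinf_pd intro!: pd_RnI\<close>)
    have q: "cop C (pd (Rn 2) 1 h) [a, b] = cop C q [a, b]"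
      by (rule cop_cong[OF C s(1), unfolded s(2)]) (use h D(2) Cinf_pd[OF h(1), of 1] in \<open>auto intro!: pd_RnI\<close>)
    have c: "cop C p [a, b] \<in> carrier (alg C)" "cop C q [a, b] \<in> carrier (alg C)"
      using cop_closed[OF C s(1), unfolded s(2)] h by (simp_all only: cA)
    have "X (cop C h [a, b]) = (\<Oplus>\<^bsub>N\<^esub>i\<in>{0, 1}. cop C (pd (Rn 2) i h) [a, b] \<odot>\<^bsub>N\<^esub> X ([a, b] ! i))"
    proof -
      have "X (cop C h as) = (\<Oplus>\<^bsub>N\<^esub>i\<in>{..<length as}. cop C (pd (Rn (length as)) i h) as \<odot>\<^bsub>N\<^esub> X (as ! i))"
        if "as \<noteq> []" "set as \<subseteq> carrier C" "h \<in> Cinf (length as)" for as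
        using X that by (simp add: cinf_derivation_def)
      note D2 = this[of "[a, b]", OF _ s(1), unfolded s(2)]
      have "{..<2::nat} = {0, 1}" by auto
      with D2 show ?thesis using h(1) by (simp only: list.distinct not_False_eq_True simp_thms)
    qed
    also have "\<dots> = cop C p [a, b] \<odot>\<^bsub>N\<^esub> X a \<oplus>\<^bsub>N\<^esub> (\<Oplus>\<^bsub>N\<^esub>i\<in>{1}. cop C (pd (Rn 2) i h) [a, b] \<odot>\<^bsub>N\<^esub> X ([a, b] ! i))"
      by (subst N.M.finsum_insert) (use p q c cl ab in auto)
    also have "(\<Oplus>\<^bsub>N\<^esub>i\<in>{1}. cop C (pd (Rn 2) i h) [a, b] \<odot>\<^bsub>N\<^esub> X ([a, b] ! i)) = cop C q [a, b] \<odot>\<^bsub>N\<^esub> X b"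
      by (subst N.M.finsum_insert) (use q c cl ab in auto)
    finally show ?thesis .
  qed
  have proj: "cop C (\<lambda>x. x 0) [a, b] = a" "cop C (\<lambda>x. x 1) [a, b] = b" "cop C (\<lambda>x. 1) [a, b] = \<one>\<^bsub>alg C\<^esub>"
     if "a \<in> carrier C" "b \<in> carrier C" for a b
    using cop_proj[OF C, of "[a, b]" 0] cop_proj[OF C, of "[a, b]" 1] cop_const[OF C, of "[a, b]" 1] that
    by (simp_all add: alg_simps)
  show "X (a \<oplus>\<^bsub>alg C\<^esub> b) = X a \<oplus>\<^bsub>N\<^esub> X b" if ab: "a \<in> carrier C" "b \<in> carrier C" for a b
    unfolding alg_simps
    by (subst X2[where p = "\<lambda>x. 1" and q = "\<lambda>x. 1"])
      (use ab cl in \<open>auto simp: proj intro!: Cinf_add derivative_eq_intros simp: has_vector_derivative_id[unfolded id_def]\<close>)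
  show "X (a \<otimes>\<^bsub>alg C\<^esub> b) = a \<odot>\<^bsub>N\<^esub> X b \<oplus>\<^bsub>N\<^esub> b \<odot>\<^bsub>N\<^esub> X a" if ab: "a \<in> carrier C" "b \<in> carrier C" for a b
  proof -
    have "((\<lambda>t. t * y) has_vector_derivative y) (at z)" "((\<lambda>t. y * t) has_vector_derivative y) (at z)" for y z :: real
      by (auto simp: has_real_derivative_iff_has_vector_derivative[symmetric] intro!: derivative_eq_intros)
    then have "X (cop C (\<lambda>x. x 0 * x 1) [a, b]) = cop C (\<lambda>x. x 1) [a, b] \<odot>\<^bsub>N\<^esub> X a \<oplus>\<^bsub>N\<^esub> cop C (\<lambda>x. x 0) [a, b] \<odot>\<^bsub>N\<^esub> X b"
      by (intro X2 ab Cinf_mult Cinf_coord) auto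
    then show ?thesis using ab cl by (simp add: proj alg_simps(2) N.M.a_comm cA del: One_nat_def)
  qed
  \<comment> \<open>Constants are nullary operations, while the derivation rule speaks of positive
    arities; so the constant is read as a unary operation on an arbitrary element.\<close>
  obtain a where a: "a \<in> carrier C" using C by (auto simp: is_cinf_ring_def)
  have s: "set [a] \<subseteq> carrier C" using a by auto
  have "cop C (pd (Rn 1) 0 (\<lambda>x. r)) [a] = cop C (\<lambda>x. 0) [a]"
    by (rule cop_cong[OF C s]) (auto simp: Cinf_pd[OF Cinf_const, of _ 1, simplified] intro!: pd_RnI)
  then have "cop C (pd (Rn 1) 0 (\<lambda>x. r)) [a] = \<zero>\<^bsub>alg C\<^esub>"
    using cop_const[OF C s, of 0] by (simp add: alg_simps)
  moreover have "X (cop C (\<lambda>x. r) [a]) = (\<Oplus>\<^bsub>N\<^esub>i\<in>{..<length [a]}. cop C (pd (Rn (length [a])) i (\<lambda>x. r)) [a] \<odot>\<^bsub>N\<^esub> X ([a] ! i))"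
    using X s unfolding cinf_derivation_def by blast
  ultimately show "X (cconst C r) = \<zero>\<^bsub>N\<^esub>"
    using cl[OF a] by (simp add: cconst_def cop_const[OF C s] lessThan_Suc)
qed

lemma kaehler_induct:
  assumes C: "is_cinf_ring C" and K: "submodule K (alg C) (kaehler C)"
    and d: "\<And>a. a \<in> carrier C \<Longrightarrow> kaehler_d C a \<in> K"
  shows "carrier (kaehler C) \<subseteq> K"
proof -
  let ?F = "free_module (alg C) (carrier C)"
  have F: "Module.module (alg C) ?F" by (rule module_free_module[OF cring_alg[OF C]])
  have q: "linear_map (alg C) ?F (kaehler C) (\<lambda>x. kaehler_rel C +>\<^bsub>?F\<^esub> x)"
    unfolding kaehler_def by (rule linear_map_quot[OF F kaehler_rel_submodule[OF C]])
  have "carrier ?F \<subseteq> {p \<in> carrier ?F. kaehler_rel C +>\<^bsub>?F\<^esub> p \<in> K}"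
    by (rule free_module_induct[OF cring_alg[OF C] linear_map_preimage[OF F module_kaehler[OF C] q K]])
      (use d free_gen_closed[OF cring_alg[OF C]] in \<open>auto simp: kaehler_d_def\<close>)
  moreover have "carrier (kaehler C) = (\<lambda>x. kaehler_rel C +>\<^bsub>?F\<^esub> x) ` carrier ?F"
    unfolding kaehler_def by (rule quot_carrier[OF F kaehler_rel_submodule[OF C]])
  ultimately show ?thesis by auto
qed

text \<open>Splitting off the last row and column leaves entries that cancel in pairs. The diagonal
  is a hypothesis of its own, since in a group with 2-torsion its vanishing does not follow from
  antisymmetry.\<close>

lemma (in abelian_group) antisymmetric_sum:
  assumes F: "\<And>i j. i < n \<Longrightarrow> j < n \<Longrightarrow> F i j \<in> carrier G"
    and anti: "\<And>i j. i < n \<Longrightarrow> j < n \<Longrightarrow> F i j \<oplus> F j i = \<zero>" and diag: "\<And>i. i < n \<Longrightarrow> F i i = \<zero>"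
  shows "(\<Oplus>i\<in>{..<n::nat}. \<Oplus>j\<in>{..<n}. F i j) = \<zero>"
  using assms
proof (induction n)
  case (Suc n)
  have c: "(\<lambda>j. F i j) \<in> {..<n} \<rightarrow> carrier G" if "i \<le> n" for i using Suc.prems(1) that by auto
  have c': "(\<lambda>i. F i n) \<in> {..<n} \<rightarrow> carrier G" using Suc.prems(1) by auto
  have Fn: "F i n \<in> carrier G" if "i \<le> n" for i using Suc.prems(1) that by auto
  have row: "(\<Oplus>j\<in>{..<Suc n}. F i j) = F i n \<oplus> (\<Oplus>j\<in>{..<n}. F i j)" if "i \<le> n" for i
    using c[OF that] Fn[OF that] by (simp add: lessThan_Suc)
  have "(\<Oplus>i\<in>{..<Suc n}. \<Oplus>j\<in>{..<Suc n}. F i j) = (\<Oplus>i\<in>{..<Suc n}. F i n \<oplus> (\<Oplus>j\<in>{..<n}. F i j))"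
    by (rule finsum_cong') (use row c Fn in auto)
  also have "\<dots> = (F n n \<oplus> (\<Oplus>j\<in>{..<n}. F n j)) \<oplus> (\<Oplus>i\<in>{..<n}. F i n \<oplus> (\<Oplus>j\<in>{..<n}. F i j))"
    unfolding lessThan_Suc by (rule finsum_insert) (use c Fn in auto)
  also have "(\<Oplus>i\<in>{..<n}. F i n \<oplus> (\<Oplus>j\<in>{..<n}. F i j)) = (\<Oplus>i\<in>{..<n}. F i n) \<oplus> (\<Oplus>i\<in>{..<n}. \<Oplus>j\<in>{..<n}. F i j)"
    by (rule finsum_addf) (use c Fn in auto)
  also have "(\<Oplus>i\<in>{..<n}. \<Oplus>j\<in>{..<n}. F i j) = \<zero>" by (rule Suc.IH) (use Suc.prems in auto)
  also have "F n n = \<zero>" using Suc.prems(3) by simp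
  also have "(\<zero> \<oplus> (\<Oplus>j\<in>{..<n}. F n j)) \<oplus> ((\<Oplus>i\<in>{..<n}. F i n) \<oplus> \<zero>) = (\<Oplus>j\<in>{..<n}. F n j \<oplus> F j n)"
    using c[of n] c' by (simp add: finsum_addf)
  also have "\<dots> = (\<Oplus>j\<in>{..<n}. \<zero>)" by (rule finsum_cong') (use Suc.prems(2) in auto)
  finally show ?case by simp
qed simp

lemma finsum_pair:
  assumes G: "abelian_group G" and H: "abelian_group H" and P: "abelian_group P"
    and "carrier P = carrier G \<times> carrier H" "\<zero>\<^bsub>P\<^esub> = (\<zero>\<^bsub>G\<^esub>, \<zero>\<^bsub>H\<^esub>)"
    and "\<And>x x' y y'. (x, x') \<oplus>\<^bsub>P\<^esub> (y, y') = (x \<oplus>\<^bsub>G\<^esub> y, x' \<oplus>\<^bsub>H\<^esub> y')"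
    and "finite I" "f \<in> I \<rightarrow> carrier G" "g \<in> I \<rightarrow> carrier H"
  shows "(\<Oplus>\<^bsub>P\<^esub>i\<in>I. (f i, g i)) = (\<Oplus>\<^bsub>G\<^esub>i\<in>I. f i, \<Oplus>\<^bsub>H\<^esub>i\<in>I. g i)"
proof -
  interpret G: abelian_group G by fact
  interpret H: abelian_group H by fact
  interpret P: abelian_group P by fact
  show ?thesis using assms(7-)
  proof (induction I)
    case empty
    then show ?case by (simp add: assms(5))
  next
    case (insert i I)
    then show ?case by (subst P.finsum_insert) (auto simp: assms(4,6))
  qed
qed

locale cinf_forms =
  fixes C :: "'c cinf_ring"
  assumes C: "is_cinf_ring C"
begin

sublocale exterior "alg C" "kaehler C"
  by (rule exterior.intro) (rule module_kaehler[OF C])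

sublocale LM: Module.module "alg C" "Lam k" for k by (rule Lam_module)

abbreviation "EA \<equiv> ext_algebra (alg C) (kaehler C)"
abbreviation "ew \<equiv> ext_word (alg C) (kaehler C)"
abbreviation "one0 \<equiv> ew 0 []"
abbreviation "dl a \<equiv> form1 C (kaehler_d C a)"
abbreviation "gs k m \<equiv> gsign (Lam m) k"

section \<open>Degrees 0 and 1, and generation of all forms by them\<close>

lemma cC: "carrier (alg C) = carrier C" by (simp add: alg_simps)

lemma one0_closed [simp]: "one0 \<in> carrier (Lam 0)"
  by (rule ext_word_closed) (simp add: ext_words_def)

lemma one0_l:
  assumes "x \<in> carrier (Lam k)"
  shows "wmult 0 k one0 x = x"
proof (rule Lam_linear_eq[OF Lam_module[of k] _ linear_map_id _ assms])
  show "linear_map (alg C) (Lam k) (Lam k) (wmult 0 k one0)"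
    using wmult_linear_r[OF one0_closed, of k] by simp
qed (subst wmult_word, simp_all add: ext_words_def)

lemma one0_r: "x \<in> carrier (Lam k) \<Longrightarrow> wmult k 0 x one0 = x"
  using wmult_comm[of x k one0 0] by (simp add: one0_l gsign_def)

lemma form0_eq: "a \<in> carrier C \<Longrightarrow> form0 C a = a \<odot>\<^bsub>Lam 0\<^esub> one0"
  unfolding form0_def ext_word_def
  by (rule linear_map_simps(3)[OF proj_linear]) (simp_all add: cC gen_closed ext_words_def)

lemma form0_closed: "a \<in> carrier C \<Longrightarrow> form0 C a \<in> carrier (Lam 0)"
  by (simp add: form0_eq cC)

lemma form0_mult: "a \<in> carrier C \<Longrightarrow> x \<in> carrier (Lam k) \<Longrightarrow> wmult 0 k (form0 C a) x = a \<odot>\<^bsub>Lam k\<^esub> x"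
  using gmult_smult_l[of a one0 0 x k] by (simp add: form0_eq cC one0_l)

lemma form1_eq: "form1 C m = ew 1 [m]"
  by (simp add: form1_def ext_word_def)

lemma form1_linear: "linear_map (alg C) (kaehler C) (Lam 1) (form1 C)"
proof (rule linear_mapI)
  show "form1 C m \<in> carrier (Lam 1)" if "m \<in> carrier (kaehler C)" for m
    unfolding form1_eq using that by (intro ext_word_closed) (simp add: ext_words_def)
  show "form1 C (x \<oplus>\<^bsub>kaehler C\<^esub> y) = form1 C x \<oplus>\<^bsub>Lam 1\<^esub> form1 C y"
    if "x \<in> carrier (kaehler C)" "y \<in> carrier (kaehler C)" for x y
    using ext_word_add[of "[]" x "[]" 1 y] that by (simp add: form1_eq ext_words_def)
  show "form1 C (r \<odot>\<^bsub>kaehler C\<^esub> x) = r \<odot>\<^bsub>Lam 1\<^esub> form1 C x"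
    if "r \<in> carrier (alg C)" "x \<in> carrier (kaehler C)" for r x
    using ext_word_smult[of "[]" x "[]" 1 r] that by (simp add: form1_eq ext_words_def)
qed

lemma form1_closed: "m \<in> carrier (kaehler C) \<Longrightarrow> form1 C m \<in> carrier (Lam 1)"
  using linear_map_simps(1)[OF form1_linear] .

lemma form1_sq: "m \<in> carrier (kaehler C) \<Longrightarrow> wmult 1 1 (form1 C m) (form1 C m) = \<zero>\<^bsub>Lam 2\<^esub>"
  using ext_word_alt[of "[]" m "[]" 2] by (simp add: form1_eq wmult_word ext_words_def)

lemma linear_derivation:
  assumes N: "Module.module (alg C) N" and N': "Module.module (alg C) N'" and X: "cinf_derivation C N X" and f: "linear_map (alg C) N N' f"
  shows "cinf_derivation C N' (\<lambda>a. f (X a))"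
  unfolding cinf_derivation_def
proof (intro conjI allI impI)
  interpret N: Module.module "alg C" N by fact
  interpret N': Module.module "alg C" N' by fact
  have Xc: "X a \<in> carrier N" if "a \<in> carrier C" for a using X that by (auto simp: cinf_derivation_def)
  then show "(\<lambda>a. f (X a)) \<in> carrier C \<rightarrow> carrier N'" using linear_map_simps(1)[OF f] by auto
  fix as h assume as: "as \<noteq> []" "set as \<subseteq> carrier C" "h \<in> Cinf (length as)"
  have c: "cop C (pd (Rn (length as)) i h) as \<in> carrier (alg C)" "X (as ! i) \<in> carrier N" if "i < length as" for i
    using cop_closed[OF C as(2) Cinf_pd[OF as(3) that]] Xc[OF subsetD[OF as(2) nth_mem[OF that]]] by (auto simp: cC)
  have "f (X (cop C h as)) = f (\<Oplus>\<^bsub>N\<^esub>i\<in>{..<length as}. cop C (pd (Rn (length as)) i h) as \<odot>\<^bsub>N\<^esub> X (as ! i))"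
    using X as by (simp add: cinf_derivation_def)
  also have "\<dots> = (\<Oplus>\<^bsub>N'\<^esub>i\<in>{..<length as}. f (cop C (pd (Rn (length as)) i h) as \<odot>\<^bsub>N\<^esub> X (as ! i)))"
    by (rule linear_map_finsum[OF N N' f]) (use c in auto)
  also have "\<dots> = (\<Oplus>\<^bsub>N'\<^esub>i\<in>{..<length as}. cop C (pd (Rn (length as)) i h) as \<odot>\<^bsub>N'\<^esub> f (X (as ! i)))"
    by (rule N'.M.finsum_cong') (use c linear_map_simps[OF f] in auto)
  finally show "f (X (cop C h as)) = (\<Oplus>\<^bsub>N'\<^esub>i\<in>{..<length as}. cop C (pd (Rn (length as)) i h) as \<odot>\<^bsub>N'\<^esub> f (X (as ! i)))" .
qed

lemma dl_derivation: "cinf_derivation C (Lam 1) dl"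
  by (rule linear_derivation[OF module_kaehler[OF C] Lam_module kaehler_d_derivation[OF C] form1_linear])

lemmas dl_closed = derivation_closed[OF Lam_module C dl_derivation]
lemmas dl_add = derivation_add[OF Lam_module C dl_derivation]
lemmas dl_mult = derivation_mult[OF Lam_module C dl_derivation]
lemmas dl_const = derivation_const[OF Lam_module C dl_derivation]

text \<open>Words are products of letters, and letters are combinations of the da. Scalars come in
  as products with \<open>form0\<close>, so closure under sums, products and the two kinds of
  generators is enough. Identities between maps that are not linear over C, such as differentials,
  can then be checked on a and da.\<close>

lemma forms_induct [consumes 1, case_names zero add mult form0 form1]:
  assumes "x \<in> carrier (Lam k)"
    and zero: "\<And>k. P k \<zero>\<^bsub>Lam k\<^esub>"
    and add: "\<And>k x y. x \<in> carrier (Lam k) \<Longrightarrow> y \<in> carrier (Lam k) \<Longrightarrow> P k x \<Longrightarrow> P k y \<Longrightarrow> P k (x \<oplus>\<^bsub>Lam k\<^esub> y)"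
    and mult: "\<And>k l x y. x \<in> carrier (Lam k) \<Longrightarrow> y \<in> carrier (Lam l) \<Longrightarrow> P k x \<Longrightarrow> P l y \<Longrightarrow> P (k + l) (wmult k l x y)"
    and form0: "\<And>a. a \<in> carrier C \<Longrightarrow> P 0 (form0 C a)"
    and form1: "\<And>a. a \<in> carrier C \<Longrightarrow> P 1 (dl a)"
  shows "P k x"
proof -
  have smult: "P k (a \<odot>\<^bsub>Lam k\<^esub> x)" if "a \<in> carrier C" "x \<in> carrier (Lam k)" "P k x" for a k x
    using mult[OF form0_closed[OF that(1)] that(2) form0[OF that(1)] that(3)] form0_mult[OF that(1,2)] by simp
  have m1: "\<ominus>\<^bsub>alg C\<^esub> \<one>\<^bsub>alg C\<^esub> \<in> carrier C" using N.R.a_inv_closed[OF N.R.one_closed] by (simp add: cC)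
  \<comment> \<open>Negation is multiplication by the scalar -1 and is therefore covered by closure
    under scalars.\<close>
  have neg: "\<ominus>\<^bsub>Lam k\<^esub> x = (\<ominus>\<^bsub>alg C\<^esub> \<one>\<^bsub>alg C\<^esub>) \<odot>\<^bsub>Lam k\<^esub> x" if "x \<in> carrier (Lam k)" for k x
    using that LM.smult_l_minus[of "\<one>\<^bsub>alg C\<^esub>" x k] by simp
  have negK: "\<ominus>\<^bsub>kaehler C\<^esub> x = (\<ominus>\<^bsub>alg C\<^esub> \<one>\<^bsub>alg C\<^esub>) \<odot>\<^bsub>kaehler C\<^esub> x" if "x \<in> carrier (kaehler C)" for x
    using that N.smult_l_minus[of "\<one>\<^bsub>alg C\<^esub>" x] by simp
  have "submodule {m \<in> carrier (kaehler C). P 1 (form1 C m)} (alg C) (kaehler C)"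
  proof (rule N.submoduleI, goal_cases)
    case 2
    then show ?case using linear_map_zero[OF base_module Lam_module form1_linear] zero by simp
  next
    case (3 m)
    then show ?case
      using smult[OF m1 form1_closed[of m]] m1 by (auto simp: negK linear_map_simps[OF form1_linear] cC)
  next
    case (4 a b)
    then show ?case using add[OF form1_closed[of a] form1_closed[of b]] by (auto simp: linear_map_simps[OF form1_linear])
  next
    case (5 a x)
    then show ?case using smult[OF _ form1_closed[of x]] by (auto simp: linear_map_simps[OF form1_linear] cC)
  qed auto
  then have P1: "P 1 (form1 C m)" if "m \<in> carrier (kaehler C)" for m
    using kaehler_induct[OF C, of "{m \<in> carrier (kaehler C). P 1 (form1 C m)}"] form1
      derivation_closed[OF base_module C kaehler_d_derivation[OF C]] that by blast
  have W: "P (int (length w)) (ew (int (length w)) w)" if "set w \<subseteq> carrier (kaehler C)" for w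
    using that
  proof (induction w)
    case Nil
    have "form0 C \<one>\<^bsub>alg C\<^esub> = one0" using N.R.one_closed by (simp add: form0_eq cC)
    then show ?case using form0[of "\<one>\<^bsub>alg C\<^esub>"] N.R.one_closed by (simp add: cC)
  next
    case (Cons m w)
    then have w: "[m] \<in> ext_words (kaehler C) 1" "w \<in> ext_words (kaehler C) (int (length w))" by (auto simp: ext_words_def)
    show ?case
      using mult[OF form1_closed ext_word_closed[OF w(2)] P1 Cons.IH, of m] Cons.prems wmult_word[OF w]
      by (simp add: form1_eq)
  qed
  have "submodule {x \<in> carrier (Lam k). P k x} (alg C) (Lam k)"
  proof (rule LM.submoduleI, goal_cases)
    case (3 x)
    then show ?case using smult[OF m1, of x] m1 by (auto simp: neg)
  next
    case (5 a x)
    then show ?case using smult[of a x] by (auto simp: cC)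
  qed (use zero add in auto)
  from Lam_induct[OF this] W assms(1) ext_word_closed show ?thesis
    by (auto simp: ext_words_def)
qed

text \<open>The dual numbers over \<open>Lam\<close>, with an odd \<open>\<epsilon>\<close> of degree -1 and \<open>a \<in> C\<close> acting as \<open>a + \<epsilon> da\<close>:
  an algebra map \<open>x \<mapsto> x + \<epsilon> d x\<close> into them is the same as a graded derivation \<open>d\<close>.\<close>

definition dual :: "('c, 'c kform \<times> 'c kform) graded"
  where "dual = \<lparr>gmod = (\<lambda>k. \<lparr>carrier = carrier (Lam k) \<times> carrier (Lam (k + 1)), mult = undefined, one = undefined,
      zero = (\<zero>\<^bsub>Lam k\<^esub>, \<zero>\<^bsub>Lam (k + 1)\<^esub>),
      add = (\<lambda>p q. (fst p \<oplus>\<^bsub>Lam k\<^esub> fst q, snd p \<oplus>\<^bsub>Lam (k + 1)\<^esub> snd q)),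
      smult = (\<lambda>a p. (a \<odot>\<^bsub>Lam k\<^esub> fst p, a \<odot>\<^bsub>Lam (k + 1)\<^esub> snd p \<oplus>\<^bsub>Lam (k + 1)\<^esub> wmult 1 k (dl a) (fst p)))\<rparr>),
    gmult = (\<lambda>k l p q. (wmult k l (fst p) (fst q),
      wmult (k + 1) l (snd p) (fst q) \<oplus>\<^bsub>Lam (k + l + 1)\<^esub> gs k (k + l + 1) (wmult k (l + 1) (fst p) (snd q))))\<rparr>"

lemma dual_simps:
  "p \<in> carrier (gmod dual k) \<longleftrightarrow> fst p \<in> carrier (Lam k) \<and> snd p \<in> carrier (Lam (k + 1))"
  "\<zero>\<^bsub>gmod dual k\<^esub> = (\<zero>\<^bsub>Lam k\<^esub>, \<zero>\<^bsub>Lam (k + 1)\<^esub>)"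
  "p \<oplus>\<^bsub>gmod dual k\<^esub> q = (fst p \<oplus>\<^bsub>Lam k\<^esub> fst q, snd p \<oplus>\<^bsub>Lam (k + 1)\<^esub> snd q)"
  "a \<odot>\<^bsub>gmod dual k\<^esub> p = (a \<odot>\<^bsub>Lam k\<^esub> fst p, a \<odot>\<^bsub>Lam (k + 1)\<^esub> snd p \<oplus>\<^bsub>Lam (k + 1)\<^esub> wmult 1 k (dl a) (fst p))"
  "gmult dual k l p q = (wmult k l (fst p) (fst q),
      wmult (k + 1) l (snd p) (fst q) \<oplus>\<^bsub>Lam (k + l + 1)\<^esub> gs k (k + l + 1) (wmult k (l + 1) (fst p) (snd q)))"
  by (cases p; auto simp: dual_def)+

text \<open>Here and in the next rules the degree of a result is a variable fixed by an equation,
  because degrees such as k + 1 + l and k + l + 1 are equal without being the same term.\<close>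

lemma wclosed: "x \<in> carrier (Lam k) \<Longrightarrow> y \<in> carrier (Lam l) \<Longrightarrow> k + l = m \<Longrightarrow> wmult k l x y \<in> carrier (Lam m)"
  using wmult_closed by auto

lemma wadd_l: "x \<in> carrier (Lam k) \<Longrightarrow> x' \<in> carrier (Lam k) \<Longrightarrow> y \<in> carrier (Lam l) \<Longrightarrow> k + l = m \<Longrightarrow>
    wmult k l (x \<oplus>\<^bsub>Lam k\<^esub> x') y = wmult k l x y \<oplus>\<^bsub>Lam m\<^esub> wmult k l x' y"
  using gmult_add_l by auto

lemma wadd_r: "x \<in> carrier (Lam k) \<Longrightarrow> y \<in> carrier (Lam l) \<Longrightarrow> y' \<in> carrier (Lam l) \<Longrightarrow> k + l = m \<Longrightarrow>
    wmult k l x (y \<oplus>\<^bsub>Lam l\<^esub> y') = wmult k l x y \<oplus>\<^bsub>Lam m\<^esub> wmult k l x y'"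
  using gmult_add_r by auto

lemma wsmult_l: "a \<in> carrier (alg C) \<Longrightarrow> x \<in> carrier (Lam k) \<Longrightarrow> y \<in> carrier (Lam l) \<Longrightarrow> k + l = m \<Longrightarrow>
    wmult k l (a \<odot>\<^bsub>Lam k\<^esub> x) y = a \<odot>\<^bsub>Lam m\<^esub> wmult k l x y"
  using gmult_smult_l by auto

lemma wsmult_r: "a \<in> carrier (alg C) \<Longrightarrow> x \<in> carrier (Lam k) \<Longrightarrow> y \<in> carrier (Lam l) \<Longrightarrow> k + l = m \<Longrightarrow>
    wmult k l x (a \<odot>\<^bsub>Lam l\<^esub> y) = a \<odot>\<^bsub>Lam m\<^esub> wmult k l x y"
  using gmult_smult_r by auto

lemma wassoc: "x \<in> carrier (Lam k) \<Longrightarrow> y \<in> carrier (Lam l) \<Longrightarrow> z \<in> carrier (Lam m) \<Longrightarrow> k + l = p \<Longrightarrow> l + m = q \<Longrightarrow>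
    wmult p m (wmult k l x y) z = wmult k q x (wmult l m y z)"
  using wmult_assoc by auto

lemma wgs_l: "x \<in> carrier (Lam k) \<Longrightarrow> y \<in> carrier (Lam l) \<Longrightarrow> k + l = m \<Longrightarrow>
    wmult k l (gs j k x) y = gs j m (wmult k l x y)"
  using gmult_gsign_l by auto

lemma wgs_r: "x \<in> carrier (Lam k) \<Longrightarrow> y \<in> carrier (Lam l) \<Longrightarrow> k + l = m \<Longrightarrow>
    wmult k l x (gs j l y) = gs j m (wmult k l x y)"
  using gmult_gsign_r by auto

lemma wcomm: "x \<in> carrier (Lam k) \<Longrightarrow> y \<in> carrier (Lam l) \<Longrightarrow> k + l = m \<Longrightarrow> wmult k l x y = gs (k * l) m (wmult l k y x)"
  using wmult_comm[of x k y l] by simp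

lemmas gs_closed = gsign_closed[OF Lam_module]
lemmas gs_gs = gsign_gsign[OF Lam_module]
lemmas gs_add = linear_map_simps(2)[OF linear_map_gsign[OF Lam_module]]
lemmas gs_smult = linear_map_simps(3)[OF linear_map_gsign[OF Lam_module]]

lemma wzero_l: "y \<in> carrier (Lam l) \<Longrightarrow> k + l = m \<Longrightarrow> wmult k l \<zero>\<^bsub>Lam k\<^esub> y = \<zero>\<^bsub>Lam m\<^esub>"
  using gmult_zero_l by auto

lemma wzero_r: "x \<in> carrier (Lam k) \<Longrightarrow> k + l = m \<Longrightarrow> wmult k l x \<zero>\<^bsub>Lam l\<^esub> = \<zero>\<^bsub>Lam m\<^esub>"
  using gmult_zero_r by auto

lemma gs_zero: "gs k m \<zero>\<^bsub>Lam m\<^esub> = \<zero>\<^bsub>Lam m\<^esub>"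
  using linear_map_zero[OF Lam_module Lam_module linear_map_gsign[OF Lam_module]] .

lemma gs_even: "even k \<Longrightarrow> gs k m x = x"
  by (simp add: gsign_def)

text \<open>The twisted scalars form an action because d is a derivation: \<open>Da\<close> and
  \<open>Dm\<close> are its additivity and its Leibniz rule, and 1 acts as the identity since d
  kills constants.\<close>

lemma dual_module: "Module.module (alg C) (gmod dual k)"
proof -
  have D: "wmult 1 k (dl a) x \<in> carrier (Lam (k + 1))" if "a \<in> carrier (alg C)" "x \<in> carrier (Lam k)" for a x
    by (rule wclosed[OF dl_closed that(2)]) (use that cC in auto)
  have Da: "wmult 1 k (dl (a \<oplus>\<^bsub>alg C\<^esub> b)) x = wmult 1 k (dl a) x \<oplus>\<^bsub>Lam (k + 1)\<^esub> wmult 1 k (dl b) x"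
    if "a \<in> carrier (alg C)" "b \<in> carrier (alg C)" "x \<in> carrier (Lam k)" for a b x
    using that by (simp add: dl_add cC dl_closed wadd_l[where m = "k + 1"])
  have Dm: "wmult 1 k (dl (a \<otimes>\<^bsub>alg C\<^esub> b)) x = a \<odot>\<^bsub>Lam (k + 1)\<^esub> wmult 1 k (dl b) x \<oplus>\<^bsub>Lam (k + 1)\<^esub> b \<odot>\<^bsub>Lam (k + 1)\<^esub> wmult 1 k (dl a) x"
    if "a \<in> carrier (alg C)" "b \<in> carrier (alg C)" "x \<in> carrier (Lam k)" for a b x
    using that by (simp add: dl_mult dl_closed wadd_l[where m = "k + 1"] wsmult_l[where m = "k + 1"] cC[symmetric] del: cC)
  have D1: "wmult 1 k (dl \<one>\<^bsub>alg C\<^esub>) x = \<zero>\<^bsub>Lam (k + 1)\<^esub>" if "x \<in> carrier (Lam k)" for x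
    using dl_const[of 1] that by (simp add: cconst_def alg_simps(4) wzero_l[where m = "k + 1"])
  have Dx: "wmult 1 k (dl a) (x \<oplus>\<^bsub>Lam k\<^esub> y) = wmult 1 k (dl a) x \<oplus>\<^bsub>Lam (k + 1)\<^esub> wmult 1 k (dl a) y"
    if "a \<in> carrier (alg C)" "x \<in> carrier (Lam k)" "y \<in> carrier (Lam k)" for a x y
    using that dl_closed by (intro wadd_r) (auto simp: cC)
  have Ds: "wmult 1 k (dl a) (b \<odot>\<^bsub>Lam k\<^esub> x) = b \<odot>\<^bsub>Lam (k + 1)\<^esub> wmult 1 k (dl a) x"
    if "a \<in> carrier (alg C)" "b \<in> carrier (alg C)" "x \<in> carrier (Lam k)" for a b x
    using that dl_closed by (intro wsmult_r) (auto simp: cC)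
  show ?thesis
  proof (intro moduleI abelian_groupI N.R.cring_axioms, goal_cases)
    case (6 x)
    then show ?case
      by (intro bexI[of _ "(\<ominus>\<^bsub>Lam k\<^esub> fst x, \<ominus>\<^bsub>Lam (k + 1)\<^esub> snd x)"]) (auto simp: dual_simps LM.M.l_neg)
  qed (auto simp: dual_simps D Da Dm D1 Dx Ds LM.M.a_ac LM.smult_l_distr LM.smult_r_distr LM.smult_assoc1)
qed

text \<open>Moving \<open>dl a\<close> to the front past x costs the sign (-1)^k, the very sign in
  the second component of the product of \<open>dual\<close>; the two cancel.\<close>

lemma dual_smult_r:
  assumes a: "a \<in> carrier (alg C)" and x: "x \<in> carrier (Lam k)" and y: "y \<in> carrier (Lam l)"
  shows "gs k (k + l + 1) (wmult k (l + 1) x (wmult 1 l (dl a) y)) = wmult 1 (k + l) (dl a) (wmult k l x y)"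
proof -
  have d: "dl a \<in> carrier (Lam 1)" using a dl_closed cC by simp
  have "wmult k (l + 1) x (wmult 1 l (dl a) y) = wmult (k + 1) l (wmult k 1 x (dl a)) y"
    by (rule wassoc[symmetric]) (use d x y in auto)
  also have "wmult k 1 x (dl a) = gs (k * 1) (k + 1) (wmult 1 k (dl a) x)"
    by (rule wcomm) (use d x in auto)
  also have "wmult (k + 1) l \<dots> y = gs (k * 1) (k + l + 1) (wmult (k + 1) l (wmult 1 k (dl a) x) y)"
    by (rule wgs_l) (use wclosed[OF d x, of "k + 1"] y in auto)
  also have "wmult (k + 1) l (wmult 1 k (dl a) x) y = wmult 1 (k + l) (dl a) (wmult k l x y)"
    by (rule wassoc) (use d x y in auto)
  finally show ?thesis
    using wclosed[OF d wmult_closed[OF x y], of "k + l + 1"] by (simp add: gs_gs gs_even)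
qed

lemma dual_graded_algebra: "graded_algebra (alg C) dual"
proof (intro graded_algebra.intro dual_module, goal_cases)
  case (1 k l x y)
  then show ?case by (auto simp: dual_simps intro!: wclosed gs_closed LM.M.a_closed)
next
  case (2 k l x x' y)
  note c = 2[unfolded dual_simps]
  have "wmult (k + 1) l (snd x) (fst y) \<in> carrier (Lam (k + l + 1))" "wmult (k + 1) l (snd x') (fst y) \<in> carrier (Lam (k + l + 1))"
     "wmult k (l + 1) (fst x) (snd y) \<in> carrier (Lam (k + l + 1))" "wmult k (l + 1) (fst x') (snd y) \<in> carrier (Lam (k + l + 1))"
     "wmult k l (fst x) (fst y) \<in> carrier (Lam (k + l))" "wmult k l (fst x') (fst y) \<in> carrier (Lam (k + l))"
    using c by (auto intro!: wclosed)
  then show ?case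
    using c by (simp add: dual_simps wadd_l[where m = "k + l + 1"] wadd_l[where m = "k + l"] gs_add gs_closed LM.M.a_ac)
next
  case (3 k l x y y')
  note c = 3[unfolded dual_simps]
  have "wmult (k + 1) l (snd x) (fst y) \<in> carrier (Lam (k + l + 1))" "wmult (k + 1) l (snd x) (fst y') \<in> carrier (Lam (k + l + 1))"
     "wmult k (l + 1) (fst x) (snd y) \<in> carrier (Lam (k + l + 1))" "wmult k (l + 1) (fst x) (snd y') \<in> carrier (Lam (k + l + 1))"
     "wmult k l (fst x) (fst y) \<in> carrier (Lam (k + l))" "wmult k l (fst x) (fst y') \<in> carrier (Lam (k + l))"
    using c by (auto intro!: wclosed)
  then show ?case
    using c by (simp add: dual_simps wadd_r[where m = "k + l + 1"] wadd_r[where m = "k + l"] gs_add gs_closed LM.M.a_ac)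
next
  case (4 k l a x y)
  note c = 4[unfolded dual_simps]
  have d: "dl a \<in> carrier (Lam 1)" using c dl_closed cC by simp
  have w: "wmult (k + 1) l (snd x) (fst y) \<in> carrier (Lam (k + l + 1))"
     "wmult k (l + 1) (fst x) (snd y) \<in> carrier (Lam (k + l + 1))"
     "wmult 1 k (dl a) (fst x) \<in> carrier (Lam (k + 1))"
     "wmult 1 (k + l) (dl a) (wmult k l (fst x) (fst y)) \<in> carrier (Lam (k + l + 1))"
    using c d by (auto intro!: wclosed)
  have "wmult (k + 1) l (wmult 1 k (dl a) (fst x)) (fst y) = wmult 1 (k + l) (dl a) (wmult k l (fst x) (fst y))"
    by (rule wassoc) (use c d in auto)
  then show ?case
    using c w by (simp add: dual_simps wadd_l[where m = "k + l + 1"] wsmult_l[where m = "k + l + 1"] wsmult_l[where m = "k + l"]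
        gs_smult gs_closed LM.smult_r_distr LM.M.a_ac)
next
  case (5 k l a x y)
  note c = 5[unfolded dual_simps]
  have d: "dl a \<in> carrier (Lam 1)" using c dl_closed cC by simp
  have w: "wmult (k + 1) l (snd x) (fst y) \<in> carrier (Lam (k + l + 1))"
     "wmult k (l + 1) (fst x) (snd y) \<in> carrier (Lam (k + l + 1))"
     "wmult 1 l (dl a) (fst y) \<in> carrier (Lam (l + 1))"
     "wmult k (l + 1) (fst x) (wmult 1 l (dl a) (fst y)) \<in> carrier (Lam (k + l + 1))"
     "wmult 1 (k + l) (dl a) (wmult k l (fst x) (fst y)) \<in> carrier (Lam (k + l + 1))"
    using c d by (auto intro!: wclosed)
  show ?case
    using c w dual_smult_r[of a "fst x" k "fst y" l]
    by (simp add: dual_simps wadd_r[where m = "k + l + 1"] wsmult_r[where m = "k + l + 1"] wsmult_r[where m = "k + l"]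
        gs_add gs_smult gs_closed LM.smult_r_distr LM.M.a_ac)
next
  case (6 k l m x y z)
  obtain x1 x2 y1 y2 z1 z2 where xyz: "x = (x1, x2)" "y = (y1, y2)" "z = (z1, z2)" by (metis surj_pair)
  note c = 6[unfolded dual_simps xyz fst_conv snd_conv]
  let ?n = "k + l + m + 1"
  have w: "wmult (k + 1) l x2 y1 \<in> carrier (Lam (k + l + 1))" "wmult k (l + 1) x1 y2 \<in> carrier (Lam (k + l + 1))"
    "wmult (l + 1) m y2 z1 \<in> carrier (Lam (l + m + 1))" "wmult l (m + 1) y1 z2 \<in> carrier (Lam (l + m + 1))"
    "wmult k l x1 y1 \<in> carrier (Lam (k + l))" "wmult l m y1 z1 \<in> carrier (Lam (l + m))"
    using c by (auto intro!: wclosed)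
  have w2: "wmult (k + 1) (l + m) x2 (wmult l m y1 z1) \<in> carrier (Lam ?n)"
    "wmult k (l + m + 1) x1 (wmult (l + 1) m y2 z1) \<in> carrier (Lam ?n)"
    "wmult k (l + m + 1) x1 (wmult l (m + 1) y1 z2) \<in> carrier (Lam ?n)"
    "wmult (k + l + 1) m (wmult k (l + 1) x1 y2) z1 \<in> carrier (Lam ?n)"
    using c w by (auto intro!: wclosed)
  have a1: "wmult (k + l + 1) m (wmult (k + 1) l x2 y1) z1 = wmult (k + 1) (l + m) x2 (wmult l m y1 z1)"
    by (rule wassoc) (use c in auto)
  have a2: "wmult (k + l + 1) m (wmult k (l + 1) x1 y2) z1 = wmult k (l + m + 1) x1 (wmult (l + 1) m y2 z1)"
    by (rule wassoc) (use c in auto)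
  have a3: "wmult (k + l) (m + 1) (wmult k l x1 y1) z2 = wmult k (l + m + 1) x1 (wmult l (m + 1) y1 z2)"
    by (rule wassoc) (use c in auto)
  have "wmult (k + l + 1) m (wmult (k + 1) l x2 y1 \<oplus>\<^bsub>Lam (k + l + 1)\<^esub> gs k (k + l + 1) (wmult k (l + 1) x1 y2)) z1
      = wmult (k + 1) (l + m) x2 (wmult l m y1 z1) \<oplus>\<^bsub>Lam ?n\<^esub> gs k ?n (wmult k (l + m + 1) x1 (wmult (l + 1) m y2 z1))"
    using c w by (simp add: wadd_l[where m = ?n] wgs_l[where m = ?n] gs_closed a1 a2)
  moreover have "wmult k (l + m + 1) x1 (wmult (l + 1) m y2 z1 \<oplus>\<^bsub>Lam (l + m + 1)\<^esub> gs l (l + m + 1) (wmult l (m + 1) y1 z2))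
      = wmult k (l + m + 1) x1 (wmult (l + 1) m y2 z1) \<oplus>\<^bsub>Lam ?n\<^esub> gs l ?n (wmult k (l + m + 1) x1 (wmult l (m + 1) y1 z2))"
    using c w by (simp add: wadd_r[where m = ?n] wgs_r[where m = ?n] gs_closed)
  moreover have "wmult (k + l) m (wmult k l x1 y1) z1 = wmult k (l + m) x1 (wmult l m y1 z1)"
    by (rule wassoc) (use c in auto)
  ultimately show ?case
    using c w w2 by (simp add: dual_simps xyz a3 gs_add gs_gs gs_closed LM.M.a_ac add.assoc[symmetric])
qed

text \<open>In the second component the twist contributes the sum of d(\<partial>_i h) \<and> da_i.
  Expanding d(\<partial>_i h) gives a double sum of second derivatives times da_j \<and> da_i, where
  symmetric coefficients meet an antisymmetric product. This is what permits the value 0 for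
  d(da).\<close>

lemma dual_derivation: "cinf_derivation C (gmod dual 1) (\<lambda>a. (dl a, \<zero>\<^bsub>Lam 2\<^esub>))"
  unfolding cinf_derivation_def
proof (intro conjI allI impI)
  show "(\<lambda>a. (dl a, \<zero>\<^bsub>Lam 2\<^esub>)) \<in> carrier C \<rightarrow> carrier (gmod dual 1)"
    using dl_closed by (auto simp: dual_simps)
  interpret D: Module.module "alg C" "gmod dual 1" by (rule dual_module)
  fix as h assume as: "as \<noteq> []" "set as \<subseteq> carrier C" "h \<in> Cinf (length as)"
  let ?n = "length as"
  let ?c = "\<lambda>i. cop C (pd (Rn ?n) i h) as"
  let ?cc = "\<lambda>i j. cop C (pd (Rn ?n) j (pd (Rn ?n) i h)) as"
  have c: "?c i \<in> carrier (alg C)" "?c i \<in> carrier C" if "i < ?n" for i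
    using cop_closed[OF C as(2) Cinf_pd[OF as(3) that]] by (auto simp: cC)
  have cc: "?cc i j \<in> carrier (alg C)" if "i < ?n" "j < ?n" for i j
    using cop_closed[OF C as(2) Cinf_pd[OF Cinf_pd[OF as(3) that(1)] that(2)]] by (auto simp: cC)
  have d: "dl (as ! i) \<in> carrier (Lam 1)" if "i < ?n" for i
    by (rule dl_closed[OF subsetD[OF as(2) nth_mem[OF that]]])
  have dd: "wmult 1 1 (dl (as ! i)) (dl (as ! j)) \<in> carrier (Lam 2)" if "i < ?n" "j < ?n" for i j
    using wclosed[OF d[OF that(1)] d[OF that(2)]] by simp
  have D: "wmult 1 1 (dl (?c i)) (dl (as ! i)) \<in> carrier (Lam 2)" if "i < ?n" for i
    using wclosed[OF dl_closed[OF c(2)[OF that]] d[OF that]] by simp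
  have "wmult 1 1 (dl (?c i)) (dl (as ! i)) = (\<Oplus>\<^bsub>Lam 2\<^esub>j\<in>{..<?n}. ?cc i j \<odot>\<^bsub>Lam 2\<^esub> wmult 1 1 (dl (as ! j)) (dl (as ! i)))"
    if i: "i < ?n" for i
  proof -
    have "dl (?c i) = (\<Oplus>\<^bsub>Lam 1\<^esub>j\<in>{..<?n}. ?cc i j \<odot>\<^bsub>Lam 1\<^esub> dl (as ! j))"
      using dl_derivation as Cinf_pd[OF as(3) i] unfolding cinf_derivation_def by blast
    moreover have "wmult 1 1 (\<Oplus>\<^bsub>Lam 1\<^esub>j\<in>{..<?n}. ?cc i j \<odot>\<^bsub>Lam 1\<^esub> dl (as ! j)) (dl (as ! i)) =
       (\<Oplus>\<^bsub>Lam (1 + 1)\<^esub>j\<in>{..<?n}. wmult 1 1 (?cc i j \<odot>\<^bsub>Lam 1\<^esub> dl (as ! j)) (dl (as ! i)))"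
      by (rule linear_map_finsum[OF Lam_module Lam_module wmult_linear_l[OF d[OF i]]]) (use d cc i in auto)
    moreover have "\<dots> = (\<Oplus>\<^bsub>Lam 2\<^esub>j\<in>{..<?n}. ?cc i j \<odot>\<^bsub>Lam 2\<^esub> wmult 1 1 (dl (as ! j)) (dl (as ! i)))"
      unfolding one_add_one by (rule LM.M.finsum_cong') (use d cc dd i in \<open>auto simp: wsmult_l[where m = 2]\<close>)
    ultimately show ?thesis by simp
  qed
  then have "(\<Oplus>\<^bsub>Lam 2\<^esub>i\<in>{..<?n}. wmult 1 1 (dl (?c i)) (dl (as ! i))) =
     (\<Oplus>\<^bsub>Lam 2\<^esub>i\<in>{..<?n}. \<Oplus>\<^bsub>Lam 2\<^esub>j\<in>{..<?n}. ?cc i j \<odot>\<^bsub>Lam 2\<^esub> wmult 1 1 (dl (as ! j)) (dl (as ! i)))"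
    by (intro LM.M.finsum_cong') (use cc dd in \<open>auto intro!: LM.M.finsum_closed\<close>)
  also have "\<dots> = \<zero>\<^bsub>Lam 2\<^esub>"
  proof (rule LM.M.antisymmetric_sum)
    fix i j assume ij: "i < ?n" "j < ?n"
    show "?cc i j \<odot>\<^bsub>Lam 2\<^esub> wmult 1 1 (dl (as ! j)) (dl (as ! i)) \<in> carrier (Lam 2)"
      using cc dd ij by auto
    \<comment> \<open>The operations coincide because the second derivatives coincide as functions
      on R^n.\<close>
    have e: "?cc i j = ?cc j i"
    proof (rule cop_cong[OF C as(2)])
      have h2: "Ck_on 2 ?n (Rn ?n) h" using as(3) by (simp add: Cinf_def)
      show "pd (Rn ?n) j (pd (Rn ?n) i h) x = pd (Rn ?n) i (pd (Rn ?n) j h) x" if "x \<in> Rn ?n" for x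
        by (rule pd_commute_open[OF _ h2 ij(2,1) that]) simp
    qed (use Cinf_pd[OF Cinf_pd[OF as(3)]] ij in auto)
    have "wmult 1 1 (dl (as ! j)) (dl (as ! i)) = gs (1 * 1) 2 (wmult 1 1 (dl (as ! i)) (dl (as ! j)))"
      by (rule wcomm) (use d ij in auto)
    then show "?cc i j \<odot>\<^bsub>Lam 2\<^esub> wmult 1 1 (dl (as ! j)) (dl (as ! i)) \<oplus>\<^bsub>Lam 2\<^esub> ?cc j i \<odot>\<^bsub>Lam 2\<^esub> wmult 1 1 (dl (as ! i)) (dl (as ! j)) = \<zero>\<^bsub>Lam 2\<^esub>"
      using cc dd ij unfolding e by (simp add: gsign_def LM.smult_r_minus LM.M.l_neg)
  next
    fix i assume i: "i < ?n"
    have "kaehler_d C (as ! i) \<in> carrier (kaehler C)"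
      by (rule derivation_closed[OF module_kaehler[OF C] C kaehler_d_derivation[OF C] subsetD[OF as(2) nth_mem[OF i]]])
    then show "?cc i i \<odot>\<^bsub>Lam 2\<^esub> wmult 1 1 (dl (as ! i)) (dl (as ! i)) = \<zero>\<^bsub>Lam 2\<^esub>"
      using form1_sq cc i by simp
  qed
  finally have s0: "(\<Oplus>\<^bsub>Lam 2\<^esub>i\<in>{..<?n}. wmult 1 1 (dl (?c i)) (dl (as ! i))) = \<zero>\<^bsub>Lam 2\<^esub>" .
  have "(\<Oplus>\<^bsub>gmod dual 1\<^esub>i\<in>{..<?n}. ?c i \<odot>\<^bsub>gmod dual 1\<^esub> (dl (as ! i), \<zero>\<^bsub>Lam 2\<^esub>)) =
      (\<Oplus>\<^bsub>gmod dual 1\<^esub>i\<in>{..<?n}. (?c i \<odot>\<^bsub>Lam 1\<^esub> dl (as ! i), wmult 1 1 (dl (?c i)) (dl (as ! i))))"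
    by (rule D.M.finsum_cong') (use c d D in \<open>auto simp: dual_simps\<close>)
  also have "\<dots> = (\<Oplus>\<^bsub>Lam 1\<^esub>i\<in>{..<?n}. ?c i \<odot>\<^bsub>Lam 1\<^esub> dl (as ! i), \<Oplus>\<^bsub>Lam 2\<^esub>i\<in>{..<?n}. wmult 1 1 (dl (?c i)) (dl (as ! i)))"
    by (rule finsum_pair[OF LM.abelian_group_axioms LM.abelian_group_axioms D.abelian_group_axioms])
      (use c d D in \<open>auto simp: dual_simps\<close>)
  also have "(\<Oplus>\<^bsub>Lam 1\<^esub>i\<in>{..<?n}. ?c i \<odot>\<^bsub>Lam 1\<^esub> dl (as ! i)) = dl (cop C h as)"
    using dl_derivation as by (simp add: cinf_derivation_def)
  finally show "(dl (cop C h as), \<zero>\<^bsub>Lam 2\<^esub>) = (\<Oplus>\<^bsub>gmod dual 1\<^esub>i\<in>{..<?n}. ?c i \<odot>\<^bsub>gmod dual 1\<^esub> (dl (as ! i), \<zero>\<^bsub>Lam 2\<^esub>))"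
    using s0 by simp
qed

lemma linear_map_fst: "linear_map (alg C) (gmod dual k) (Lam k) fst"
  by (rule linear_mapI) (auto simp: dual_simps)

text \<open>The derivation (da, 0) induces a linear map \<phi> on one-forms and then an algebra map
  F into the dual numbers; d is the second component of F. The Leibniz rule is multiplicativity of
  F, once its first component is known to be the identity.\<close>

lemma differential_exists:
  "\<exists>d. (\<forall>k. d k \<in> extensional (carrier (Lam k))) \<and> differential C (EA) d \<and>
    (\<forall>a\<in>carrier C. d 0 (form0 C a) = dl a)"
proof -
  obtain \<phi> where \<phi>: "linear_map (alg C) (kaehler C) (gmod dual 1) \<phi>"
    "\<And>a. a \<in> carrier C \<Longrightarrow> \<phi> (kaehler_d C a) = (dl a, \<zero>\<^bsub>Lam 2\<^esub>)"
    using kaehler_universal[OF C dual_module dual_derivation] by auto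
  note \<phi>c = linear_map_simps(1)[OF \<phi>(1)]
  have "carrier (kaehler C) \<subseteq> {m \<in> carrier (kaehler C). fst (\<phi> m) = form1 C m}"
    by (rule kaehler_induct[OF C linear_map_equalizer[OF base_module Lam_module linear_map_comp[OF \<phi>(1) linear_map_fst] form1_linear]])
      (use \<phi>(2) derivation_closed[OF base_module C kaehler_d_derivation[OF C]] in auto)
  then have fst\<phi>: "fst (\<phi> m) = form1 C m" if "m \<in> carrier (kaehler C)" for m using that by auto
  have e: "(one0, \<zero>\<^bsub>Lam 1\<^esub>) \<in> carrier (gmod dual 0)" by (simp add: dual_simps)
  have unit: "gmult dual 0 k (one0, \<zero>\<^bsub>Lam 1\<^esub>) x = x" if "x \<in> carrier (gmod dual k)" for k x
    using that by (cases x) (simp add: dual_simps one0_l wzero_l[where m = "k + 1"] gs_even)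
  \<comment> \<open>The second component of the square consists of the two products of a 1-form and
    a 2-form, with opposite signs; such forms commute, so it vanishes.\<close>
  have sq: "gmult dual 1 1 (\<phi> m) (\<phi> m) = \<zero>\<^bsub>gmod dual 2\<^esub>" if m: "m \<in> carrier (kaehler C)" for m
  proof -
    have c: "fst (\<phi> m) \<in> carrier (Lam 1)" "snd (\<phi> m) \<in> carrier (Lam 2)"
      using \<phi>c[OF m] by (simp_all add: dual_simps)
    have "wmult 2 1 (snd (\<phi> m)) (fst (\<phi> m)) = gs (2 * 1) 3 (wmult 1 2 (fst (\<phi> m)) (snd (\<phi> m)))"
      by (rule wcomm) (use c in auto)
    then show ?thesis
      using c wclosed[OF c, of 3] form1_sq[OF m] fst\<phi>[OF m] by (simp add: dual_simps gsign_def LM.M.r_neg)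
  qed
  obtain F where F: "\<And>k. linear_map (alg C) (Lam k) (gmod dual k) (F k)"
    "\<And>k l x y. x \<in> carrier (Lam k) \<Longrightarrow> y \<in> carrier (Lam l) \<Longrightarrow> F (k + l) (wmult k l x y) = gmult dual k l (F k x) (F l y)"
    "F 0 one0 = (one0, \<zero>\<^bsub>Lam 1\<^esub>)"
    "\<And>m. m \<in> carrier (kaehler C) \<Longrightarrow> F 1 (ew 1 [m]) = gmult dual 1 0 (\<phi> m) (one0, \<zero>\<^bsub>Lam 1\<^esub>)"
    using ext_universal[OF dual_graded_algebra e unit \<phi>(1) sq] by blast
  have F1: "F 1 (form1 C m) = \<phi> m" if m: "m \<in> carrier (kaehler C)" for m
  proof (cases "\<phi> m")
    case (Pair a b)
    then have "a \<in> carrier (Lam 1)" "b \<in> carrier (Lam 2)" using \<phi>c[OF m] by (simp_all add: dual_simps)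
    then show ?thesis using F(4)[OF m] Pair
      by (simp add: form1_eq dual_simps one0_r wzero_r[where m = 2] gs_zero)
  qed
  note Fc = linear_map_simps(1)[OF F(1)]
  \<comment> \<open>F followed by the first projection is additive and multiplicative and fixes a
    and da.\<close>
  have fstF: "fst (F k x) = x" if "x \<in> carrier (Lam k)" for k x
    using that
  proof (induction rule: forms_induct)
    case (zero k)
    then show ?case using linear_map_zero[OF Lam_module dual_module F(1)] by (simp add: dual_simps)
  next
    case (form0 a)
    then show ?case by (simp add: form0_eq cC linear_map_simps[OF F(1)] F(3) dual_simps)
  next
    case (form1 a)
    then have "kaehler_d C a \<in> carrier (kaehler C)" using derivation_closed[OF base_module C kaehler_d_derivation[OF C]] by blast
    then show ?case using F1 fst\<phi> by simp
  qed (simp_all add: linear_map_simps[OF F(1)] F(2) dual_simps)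
  define d where "d k = restrict (\<lambda>x. snd (F k x)) (carrier (Lam k))" for k
  have d: "d k x = snd (F k x)" if "x \<in> carrier (Lam k)" for k x using that by (simp add: d_def)
  have dc: "d k x \<in> carrier (Lam (k + 1))" if "x \<in> carrier (Lam k)" for k x
    using Fc[OF that] d[OF that] by (simp add: dual_simps)
  have dadd: "d k (x \<oplus>\<^bsub>Lam k\<^esub> y) = d k x \<oplus>\<^bsub>Lam (k + 1)\<^esub> d k y"
    if "x \<in> carrier (Lam k)" "y \<in> carrier (Lam k)" for k x y
    using that by (simp add: d linear_map_simps[OF F(1)] dual_simps)
  have leib: "d (k + l) (wmult k l x y) = wmult (k + 1) l (d k x) y \<oplus>\<^bsub>Lam (k + l + 1)\<^esub> gs k (k + l + 1) (wmult k (l + 1) x (d l y))"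
    if "x \<in> carrier (Lam k)" "y \<in> carrier (Lam l)" for k l x y
    using that wmult_closed[OF that] by (simp add: d F(2) fstF dual_simps)
  have d0: "d 0 (form0 C a) = dl a" if "a \<in> carrier C" for a
    using that by (simp add: form0_eq cC d linear_map_simps[OF F(1)] F(3) dual_simps one0_r dl_closed)
  have d1: "d 1 (dl a) = \<zero>\<^bsub>Lam 2\<^esub>" if "a \<in> carrier C" for a
  proof -
    have "kaehler_d C a \<in> carrier (kaehler C)" using that derivation_closed[OF base_module C kaehler_d_derivation[OF C]] by blast
    then show ?thesis using that by (simp add: d dl_closed F1 \<phi>(2))
  qed
  have dz: "d k \<zero>\<^bsub>Lam k\<^esub> = \<zero>\<^bsub>Lam (k + 1)\<^esub>" for k
    using linear_map_zero[OF Lam_module dual_module F(1)] by (simp add: d dual_simps)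
  \<comment> \<open>By the Leibniz rule the square of d on a product leaves only two copies of dx
    \<and> dy, with the signs (-1)^(k + 1) and (-1)^k.\<close>
  have sq: "d (k + 1) (d k x) = \<zero>\<^bsub>Lam (k + 2)\<^esub>" if "x \<in> carrier (Lam k)" for k x
    using that
  proof (induction rule: forms_induct)
    case (mult k l x y)
    \<comment> \<open>d is additive but not linear over C, so its behaviour on signs is derived from
      additivity.\<close>
    have dgs: "d m (gs j m z) = gs j (m + 1) (d m z)" if "z \<in> carrier (Lam m)" for m j z
    proof (cases "even j")
      case False
      have "d m z \<oplus>\<^bsub>Lam (m + 1)\<^esub> d m (\<ominus>\<^bsub>Lam m\<^esub> z) = \<zero>\<^bsub>Lam (m + 1)\<^esub>"
        using dadd[of z m "\<ominus>\<^bsub>Lam m\<^esub> z"] that dz by (simp add: LM.M.r_neg)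
      then have "d m (\<ominus>\<^bsub>Lam m\<^esub> z) = \<ominus>\<^bsub>Lam (m + 1)\<^esub> d m z"
        using that dc by (metis LM.M.a_inv_closed LM.M.minus_equality LM.M.a_comm)
      then show ?thesis using False by (simp add: gsign_def)
    qed (simp add: gsign_def)
    note dx = dc[OF mult(1)] and dy = dc[OF mult(2)]
    have w: "wmult (k + 1) l (d k x) y \<in> carrier (Lam (k + l + 1))" "wmult k (l + 1) x (d l y) \<in> carrier (Lam (k + l + 1))"
      "wmult (k + 1) (l + 1) (d k x) (d l y) \<in> carrier (Lam (k + l + 2))"
      by (auto intro!: wclosed mult dx dy)
    have 1: "d (k + l + 1) (wmult (k + 1) l (d k x) y) = gs (k + 1) (k + l + 2) (wmult (k + 1) (l + 1) (d k x) (d l y))"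
    proof -
      have "d (k + 1 + l) (wmult (k + 1) l (d k x) y) = wmult (k + 1 + 1) l (d (k + 1) (d k x)) y \<oplus>\<^bsub>Lam (k + 1 + l + 1)\<^esub> gs (k + 1) (k + 1 + l + 1) (wmult (k + 1) (l + 1) (d k x) (d l y))"
        by (rule leib[OF dx mult(2)])
      moreover have "k + 1 + l = k + l + 1" "k + 1 + 1 = k + 2" "k + l + 1 + 1 = k + l + 2" by auto
      ultimately show ?thesis using mult w by (simp add: wzero_l[where m = "k + l + 2"] gs_closed)
    qed
    have 2: "d (k + l + 1) (wmult k (l + 1) x (d l y)) = wmult (k + 1) (l + 1) (d k x) (d l y)"
    proof -
      have "d (k + (l + 1)) (wmult k (l + 1) x (d l y)) = wmult (k + 1) (l + 1) (d k x) (d l y) \<oplus>\<^bsub>Lam (k + (l + 1) + 1)\<^esub> gs k (k + (l + 1) + 1) (wmult k (l + 1 + 1) x (d (l + 1) (d l y)))"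
        by (rule leib[OF mult(1) dy])
      moreover have "k + (l + 1) = k + l + 1" "l + 1 + 1 = l + 2" "k + l + 1 + 1 = k + l + 2" by auto
      ultimately show ?thesis using mult w by (simp add: wzero_r[where m = "k + l + 2"] gs_zero)
    qed
    have i: "k + l + 1 + 1 = k + l + 2" by simp
    show ?case
      using w 1 2 unfolding leib[OF mult(1,2)]
      by (simp add: dadd gs_closed dgs i) (simp add: gsign_def LM.M.l_neg LM.M.r_neg)
  qed (simp_all add: dz dadd dc d0 d1 add.assoc)
  \<comment> \<open>For a constant r the twist is a product with dr = 0, so the scalar action on the
    dual numbers is the ordinary one.\<close>
  have "d k (cconst C r \<odot>\<^bsub>Lam k\<^esub> x) = cconst C r \<odot>\<^bsub>Lam (k + 1)\<^esub> d k x" if "x \<in> carrier (Lam k)" for k x r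
  proof -
    have r: "cconst C r \<in> carrier C" unfolding cconst_def by (rule cop_closed[OF C]) auto
    then show ?thesis
      using that Fc[OF that] by (simp add: d cC linear_map_simps[OF F(1)] dual_simps dl_const wzero_l[where m = "k + 1"])
  qed
  then have "differential C (EA) d"
    unfolding differential_def using dc dadd leib sq by auto
  moreover have "\<forall>k. d k \<in> extensional (carrier (Lam k))" by (simp add: d_def)
  ultimately show ?thesis using d0 by blast
qed

end

section \<open>Consequences of the axioms of a differential, and uniqueness of
  \<open>form_d\<close>\<close>

lemma
  assumes d: "differential C A d"
  shows diff_closed: "x \<in> carrier (gmod A k) \<Longrightarrow> d k x \<in> carrier (gmod A (k + 1))"
    and diff_add: "x \<in> carrier (gmod A k) \<Longrightarrow> y \<in> carrier (gmod A k) \<Longrightarrow>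
       d k (x \<oplus>\<^bsub>gmod A k\<^esub> y) = d k x \<oplus>\<^bsub>gmod A (k + 1)\<^esub> d k y"
    and diff_const: "x \<in> carrier (gmod A k) \<Longrightarrow> d k (cconst C r \<odot>\<^bsub>gmod A k\<^esub> x) = cconst C r \<odot>\<^bsub>gmod A (k + 1)\<^esub> d k x"
    and diff_mult: "x \<in> carrier (gmod A k) \<Longrightarrow> y \<in> carrier (gmod A l) \<Longrightarrow>
       d (k + l) (gmult A k l x y) =
         gmult A (k + 1) l (d k x) y \<oplus>\<^bsub>gmod A (k + l + 1)\<^esub>
         gsign (gmod A (k + l + 1)) k (gmult A k (l + 1) x (d l y))"
    and diff_diff: "x \<in> carrier (gmod A k) \<Longrightarrow> d (k + 1) (d k x) = \<zero>\<^bsub>gmod A (k + 2)\<^esub>"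
proof goal_cases
  note D = d[unfolded differential_def]
  { case 1 then show ?case using D[THEN conjunct1] by blast }
  { case 2 then show ?case using D[THEN conjunct2, THEN conjunct1] by blast }
  { case 3 then show ?case using D[THEN conjunct2, THEN conjunct2, THEN conjunct1] by blast }
  { case 4 then show ?case using D[THEN conjunct2, THEN conjunct2, THEN conjunct2, THEN conjunct1] by blast }
  { case 5 then show ?case using D[THEN conjunct2, THEN conjunct2, THEN conjunct2, THEN conjunct2] by blast }
qed

lemma diff_zero:
  assumes d: "differential C A d" and A: "\<And>k. Module.module (alg C) (gmod A k)"
  shows "d k \<zero>\<^bsub>gmod A k\<^esub> = \<zero>\<^bsub>gmod A (k + 1)\<^esub>"
proof -
  interpret M: Module.module "alg C" "gmod A k" by (rule A)
  interpret M': Module.module "alg C" "gmod A (k + 1)" by (rule A)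
  have c: "d k \<zero>\<^bsub>gmod A k\<^esub> \<in> carrier (gmod A (k + 1))" by (rule diff_closed[OF d]) simp
  have "d k \<zero>\<^bsub>gmod A k\<^esub> = d k \<zero>\<^bsub>gmod A k\<^esub> \<oplus>\<^bsub>gmod A (k + 1)\<^esub> d k \<zero>\<^bsub>gmod A k\<^esub>"
    using diff_add[OF d M.zero_closed M.zero_closed] by simp
  then show ?thesis using c by (metis M'.M.add.l_cancel_one)
qed

lemma cga_cong: "gmod A = gmod A' \<Longrightarrow> gmult A = gmult A' \<Longrightarrow> cga C A = cga C A'"
  by (simp only: cga_def)

lemma differential_cong: "gmod A = gmod A' \<Longrightarrow> gmult A = gmult A' \<Longrightarrow> differential C A d = differential C A' d"
  by (simp only: differential_def)

context cinf_forms
begin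

text \<open>The definite description is justified by uniqueness: the value of d on a is prescribed,
  on da it is forced to be 0 by d d = 0, and additivity and the Leibniz rule propagate this to all
  forms. Off the carriers extensionality decides.\<close>

lemma form_d_props:
  "(\<forall>k. form_d C k \<in> extensional (carrier (Lam k))) \<and> differential C (EA) (form_d C) \<and>
    (\<forall>a\<in>carrier C. form_d C 0 (form0 C a) = dl a)" (is "?P (form_d C)")
proof -
  obtain d where d: "?P d" using differential_exists by blast
  have uniq: "d' = d" if d': "?P d'" for d'
  proof -
    have A: "differential C (EA) d" "differential C (EA) d'"
      using d d' by auto
    have z: "e 1 (dl a) = \<zero>\<^bsub>Lam 2\<^esub>" if "a \<in> carrier C" "?P e" for a e
      using diff_diff[of C "EA" e "form0 C a" 0] that form0_closed by auto
    have "d' k x = d k x" if "x \<in> carrier (Lam k)" for k x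
      using that
    proof (induction rule: forms_induct)
      case (zero k)
      then show ?case using diff_zero[OF A(1) Lam_module] diff_zero[OF A(2) Lam_module] by simp
    next
      case (form0 a)
      then show ?case using d d' by simp
    next
      case (form1 a)
      then show ?case using z[OF _ d] z[OF _ d'] by simp
    next
      case (add k x y)
      then show ?case by (simp only: diff_add[OF A(1) add(1,2)] diff_add[OF A(2) add(1,2)])
    next
      case (mult k l x y)
      then show ?case by (simp only: diff_mult[OF A(1) mult(1,2)] diff_mult[OF A(2) mult(1,2)])
    qed
    then have "d' k x = d k x" for k x
      using d d' by (cases "x \<in> carrier (Lam k)") (auto simp: extensional_def)
    then show ?thesis by (intro ext)
  qed
  have "?P (THE d. ?P d)" by (rule theI[of ?P, OF d uniq])
  then show ?thesis by (simp add: form_d_def)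
qed

lemma form_d_differential: "differential C (EA) (form_d C)"
  and form_d_form0: "a \<in> carrier C \<Longrightarrow> form_d C 0 (form0 C a) = dl a"
  using form_d_props by auto

lemma form_d_dl: "a \<in> carrier C \<Longrightarrow> form_d C 1 (dl a) = \<zero>\<^bsub>Lam 2\<^esub>"
  using diff_diff[OF form_d_differential form0_closed, of a] by (simp add: form_d_form0)

lemma is_cdga_forms: "is_cdga C (forms C)"
proof -
  have "cga C (EA)"
    unfolding cga_iff using graded_algebra_ext wmult_comm by blast
  moreover have "gmod (forms C) = gmod (EA)" "gmult (forms C) = gmult (EA)"
    "gdiff (forms C) = form_d C" by (simp_all add: forms_def)
  ultimately show ?thesis
    using form_d_differential cga_cong[of "forms C" "EA" C]
      differential_cong[of "forms C" "EA" C]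
    unfolding is_cdga_def by simp
qed

end

lemma forms_simps [simp]:
  "gmod (forms C) = gmod (ext_algebra (alg C) (kaehler C))"
  "gmult (forms C) = gmult (ext_algebra (alg C) (kaehler C))"
  "gdiff (forms C) = form_d C"
  by (simp_all add: forms_def)

section \<open>Restriction of scalars\<close>

text \<open>Restriction of scalars for one module. Sums, inverses and cosets read the additive
  structure only and stay literally the same, as the simplification rules below record.\<close>

definition rsmod :: "('b \<Rightarrow> 'c) \<Rightarrow> ('c, 'e) module \<Rightarrow> ('b, 'e) module"
  where "rsmod \<phi> N = \<lparr>carrier = carrier N, mult = undefined, one = undefined,
      zero = zero N, add = add N, smult = (\<lambda>b. smult N (\<phi> b))\<rparr>"

lemma rsmod_simps [simp]:
  "carrier (rsmod \<phi> N) = carrier N" "\<zero>\<^bsub>rsmod \<phi> N\<^esub> = \<zero>\<^bsub>N\<^esub>" "x \<oplus>\<^bsub>rsmod \<phi> N\<^esub> y = x \<oplus>\<^bsub>N\<^esub> y"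
  "b \<odot>\<^bsub>rsmod \<phi> N\<^esub> x = \<phi> b \<odot>\<^bsub>N\<^esub> x"
  by (simp_all add: rsmod_def)

lemma rsmod_a_inv [simp]: "\<ominus>\<^bsub>rsmod \<phi> N\<^esub> x = \<ominus>\<^bsub>N\<^esub> x"
  by (simp add: a_inv_def m_inv_def rsmod_def)

lemma rsmod_a_minus [simp]: "x \<ominus>\<^bsub>rsmod \<phi> N\<^esub> y = x \<ominus>\<^bsub>N\<^esub> y"
  by (simp add: a_minus_def)

lemma rsmod_finsum [simp]: "finsum (rsmod \<phi> N) u I = finsum N u I"
  by (simp add: finsum_def finprod_def rsmod_def)

lemma rsmod_gsign [simp]: "gsign (rsmod \<phi> N) k x = gsign N k x"
  by (simp add: gsign_def)

lemma rsmod_coset [simp]: "H +>\<^bsub>rsmod \<phi> N\<^esub> x = H +>\<^bsub>N\<^esub> x"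
  by (simp add: a_r_coset_def r_coset_def rsmod_def)

lemma restrict_scalars_simps [simp]:
  "gmod (restrict_scalars \<phi> A) k = rsmod \<phi> (gmod A k)"
  "gmult (restrict_scalars \<phi> A) = gmult A" "gdiff (restrict_scalars \<phi> A) = gdiff A"
  by (simp_all add: restrict_scalars_def rsmod_def)

lemma module_rsmod:
  assumes R: "cring R" and \<phi>: "\<phi> \<in> ring_hom R S" and N: "Module.module S N"
  shows "Module.module R (rsmod \<phi> N)"
proof -
  interpret N: Module.module S N by fact
  show ?thesis
  proof (intro moduleI abelian_groupI R, goal_cases)
    case (6 x)
    then show ?case using N.M.l_neg[of x] by (intro bexI[of _ "\<ominus>\<^bsub>N\<^esub> x"]) auto
  qed (use ring_hom_closed[OF \<phi>] ring_hom_add[OF \<phi>] ring_hom_mult[OF \<phi>] ring_hom_one[OF \<phi>] in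
      \<open>auto simp: N.M.a_ac N.smult_l_distr N.smult_r_distr N.smult_assoc1\<close>)
qed

lemma linear_map_rsmod:
  "\<phi> \<in> ring_hom R S \<Longrightarrow> linear_map S N N' f \<Longrightarrow> linear_map R (rsmod \<phi> N) (rsmod \<phi> N') f"
  by (auto simp: linear_map_def ring_hom_closed)

lemma submodule_rsmod:
  assumes "cring R" "\<phi> \<in> ring_hom R S" "Module.module S N" "submodule H S N"
  shows "submodule H R (rsmod \<phi> N)"
proof -
  interpret N: Module.module S N by fact
  interpret rs: Module.module R "rsmod \<phi> N" using assms by (intro module_rsmod)
  show ?thesis
    by (rule rs.submoduleI) (use N.submoduleE[OF assms(4)] submodule_zero[OF assms(4)] ring_hom_closed[OF assms(2)] in auto)
qed

lemma cinf_map_closed: "cinf_map C D \<phi> \<Longrightarrow> a \<in> carrier C \<Longrightarrow> \<phi> a \<in> carrier D"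
  by (auto simp: cinf_map_def)

lemma cinf_map_cop: "cinf_map C D \<phi> \<Longrightarrow> set as \<subseteq> carrier C \<Longrightarrow> g \<in> Cinf (length as) \<Longrightarrow> \<phi> (cop C g as) = cop D g (map \<phi> as)"
  by (auto simp: cinf_map_def)

lemma cinf_map_ring_hom:
  assumes "cinf_map C D \<phi>"
  shows "\<phi> \<in> ring_hom (alg C) (alg D)"
  by (rule ring_hom_memI)
    (use cinf_map_closed[OF assms] in \<open>auto simp: alg_simps cinf_map_cop[OF assms] Cinf_add Cinf_mult\<close>)

lemma cinf_map_cconst: "cinf_map C D \<phi> \<Longrightarrow> \<phi> (cconst C r) = cconst D r"
  by (simp add: cconst_def cinf_map_cop)

text \<open>The only scalars in the axioms of a differential are constants, and these are preserved
  by \<open>cinf_map_cconst\<close>.\<close>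

lemma is_cdga_restrict_scalars:
  assumes C: "is_cinf_ring C" and \<phi>: "cinf_map C D \<phi>" and A: "is_cdga D A"
  shows "is_cdga C (restrict_scalars \<phi> A)"
proof -
  have hom: "\<phi> \<in> ring_hom (alg C) (alg D)" by (rule cinf_map_ring_hom[OF \<phi>])
  have cC: "carrier (alg C) = carrier C" by (simp add: alg_simps)
  have cga: "graded_algebra (alg D) A" and comm: "\<And>k l x y. x \<in> carrier (gmod A k) \<Longrightarrow> y \<in> carrier (gmod A l) \<Longrightarrow>
       gmult A k l x y = gsign (gmod A (k + l)) (k * l) (gmult A l k y x)" and d: "differential D A (gdiff A)"
    using A unfolding is_cdga_def cga_iff by blast+
  interpret A: graded_algebra "alg D" A by fact
  have "graded_algebra (alg C) (restrict_scalars \<phi> A)"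
    by (intro graded_algebra.intro)
      (use ring_hom_closed[OF hom] in \<open>auto intro!: module_rsmod[OF cring_alg[OF C] hom A.gmod_module]
        simp: A.gmult_closed A.gmult_add_l A.gmult_add_r A.gmult_smult_l A.gmult_smult_r A.gmult_assoc\<close>)
  moreover have "differential C (restrict_scalars \<phi> A) (gdiff A)"
    using d unfolding differential_def restrict_scalars_simps rsmod_simps rsmod_gsign cinf_map_cconst[OF \<phi>] .
  ultimately show ?thesis
    unfolding is_cdga_def cga_iff restrict_scalars_simps rsmod_simps rsmod_gsign using comm by blast
qed

section \<open>Functoriality of $\Lambda^\bullet\Omega^1_C$\<close>

lemma
  assumes R: "cring R" and S: "cring S" and \<phi>: "\<phi> \<in> ring_hom R S" and p: "p \<in> A \<rightarrow> B"
  shows free_push_linear: "linear_map R (free_module R A) (rsmod \<phi> (free_module S B)) (free_push S R \<phi> p)"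
    and free_push_gen: "a \<in> A \<Longrightarrow> free_push S R \<phi> p (free_gen R a) = free_gen S (p a)"
proof -
  interpret R: cring R by fact
  interpret S: cring S by fact
  have \<phi>0: "\<phi> \<zero>\<^bsub>R\<^esub> = \<zero>\<^bsub>S\<^esub>" by (rule ring_hom_zero[OF \<phi> R.ring_axioms S.ring_axioms])
  note hom = ring_hom_closed[OF \<phi>] ring_hom_add[OF \<phi>] ring_hom_mult[OF \<phi>] ring_hom_one[OF \<phi>]
  \<comment> \<open>The sum in \<open>free_push\<close> is indexed by the support of its argument,
    which changes under addition; a larger finite set \<open>T\<close> serves as a common index
    set.\<close>
  have push: "free_push S R \<phi> p q t = (\<Oplus>\<^bsub>S\<^esub>s\<in>{s \<in> T. p s = t}. \<phi> (q s))"
    if "q \<in> carrier (free_module R A)" "finite T" "{s. q s \<noteq> \<zero>\<^bsub>R\<^esub>} \<subseteq> T" for q T t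
    unfolding free_push_def
    by (rule S.add.finprod_mono_neutral_cong_left)
      (use that \<phi>0 hom in \<open>auto simp: Pi_iff free_module_simps\<close>)
  have pc: "free_push S R \<phi> p q \<in> carrier (free_module S B)" if q: "q \<in> carrier (free_module R A)" for q
  proof -
    let ?T = "{s. q s \<noteq> \<zero>\<^bsub>R\<^esub>}"
    have f: "finite ?T" "?T \<subseteq> A" using q by (auto simp: free_module_simps)
    have "free_push S R \<phi> p q t = \<zero>\<^bsub>S\<^esub>" if "t \<notin> p ` ?T" for t
    proof -
      have "{s. q s \<noteq> \<zero>\<^bsub>R\<^esub> \<and> p s = t} = {}" using that by auto
      then show ?thesis unfolding free_push_def by (simp only: S.finsum_empty)
    qed
    moreover have "p ` ?T \<subseteq> B" using f p by auto
    ultimately have "{t. free_push S R \<phi> p q t \<noteq> \<zero>\<^bsub>S\<^esub>} \<subseteq> p ` ?T" "\<And>t. t \<notin> B \<Longrightarrow> free_push S R \<phi> p q t = \<zero>\<^bsub>S\<^esub>" by blast+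
    moreover have "free_push S R \<phi> p q t \<in> carrier S" for t
      unfolding free_push_def by (rule S.finsum_closed) (use q hom in \<open>auto simp: free_module_simps\<close>)
    ultimately show ?thesis using finite_subset[OF _ finite_imageI[OF f(1)]] by (auto simp: free_module_simps)
  qed
  show "linear_map R (free_module R A) (rsmod \<phi> (free_module S B)) (free_push S R \<phi> p)"
  proof (rule linear_mapI, goal_cases)
    case (1 q)
    then show ?case using pc by simp
  next
    case (2 q r)
    let ?T = "{s. q s \<noteq> \<zero>\<^bsub>R\<^esub>} \<union> {s. r s \<noteq> \<zero>\<^bsub>R\<^esub>}"
    have c: "q s \<in> carrier R" "r s \<in> carrier R" for s using 2 by (auto simp: free_module_simps)
    have f: "finite ?T" using 2 by (auto simp: free_module_simps)
    interpret F: Module.module R "free_module R A" by (rule module_free_module[OF R])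
    have "free_push S R \<phi> p (q \<oplus>\<^bsub>free_module R A\<^esub> r) t = free_push S R \<phi> p q t \<oplus>\<^bsub>S\<^esub> free_push S R \<phi> p r t" for t
    proof -
      have "free_push S R \<phi> p (q \<oplus>\<^bsub>free_module R A\<^esub> r) t = (\<Oplus>\<^bsub>S\<^esub>s\<in>{s \<in> ?T. p s = t}. \<phi> ((q \<oplus>\<^bsub>free_module R A\<^esub> r) s))"
        by (rule push[OF F.M.a_closed[OF 2] f]) (use c in \<open>auto simp: free_module_simps(3)\<close>)
      also have "\<dots> = (\<Oplus>\<^bsub>S\<^esub>s\<in>{s \<in> ?T. p s = t}. \<phi> (q s) \<oplus>\<^bsub>S\<^esub> \<phi> (r s))"
        by (rule S.finsum_cong') (use c hom in \<open>auto simp: free_module_simps(3)\<close>)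
      also have "\<dots> = (\<Oplus>\<^bsub>S\<^esub>s\<in>{s \<in> ?T. p s = t}. \<phi> (q s)) \<oplus>\<^bsub>S\<^esub> (\<Oplus>\<^bsub>S\<^esub>s\<in>{s \<in> ?T. p s = t}. \<phi> (r s))"
        by (rule S.finsum_addf) (use c hom in auto)
      finally show ?thesis using push[OF 2(1) f, of t] push[OF 2(2) f, of t] by simp
    qed
    then show ?case by (simp add: free_module_simps(3) fun_eq_iff)
  next
    case (3 a q)
    let ?T = "{s. q s \<noteq> \<zero>\<^bsub>R\<^esub>}"
    have c: "q s \<in> carrier R" for s using 3 by (auto simp: free_module_simps)
    have f: "finite ?T" using 3 by (auto simp: free_module_simps)
    interpret F: Module.module R "free_module R A" by (rule module_free_module[OF R])
    have "free_push S R \<phi> p (a \<odot>\<^bsub>free_module R A\<^esub> q) t = \<phi> a \<otimes>\<^bsub>S\<^esub> free_push S R \<phi> p q t" for t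
    proof -
      have "free_push S R \<phi> p (a \<odot>\<^bsub>free_module R A\<^esub> q) t = (\<Oplus>\<^bsub>S\<^esub>s\<in>{s \<in> ?T. p s = t}. \<phi> ((a \<odot>\<^bsub>free_module R A\<^esub> q) s))"
        by (rule push[OF F.smult_closed[OF 3] f]) (use 3 c in \<open>auto simp: free_module_simps(4)\<close>)
      also have "\<dots> = (\<Oplus>\<^bsub>S\<^esub>s\<in>{s \<in> ?T. p s = t}. \<phi> a \<otimes>\<^bsub>S\<^esub> \<phi> (q s))"
        by (rule S.finsum_cong') (use 3 c hom in \<open>auto simp: free_module_simps(4)\<close>)
      also have "\<dots> = \<phi> a \<otimes>\<^bsub>S\<^esub> (\<Oplus>\<^bsub>S\<^esub>s\<in>{s \<in> ?T. p s = t}. \<phi> (q s))"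
        by (rule S.finsum_rdistr[symmetric]) (use 3 f c hom in auto)
      finally show ?thesis using push[OF 3(2) f subset_refl, of t] by simp
    qed
    then show ?case by (simp add: free_module_simps(4) fun_eq_iff)
  qed
  show "free_push S R \<phi> p (free_gen R a) = free_gen S (p a)" if a: "a \<in> A"
  proof
    fix t
    have "free_push S R \<phi> p (free_gen R a) t = (\<Oplus>\<^bsub>S\<^esub>s\<in>{s \<in> {a}. p s = t}. \<phi> (free_gen R a s))"
      by (rule push[OF free_gen_closed[OF R a]]) (auto simp: free_gen_def)
    also have "\<dots> = free_gen S (p a) t"
    proof (cases "p a = t")
      case True
      then have "{s \<in> {a}. p s = t} = {a}" by auto
      then show ?thesis using True hom by (simp add: free_gen_def)
    next
      case False
      then have "{s \<in> {a}. p s = t} = {}" by auto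
      then show ?thesis using False by (simp only: S.finsum_empty) (simp add: free_gen_def)
    qed
    finally show "free_push S R \<phi> p (free_gen R a) t = free_gen S (p a) t" .
  qed
qed

lemma
  fixes S :: "'d ring"
  assumes R: "cring R" and \<phi>: "\<phi> \<in> ring_hom R S" and F: "Module.module R F" and F': "Module.module S F'"
    and H: "submodule H R F" and H': "submodule H' S F'" and f: "linear_map R F (rsmod \<phi> F') f"
    and fH: "\<And>x. x \<in> H \<Longrightarrow> f x \<in> H'"
  shows quot_push: "x \<in> carrier F \<Longrightarrow> (\<Union>p\<in>H +>\<^bsub>F\<^esub> x. H' +>\<^bsub>F'\<^esub> f p) = H' +>\<^bsub>F'\<^esub> f x"
    and quot_push_linear: "linear_map R (quot_module F H) (rsmod \<phi> (quot_module F' H')) (\<lambda>X. \<Union>p\<in>X. H' +>\<^bsub>F'\<^esub> f p)"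
proof -
  interpret F: Module.module R F by fact
  have rs: "Module.module R (rsmod \<phi> F')" by (rule module_rsmod[OF R \<phi> F'])
  have fc: "f x \<in> carrier F'" if "x \<in> carrier F" for x using linear_map_simps(1)[OF f that] by simp
  show 1: "(\<Union>p\<in>H +>\<^bsub>F\<^esub> x. H' +>\<^bsub>F'\<^esub> f p) = H' +>\<^bsub>F'\<^esub> f x" if x: "x \<in> carrier F" for x
  proof (rule coset_UN[OF F H x])
    fix y assume y: "y \<in> carrier F" "H +>\<^bsub>F\<^esub> y = H +>\<^bsub>F\<^esub> x"
    then have "f (y \<ominus>\<^bsub>F\<^esub> x) \<in> H'" using quot_eq_iff[OF F H y(1) x] fH by simp
    then have "f y \<ominus>\<^bsub>F'\<^esub> f x \<in> H'" using linear_map_minus[OF F rs f y(1) x] by simp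
    then show "H' +>\<^bsub>F'\<^esub> f y = H' +>\<^bsub>F'\<^esub> f x" using quot_eq_iff[OF F' H' fc[OF y(1)] fc[OF x]] by simp
  qed
  note q = linear_map_quot[OF F H] and q' = linear_map_quot[OF F' H']
  show "linear_map R (quot_module F H) (rsmod \<phi> (quot_module F' H')) (\<lambda>X. \<Union>p\<in>X. H' +>\<^bsub>F'\<^esub> f p)"
  proof (rule linear_mapI, goal_cases)
    case (1 X)
    then show ?case using 1 fc by (auto simp: quot_carrier[OF F H] quot_carrier[OF F' H'] \<open>\<And>x. x \<in> carrier F \<Longrightarrow> \<Union>_ = _\<close>)
  next
    case (2 X Y)
    then obtain x y where xy: "x \<in> carrier F" "y \<in> carrier F" "X = H +>\<^bsub>F\<^esub> x" "Y = H +>\<^bsub>F\<^esub> y"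
      by (auto simp: quot_carrier[OF F H])
    show ?case unfolding xy(3,4) linear_map_simps(2)[OF q xy(1,2), symmetric]
      using xy fc by (simp add: 1 linear_map_simps(2)[OF f] linear_map_simps(2)[OF q'])
  next
    case (3 r X)
    then obtain x where x: "x \<in> carrier F" "X = H +>\<^bsub>F\<^esub> x" by (auto simp: quot_carrier[OF F H])
    show ?case unfolding x(2) linear_map_simps(3)[OF q 3(1) x(1), symmetric]
      using x 3(1) fc ring_hom_closed[OF \<phi> 3(1)] by (simp add: 1 linear_map_simps(3)[OF f] linear_map_simps(3)[OF q'])
  qed
qed

text \<open>\<phi> commutes with all operations, in particular with those given by the partial
  derivatives of \<open>h\<close>.\<close>

lemma derivation_pullback:
  assumes C: "is_cinf_ring C" and D: "is_cinf_ring D" and \<phi>: "cinf_map C D \<phi>" and N: "Module.module (alg D) N" and X: "cinf_derivation D N X"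
  shows "cinf_derivation C (rsmod \<phi> N) (\<lambda>a. X (\<phi> a))"
  unfolding cinf_derivation_def
proof (intro conjI allI impI)
  interpret N: Module.module "alg D" N by (rule N)
  have Xc: "X a \<in> carrier N" if "a \<in> carrier D" for a by (rule derivation_closed[OF N D X that])
  show "(\<lambda>a. X (\<phi> a)) \<in> carrier C \<rightarrow> carrier (rsmod \<phi> N)" using Xc cinf_map_closed[OF \<phi>] by auto
  fix as h assume as: "as \<noteq> []" "set as \<subseteq> carrier C" "h \<in> Cinf (length as)"
  have as': "map \<phi> as \<noteq> []" "set (map \<phi> as) \<subseteq> carrier D" "h \<in> Cinf (length (map \<phi> as))"
    using as cinf_map_closed[OF \<phi>] by auto
  have p: "\<phi> (cop C (pd (Rn (length as)) i h) as) = cop D (pd (Rn (length as)) i h) (map \<phi> as)" if "i < length as" for i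
    by (rule cinf_map_cop[OF \<phi> as(2) Cinf_pd[OF as(3) that]])
  have cl: "cop D (pd (Rn (length as)) i h) (map \<phi> as) \<odot>\<^bsub>N\<^esub> X (\<phi> (as ! i)) \<in> carrier N" if "i < length as" for i
    using cop_closed[OF D as'(2)] Cinf_pd[OF as(3) that] Xc cinf_map_closed[OF \<phi>] subsetD[OF as(2) nth_mem[OF that]]
    by (intro N.smult_closed) (simp_all add: alg_simps)
  have "X (\<phi> (cop C h as)) = (\<Oplus>\<^bsub>N\<^esub>i\<in>{..<length as}. cop D (pd (Rn (length as)) i h) (map \<phi> as) \<odot>\<^bsub>N\<^esub> X (map \<phi> as ! i))"
    using X[unfolded cinf_derivation_def, THEN conjunct2, rule_format, OF as'] cinf_map_cop[OF \<phi> as(2,3)] by simp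
  also have "\<dots> = (\<Oplus>\<^bsub>N\<^esub>i\<in>{..<length as}. \<phi> (cop C (pd (Rn (length as)) i h) as) \<odot>\<^bsub>N\<^esub> X (\<phi> (as ! i)))"
    by (rule N.M.finsum_cong') (use cl p in auto)
  finally show "X (\<phi> (cop C h as)) = (\<Oplus>\<^bsub>rsmod \<phi> N\<^esub>i\<in>{..<length as}. cop C (pd (Rn (length as)) i h) as \<odot>\<^bsub>rsmod \<phi> N\<^esub> X (\<phi> (as ! i)))"
    by simp
qed

locale cinf_hom =
  fixes C :: "'c cinf_ring" and D :: "'d cinf_ring" and \<phi> :: "'c \<Rightarrow> 'd"
  assumes cinf_ring_dom: "is_cinf_ring C" and cinf_ring_cod: "is_cinf_ring D" and cinf_map: "cinf_map C D \<phi>"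
begin

section \<open>Maps induced by \<phi> on one-forms and on the exterior algebra\<close>

sublocale FC: cinf_forms C by (rule cinf_forms.intro) (rule cinf_ring_dom)
sublocale FD: cinf_forms D by (rule cinf_forms.intro) (rule cinf_ring_cod)

lemma hom: "\<phi> \<in> ring_hom (alg C) (alg D)" by (rule cinf_map_ring_hom[OF cinf_map])
lemma cringC: "cring (alg C)" by (rule cring_alg[OF cinf_ring_dom])
lemma cringD: "cring (alg D)" by (rule cring_alg[OF cinf_ring_cod])

lemma rs_module: "Module.module (alg D) N \<Longrightarrow> Module.module (alg C) (rsmod \<phi> N)"
  by (rule module_rsmod[OF cringC hom])

text \<open>Relations are not pushed forward by explicit computation. The derivation of D after
  \<phi> is a derivation of C, so its linear extension to the free module kills every relation; and
  being zero in \<open>kaehler D\<close> means lying in \<open>kaehler_rel D\<close>.\<close>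

lemma kaehler_push:
  assumes "p \<in> kaehler_rel C"
  shows "free_push (alg D) (alg C) \<phi> \<phi> p \<in> kaehler_rel D"
proof -
  let ?F = "free_module (alg C) (carrier C)" and ?F' = "free_module (alg D) (carrier D)"
  let ?g = "free_gen (alg C)" and ?L = "free_push (alg D) (alg C) \<phi> \<phi>"
  let ?q = "\<lambda>p. kaehler_rel D +>\<^bsub>?F'\<^esub> ?L p" and ?K = "rsmod \<phi> (kaehler D)"
  have pc: "\<phi> \<in> carrier C \<rightarrow> carrier D" using cinf_map_closed[OF cinf_map] by auto
  have F: "Module.module (alg C) ?F" and F': "Module.module (alg D) ?F'"
    by (rule module_free_module[OF cringC], rule module_free_module[OF cringD])
  have K: "Module.module (alg C) ?K" by (rule rs_module[OF module_kaehler[OF cinf_ring_cod]])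
  interpret F: Module.module "alg C" ?F by (rule F)
  interpret K: Module.module "alg C" ?K by (rule K)
  note H' = kaehler_rel_submodule[OF cinf_ring_cod]
  note L = free_push_linear[OF cringC cringD hom pc]
  have q: "linear_map (alg C) ?F ?K ?q"
    unfolding kaehler_def by (rule linear_map_comp[OF L linear_map_rsmod[OF hom linear_map_quot[OF F' H']]])
  have qg: "?q (?g a) = kaehler_d D (\<phi> a)" if "a \<in> carrier C" for a
    by (simp add: kaehler_d_def free_push_gen[OF cringC cringD hom pc that])
  have X: "cinf_derivation C ?K (\<lambda>a. kaehler_d D (\<phi> a))"
    by (rule derivation_pullback[OF cinf_ring_dom cinf_ring_cod cinf_map module_kaehler[OF cinf_ring_cod] kaehler_d_derivation[OF cinf_ring_cod]])
  have "linear_map (alg C) ?F ?K (\<lambda>x. \<zero>\<^bsub>?K\<^esub>)" by (simp add: linear_map_def del: rsmod_simps)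
  note sub = linear_map_equalizer[OF F K q this]
  have "kaehler_rel C \<subseteq> {p \<in> carrier ?F. ?q p = \<zero>\<^bsub>?K\<^esub>}"
    unfolding kaehler_rel_def[of C]
  proof (rule span_module_minimal[OF sub], rule subsetI, elim CollectE exE conjE)
    fix z h as assume as: "as \<noteq> []" "set as \<subseteq> carrier C" "h \<in> Cinf (length as)"
      and z: "z = ?g (cop C h as) \<ominus>\<^bsub>?F\<^esub> (\<Oplus>\<^bsub>?F\<^esub>i\<in>{..<length as}. cop C (pd (Rn (length as)) i h) as \<odot>\<^bsub>?F\<^esub> ?g (as ! i))"
    let ?c = "\<lambda>i. cop C (pd (Rn (length as)) i h) as"
    let ?s = "\<Oplus>\<^bsub>?F\<^esub>i\<in>{..<length as}. ?c i \<odot>\<^bsub>?F\<^esub> ?g (as ! i)"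
    have n: "as ! i \<in> carrier C" if "i < length as" for i using subsetD[OF as(2) nth_mem[OF that]] .
    have g: "?g a \<in> carrier ?F" if "a \<in> carrier C" for a by (rule free_gen_closed[OF cringC that])
    have c: "?c i \<in> carrier (alg C)" if "i < length as" for i
      using cop_closed[OF cinf_ring_dom as(2) Cinf_pd[OF as(3) that]] by (simp add: alg_simps)
    have t: "(\<lambda>i. ?c i \<odot>\<^bsub>?F\<^esub> ?g (as ! i)) \<in> {..<length as} \<rightarrow> carrier ?F" using c n g F.smult_closed by auto
    have s: "?s \<in> carrier ?F" by (rule F.M.finsum_closed[OF t])
    have hc: "cop C h as \<in> carrier C" by (rule cop_closed[OF cinf_ring_dom as(2,3)])
    have "?q ?s = (\<Oplus>\<^bsub>?K\<^esub>i\<in>{..<length as}. ?q (?c i \<odot>\<^bsub>?F\<^esub> ?g (as ! i)))"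
      by (rule linear_map_finsum[OF F K q _ t]) simp
    also have "\<dots> = (\<Oplus>\<^bsub>?K\<^esub>i\<in>{..<length as}. ?c i \<odot>\<^bsub>?K\<^esub> kaehler_d D (\<phi> (as ! i)))"
      using K.smult_closed[OF c derivation_closed[OF K cinf_ring_dom X n]]
      by (intro K.M.finsum_cong') (auto simp only: lessThan_iff linear_map_simps(3)[OF q c g[OF n]] qg[OF n] Pi_iff)
    also have "\<dots> = kaehler_d D (\<phi> (cop C h as))" using X as by (simp add: cinf_derivation_def)
    finally have "?q z = \<zero>\<^bsub>?K\<^esub>" unfolding z
      using linear_map_minus[OF F K q g[OF hc] s] derivation_closed[OF K cinf_ring_dom X hc] by (simp only: qg[OF hc] K.M.minus_eq K.M.r_neg)
    then show "z \<in> {p \<in> carrier ?F. ?q p = \<zero>\<^bsub>?K\<^esub>}" using F.M.minus_closed[OF g[OF hc] s] z by simp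
  qed
  then have p: "p \<in> carrier ?F" "?q p = kaehler_rel D" using assms by (auto simp: kaehler_def quot_module_def)
  then show ?thesis using coset_self[OF F' H', of "?L p"] linear_map_simps(1)[OF L p(1)] by simp
qed

lemma kaehler_map_linear: "linear_map (alg C) (kaehler C) (rsmod \<phi> (kaehler D)) (kaehler_map C D \<phi>)"
  and kaehler_map_d: "a \<in> carrier C \<Longrightarrow> kaehler_map C D \<phi> (kaehler_d C a) = kaehler_d D (\<phi> a)"
proof -
  have pc: "\<phi> \<in> carrier C \<rightarrow> carrier D" using cinf_map_closed[OF cinf_map] by auto
  note Q = module_free_module[OF cringC] module_free_module[OF cringD]
    kaehler_rel_submodule[OF cinf_ring_dom] kaehler_rel_submodule[OF cinf_ring_cod]
    free_push_linear[OF cringC cringD hom pc] kaehler_push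
  show "linear_map (alg C) (kaehler C) (rsmod \<phi> (kaehler D)) (kaehler_map C D \<phi>)"
    unfolding kaehler_map_def[abs_def] kaehler_def by (rule quot_push_linear[OF cringC hom Q])
  show "kaehler_map C D \<phi> (kaehler_d C a) = kaehler_d D (\<phi> a)" if "a \<in> carrier C"
    unfolding kaehler_map_def kaehler_d_def
    using quot_push[OF cringC hom Q free_gen_closed[OF cringC that]] free_push_gen[OF cringC cringD hom pc that] by simp
qed

abbreviation "KM \<equiv> kaehler_map C D \<phi>"

lemma KM_closed: "m \<in> carrier (kaehler C) \<Longrightarrow> KM m \<in> carrier (kaehler D)"
  using linear_map_simps(1)[OF kaehler_map_linear] by simp

lemma words_map: "w \<in> ext_words (kaehler C) k \<Longrightarrow> map KM w \<in> ext_words (kaehler D) k"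
  using KM_closed by (auto simp: ext_words_def)

lemma
  shows ext_push_linear: "linear_map (alg C) (FC.Fr k) (rsmod \<phi> (FD.Fr k)) (free_push (alg D) (alg C) \<phi> (map KM))"
    and ext_push_gen: "w \<in> ext_words (kaehler C) k \<Longrightarrow> free_push (alg D) (alg C) \<phi> (map KM) (free_gen (alg C) w) = free_gen (alg D) (map KM w)"
proof -
  have p: "map KM \<in> ext_words (kaehler C) k \<rightarrow> ext_words (kaehler D) k" using words_map by auto
  show "linear_map (alg C) (FC.Fr k) (rsmod \<phi> (FD.Fr k)) (free_push (alg D) (alg C) \<phi> (map KM))"
    unfolding FC.Fr_eq FD.Fr_eq by (rule free_push_linear[OF cringC cringD hom p])
  show "w \<in> ext_words (kaehler C) k \<Longrightarrow> free_push (alg D) (alg C) \<phi> (map KM) (free_gen (alg C) w) = free_gen (alg D) (map KM w)"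
    by (rule free_push_gen[OF cringC cringD hom p])
qed

text \<open>Words are mapped letter by letter, so each of the three kinds of relation goes to one of
  the same kind, with the context mapped along.\<close>

lemma ext_push_rel:
  assumes "p \<in> FC.Rl k"
  shows "free_push (alg D) (alg C) \<phi> (map KM) p \<in> FD.Rl k"
proof -
  let ?L = "free_push (alg D) (alg C) \<phi> (map KM)"
  note rs = rs_module[OF FD.Fr_module] and L = ext_push_linear
  have km: "KM (x \<oplus>\<^bsub>kaehler C\<^esub> y) = KM x \<oplus>\<^bsub>kaehler D\<^esub> KM y" "KM (r \<odot>\<^bsub>kaehler C\<^esub> x) = \<phi> r \<odot>\<^bsub>kaehler D\<^esub> KM x"
    if "x \<in> carrier (kaehler C)" "y \<in> carrier (kaehler C)" "r \<in> carrier (alg C)" for x y r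
    using that linear_map_simps(2,3)[OF kaehler_map_linear] by auto
  have "FC.Rl k \<subseteq> {p \<in> carrier (FC.Fr k). ?L p \<in> FD.Rl k}"
  proof (rule FC.rel_induct[OF linear_map_preimage[OF FC.Fr_module rs L submodule_rsmod[OF cringC hom FD.Fr_module FD.Rl_submodule]]], goal_cases)
    case (1 u v x y)
    then have w: "u @ [x \<oplus>\<^bsub>kaehler C\<^esub> y] @ v \<in> ext_words (kaehler C) k" "u @ [y] @ v \<in> ext_words (kaehler C) k"
      "x \<in> carrier (kaehler C)" by (auto simp: FC.ext_words_simps)
    note c = FC.gen_closed[OF w(1)] FC.gen_closed[OF 1(1)] FC.gen_closed[OF w(2)]
    have m: "map KM u @ [KM x] @ map KM v \<in> ext_words (kaehler D) k" using words_map[OF 1(1)] by simp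
    show ?case
      using FC.Fr_closed c FD.rel_add[OF m KM_closed[OF 1(2)]] linear_map_minus[OF FC.Fr_module rs L c(1) FC.Fr_closed(2)[OF c(2,3)]]
      by (simp add: linear_map_simps(2)[OF L c(2,3)] ext_push_gen[OF w(1)] ext_push_gen[OF w(2)] ext_push_gen[OF 1(1)] linear_map_simps(2)[OF kaehler_map_linear w(3) 1(2)] del: append_Cons append_Nil)
  next
    case (2 u v x r)
    then have w: "u @ [r \<odot>\<^bsub>kaehler C\<^esub> x] @ v \<in> ext_words (kaehler C) k"
      "x \<in> carrier (kaehler C)" by (auto simp: FC.ext_words_simps)
    note c = FC.gen_closed[OF w(1)] FC.gen_closed[OF 2(1)]
    have m: "map KM u @ [KM x] @ map KM v \<in> ext_words (kaehler D) k" using words_map[OF 2(1)] by simp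
    show ?case
      using FC.Fr_closed c 2(2) FD.rel_smult[OF m ring_hom_closed[OF hom 2(2)]] linear_map_minus[OF FC.Fr_module rs L c(1) FC.Fr_closed(3)[OF 2(2) c(2)]]
      by (simp add: linear_map_simps(3)[OF L 2(2) c(2)] ext_push_gen[OF w(1)] ext_push_gen[OF 2(1)] linear_map_simps(3)[OF kaehler_map_linear 2(2) w(2)] del: append_Cons append_Nil)
  next
    case (3 u v x)
    have m: "map KM u @ [KM x, KM x] @ map KM v \<in> ext_words (kaehler D) k" using words_map[OF 3] by simp
    show ?case using FC.gen_closed[OF 3] FD.rel_alt[OF m] by (simp add: ext_push_gen[OF 3] del: append_Cons append_Nil)
  qed
  then show ?thesis using assms by auto
qed

abbreviation "FM \<equiv> forms_map C D \<phi>"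

lemma FM_linear: "linear_map (alg C) (FC.Lam k) (rsmod \<phi> (FD.Lam k)) (FM k)"
  unfolding forms_map_def[abs_def] FC.Lam_eq FD.Lam_eq
  by (rule quot_push_linear[OF cringC hom FC.Fr_module FD.Fr_module FC.Rl_submodule FD.Rl_submodule ext_push_linear ext_push_rel])

lemma FM_proj: "p \<in> carrier (FC.Fr k) \<Longrightarrow> FM k (FC.Rl k +>\<^bsub>FC.Fr k\<^esub> p) = FD.Rl k +>\<^bsub>FD.Fr k\<^esub> free_push (alg D) (alg C) \<phi> (map KM) p"
  unfolding forms_map_def
  by (rule quot_push[OF cringC hom FC.Fr_module FD.Fr_module FC.Rl_submodule FD.Rl_submodule ext_push_linear ext_push_rel])

lemma FM_word: "w \<in> ext_words (kaehler C) k \<Longrightarrow> FM k (ext_word (alg C) (kaehler C) k w) = ext_word (alg D) (kaehler D) k (map KM w)"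
  using FM_proj[OF FC.gen_closed] ext_push_gen by (simp add: ext_word_def)

lemma FM_closed: "x \<in> carrier (FC.Lam k) \<Longrightarrow> FM k x \<in> carrier (FD.Lam k)"
  using linear_map_simps(1)[OF FM_linear] by simp

lemma FM_add: "x \<in> carrier (FC.Lam k) \<Longrightarrow> y \<in> carrier (FC.Lam k) \<Longrightarrow> FM k (x \<oplus>\<^bsub>FC.Lam k\<^esub> y) = FM k x \<oplus>\<^bsub>FD.Lam k\<^esub> FM k y"
  using linear_map_simps(2)[OF FM_linear] by simp

lemma FM_smult: "a \<in> carrier C \<Longrightarrow> x \<in> carrier (FC.Lam k) \<Longrightarrow> FM k (a \<odot>\<^bsub>FC.Lam k\<^esub> x) = \<phi> a \<odot>\<^bsub>FD.Lam k\<^esub> FM k x"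
  using linear_map_simps(3)[OF FM_linear] by (simp add: alg_simps)

lemma FM_zero: "FM k \<zero>\<^bsub>FC.Lam k\<^esub> = \<zero>\<^bsub>FD.Lam k\<^esub>"
  using linear_map_zero[OF FC.Lam_module rs_module[OF FD.Lam_module] FM_linear] by simp

lemma FM_gsign: "x \<in> carrier (FC.Lam k) \<Longrightarrow> FM k (gsign (FC.Lam k) j x) = gsign (FD.Lam k) j (FM k x)"
  using linear_map_gsign_commute[OF FC.Lam_module rs_module[OF FD.Lam_module] FM_linear] by simp

lemma FM_mult:
  assumes x: "x \<in> carrier (FC.Lam k)" and y: "y \<in> carrier (FC.Lam l)"
  shows "FM (k + l) (FC.wmult k l x y) = FD.wmult k l (FM k x) (FM l y)"
proof -
  note rsL = rs_module[OF FD.Lam_module]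
  have ww: "FM (k + l) (FC.wmult k l (ext_word (alg C) (kaehler C) k u) (ext_word (alg C) (kaehler C) l v)) =
     FD.wmult k l (FM k (ext_word (alg C) (kaehler C) k u)) (FM l (ext_word (alg C) (kaehler C) l v))"
    if "u \<in> ext_words (kaehler C) k" "v \<in> ext_words (kaehler C) l" for u v
  proof -
    have "u @ v \<in> ext_words (kaehler C) (k + l)" using that by (auto simp: ext_words_def)
    then show ?thesis using that by (simp add: FC.wmult_word FD.wmult_word FM_word words_map)
  qed
  have wy: "FM (k + l) (FC.wmult k l (ext_word (alg C) (kaehler C) k u) y) =
     FD.wmult k l (FM k (ext_word (alg C) (kaehler C) k u)) (FM l y)" if u: "u \<in> ext_words (kaehler C) k" for u
  proof (rule FC.Lam_linear_eq[OF rsL[of "k + l"], where k = l and x = y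
        and f = "\<lambda>y. FM (k + l) (FC.wmult k l (ext_word (alg C) (kaehler C) k u) y)"
        and g = "\<lambda>y. FD.wmult k l (FM k (ext_word (alg C) (kaehler C) k u)) (FM l y)"])
    show "linear_map (alg C) (FC.Lam l) (rsmod \<phi> (FD.Lam (k + l))) (\<lambda>y. FM (k + l) (FC.wmult k l (ext_word (alg C) (kaehler C) k u) y))"
      by (rule linear_map_comp[OF FC.wmult_linear_r[OF FC.ext_word_closed[OF u]] FM_linear])
    show "linear_map (alg C) (FC.Lam l) (rsmod \<phi> (FD.Lam (k + l))) (\<lambda>y. FD.wmult k l (FM k (ext_word (alg C) (kaehler C) k u)) (FM l y))"
      by (rule linear_map_comp[OF FM_linear linear_map_rsmod[OF hom FD.wmult_linear_r[OF FM_closed[OF FC.ext_word_closed[OF u]]]]])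
  qed (use ww[OF u] y in auto)
  show ?thesis
  proof (rule FC.Lam_linear_eq[OF rsL[of "k + l"], where k = k and x = x
        and f = "\<lambda>x. FM (k + l) (FC.wmult k l x y)" and g = "\<lambda>x. FD.wmult k l (FM k x) (FM l y)"])
    show "linear_map (alg C) (FC.Lam k) (rsmod \<phi> (FD.Lam (k + l))) (\<lambda>x. FM (k + l) (FC.wmult k l x y))"
      by (rule linear_map_comp[OF FC.wmult_linear_l[OF y] FM_linear])
    show "linear_map (alg C) (FC.Lam k) (rsmod \<phi> (FD.Lam (k + l))) (\<lambda>x. FD.wmult k l (FM k x) (FM l y))"
      by (rule linear_map_comp[OF FM_linear linear_map_rsmod[OF hom FD.wmult_linear_l[OF FM_closed[OF y]]]])
  qed (use wy x in auto)
qed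

lemma FM_form0:
  assumes "a \<in> carrier C"
  shows "FM 0 (form0 C a) = form0 D (\<phi> a)"
proof -
  have "FM 0 FC.one0 = FD.one0" using FM_word[of "[]" 0] by (simp add: ext_words_def)
  then show ?thesis using assms cinf_map_closed[OF cinf_map] by (simp add: FC.form0_eq FD.form0_eq FM_smult)
qed

lemma FM_dl:
  assumes "a \<in> carrier C"
  shows "FM 1 (FC.dl a) = FD.dl (\<phi> a)"
proof -
  have "kaehler_d C a \<in> carrier (kaehler C)"
    using assms derivation_closed[OF FC.base_module cinf_ring_dom kaehler_d_derivation[OF cinf_ring_dom]] by blast
  then show ?thesis
    using FM_word[of "[kaehler_d C a]" 1] kaehler_map_d[OF assms] by (simp add: FC.form1_eq FD.form1_eq ext_words_def)
qed

text \<open>Neither side is linear over C, so the comparison runs by \<open>forms_induct\<close>: on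
  a it is \<open>FM_dl\<close>, and on da both sides vanish.\<close>

lemma FM_diff: "x \<in> carrier (FC.Lam k) \<Longrightarrow> FM (k + 1) (form_d C k x) = form_d D k (FM k x)"
proof (induction rule: FC.forms_induct)
  case (zero k)
  then show ?case
    by (simp add: diff_zero[OF FC.form_d_differential FC.Lam_module] diff_zero[OF FD.form_d_differential FD.Lam_module] FM_zero)
next
  case (add k x y)
  then show ?case
    by (simp add: diff_add[OF FC.form_d_differential] diff_add[OF FD.form_d_differential] FM_add FM_closed diff_closed[OF FC.form_d_differential])
next
  case (mult k l x y)
  note dC = diff_closed[OF FC.form_d_differential]
  have c: "FC.wmult (k + 1) l (form_d C k x) y \<in> carrier (FC.Lam (k + l + 1))" "FC.wmult k (l + 1) x (form_d C l y) \<in> carrier (FC.Lam (k + l + 1))"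
    by (auto intro!: FC.wclosed mult dC)
  have i: "FM (k + l + 1) (FC.wmult (k + 1) l (form_d C k x) y) = FD.wmult (k + 1) l (FM (k + 1) (form_d C k x)) (FM l y)"
    "FM (k + l + 1) (FC.wmult k (l + 1) x (form_d C l y)) = FD.wmult k (l + 1) (FM k x) (FM (l + 1) (form_d C l y))"
    using FM_mult[OF dC[OF mult(1)] mult(2)] FM_mult[OF mult(1) dC[OF mult(2)]] by (simp_all add: algebra_simps)
  show ?case
    unfolding diff_mult[OF FC.form_d_differential mult(1,2)] FM_mult[OF mult(1,2)]
      diff_mult[OF FD.form_d_differential FM_closed[OF mult(1)] FM_closed[OF mult(2)]]
    using c by (simp add: FM_add FC.gs_closed FM_gsign i mult(3,4))
next
  case (form0 a)
  then show ?case
    using FM_dl cinf_map_closed[OF cinf_map] by (simp add: FC.form_d_form0 FM_form0 FD.form_d_form0)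
next
  case (form1 a)
  then show ?case
    using cinf_map_closed[OF cinf_map] FM_zero by (simp add: FC.form_d_dl FM_dl FD.form_d_dl)
qed

end

lemma forms_map_id:
  assumes C: "is_cinf_ring C" and \<phi>: "cinf_map C C \<phi>" "\<And>a. a \<in> carrier C \<Longrightarrow> \<phi> a = a"
    and x: "x \<in> carrier (gmod (forms C) k)"
  shows "forms_map C C \<phi> k x = x"
proof -
  interpret H: cinf_hom C C \<phi> by (intro cinf_hom.intro C \<phi>)
  show ?thesis using x unfolding forms_simps
    by (induction rule: H.FC.forms_induct) (simp_all add: H.FM_zero H.FM_add H.FM_mult H.FM_form0 H.FM_dl \<phi>(2))
qed

text \<open>Both sides are additive and multiplicative and agree on a and da; a comparison of unions
  over representatives is thereby avoided.\<close>

lemma forms_map_comp: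
  assumes "is_cinf_ring C" "is_cinf_ring D" "is_cinf_ring E" "cinf_map C D \<phi>" "cinf_map D E \<psi>" "cinf_map C E \<theta>"
    and eq: "\<And>a. a \<in> carrier C \<Longrightarrow> \<psi> (\<phi> a) = \<theta> a"
    and x: "x \<in> carrier (gmod (forms C) k)"
  shows "forms_map D E \<psi> k (forms_map C D \<phi> k x) = forms_map C E \<theta> k x"
proof -
  interpret H1: cinf_hom C D \<phi> by (intro cinf_hom.intro assms)
  interpret H2: cinf_hom D E \<psi> by (intro cinf_hom.intro assms)
  interpret H3: cinf_hom C E \<theta> by (intro cinf_hom.intro assms)
  show ?thesis using x unfolding forms_simps
    by (induction rule: H1.FC.forms_induct)
      (simp_all add: H1.FM_zero H1.FM_add H1.FM_mult H1.FM_form0 H1.FM_dl H1.FM_closed cinf_map_closed[OF assms(4)]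
        H2.FM_zero H2.FM_add H2.FM_mult H2.FM_form0 H2.FM_dl H3.FM_zero H3.FM_add H3.FM_mult H3.FM_form0 H3.FM_dl eq)
qed

lemma ring_hom_uminus:
  assumes "ring R" "ring S" and h: "h \<in> ring_hom R S" and a: "a \<in> carrier R"
  shows "h (\<ominus>\<^bsub>R\<^esub> a) = \<ominus>\<^bsub>S\<^esub> h a"
proof -
  interpret R: ring R by fact
  interpret S: ring S by fact
  have "h (\<ominus>\<^bsub>R\<^esub> a) \<oplus>\<^bsub>S\<^esub> h a = \<zero>\<^bsub>S\<^esub>"
    using a ring_hom_add[OF h, of "\<ominus>\<^bsub>R\<^esub> a" a] ring_hom_zero[OF h R.ring_axioms S.ring_axioms] by (simp add: R.l_neg)
  then show ?thesis using ring_hom_closed[OF h] a by (intro S.minus_equality[symmetric]) auto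
qed

section \<open>Germs\<close>

lemma
  assumes P: "is_presheaf X P"
  shows presheaf_closed: "openin X U \<Longrightarrow> openin X V \<Longrightarrow> V \<subseteq> U \<Longrightarrow> s \<in> secs P U \<Longrightarrow> restr P U V s \<in> secs P V"
    and presheaf_id: "openin X U \<Longrightarrow> s \<in> secs P U \<Longrightarrow> restr P U U s = s"
    and presheaf_comp: "openin X U \<Longrightarrow> openin X V \<Longrightarrow> openin X W \<Longrightarrow> W \<subseteq> V \<Longrightarrow> V \<subseteq> U \<Longrightarrow> s \<in> secs P U \<Longrightarrow>
       restr P V W (restr P U V s) = restr P U W s"
proof goal_cases
  note P = P[unfolded is_presheaf_def]
  { case 1 then show ?case using P[THEN conjunct1] by blast }
  { case 2 then show ?case using P[THEN conjunct2, THEN conjunct1] by blast }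
  { case 3 then show ?case using P[THEN conjunct2, THEN conjunct2] by blast }
qed

lemma germ_mem: "(V, t) \<in> germ X P x U s \<longleftrightarrow> openin X V \<and> x \<in> V \<and> t \<in> secs P V \<and>
    (\<exists>W. openin X W \<and> x \<in> W \<and> W \<subseteq> U \<and> W \<subseteq> V \<and> restr P U W s = restr P V W t)"
  by (auto simp: germ_def)

lemma germ_self: "openin X U \<Longrightarrow> x \<in> U \<Longrightarrow> s \<in> secs P U \<Longrightarrow> (U, s) \<in> germ X P x U s"
  by (auto simp: germ_mem)

text \<open>Transitivity of having the same germ: the two neighbourhoods of agreement are
  intersected and all sections are restricted there.\<close>

lemma mem_germ_subset:
  assumes P: "is_presheaf X P" and U: "openin X U" "s \<in> secs P U" and V: "(V, t) \<in> germ X P x U s"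
  shows "germ X P x V t \<subseteq> germ X P x U s"
proof (rule subrelI)
  fix V' t' assume V': "(V', t') \<in> germ X P x V t"
  obtain W where W: "openin X W" "x \<in> W" "W \<subseteq> U" "W \<subseteq> V" "restr P U W s = restr P V W t" and oV: "openin X V" "t \<in> secs P V"
    using V unfolding germ_mem by blast
  obtain W' where W': "openin X W'" "x \<in> W'" "W' \<subseteq> V" "W' \<subseteq> V'" "restr P V W' t = restr P V' W' t'" and oV': "openin X V'" "x \<in> V'" "t' \<in> secs P V'"
    using V' unfolding germ_mem by blast
  let ?W = "W \<inter> W'"
  have o: "openin X ?W" using W W' by auto
  have "restr P U ?W s = restr P W ?W (restr P U W s)"
    by (rule presheaf_comp[OF P U(1) W(1) o _ W(3) U(2), symmetric]) auto
  also have "\<dots> = restr P V ?W t" unfolding W(5)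
    by (rule presheaf_comp[OF P oV(1) W(1) o _ W(4) oV(2)]) auto
  also have "\<dots> = restr P W' ?W (restr P V W' t)"
    by (rule presheaf_comp[OF P oV(1) W'(1) o _ W'(3) oV(2), symmetric]) auto
  also have "\<dots> = restr P V' ?W t'" unfolding W'(5)
    by (rule presheaf_comp[OF P oV'(1) W'(1) o _ W'(4) oV'(3)]) auto
  finally show "(V', t') \<in> germ X P x U s"
    unfolding germ_mem using oV' o W W' by (intro conjI exI[of _ ?W]) auto
qed

lemma mem_germ_eq:
  assumes P: "is_presheaf X P" and U: "openin X U" "x \<in> U" "s \<in> secs P U" and V: "(V, t) \<in> germ X P x U s"
  shows "germ X P x V t = germ X P x U s"
proof
  show "germ X P x V t \<subseteq> germ X P x U s" by (rule mem_germ_subset[OF P U(1,3) V])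
  have "(U, s) \<in> germ X P x V t" "openin X V" "t \<in> secs P V"
    using V U unfolding germ_mem by (auto dest: sym)
  then show "germ X P x U s \<subseteq> germ X P x V t" by (intro mem_germ_subset[OF P])
qed

lemma germ_restr:
  assumes P: "is_presheaf X P" and "openin X U" "openin X W" "x \<in> W" "W \<subseteq> U" "s \<in> secs P U"
  shows "germ X P x W (restr P U W s) = germ X P x U s"
proof (rule mem_germ_eq[OF P])
  show "(W, restr P U W s) \<in> germ X P x U s"
    unfolding germ_mem using assms presheaf_closed[OF P] presheaf_id[OF P]
    by (intro conjI exI[of _ W]) auto
qed (use assms in auto)

section \<open>Sheafification of presheaves of CDGAs\<close>

locale presheaf_of_cdgas =
  fixes X :: "'x topology" and B :: "('x, 'c) cinf_presheaf" and A :: "('x, 'c, 'e) cdga_presheaf"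
  assumes rings: "\<And>U. openin X U \<Longrightarrow> is_cinf_ring (rings B U)"
    and rres_map: "\<And>U V. openin X U \<Longrightarrow> openin X V \<Longrightarrow> V \<subseteq> U \<Longrightarrow> cinf_map (rings B U) (rings B V) (rres B U V)"
    and rres_comp: "\<And>U V W b. openin X U \<Longrightarrow> openin X V \<Longrightarrow> openin X W \<Longrightarrow> W \<subseteq> V \<Longrightarrow> V \<subseteq> U \<Longrightarrow> b \<in> carrier (rings B U) \<Longrightarrow>
      rres B V W (rres B U V b) = rres B U W b"
    and cdga: "\<And>U. openin X U \<Longrightarrow> is_cdga (rings B U) (algs A U)"
    and ares_closed: "\<And>U V k s. openin X U \<Longrightarrow> openin X V \<Longrightarrow> V \<subseteq> U \<Longrightarrow> s \<in> carrier (gmod (algs A U) k) \<Longrightarrow>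
      ares A U V k s \<in> carrier (gmod (algs A V) k)"
    and ares_add: "\<And>U V k s t. openin X U \<Longrightarrow> openin X V \<Longrightarrow> V \<subseteq> U \<Longrightarrow> s \<in> carrier (gmod (algs A U) k) \<Longrightarrow>
      t \<in> carrier (gmod (algs A U) k) \<Longrightarrow> ares A U V k (s \<oplus>\<^bsub>gmod (algs A U) k\<^esub> t) = ares A U V k s \<oplus>\<^bsub>gmod (algs A V) k\<^esub> ares A U V k t"
    and ares_smult: "\<And>U V k b s. openin X U \<Longrightarrow> openin X V \<Longrightarrow> V \<subseteq> U \<Longrightarrow> b \<in> carrier (rings B U) \<Longrightarrow> s \<in> carrier (gmod (algs A U) k) \<Longrightarrow>
      ares A U V k (b \<odot>\<^bsub>gmod (algs A U) k\<^esub> s) = rres B U V b \<odot>\<^bsub>gmod (algs A V) k\<^esub> ares A U V k s"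
    and ares_mult: "\<And>U V k l s t. openin X U \<Longrightarrow> openin X V \<Longrightarrow> V \<subseteq> U \<Longrightarrow> s \<in> carrier (gmod (algs A U) k) \<Longrightarrow>
      t \<in> carrier (gmod (algs A U) l) \<Longrightarrow> ares A U V (k + l) (gmult (algs A U) k l s t) = gmult (algs A V) k l (ares A U V k s) (ares A U V l t)"
    and ares_diff: "\<And>U V k s. openin X U \<Longrightarrow> openin X V \<Longrightarrow> V \<subseteq> U \<Longrightarrow> s \<in> carrier (gmod (algs A U) k) \<Longrightarrow>
      ares A U V (k + 1) (gdiff (algs A U) k s) = gdiff (algs A V) k (ares A U V k s)"
    and ares_id: "\<And>U k s. openin X U \<Longrightarrow> s \<in> carrier (gmod (algs A U) k) \<Longrightarrow> ares A U U k s = s"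
    and ares_comp: "\<And>U V W k s. openin X U \<Longrightarrow> openin X V \<Longrightarrow> openin X W \<Longrightarrow> W \<subseteq> V \<Longrightarrow> V \<subseteq> U \<Longrightarrow> s \<in> carrier (gmod (algs A U) k) \<Longrightarrow>
      ares A V W k (ares A U V k s) = ares A U W k s"
begin

abbreviation "RA U \<equiv> alg (rings B U)"
abbreviation "M U k \<equiv> gmod (algs A U) k"
abbreviation "P k \<equiv> degree_presheaf A k"
abbreviation "SM V k \<equiv> gmod (algs (sheafify X B A) V) k"

lemma P_simps [simp]: "secs (P k) U = carrier (M U k)" "restr (P k) U V = ares A U V k"
  by (simp_all add: degree_presheaf_def)

lemma P_presheaf: "is_presheaf X (P k)"
  unfolding is_presheaf_def using ares_closed ares_id ares_comp by auto

lemma galg: "openin X U \<Longrightarrow> graded_algebra (RA U) (algs A U)"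
  and gcomm: "openin X U \<Longrightarrow> x \<in> carrier (M U k) \<Longrightarrow> y \<in> carrier (M U l) \<Longrightarrow>
       gmult (algs A U) k l x y = gsign (M U (k + l)) (k * l) (gmult (algs A U) l k y x)"
  and gd: "openin X U \<Longrightarrow> differential (rings B U) (algs A U) (gdiff (algs A U))"
  using cdga[unfolded is_cdga_def cga_iff] by blast+

lemma M_module: "openin X U \<Longrightarrow> Module.module (RA U) (M U k)"
  using graded_algebra.gmod_module[OF galg] .

lemma ares_zero:
  assumes "openin X U" "openin X V" "V \<subseteq> U"
  shows "ares A U V k \<zero>\<^bsub>M U k\<^esub> = \<zero>\<^bsub>M V k\<^esub>"
proof -
  interpret U: Module.module "RA U" "M U k" by (rule M_module[OF assms(1)])
  interpret V: Module.module "RA V" "M V k" by (rule M_module[OF assms(2)])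
  have c: "ares A U V k \<zero>\<^bsub>M U k\<^esub> \<in> carrier (M V k)" by (rule ares_closed[OF assms]) simp
  have "ares A U V k \<zero>\<^bsub>M U k\<^esub> = ares A U V k \<zero>\<^bsub>M U k\<^esub> \<oplus>\<^bsub>M V k\<^esub> ares A U V k \<zero>\<^bsub>M U k\<^esub>"
    using ares_add[OF assms U.zero_closed U.zero_closed] by simp
  then show ?thesis using c by (metis V.M.add.l_cancel_one)
qed

text \<open>An operation that commutes with restriction is well defined on germs: any other common
  pair of representatives agrees with the given one near \<open>y\<close>, so all germs in the union
  are the same.\<close>

lemma op2_germ:
  assumes op: "\<And>U W s t. openin X U \<Longrightarrow> openin X W \<Longrightarrow> W \<subseteq> U \<Longrightarrow> s \<in> carrier (M U k) \<Longrightarrow> t \<in> carrier (M U l) \<Longrightarrow>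
      f U s t \<in> carrier (M U m) \<and> ares A U W m (f U s t) = f W (ares A U W k s) (ares A U W l t)"
    and U: "openin X U" "y \<in> U" "s \<in> carrier (M U k)" "t \<in> carrier (M U l)"
  shows "\<Union>{germ X (P m) y U' (f U' s' t') | U' s' t'. (U', s') \<in> germ X (P k) y U s \<and> (U', t') \<in> germ X (P l) y U t}
     = germ X (P m) y U (f U s t)"
proof -
  have "germ X (P m) y U' (f U' s' t') = germ X (P m) y U (f U s t)"
    if mem: "(U', s') \<in> germ X (P k) y U s" "(U', t') \<in> germ X (P l) y U t" for U' s' t'
  proof -
    obtain W1 where W1: "openin X W1" "y \<in> W1" "W1 \<subseteq> U" "W1 \<subseteq> U'" "ares A U W1 k s = ares A U' W1 k s'"
      and U': "openin X U'" "y \<in> U'" "s' \<in> carrier (M U' k)"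
      using mem(1) unfolding germ_mem P_simps by blast
    obtain W2 where W2: "openin X W2" "y \<in> W2" "W2 \<subseteq> U" "W2 \<subseteq> U'" "ares A U W2 l t = ares A U' W2 l t'"
      and t': "t' \<in> carrier (M U' l)"
      using mem(2) unfolding germ_mem P_simps by blast
    \<comment> \<open>The two operands may agree with their replacements on different
      neighbourhoods.\<close>
    let ?W = "W1 \<inter> W2"
    have o: "openin X ?W" using W1 W2 by auto
    have s: "ares A U ?W k s = ares A U' ?W k s'"
      using ares_comp[OF U(1) W1(1) o _ W1(3) U(3)] ares_comp[OF U'(1) W1(1) o _ W1(4) U'(3)] W1(5) by simp
    have t: "ares A U ?W l t = ares A U' ?W l t'"
      using ares_comp[OF U(1) W2(1) o _ W2(3) U(4)] ares_comp[OF U'(1) W2(1) o _ W2(4) t'] W2(5) by simp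
    have "?W \<subseteq> U" "?W \<subseteq> U'" "y \<in> ?W" using W1 W2 by auto
    then have "ares A U ?W m (f U s t) = ares A U' ?W m (f U' s' t')"
      using op[OF U(1) o _ U(3,4)] op[OF U'(1) o _ U'(3) t'] s t by simp
    then have "(U', f U' s' t') \<in> germ X (P m) y U (f U s t)"
      unfolding germ_mem P_simps using U' op[OF U'(1) U'(1) _ U'(3) t'] o \<open>?W \<subseteq> U\<close> \<open>?W \<subseteq> U'\<close> \<open>y \<in> ?W\<close> by blast
    then show ?thesis using U op[OF U(1,1) _ U(3,4)] by (intro mem_germ_eq[OF P_presheaf]) auto
  qed
  moreover have "(U, s) \<in> germ X (P k) y U s" "(U, t) \<in> germ X (P l) y U t" using U by (auto intro: germ_self)
  ultimately have "{germ X (P m) y U' (f U' s' t') | U' s' t'. (U', s') \<in> germ X (P k) y U s \<and> (U', t') \<in> germ X (P l) y U t}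
     = {germ X (P m) y U (f U s t)}" by blast
  then show ?thesis by simp
qed

text \<open>The predicate \<open>Q\<close> restricts the open sets of the representatives. It is
  there for scalar multiplication by a section over \<open>V\<close>, which makes sense on subsets
  of \<open>V\<close> only.\<close>

lemma op1_germ:
  assumes op: "\<And>U W s. openin X U \<Longrightarrow> openin X W \<Longrightarrow> W \<subseteq> U \<Longrightarrow> Q U \<Longrightarrow> s \<in> carrier (M U k) \<Longrightarrow>
      f U s \<in> carrier (M U m) \<and> ares A U W m (f U s) = f W (ares A U W k s)"
    and U: "openin X U" "y \<in> U" "s \<in> carrier (M U k)" "Q U"
  shows "\<Union>{germ X (P m) y U' (f U' s') | U' s'. (U', s') \<in> germ X (P k) y U s \<and> Q U'} = germ X (P m) y U (f U s)"
proof -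
  have "germ X (P m) y U' (f U' s') = germ X (P m) y U (f U s)"
    if mem: "(U', s') \<in> germ X (P k) y U s" "Q U'" for U' s'
  proof -
    obtain W where W: "openin X W" "y \<in> W" "W \<subseteq> U" "W \<subseteq> U'" "ares A U W k s = ares A U' W k s'"
      and U': "openin X U'" "y \<in> U'" "s' \<in> carrier (M U' k)"
      using mem(1) unfolding germ_mem P_simps by blast
    have "ares A U W m (f U s) = ares A U' W m (f U' s')"
      using op[OF U(1) W(1,3) U(4,3)] op[OF U'(1) W(1,4) mem(2) U'(3)] W(5) by simp
    then have "(U', f U' s') \<in> germ X (P m) y U (f U s)"
      unfolding germ_mem P_simps using U' op[OF U'(1) U'(1) _ mem(2) U'(3)] W by blast
    then show ?thesis using U op[OF U(1,1) _ U(4,3)] by (intro mem_germ_eq[OF P_presheaf]) auto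
  qed
  moreover have "(U, s) \<in> germ X (P k) y U s" using U by (auto intro: germ_self)
  ultimately have "{germ X (P m) y U' (f U' s') | U' s'. (U', s') \<in> germ X (P k) y U s \<and> Q U'}
     = {germ X (P m) y U (f U s)}" using U(4) by blast
  then show ?thesis by simp
qed

text \<open>The domain of \<sigma> does not occur, so one pair \<open>U\<close>, \<open>s\<close>
  serves a section and all its restrictions to sets containing \<open>U\<close>.\<close>

definition lrep :: "int \<Rightarrow> ('x \<Rightarrow> ('x set \<times> 'e) set) \<Rightarrow> 'x set \<Rightarrow> 'e \<Rightarrow> bool"
  where "lrep k \<sigma> U s \<longleftrightarrow> openin X U \<and> s \<in> carrier (M U k) \<and> (\<forall>y\<in>U. \<sigma> y = germ X (P k) y U s)"

lemma lrep_restrict: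
  assumes "lrep k \<sigma> U s" "openin X W" "W \<subseteq> U"
  shows "lrep k \<sigma> W (ares A U W k s)"
  using assms germ_restr[OF P_presheaf, of U W _ s k] by (auto simp: lrep_def ares_closed subset_iff)

lemma SM_carrier: "\<sigma> \<in> carrier (SM V k) \<longleftrightarrow> \<sigma> \<in> extensional V \<and> (\<forall>x\<in>V. \<exists>U s. x \<in> U \<and> U \<subseteq> V \<and> lrep k \<sigma> U s)"
  unfolding sheafify_def sheafified_secs_def lrep_def by simp blast

lemma SM_rep: "\<sigma> \<in> carrier (SM V k) \<Longrightarrow> x \<in> V \<Longrightarrow> \<exists>U s. x \<in> U \<and> U \<subseteq> V \<and> lrep k \<sigma> U s"
  by (simp add: SM_carrier)

lemma SM_rep2:
  assumes "\<sigma> \<in> carrier (SM V k)" "\<tau> \<in> carrier (SM V l)" "x \<in> V"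
  shows "\<exists>U s t. openin X U \<and> x \<in> U \<and> U \<subseteq> V \<and> lrep k \<sigma> U s \<and> lrep l \<tau> U t"
proof -
  obtain U1 s where 1: "x \<in> U1" "U1 \<subseteq> V" "lrep k \<sigma> U1 s" using SM_rep[OF assms(1,3)] by blast
  obtain U2 t where 2: "x \<in> U2" "U2 \<subseteq> V" "lrep l \<tau> U2 t" using SM_rep[OF assms(2,3)] by blast
  have o: "openin X (U1 \<inter> U2)" using 1 2 by (auto simp: lrep_def)
  show ?thesis
    using lrep_restrict[OF 1(3) o] lrep_restrict[OF 2(3) o] o 1 2 by blast
qed

lemma SM_rep3:
  assumes "\<sigma> \<in> carrier (SM V k)" "\<tau> \<in> carrier (SM V l)" "\<rho> \<in> carrier (SM V m)" "x \<in> V"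
  shows "\<exists>U s t r. openin X U \<and> x \<in> U \<and> U \<subseteq> V \<and> lrep k \<sigma> U s \<and> lrep l \<tau> U t \<and> lrep m \<rho> U r"
proof -
  obtain U1 s t where 1: "openin X U1" "x \<in> U1" "U1 \<subseteq> V" "lrep k \<sigma> U1 s" "lrep l \<tau> U1 t" using SM_rep2[OF assms(1,2,4)] by blast
  obtain U2 r where 2: "x \<in> U2" "U2 \<subseteq> V" "lrep m \<rho> U2 r" using SM_rep[OF assms(3,4)] by blast
  have o: "openin X (U1 \<inter> U2)" using 1 2 by (auto simp: lrep_def)
  show ?thesis
    using lrep_restrict[OF 1(4) o] lrep_restrict[OF 1(5) o] lrep_restrict[OF 2(3) o] o 1 2 by blast
qed

lemma SM_eqI:
  assumes "\<sigma> \<in> extensional V" "\<tau> \<in> extensional V" "\<And>x. x \<in> V \<Longrightarrow> \<exists>U s. x \<in> U \<and> lrep k \<sigma> U s \<and> lrep k \<tau> U s"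
  shows "\<sigma> = \<tau>"
  by (rule extensionalityI[OF assms(1,2)]) (use assms(3) in \<open>force simp: lrep_def\<close>)

lemma SM_ext: "\<sigma> \<in> carrier (SM V k) \<Longrightarrow> \<sigma> \<in> extensional V"
  by (simp add: SM_carrier)

abbreviation "smul V k l \<equiv> gmult (algs (sheafify X B A) V) k l"
abbreviation "sd V k \<equiv> gdiff (algs (sheafify X B A) V) k"

section \<open>Local representatives of the operations on the sheafification\<close>

lemma SM_ops_ext [simp]: "\<sigma> \<oplus>\<^bsub>SM V k\<^esub> \<tau> \<in> extensional V" "b \<odot>\<^bsub>SM V k\<^esub> \<sigma> \<in> extensional V" "\<zero>\<^bsub>SM V k\<^esub> \<in> extensional V"
  "smul V k l \<sigma> \<tau> \<in> extensional V" "sd V k \<sigma> \<in> extensional V"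
  by (simp_all add: sheafify_def)

lemma lrep_zero:
  assumes "openin X V" "openin X U" "U \<subseteq> V"
  shows "lrep k \<zero>\<^bsub>SM V k\<^esub> U \<zero>\<^bsub>M U k\<^esub>"
proof -
  interpret V: Module.module "RA V" "M V k" by (rule M_module[OF assms(1)])
  interpret U: Module.module "RA U" "M U k" by (rule M_module[OF assms(2)])
  have "germ X (P k) y V \<zero>\<^bsub>M V k\<^esub> = germ X (P k) y U \<zero>\<^bsub>M U k\<^esub>" if "y \<in> U" for y
    using germ_restr[OF P_presheaf assms(1,2) that assms(3), of "\<zero>\<^bsub>M V k\<^esub>" k] ares_zero[OF assms] by simp
  then show ?thesis using assms by (auto simp: lrep_def sheafify_def)
qed

lemma lrep_add:
  assumes "U \<subseteq> V" "lrep k \<sigma> U s" "lrep k \<tau> U t"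
  shows "lrep k (\<sigma> \<oplus>\<^bsub>SM V k\<^esub> \<tau>) U (s \<oplus>\<^bsub>M U k\<^esub> t)"
proof -
  have U: "openin X U" "s \<in> carrier (M U k)" "t \<in> carrier (M U k)" using assms by (auto simp: lrep_def)
  have c: "x \<oplus>\<^bsub>M W k\<^esub> y \<in> carrier (M W k)" if "openin X W" "x \<in> carrier (M W k)" "y \<in> carrier (M W k)" for W x y
  proof -
    interpret W: Module.module "RA W" "M W k" by (rule M_module[OF that(1)])
    show ?thesis using that by simp
  qed
  have "(\<sigma> \<oplus>\<^bsub>SM V k\<^esub> \<tau>) y = germ X (P k) y U (s \<oplus>\<^bsub>M U k\<^esub> t)" if "y \<in> U" for y
    using that assms op2_germ[of k k "\<lambda>U s t. s \<oplus>\<^bsub>M U k\<^esub> t" k U y s t] U by (auto simp: sheafify_def lrep_def c ares_add)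
  then show ?thesis using U c by (simp add: lrep_def)
qed

lemma lrep_smult:
  assumes "openin X V" "U \<subseteq> V" "lrep k \<sigma> U s" "b \<in> carrier (rings B V)"
  shows "lrep k (b \<odot>\<^bsub>SM V k\<^esub> \<sigma>) U (rres B V U b \<odot>\<^bsub>M U k\<^esub> s)"
proof -
  have U: "openin X U" "s \<in> carrier (M U k)" using assms by (auto simp: lrep_def)
  have r: "rres B V W b \<in> carrier (rings B W)" if "openin X W" "W \<subseteq> V" for W
    using cinf_map_closed[OF rres_map[OF assms(1) that] assms(4)] .
  have c: "rres B V W b \<odot>\<^bsub>M W k\<^esub> x \<in> carrier (M W k)" if "openin X W" "x \<in> carrier (M W k)" "W \<subseteq> V" for W x
  proof -
    interpret W: Module.module "RA W" "M W k" by (rule M_module[OF that(1)])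
    show ?thesis using that r by (simp add: alg_simps)
  qed
  have "\<Union>{germ X (P k) y U' (rres B V U' b \<odot>\<^bsub>M U' k\<^esub> s') | U' s'. (U', s') \<in> germ X (P k) y U s \<and> U' \<subseteq> V}
      = germ X (P k) y U (rres B V U b \<odot>\<^bsub>M U k\<^esub> s)" if "y \<in> U" for y
  proof (rule op1_germ)
    fix U' W s' assume *: "openin X U'" "openin X W" "W \<subseteq> U'" "U' \<subseteq> V" "s' \<in> carrier (M U' k)"
    show "rres B V U' b \<odot>\<^bsub>M U' k\<^esub> s' \<in> carrier (M U' k) \<and>
       ares A U' W k (rres B V U' b \<odot>\<^bsub>M U' k\<^esub> s') = rres B V W b \<odot>\<^bsub>M W k\<^esub> ares A U' W k s'"
      using * c[of U' s'] ares_smult[OF *(1-3) r[OF *(1,4)] *(5)] rres_comp[OF assms(1) *(1,2,3,4) assms(4)] by simp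
  qed (use U that assms(2) in auto)
  then have "(b \<odot>\<^bsub>SM V k\<^esub> \<sigma>) y = germ X (P k) y U (rres B V U b \<odot>\<^bsub>M U k\<^esub> s)" if "y \<in> U" for y
    using that assms(2,3) by (auto simp: sheafify_def lrep_def)
  then show ?thesis using U c assms(2) by (simp add: lrep_def)
qed

lemma lrep_mult:
  assumes "U \<subseteq> V" "lrep k \<sigma> U s" "lrep l \<tau> U t"
  shows "lrep (k + l) (smul V k l \<sigma> \<tau>) U (gmult (algs A U) k l s t)"
proof -
  have U: "openin X U" "s \<in> carrier (M U k)" "t \<in> carrier (M U l)" using assms by (auto simp: lrep_def)
  have c: "gmult (algs A W) k l x y \<in> carrier (M W (k + l))" if "openin X W" "x \<in> carrier (M W k)" "y \<in> carrier (M W l)" for W x y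
    by (rule graded_algebra.gmult_closed[OF galg[OF that(1)] that(2,3)])
  have "(smul V k l \<sigma> \<tau>) y = germ X (P (k + l)) y U (gmult (algs A U) k l s t)" if "y \<in> U" for y
    using that assms op2_germ[of k l "\<lambda>U s t. gmult (algs A U) k l s t" "k + l" U y s t] U by (auto simp: sheafify_def lrep_def c ares_mult)
  then show ?thesis using U c by (simp add: lrep_def)
qed

lemma lrep_diff:
  assumes "U \<subseteq> V" "lrep k \<sigma> U s"
  shows "lrep (k + 1) (sd V k \<sigma>) U (gdiff (algs A U) k s)"
proof -
  have U: "openin X U" "s \<in> carrier (M U k)" using assms by (auto simp: lrep_def)
  have c: "gdiff (algs A W) k x \<in> carrier (M W (k + 1))" if "openin X W" "x \<in> carrier (M W k)" for W x
    by (rule diff_closed[OF gd[OF that(1)] that(2)])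
  have "(sd V k \<sigma>) y = germ X (P (k + 1)) y U (gdiff (algs A U) k s)" if "y \<in> U" for y
    using that assms op1_germ[of "\<lambda>U. True" k "\<lambda>U s. gdiff (algs A U) k s" "k + 1" U y s] U by (auto simp: sheafify_def lrep_def c ares_diff)
  then show ?thesis using U c by (simp add: lrep_def)
qed

lemma SM_closed:
  assumes V: "openin X V"
  shows "\<zero>\<^bsub>SM V k\<^esub> \<in> carrier (SM V k)"
    and "\<sigma> \<in> carrier (SM V k) \<Longrightarrow> \<tau> \<in> carrier (SM V k) \<Longrightarrow> \<sigma> \<oplus>\<^bsub>SM V k\<^esub> \<tau> \<in> carrier (SM V k)"
    and "b \<in> carrier (rings B V) \<Longrightarrow> \<sigma> \<in> carrier (SM V k) \<Longrightarrow> b \<odot>\<^bsub>SM V k\<^esub> \<sigma> \<in> carrier (SM V k)"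
    and "\<sigma> \<in> carrier (SM V k) \<Longrightarrow> \<rho> \<in> carrier (SM V l) \<Longrightarrow> smul V k l \<sigma> \<rho> \<in> carrier (SM V (k + l))"
    and "\<sigma> \<in> carrier (SM V k) \<Longrightarrow> sd V k \<sigma> \<in> carrier (SM V (k + 1))"
proof goal_cases
  case 1
  show ?case using lrep_zero[OF V V] V by (auto simp: SM_carrier)
next
  case 2
  then show ?case unfolding SM_carrier[of "_ \<oplus>\<^bsub>_\<^esub> _"] using SM_rep2[of \<sigma> V k \<tau> k] lrep_add SM_ops_ext by meson
next
  case 3
  then show ?case unfolding SM_carrier[of "_ \<odot>\<^bsub>_\<^esub> _"] using SM_rep[of \<sigma> V k] lrep_smult[OF V] SM_ops_ext by meson
next
  case 4
  then show ?case unfolding SM_carrier[of "smul V k l _ _"] using SM_rep2[of \<sigma> V k \<rho> l] lrep_mult SM_ops_ext by meson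
next
  case 5
  then show ?case unfolding SM_carrier[of "sd V k _"] using SM_rep[of \<sigma> V k] lrep_diff SM_ops_ext by meson
qed

text \<open>Together with the rules for \<open>lrep\<close> this turns each axiom for the
  sheafification into the same axiom over small open sets \<open>U\<close>; the versions with two
  and three arguments first pass to a common \<open>U\<close>.\<close>

lemma SM_eqI1:
  assumes \<sigma>: "\<sigma> \<in> carrier (SM V k)" and e: "\<alpha> \<in> extensional V" "\<beta> \<in> extensional V"
    and "\<And>U s. openin X U \<Longrightarrow> U \<subseteq> V \<Longrightarrow> lrep k \<sigma> U s \<Longrightarrow> s \<in> carrier (M U k) \<Longrightarrow> \<exists>a. lrep p \<alpha> U a \<and> lrep p \<beta> U a"
  shows "\<alpha> = \<beta>"
proof (rule SM_eqI[OF e])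
  fix x assume "x \<in> V"
  then obtain U s where *: "x \<in> U" "U \<subseteq> V" "lrep k \<sigma> U s"
    using SM_rep[OF \<sigma>] by blast
  have "\<exists>a. lrep p \<alpha> U a \<and> lrep p \<beta> U a"
    using * by (intro assms(4)) (auto simp: lrep_def)
  then show "\<exists>U s. x \<in> U \<and> lrep p \<alpha> U s \<and> lrep p \<beta> U s" using *(1) by blast
qed

lemma SM_eqI2:
  assumes \<sigma>: "\<sigma> \<in> carrier (SM V k)" "\<tau> \<in> carrier (SM V l)" and e: "\<alpha> \<in> extensional V" "\<beta> \<in> extensional V"
    and "\<And>U s t. openin X U \<Longrightarrow> U \<subseteq> V \<Longrightarrow> lrep k \<sigma> U s \<Longrightarrow> lrep l \<tau> U t \<Longrightarrow> s \<in> carrier (M U k) \<Longrightarrow>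
      t \<in> carrier (M U l) \<Longrightarrow> \<exists>a. lrep p \<alpha> U a \<and> lrep p \<beta> U a"
  shows "\<alpha> = \<beta>"
proof (rule SM_eqI[OF e])
  fix x assume "x \<in> V"
  then obtain U s t where *: "x \<in> U" "U \<subseteq> V" "lrep k \<sigma> U s" "lrep l \<tau> U t"
    using SM_rep2[OF \<sigma>] by blast
  have "\<exists>a. lrep p \<alpha> U a \<and> lrep p \<beta> U a"
    using * by (intro assms(5)) (auto simp: lrep_def)
  then show "\<exists>U s. x \<in> U \<and> lrep p \<alpha> U s \<and> lrep p \<beta> U s" using *(1) by blast
qed

lemma SM_eqI3:
  assumes \<sigma>: "\<sigma> \<in> carrier (SM V k)" "\<tau> \<in> carrier (SM V l)" "\<rho> \<in> carrier (SM V m)"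
    and e: "\<alpha> \<in> extensional V" "\<beta> \<in> extensional V"
    and "\<And>U s t r. openin X U \<Longrightarrow> U \<subseteq> V \<Longrightarrow> lrep k \<sigma> U s \<Longrightarrow> lrep l \<tau> U t \<Longrightarrow> lrep m \<rho> U r \<Longrightarrow> s \<in> carrier (M U k) \<Longrightarrow>
      t \<in> carrier (M U l) \<Longrightarrow> r \<in> carrier (M U m) \<Longrightarrow> \<exists>a. lrep p \<alpha> U a \<and> lrep p \<beta> U a"
  shows "\<alpha> = \<beta>"
proof (rule SM_eqI[OF e])
  fix x assume "x \<in> V"
  from SM_rep3[OF \<sigma> this] obtain U s t r where *: "x \<in> U" "U \<subseteq> V" "lrep k \<sigma> U s" "lrep l \<tau> U t" "lrep m \<rho> U r"
    by (elim exE conjE)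
  have "\<exists>a. lrep p \<alpha> U a \<and> lrep p \<beta> U a"
    using * by (intro assms(6)) (auto simp: lrep_def)
  then show "\<exists>U s. x \<in> U \<and> lrep p \<alpha> U s \<and> lrep p \<beta> U s" using *(1) by blast
qed

lemma lrep_eqI: "lrep p \<alpha> U a \<Longrightarrow> lrep p \<beta> U b \<Longrightarrow> a = b \<Longrightarrow> \<exists>a. lrep p \<alpha> U a \<and> lrep p \<beta> U a"
  by blast

lemma SM_module:
  assumes V: "openin X V"
  shows "Module.module (RA V) (SM V k)"
proof -
  interpret RV: cring "RA V" by (rule cring_alg[OF rings[OF V]])
  note cl = SM_closed[OF V]
  note hom = cinf_map_ring_hom[OF rres_map[OF V]]
  have cC: "carrier (RA U) = carrier (rings B U)" for U by (simp add: alg_simps)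
  have m1: "\<ominus>\<^bsub>RA V\<^esub> \<one>\<^bsub>RA V\<^esub> \<in> carrier (rings B V)" using RV.a_inv_closed[OF RV.one_closed] by (simp add: cC)
  show ?thesis
  proof (intro moduleI abelian_groupI RV.cring_axioms, goal_cases)
    case (1 x y)
    then show ?case by (rule cl(2))
  next
    case 2
    show ?case by (rule cl(1))
  next
    case (3 x y z)
    show ?case
    proof (rule SM_eqI3[OF 3, where p = k], simp, simp, goal_cases)
      case *: (1 U s t r)
      interpret U: Module.module "RA U" "M U k" by (rule M_module[OF *(1)])
      show ?case
        by (rule lrep_eqI[OF lrep_add[OF *(2) lrep_add[OF *(2,3,4)] *(5)] lrep_add[OF *(2,3) lrep_add[OF *(2,4,5)]]]) (use * in \<open>simp add: U.M.a_assoc\<close>)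
    qed
  next
    case (4 x y)
    show ?case
    proof (rule SM_eqI2[OF 4, where p = k], simp, simp, goal_cases)
      case *: (1 U s t)
      interpret U: Module.module "RA U" "M U k" by (rule M_module[OF *(1)])
      show ?case
        by (rule lrep_eqI[OF lrep_add[OF *(2,3,4)] lrep_add[OF *(2,4,3)]]) (use * in \<open>simp add: U.M.a_comm\<close>)
    qed
  next
    case (5 x)
    show ?case
    proof (rule SM_eqI1[OF 5, where p = k], simp, rule SM_ext[OF 5], goal_cases)
      case *: (1 U s)
      interpret U: Module.module "RA U" "M U k" by (rule M_module[OF *(1)])
      show ?case
        by (rule lrep_eqI[OF lrep_add[OF *(2) lrep_zero[OF V *(1,2)] *(3)] *(3)]) (use * in simp)
    qed
  next
    case (6 x)
    \<comment> \<open>No negative is defined on families of germs; multiplication by -1 supplies the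
      additive inverse, and restriction maps preserve -1.\<close>
    let ?m = "\<ominus>\<^bsub>RA V\<^esub> \<one>\<^bsub>RA V\<^esub>"
    have "?m \<odot>\<^bsub>SM V k\<^esub> x \<oplus>\<^bsub>SM V k\<^esub> x = \<zero>\<^bsub>SM V k\<^esub>"
    proof (rule SM_eqI1[OF 6, where p = k], simp, simp, goal_cases)
      case *: (1 U s)
      interpret U: Module.module "RA U" "M U k" by (rule M_module[OF *(1)])
      have "rres B V U ?m = \<ominus>\<^bsub>RA U\<^esub> \<one>\<^bsub>RA U\<^esub>"
        by (simp add: ring_hom_uminus[OF RV.ring_axioms U.R.ring_axioms hom[OF *(1,2)]] ring_hom_one[OF hom[OF *(1,2)]])
      then show ?case
        by (intro lrep_eqI[OF lrep_add[OF *(2) lrep_smult[OF V *(2,3) m1] *(3)] lrep_zero[OF V *(1,2)]])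
          (use * in \<open>simp add: U.smult_l_minus U.M.l_neg\<close>)
    qed
    then show ?case using cl(3)[OF m1 6] by blast
  next
    case (7 a x)
    then show ?case using cl(3) by (simp add: cC)
  next
    case (8 a b x)
    then have ab: "a \<in> carrier (rings B V)" "b \<in> carrier (rings B V)" "a \<oplus>\<^bsub>RA V\<^esub> b \<in> carrier (rings B V)"
      using RV.a_closed[of a b] by (auto simp: cC)
    show ?case
    proof (rule SM_eqI1[OF 8(3), where p = k], simp, simp, goal_cases)
      case *: (1 U s)
      interpret U: Module.module "RA U" "M U k" by (rule M_module[OF *(1)])
      show ?case
        by (rule lrep_eqI[OF lrep_smult[OF V *(2,3) ab(3)] lrep_add[OF *(2) lrep_smult[OF V *(2,3) ab(1)] lrep_smult[OF V *(2,3) ab(2)]]])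
          (use 8 * ring_hom_closed[OF hom[OF *(1,2)]] in \<open>simp add: ring_hom_add[OF hom[OF *(1,2)]] U.smult_l_distr\<close>)
    qed
  next
    case (9 a x y)
    then have a: "a \<in> carrier (rings B V)" by (simp add: cC)
    show ?case
    proof (rule SM_eqI2[OF 9(2,3), where p = k], simp, simp, goal_cases)
      case *: (1 U s t)
      interpret U: Module.module "RA U" "M U k" by (rule M_module[OF *(1)])
      show ?case
        by (rule lrep_eqI[OF lrep_smult[OF V *(2) lrep_add[OF *(2,3,4)] a] lrep_add[OF *(2) lrep_smult[OF V *(2,3) a] lrep_smult[OF V *(2,4) a]]])
          (use 9 * ring_hom_closed[OF hom[OF *(1,2)]] in \<open>simp add: U.smult_r_distr\<close>)
    qed
  next
    case (10 a b x)
    then have ab: "a \<in> carrier (rings B V)" "b \<in> carrier (rings B V)" "a \<otimes>\<^bsub>RA V\<^esub> b \<in> carrier (rings B V)"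
      using RV.m_closed[of a b] by (auto simp: cC)
    show ?case
    proof (rule SM_eqI1[OF 10(3), where p = k], simp, simp, goal_cases)
      case *: (1 U s)
      interpret U: Module.module "RA U" "M U k" by (rule M_module[OF *(1)])
      show ?case
        by (rule lrep_eqI[OF lrep_smult[OF V *(2,3) ab(3)] lrep_smult[OF V *(2) lrep_smult[OF V *(2,3) ab(2)] ab(1)]])
          (use 10 * ring_hom_closed[OF hom[OF *(1,2)]] in \<open>simp add: ring_hom_mult[OF hom[OF *(1,2)]] U.smult_assoc1\<close>)
    qed
  next
    case (11 x)
    have a: "\<one>\<^bsub>RA V\<^esub> \<in> carrier (rings B V)" using RV.one_closed by (simp add: cC)
    show ?case
    proof (rule SM_eqI1[OF 11, where p = k], simp, rule SM_ext[OF 11], goal_cases)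
      case *: (1 U s)
      interpret U: Module.module "RA U" "M U k" by (rule M_module[OF *(1)])
      show ?case
        by (rule lrep_eqI[OF lrep_smult[OF V *(2,3) a] *(3)])
          (use * in \<open>simp add: ring_hom_one[OF hom[OF *(1,2)]]\<close>)
    qed
  qed
qed

text \<open>The negative in \<open>SM V k\<close> is characterized only as an inverse, so it is
  rewritten as multiplication by -1, for which representatives are known.\<close>

lemma lrep_gsign:
  assumes V: "openin X V" and U: "U \<subseteq> V" and \<sigma>: "\<sigma> \<in> carrier (SM V k)" "lrep k \<sigma> U s"
  shows "lrep k (gsign (SM V k) j \<sigma>) U (gsign (M U k) j s)"
proof (cases "even j")
  case False
  have oU: "openin X U" and s: "s \<in> carrier (M U k)" using \<sigma>(2) by (auto simp: lrep_def)
  interpret V: Module.module "RA V" "SM V k" by (rule SM_module[OF V])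
  interpret U: Module.module "RA U" "M U k" by (rule M_module[OF oU])
  note hom = cinf_map_ring_hom[OF rres_map[OF V oU U]]
  let ?m = "\<ominus>\<^bsub>RA V\<^esub> \<one>\<^bsub>RA V\<^esub>"
  have m1: "?m \<in> carrier (rings B V)" using V.R.a_inv_closed[OF V.R.one_closed] by (simp add: alg_simps)
  have "\<ominus>\<^bsub>SM V k\<^esub> \<sigma> = ?m \<odot>\<^bsub>SM V k\<^esub> \<sigma>" "\<ominus>\<^bsub>M U k\<^esub> s = rres B V U ?m \<odot>\<^bsub>M U k\<^esub> s"
    using \<sigma>(1) s by (simp_all add: V.smult_l_minus U.smult_l_minus ring_hom_one[OF hom]
      ring_hom_uminus[OF V.R.ring_axioms U.R.ring_axioms hom])
  then show ?thesis using lrep_smult[OF V U \<sigma>(2) m1] False by (simp add: gsign_def)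
qed (use \<sigma> in \<open>simp add: gsign_def\<close>)

lemma gsign_ext: "openin X V \<Longrightarrow> \<sigma> \<in> carrier (SM V k) \<Longrightarrow> gsign (SM V k) j \<sigma> \<in> extensional V"
  using gsign_closed[OF SM_module] SM_ext by blast

lemma is_cdga_sheafify:
  assumes V: "openin X V"
  shows "is_cdga (rings B V) (algs (sheafify X B A) V)"
  unfolding is_cdga_def cga_iff
proof (intro conjI)
  note cl = SM_closed[OF V]
  have cC: "carrier (RA U) = carrier (rings B U)" for U by (simp add: alg_simps)
  note hom = ring_hom_closed[OF cinf_map_ring_hom[OF rres_map[OF V]]]
  show "graded_algebra (RA V) (algs (sheafify X B A) V)"
  proof (intro graded_algebra.intro SM_module[OF V] cl(4), goal_cases)
    case (1 k l x y)
    then show ?case by simp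
  next
    case (2 k l x y)
    then show ?case by simp
  next
    case (3 k l x x' y)
    show ?case
    proof (rule SM_eqI3[OF 3, where p = "k + l"], simp, simp, goal_cases)
      case *: (1 U s t r)
      interpret U: graded_algebra "RA U" "algs A U" by (rule galg[OF *(1)])
      show ?case
        by (rule lrep_eqI[OF lrep_mult[OF *(2) lrep_add[OF *(2,3,4)] *(5)] lrep_add[OF *(2) lrep_mult[OF *(2,3,5)] lrep_mult[OF *(2,4,5)]]]) (use * in \<open>simp add: U.gmult_add_l\<close>)
    qed
  next
    case (4 k l x y y')
    show ?case
    proof (rule SM_eqI3[OF 4, where p = "k + l"], simp, simp, goal_cases)
      case *: (1 U s t r)
      interpret U: graded_algebra "RA U" "algs A U" by (rule galg[OF *(1)])
      show ?case
        by (rule lrep_eqI[OF lrep_mult[OF *(2,3) lrep_add[OF *(2,4,5)]] lrep_add[OF *(2) lrep_mult[OF *(2,3,4)] lrep_mult[OF *(2,3,5)]]]) (use * in \<open>simp add: U.gmult_add_r\<close>)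
    qed
  next
    case (5 k l a x y)
    then have a: "a \<in> carrier (rings B V)" by (simp add: cC)
    show ?case
    proof (rule SM_eqI2[OF 5(2,3), where p = "k + l"], simp, simp, goal_cases)
      case *: (1 U s t)
      interpret U: graded_algebra "RA U" "algs A U" by (rule galg[OF *(1)])
      show ?case
        by (rule lrep_eqI[OF lrep_mult[OF *(2) lrep_smult[OF V *(2,3) a] *(4)] lrep_smult[OF V *(2) lrep_mult[OF *(2,3,4)] a]]) (use 5 * hom[OF *(1,2)] in \<open>simp add: U.gmult_smult_l\<close>)
    qed
  next
    case (6 k l a x y)
    then have a: "a \<in> carrier (rings B V)" by (simp add: cC)
    show ?case
    proof (rule SM_eqI2[OF 6(2,3), where p = "k + l"], simp, simp, goal_cases)
      case *: (1 U s t)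
      interpret U: graded_algebra "RA U" "algs A U" by (rule galg[OF *(1)])
      show ?case
        by (rule lrep_eqI[OF lrep_mult[OF *(2,3) lrep_smult[OF V *(2,4) a]] lrep_smult[OF V *(2) lrep_mult[OF *(2,3,4)] a]]) (use 6 * hom[OF *(1,2)] in \<open>simp add: U.gmult_smult_r\<close>)
    qed
  next
    case (7 k l m x y z)
    show ?case
    proof (rule SM_eqI3[OF 7, where p = "k + l + m"], simp, simp, goal_cases)
      case *: (1 U s t r)
      interpret U: graded_algebra "RA U" "algs A U" by (rule galg[OF *(1)])
      show ?case
        by (rule lrep_eqI[OF lrep_mult[OF *(2) lrep_mult[OF *(2,3,4)] *(5)] lrep_mult[OF *(2,3) lrep_mult[OF *(2,4,5)], folded add.assoc[of k l m]]])
          (use * in \<open>simp add: U.gmult_assoc\<close>)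
    qed
  qed
  show "\<forall>k l. \<forall>x\<in>carrier (SM V k). \<forall>y\<in>carrier (SM V l). smul V k l x y = gsign (SM V (k + l)) (k * l) (smul V l k y x)"
  proof (intro allI ballI)
    fix k l x y assume xy: "x \<in> carrier (SM V k)" "y \<in> carrier (SM V l)"
    have c: "smul V l k y x \<in> carrier (SM V (k + l))" using cl(4)[OF xy(2,1)] by (simp add: add.commute)
    show "smul V k l x y = gsign (SM V (k + l)) (k * l) (smul V l k y x)"
    proof (rule SM_eqI2[OF xy, where p = "k + l"], simp, rule gsign_ext[OF V c], goal_cases)
      case *: (1 U s t)
      have "lrep (k + l) (smul V l k y x) U (gmult (algs A U) l k t s)"
        using lrep_mult[OF *(2,4,3)] by (simp add: add.commute)
      from lrep_gsign[OF V *(2) c this]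
      show ?case
        using lrep_mult[OF *(2,3,4)] gcomm[OF *(1,5,6)] by (intro lrep_eqI) auto
    qed
  qed
  show "differential (rings B V) (algs (sheafify X B A) V) (gdiff (algs (sheafify X B A) V))"
    unfolding differential_def
  proof (intro conjI allI ballI)
    show "sd V k \<in> carrier (SM V k) \<rightarrow> carrier (SM V (k + 1))" for k using cl(5) by auto
  next
    fix k x y assume xy: "x \<in> carrier (SM V k)" "y \<in> carrier (SM V k)"
    show "sd V k (x \<oplus>\<^bsub>SM V k\<^esub> y) = sd V k x \<oplus>\<^bsub>SM V (k + 1)\<^esub> sd V k y"
    proof (rule SM_eqI2[OF xy, where p = "k + 1"], simp, simp, goal_cases)
      case *: (1 U s t)
      show ?case
        by (rule lrep_eqI[OF lrep_diff[OF *(2) lrep_add[OF *(2,3,4)]] lrep_add[OF *(2) lrep_diff[OF *(2,3)] lrep_diff[OF *(2,4)]]]) (use * in \<open>simp add: diff_add[OF gd]\<close>)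
    qed
  next
    fix k r x assume x: "x \<in> carrier (SM V k)"
    have a: "cconst (rings B V) r \<in> carrier (rings B V)" unfolding cconst_def by (rule cop_closed[OF rings[OF V]]) auto
    show "sd V k (cconst (rings B V) r \<odot>\<^bsub>SM V k\<^esub> x) = cconst (rings B V) r \<odot>\<^bsub>SM V (k + 1)\<^esub> sd V k x"
    proof (rule SM_eqI1[OF x, where p = "k + 1"], simp, simp, goal_cases)
      case *: (1 U s)
      show ?case
        by (rule lrep_eqI[OF lrep_diff[OF *(2) lrep_smult[OF V *(2,3) a]] lrep_smult[OF V *(2) lrep_diff[OF *(2,3)] a]])
          (use * in \<open>simp add: diff_const[OF gd] cinf_map_cconst[OF rres_map[OF V]]\<close>)
    qed
  next
    fix k l x y assume xy: "x \<in> carrier (SM V k)" "y \<in> carrier (SM V l)"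
    have c: "smul V k (l + 1) x (sd V l y) \<in> carrier (SM V (k + l + 1))"
      using cl(4)[OF xy(1) cl(5)[OF xy(2)]] by (simp add: add.assoc)
    show "sd V (k + l) (smul V k l x y) = smul V (k + 1) l (sd V k x) y \<oplus>\<^bsub>SM V (k + l + 1)\<^esub> gsign (SM V (k + l + 1)) k (smul V k (l + 1) x (sd V l y))"
    proof (rule SM_eqI2[OF xy, where p = "k + l + 1"], simp, simp, goal_cases)
      case *: (1 U s t)
      have 1: "lrep (k + l + 1) (smul V (k + 1) l (sd V k x) y) U (gmult (algs A U) (k + 1) l (gdiff (algs A U) k s) t)"
        using lrep_mult[OF *(2) lrep_diff[OF *(2,3)] *(4)] by (simp add: algebra_simps)
      have "lrep (k + l + 1) (smul V k (l + 1) x (sd V l y)) U (gmult (algs A U) k (l + 1) s (gdiff (algs A U) l t))"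
        using lrep_mult[OF *(2,3) lrep_diff[OF *(2,4)]] by (simp add: algebra_simps)
      note g = lrep_gsign[OF V *(2) c this, of k]
      show ?case
        by (rule lrep_eqI[OF lrep_diff[OF *(2) lrep_mult[OF *(2,3,4)]] lrep_add[OF *(2) 1 g] diff_mult[OF gd[OF *(1)] *(5,6)]])
    qed
  next
    fix k x assume x: "x \<in> carrier (SM V k)"
    show "sd V (k + 1) (sd V k x) = \<zero>\<^bsub>SM V (k + 2)\<^esub>"
    proof (rule SM_eqI1[OF x, where p = "k + 2"], simp, simp, goal_cases)
      case *: (1 U s)
      have "lrep (k + 2) (sd V (k + 1) (sd V k x)) U (gdiff (algs A U) (k + 1) (gdiff (algs A U) k s))"
        using lrep_diff[OF *(2) lrep_diff[OF *(2,3)]] by (simp add: add.assoc)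
      then show ?case
        using lrep_zero[OF V *(1,2)] diff_diff[OF gd[OF *(1)] *(4)] by (intro lrep_eqI)
    qed
  qed
qed

end

lemma presheaf_of_cdgas_forms:
  assumes B: "is_cinf_sheaf X B"
  shows "presheaf_of_cdgas X B (forms_presheaf B)"
proof -
  have ps: "is_presheaf X (set_presheaf B)" and r: "\<And>U. openin X U \<Longrightarrow> is_cinf_ring (rings B U)"
    and m: "\<And>U V. openin X U \<Longrightarrow> openin X V \<Longrightarrow> V \<subseteq> U \<Longrightarrow> cinf_map (rings B U) (rings B V) (rres B U V)"
    using B unfolding is_cinf_sheaf_def is_sheaf_def by blast+
  have id: "rres B U U b = b" if "openin X U" "b \<in> carrier (rings B U)" for U b
    using presheaf_id[OF ps, of U b] that by (simp add: set_presheaf_def)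
  have comp: "rres B V W (rres B U V b) = rres B U W b"
    if "openin X U" "openin X V" "openin X W" "W \<subseteq> V" "V \<subseteq> U" "b \<in> carrier (rings B U)" for U V W b
    using presheaf_comp[OF ps, of U V W b] that by (simp add: set_presheaf_def)
  have H: "cinf_hom (rings B U) (rings B V) (rres B U V)" if "openin X U" "openin X V" "V \<subseteq> U" for U V
    by (intro cinf_hom.intro r m that)
  show ?thesis
  proof (rule presheaf_of_cdgas.intro, goal_cases)
    case (4 U)
    then show ?case using cinf_forms.is_cdga_forms[OF cinf_forms.intro[OF r]] by (simp add: forms_presheaf_def)
  next
    case (10 U k s)
    then show ?case using forms_map_id[OF r[OF 10(1)] m[OF 10(1,1)] id[OF 10(1)]] by (simp add: forms_presheaf_def)
  next
    case (11 U V W k s)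
    have "W \<subseteq> U" using 11 by auto
    then show ?case
      using forms_map_comp[OF r[OF 11(1)] r[OF 11(2)] r[OF 11(3)] m[OF 11(1,2,5)] m[OF 11(2,3,4)] m[OF 11(1,3)] comp[OF 11(1-5)]] 11(6)
      by (simp add: forms_presheaf_def)
  qed (simp_all add: r m comp forms_presheaf_def cinf_hom.FM_closed[OF H] cinf_hom.FM_add[OF H] cinf_hom.FM_smult[OF H]
     cinf_hom.FM_mult[OF H] cinf_hom.FM_diff[OF H])
qed

section \<open>Smooth functions on a manifold with corners\<close>

definition cimg :: "'m chart \<Rightarrow> 'm set \<Rightarrow> (nat \<Rightarrow> real) set"
  where "cimg c V = snd c ` (fst c \<inter> V)"

definition sm :: "'m mfd \<Rightarrow> 'm chart \<Rightarrow> 'm set \<Rightarrow> ('m \<Rightarrow> real) \<Rightarrow> bool"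
  where "sm M c V u \<longleftrightarrow> smooth_on_Rn (mdim M) (cimg c V) (\<lambda>y. u (chart_inv c y))"

text \<open>The set \<open>V\<close> only fixes where the derivative is taken; for smooth
  \<open>u\<close> the value is unchanged when an open \<open>V\<close> shrinks, by
  \<open>cpd_mono\<close>.\<close>

definition cpd :: "'m chart \<Rightarrow> 'm set \<Rightarrow> nat \<Rightarrow> ('m \<Rightarrow> real) \<Rightarrow> 'm \<Rightarrow> real"
  where "cpd c V j u x = pd (cimg c V) j (\<lambda>y. u (chart_inv c y)) (snd c x)"

lemma jacobian_cpd: "jacobian c c' x i j = cpd c (fst c') j (\<lambda>x. snd c' x i) x"
  by (simp add: jacobian_def cpd_def cimg_def)

locale corner_manifold =
  fixes M :: "'m mfd"
  assumes mfd: "manifold_with_corners M"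
begin

abbreviation "n \<equiv> mdim M"
abbreviation "T \<equiv> mtop M"

lemma chart: "c \<in> atlas M \<Longrightarrow> is_chart T n c"
  and transition: "c \<in> atlas M \<Longrightarrow> c' \<in> atlas M \<Longrightarrow> i < n \<Longrightarrow>
       smooth_on_Rn n (cimg c (fst c')) (\<lambda>y. snd c' (chart_inv c y) i)"
  and atlas_cover: "(\<Union>c\<in>atlas M. fst c) = topspace T"
  using mfd unfolding manifold_with_corners_def cimg_def by blast+

lemma chart_open: "c \<in> atlas M \<Longrightarrow> openin T (fst c)"
  using chart by (simp add: is_chart_def)

lemma chart_homeo: "c \<in> atlas M \<Longrightarrow> homeomorphic_map (subtopology T (fst c)) (subtopology (Euclidean_space n) (snd c ` fst c)) (snd c)"
  using chart by (simp add: is_chart_def)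

lemma chart_inj:
  assumes "c \<in> atlas M"
  shows "inj_on (snd c) (fst c)"
proof -
  have "topspace (subtopology T (fst c)) = fst c"
    using openin_subset[OF chart_open[OF assms]] by auto
  then show ?thesis using homeomorphic_imp_injective_map[OF chart_homeo[OF assms]] by simp
qed

lemma chart_inv_snd [simp]: "c \<in> atlas M \<Longrightarrow> x \<in> fst c \<Longrightarrow> chart_inv c (snd c x) = x"
  by (simp add: chart_inj)

lemma snd_chart_inv: "y \<in> cimg c V \<Longrightarrow> snd c (chart_inv c y) = y"
  unfolding cimg_def by (intro f_inv_into_f) auto

lemma chart_inv_mem: "c \<in> atlas M \<Longrightarrow> y \<in> cimg c V \<Longrightarrow> chart_inv c y \<in> fst c \<and> chart_inv c y \<in> V"
  by (auto simp: cimg_def)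

lemma cimg_mem: "x \<in> fst c \<Longrightarrow> x \<in> V \<Longrightarrow> snd c x \<in> cimg c V"
  by (auto simp: cimg_def)

lemma cimg_mono: "V' \<subseteq> V \<Longrightarrow> cimg c V' \<subseteq> cimg c V"
  by (auto simp: cimg_def)

lemma cimg_open:
  assumes c: "c \<in> atlas M" and V: "openin T V"
  shows "openin (subtopology (Euclidean_space n) (snd c ` fst c)) (cimg c V)"
proof -
  have "open_map (subtopology T (fst c)) (subtopology (Euclidean_space n) (snd c ` fst c)) (snd c)"
    by (rule homeomorphic_imp_open_map[OF chart_homeo[OF c]])
  moreover have "openin (subtopology T (fst c)) (fst c \<inter> V)"
    using V by (auto simp: openin_subtopology)
  ultimately show ?thesis by (simp add: open_map_def cimg_def)
qed

lemma cimg_corner_open: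
  assumes c: "c \<in> atlas M" and V: "openin T V"
  shows "corner_open n (cimg c V)"
proof -
  obtain k where k: "k \<le> n" "openin (subtopology (Euclidean_space n) (corner n k)) (snd c ` fst c)"
    using chart[OF c] by (auto simp: is_chart_def)
  have "snd c ` fst c \<subseteq> corner n k"
    using openin_subset[OF k(2)] by auto
  then have "subtopology (Euclidean_space n) (snd c ` fst c) = subtopology (subtopology (Euclidean_space n) (corner n k)) (snd c ` fst c)"
    by (simp add: subtopology_subtopology Int_absorb1)
  then have "openin (subtopology (Euclidean_space n) (corner n k)) (cimg c V)"
    using cimg_open[OF c V] openin_trans_full[OF _ k(2)] by simp
  then show ?thesis using k(1) by (auto simp: corner_open_def)
qed

lemma cimg_Rn: "c \<in> atlas M \<Longrightarrow> openin T V \<Longrightarrow> cimg c V \<subseteq> Rn n"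
  by (rule corner_open_subset[OF cimg_corner_open])

lemma snd_Rn: "c \<in> atlas M \<Longrightarrow> x \<in> fst c \<Longrightarrow> snd c x \<in> Rn n"
  using cimg_Rn[OF _ chart_open, of c c] by (auto simp: cimg_def)

lemma trans_tuple:
  assumes "c' \<in> atlas M" "chart_inv c y \<in> fst c'"
  shows "tuple n (\<lambda>i y. snd c' (chart_inv c y) i) y = snd c' (chart_inv c y)"
  using snd_Rn[OF assms] by (auto simp: tuple_def Rn_iff)

lemma open_subset: "openin T V \<Longrightarrow> V \<subseteq> topspace T"
  by (rule openin_subset)

lemma chart_at: "x \<in> topspace T \<Longrightarrow> \<exists>c. c \<in> atlas M \<and> x \<in> fst c"
  using atlas_cover by blast

lemma sm_mono: "sm M c V u \<Longrightarrow> V' \<subseteq> V \<Longrightarrow> sm M c V' u"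
  unfolding sm_def by (erule smooth_on_subset) (rule cimg_mono)

lemma sm_cong: "c \<in> atlas M \<Longrightarrow> sm M c V u \<Longrightarrow> (\<And>x. x \<in> fst c \<Longrightarrow> x \<in> V \<Longrightarrow> u x = v x) \<Longrightarrow> sm M c V v"
  unfolding sm_def using chart_inv_mem by (elim smooth_on_cong) blast

lemma sm_local:
  assumes c: "c \<in> atlas M" and V: "openin T V"
    and l: "\<And>x. x \<in> V \<Longrightarrow> x \<in> fst c \<Longrightarrow> \<exists>W. openin T W \<and> x \<in> W \<and> sm M c (V \<inter> W) u"
  shows "sm M c V u"
  unfolding sm_def
proof (rule smooth_on_local[OF cimg_Rn[OF c V]])
  fix y assume y: "y \<in> cimg c V"
  then obtain W where W: "openin T W" "chart_inv c y \<in> W" "sm M c (V \<inter> W) u"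
    using l chart_inv_mem[OF c y] by blast
  obtain T' where T': "open_Rn n T'" "cimg c W = T' \<inter> snd c ` fst c"
    using cimg_open[OF c W(1)] by (auto simp: openin_subtopology)
  have "y \<in> cimg c W" using cimg_mem[OF conjunct1[OF chart_inv_mem[OF c y]] W(2)] snd_chart_inv[OF y] by simp
  then have "y \<in> T'" using T'(2) by auto
  \<comment> \<open>Charts are injective, so the image of an intersection is the intersection of the
    images.\<close>
  moreover have "T' \<inter> cimg c V = cimg c (V \<inter> W)"
  proof -
    have "cimg c V \<subseteq> snd c ` fst c" by (auto simp: cimg_def)
    then have "T' \<inter> cimg c V = cimg c W \<inter> cimg c V" using T'(2) by auto
    also have "\<dots> = snd c ` ((fst c \<inter> W) \<inter> (fst c \<inter> V))"
      unfolding cimg_def by (rule inj_on_image_Int[OF chart_inj[OF c], symmetric]) auto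
    also have "(fst c \<inter> W) \<inter> (fst c \<inter> V) = fst c \<inter> (V \<inter> W)" by auto
    finally show ?thesis by (simp add: cimg_def)
  qed
  ultimately show "\<exists>W. open_Rn n W \<and> y \<in> W \<and> smooth_on_Rn n (W \<inter> cimg c V) (\<lambda>y. u (chart_inv c y))"
    using T'(1) W(3) by (auto simp: sm_def)
qed

text \<open>In the chart \<open>c'\<close> the function is its expression in \<open>c\<close>
  composed with the transition map, whose smoothness is the axiom on the atlas.\<close>

lemma sm_change:
  assumes c: "c \<in> atlas M" and c': "c' \<in> atlas M" and V: "openin T V" "V \<subseteq> fst c" and u: "sm M c V u"
  shows "sm M c' V u"
proof -
  let ?h = "\<lambda>i y. snd c (chart_inv c' y) i"
  have mem: "chart_inv c' y \<in> fst c \<and> chart_inv c' y \<in> V" if "y \<in> cimg c' V" for y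
    using chart_inv_mem[OF c' that] V by auto
  have "smooth_on_Rn n (cimg c' V) (\<lambda>y. (\<lambda>z. u (chart_inv c z)) (tuple n ?h y))"
  proof (rule smooth_on_tuple_comp[OF u[unfolded sm_def]])
    show "smooth_on_Rn n (cimg c' V) (?h i)" if "i < n" for i
      by (rule smooth_on_subset[OF transition[OF c' c that] cimg_mono[OF V(2)]])
    show "tuple n ?h y \<in> cimg c V" if "y \<in> cimg c' V" for y
      using mem[OF that] by (simp add: trans_tuple[OF c] cimg_mem)
  qed (rule cimg_Rn[OF c' V(1)])
  then show ?thesis unfolding sm_def
    by (rule smooth_on_cong) (use mem in \<open>simp add: trans_tuple[OF c] c\<close>)
qed

lemma
  assumes c: "c \<in> atlas M" and V: "openin T V"
  shows sm_const: "sm M c V (\<lambda>x. r)"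
    and sm_mult: "sm M c V u \<Longrightarrow> sm M c V v \<Longrightarrow> sm M c V (\<lambda>x. u x * v x)"
    and sm_sum: "(\<And>i. i \<in> I \<Longrightarrow> sm M c V (h i)) \<Longrightarrow> sm M c V (\<lambda>x. \<Sum>i\<in>I. h i x)"
    and sm_tuple: "smooth_on_Rn m B g \<Longrightarrow> (\<And>i. i < m \<Longrightarrow> sm M c V (w i)) \<Longrightarrow> (\<And>x. x \<in> V \<Longrightarrow> tuple m w x \<in> B) \<Longrightarrow>
       sm M c V (\<lambda>x. g (tuple m w x))"
  unfolding sm_def
proof goal_cases
  note A = cimg_Rn[OF c V]
  { case 1 show ?case by (rule smooth_on_const[OF A]) }
  { case 2 then show ?case by (rule smooth_on_mult) }
  { case 3 then show ?case by (rule smooth_on_sum[OF A]) }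
  case 4
  have e: "tuple m (\<lambda>i y. w i (chart_inv c y)) y = tuple m w (chart_inv c y)" for y by (simp add: tuple_def)
  show ?case
    unfolding e[symmetric] by (rule smooth_on_tuple_comp[OF 4(1,2) _ A]) (use 4(3) chart_inv_mem[OF c] e in auto)
qed

subsection \<open>Partial derivatives in a chart\<close>

lemma cpd_cong:
  assumes "c \<in> atlas M" "\<And>y. y \<in> fst c \<Longrightarrow> y \<in> V \<Longrightarrow> u y = v y" "x \<in> fst c" "x \<in> V"
  shows "cpd c V j u x = cpd c V j v x"
  unfolding cpd_def by (rule pd_cong) (use assms(1,2) chart_inv_mem in blast, rule cimg_mem[OF assms(3,4)])

lemma cpd_mono:
  assumes "c \<in> atlas M" "openin T V" "openin T V'" "V' \<subseteq> V" "sm M c V u" "j < n" "x \<in> fst c" "x \<in> V'"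
  shows "cpd c V' j u x = cpd c V j u x"
  unfolding cpd_def using assms
  by (intro pd_mono[of n] cimg_corner_open cimg_mono cimg_mem) (auto simp: sm_def)

lemma sm_cpd:
  assumes "c \<in> atlas M" "openin T V" "sm M c V u" "j < n"
  shows "sm M c V (cpd c V j u)"
  unfolding sm_def cpd_def
  by (rule smooth_on_cong[OF smooth_on_pd[OF cimg_corner_open[OF assms(1,2)] assms(3)[unfolded sm_def] assms(4)]])
    (simp add: snd_chart_inv)

lemma cpd_commute:
  assumes c: "c \<in> atlas M" "openin T V" and u: "sm M c V u" and ij: "i < n" "j < n" and x: "x \<in> fst c" "x \<in> V"
  shows "cpd c V i (cpd c V j u) x = cpd c V j (cpd c V i u) x"
proof -
  have e: "pd (cimg c V) i (\<lambda>y. cpd c V j u (chart_inv c y)) (snd c x) = pd (cimg c V) i (pd (cimg c V) j (\<lambda>y. u (chart_inv c y))) (snd c x)" for i j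
    by (rule pd_cong) (use x in \<open>auto simp: cpd_def snd_chart_inv cimg_mem\<close>)
  show ?thesis
    unfolding cpd_def[of c V i] cpd_def[of c V j] using e
    by (simp add: cpd_def[symmetric] pd_commute[OF cimg_corner_open[OF c] u[unfolded sm_def] ij cimg_mem[OF x]])
qed

lemma
  assumes c: "c \<in> atlas M" "openin T V" and i: "i < n" and x: "x \<in> fst c" "x \<in> V"
  shows cpd_const: "cpd c V i (\<lambda>x. r) x = 0"
    and cpd_coord: "cpd c V i (\<lambda>x. snd c x j) x = (if i = j then 1 else 0)"
    and cpd_add: "sm M c V u \<Longrightarrow> sm M c V v \<Longrightarrow> cpd c V i (\<lambda>x. u x + v x) x = cpd c V i u x + cpd c V i v x"
    and cpd_mult: "sm M c V u \<Longrightarrow> sm M c V v \<Longrightarrow> cpd c V i (\<lambda>x. u x * v x) x = cpd c V i u x * v x + u x * cpd c V i v x"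
    and cpd_cmult: "sm M c V u \<Longrightarrow> cpd c V i (\<lambda>x. r * u x) x = r * cpd c V i u x"
    and cpd_sum: "(\<And>j. j \<in> I \<Longrightarrow> sm M c V (w j)) \<Longrightarrow> cpd c V i (\<lambda>x. \<Sum>j\<in>I. w j x) x = (\<Sum>j\<in>I. cpd c V i (w j) x)"
proof goal_cases
  note A = cimg_corner_open[OF c] cimg_mem[OF x] i
  { case 1 show ?case by (simp add: cpd_def pd_const[OF A]) }
  { case 2
    have "pd (cimg c V) i (\<lambda>y. snd c (chart_inv c y) j) (snd c x) = pd (cimg c V) i (\<lambda>y. y j) (snd c x)"
      by (rule pd_cong) (auto simp: snd_chart_inv A)
    then show ?case by (simp add: cpd_def pd_coord[OF A]) }
  { case 3 then show ?case by (simp add: cpd_def sm_def pd_add[OF A]) }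
  { case 4 then show ?case by (simp add: cpd_def sm_def pd_mult[OF A] c x) }
  { case 5 then show ?case by (simp add: cpd_def sm_def pd_cmult[OF A]) }
  { case 6 then show ?case by (simp add: cpd_def sm_def pd_sum[OF A]) }
qed

lemma cpd_tuple:
  assumes c: "c \<in> atlas M" "openin T V" and j: "j < n" and x: "x \<in> fst c" "x \<in> V"
    and B: "corner_open m B" and g: "smooth_on_Rn m B g" and w: "\<And>i. i < m \<Longrightarrow> sm M c V (w i)"
    and t: "\<And>x. x \<in> V \<Longrightarrow> tuple m w x \<in> B"
  shows "cpd c V j (\<lambda>x. g (tuple m w x)) x = (\<Sum>i<m. pd B i g (tuple m w x) * cpd c V j (w i) x)"
proof -
  have e: "tuple m w (chart_inv c y) = tuple m (\<lambda>i y. w i (chart_inv c y)) y" for y by (simp add: tuple_def)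
  have "pd (cimg c V) j (\<lambda>y. g (tuple m (\<lambda>i y. w i (chart_inv c y)) y)) (snd c x) =
     (\<Sum>i<m. pd B i g (tuple m (\<lambda>i y. w i (chart_inv c y)) (snd c x)) * pd (cimg c V) j (\<lambda>y. w i (chart_inv c y)) (snd c x))"
    by (rule pd_tuple_comp[OF cimg_corner_open[OF c] B g])
      (use w t chart_inv_mem[OF c(1)] cimg_mem[OF x] j in \<open>auto simp: sm_def e[symmetric]\<close>)
  then show ?thesis using c x by (simp add: cpd_def e[symmetric])
qed

lemma sm_trans: "c \<in> atlas M \<Longrightarrow> c' \<in> atlas M \<Longrightarrow> i < n \<Longrightarrow> sm M c (fst c') (\<lambda>x. snd c' x i)"
  unfolding sm_def by (rule transition)

lemma sm_jacobian: "c \<in> atlas M \<Longrightarrow> c' \<in> atlas M \<Longrightarrow> i < n \<Longrightarrow> j < n \<Longrightarrow> sm M c (fst c') (\<lambda>x. jacobian c c' x i j)"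
  unfolding jacobian_cpd by (intro sm_cpd sm_trans chart_open)

text \<open>The expression in \<open>c\<close> is the one in \<open>c'\<close> after the transition
  map, but only over \<open>V \<inter> fst c'\<close>; \<open>cpd_mono\<close> passes to that
  smaller set.\<close>

lemma cpd_chain:
  assumes c: "c \<in> atlas M" and c': "c' \<in> atlas M" and V: "openin T V" and x: "x \<in> V" "x \<in> fst c" "x \<in> fst c'"
    and u: "sm M c V u" "sm M c' V u" and j: "j < n"
  shows "cpd c V j u x = (\<Sum>i<n. cpd c' V i u x * jacobian c c' x i j)"
proof -
  let ?W = "V \<inter> fst c'"
  let ?w = "\<lambda>i x. snd c' x i"
  have W: "openin T ?W" using V chart_open[OF c'] by auto
  have tup: "tuple n ?w y = snd c' y" if "y \<in> fst c'" for y
    using snd_Rn[OF c' that] by (auto simp: tuple_def Rn_iff)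
  have "cpd c V j u x = cpd c ?W j u x"
    by (rule cpd_mono[symmetric, OF c V W]) (use u x j in auto)
  also have "\<dots> = cpd c ?W j (\<lambda>x. (\<lambda>z. u (chart_inv c' z)) (tuple n ?w x)) x"
    by (rule cpd_cong[OF c]) (use x tup c' in auto)
  also have "\<dots> = (\<Sum>i<n. pd (cimg c' V) i (\<lambda>z. u (chart_inv c' z)) (tuple n ?w x) * cpd c ?W j (?w i) x)"
    by (rule cpd_tuple[OF c W j x(2) _ cimg_corner_open[OF c' V] u(2)[unfolded sm_def]])
      (use x tup sm_mono[OF sm_trans[OF c c']] in \<open>auto intro: cimg_mem\<close>)
  also have "\<dots> = (\<Sum>i<n. cpd c' V i u x * jacobian c c' x i j)"
  proof (rule sum.cong[OF refl])
    fix i assume "i \<in> {..<n}"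
    then have "cpd c ?W j (?w i) x = jacobian c c' x i j"
      unfolding jacobian_cpd using x by (intro cpd_mono[OF c chart_open[OF c'] W _ sm_trans[OF c c'] j]) auto
    then show "pd (cimg c' V) i (\<lambda>z. u (chart_inv c' z)) (tuple n ?w x) * cpd c ?W j (?w i) x = cpd c' V i u x * jacobian c c' x i j"
      using tup[OF x(3)] by (simp add: cpd_def)
  qed
  finally show ?thesis .
qed

lemma jacobian_refl: "c \<in> atlas M \<Longrightarrow> x \<in> fst c \<Longrightarrow> j < n \<Longrightarrow> jacobian c c x i j = (if i = j then 1 else 0)"
  unfolding jacobian_cpd by (subst cpd_coord) (auto intro: chart_open)

text \<open>The chain rule for the coordinate functions of \<open>c''\<close>.\<close>

lemma jacobian_cocycle:
  assumes "c \<in> atlas M" "c' \<in> atlas M" "c'' \<in> atlas M" "x \<in> fst c" "x \<in> fst c'" "x \<in> fst c''" "i < n" "j < n"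
  shows "jacobian c c'' x i j = (\<Sum>l<n. jacobian c' c'' x i l * jacobian c c' x l j)"
  unfolding jacobian_cpd[of _ c''] using assms
  by (intro cpd_chain[OF assms(1,2) chart_open[OF assms(3)]] sm_trans) auto

section \<open>The $C^\infty$-ring of smooth functions\<close>

abbreviation "SF V \<equiv> rings (smooth_functions M) V"

lemma SF_carrier: "u \<in> carrier (SF V) \<longleftrightarrow> u \<in> extensional V \<and> (\<forall>c\<in>atlas M. sm M c V u)"
  by (auto simp: smooth_functions_def sm_def cimg_def)

lemma SF_cop: "cop (SF V) g us = (\<lambda>x\<in>V. g (tuple (length us) (\<lambda>i. us ! i) x))"
proof -
  have "nth_default 0 (map (\<lambda>u. u x) us) = tuple (length us) (\<lambda>i. us ! i) x" for x
    by (auto simp: nth_default_def tuple_def)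
  then show ?thesis by (simp add: smooth_functions_def)
qed

lemma is_cinf_ring_SF:
  assumes V: "openin T V"
  shows "is_cinf_ring (SF V)"
  unfolding is_cinf_ring_def
proof (intro conjI allI impI)
  have "(\<lambda>x\<in>V. 0) \<in> carrier (SF V)"
    by (auto simp: SF_carrier intro!: sm_cong[OF _ sm_const[OF _ V, of _ 0]])
  then show "carrier (SF V) \<noteq> {}" by blast
next
  fix us g assume us: "set us \<subseteq> carrier (SF V)" and g: "g \<in> Cinf (length us)"
  have "sm M c V (\<lambda>x\<in>V. g (tuple (length us) (\<lambda>i. us ! i) x))" if c: "c \<in> atlas M" for c
    by (rule sm_cong[OF c sm_tuple[OF c V smooth_on_Cinf[OF g subset_refl]]])
      (use us c in \<open>auto simp: SF_carrier subset_iff\<close>)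
  then show "cop (SF V) g us \<in> carrier (SF V)" by (simp add: SF_carrier SF_cop)
next
  fix us :: "('m \<Rightarrow> real) list" and g h :: "(nat \<Rightarrow> real) \<Rightarrow> real"
  assume "\<forall>x\<in>Rn (length us). g x = h x"
  then show "cop (SF V) g us = cop (SF V) h us" by (simp add: SF_cop)
next
  fix us i assume "set us \<subseteq> carrier (SF V)" "i < length us"
  then have "us ! i \<in> carrier (SF V)" by auto
  then show "cop (SF V) (\<lambda>x. x i) us = us ! i"
    using \<open>i < length us\<close> by (auto simp: SF_cop SF_carrier tuple_def extensional_def)
next
  fix us g hs
  assume "set us \<subseteq> carrier (SF V)" "g \<in> Cinf (length hs)" "set hs \<subseteq> Cinf (length us)"
  have "tuple (length hs) (\<lambda>i. (map (\<lambda>h. cop (SF V) h us) hs) ! i) x =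
       nth_default 0 (map (\<lambda>h. h (tuple (length us) (\<lambda>i. us ! i) x)) hs)" if "x \<in> V" for x
    using that by (auto simp: tuple_def nth_default_def SF_cop)
  then show "cop (SF V) (\<lambda>x. g (nth_default 0 (map (\<lambda>h. h x) hs))) us = cop (SF V) g (map (\<lambda>h. cop (SF V) h us) hs)"
    by (auto simp: SF_cop)
qed

lemma alg_SF_simps:
  "u \<oplus>\<^bsub>alg (SF V)\<^esub> v = (\<lambda>x\<in>V. u x + v x)" "u \<otimes>\<^bsub>alg (SF V)\<^esub> v = (\<lambda>x\<in>V. u x * v x)"
  "\<one>\<^bsub>alg (SF V)\<^esub> = (\<lambda>x\<in>V. 1)" "cconst (SF V) r = (\<lambda>x\<in>V. r)" "carrier (alg (SF V)) = carrier (SF V)"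
  by (simp_all add: alg_simps SF_cop cconst_def tuple_def)

section \<open>Tangent vectors\<close>

definition vcomb :: "real \<Rightarrow> 'm tvec \<Rightarrow> real \<Rightarrow> 'm tvec \<Rightarrow> 'm tvec"
  where "vcomb a v b w = (\<lambda>c i. a * v c i + b * w c i)"

lemma charts_at_iff: "c \<in> charts_at M x \<longleftrightarrow> c \<in> atlas M \<and> x \<in> fst c"
  by (simp add: charts_at_def)

lemma tangent_vcomb:
  assumes "v \<in> tangent_space M x" "w \<in> tangent_space M x"
  shows "vcomb a v b w \<in> tangent_space M x"
  unfolding tangent_space_def mem_Collect_eq
proof (intro conjI ballI allI impI)
  fix c c' i assume c: "c \<in> charts_at M x" "c' \<in> charts_at M x" "i < n"
  have "v c' i = (\<Sum>j<n. jacobian c c' x i j * v c j)" "w c' i = (\<Sum>j<n. jacobian c c' x i j * w c j)"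
    using assms c by (simp_all add: tangent_space_def)
  then show "vcomb a v b w c' i = (\<Sum>j<n. jacobian c c' x i j * vcomb a v b w c j)"
    by (simp add: vcomb_def sum_distrib_left sum.distrib[symmetric] algebra_simps)
qed (use assms in \<open>auto simp: tangent_space_def vcomb_def Rn_iff\<close>)

text \<open>Compatibility between two further charts is the cocycle rule for Jacobians.\<close>

lemma chart_vec_tangent:
  assumes c: "c \<in> charts_at M x"
  shows "chart_vec M c x \<xi> \<in> tangent_space M x"
  unfolding tangent_space_def mem_Collect_eq
proof (intro conjI ballI allI impI)
  fix c1 c2 i assume cs: "c1 \<in> charts_at M x" "c2 \<in> charts_at M x" "i < n"
  have "(\<Sum>j<n. jacobian c c2 x i j * \<xi> j) = (\<Sum>j<n. (\<Sum>l<n. jacobian c1 c2 x i l * jacobian c c1 x l j) * \<xi> j)"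
    using cs c by (intro sum.cong refl arg_cong2[where f = "(*)"] jacobian_cocycle) (auto simp: charts_at_iff)
  also have "\<dots> = (\<Sum>l<n. jacobian c1 c2 x i l * (\<Sum>j<n. jacobian c c1 x l j * \<xi> j))"
    by (simp add: sum_distrib_left sum_distrib_right mult.assoc) (rule sum.swap)
  finally show "chart_vec M c x \<xi> c2 i = (\<Sum>j<n. jacobian c1 c2 x i j * chart_vec M c x \<xi> c1 j)"
    using cs by (simp add: chart_vec_def)
qed (auto simp: chart_vec_def Rn_iff)

lemma chart_vec_self:
  assumes "c \<in> charts_at M x" "i < n"
  shows "chart_vec M c x \<xi> c i = \<xi> i"
proof -
  have "(\<Sum>j<n. jacobian c c x i j * \<xi> j) = (\<Sum>j<n. if i = j then \<xi> j else 0)"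
    using assms by (intro sum.cong refl) (simp add: jacobian_refl charts_at_iff)
  then show ?thesis using assms by (simp add: chart_vec_def)
qed

lemma coord_vec_tangent: "c \<in> charts_at M x \<Longrightarrow> coord_vec M c x j \<in> tangent_space M x"
  unfolding coord_vec_def by (rule chart_vec_tangent)

lemma coord_vec_self: "c \<in> charts_at M x \<Longrightarrow> i < n \<Longrightarrow> coord_vec M c x j c i = (if i = j then 1 else 0)"
  unfolding coord_vec_def by (rule chart_vec_self)

text \<open>A tangent vector is a compatible family, so its coordinates in one chart determine it;
  off the charts at x and from index \<open>n\<close> on, both sides are 0.\<close>

lemma chart_vec_coords:
  assumes "c \<in> charts_at M x" "v \<in> tangent_space M x"
  shows "chart_vec M c x (v c) = v"
proof (intro ext)
  fix c' i
  show "chart_vec M c x (v c) c' i = v c' i"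
  proof (cases "c' \<in> charts_at M x \<and> i < n")
    case True
    then have "v c' i = (\<Sum>j<n. jacobian c c' x i j * v c j)"
      using assms unfolding tangent_space_def by blast
    then show ?thesis using True by (simp add: chart_vec_def)
  next
    case False
    have "c' \<in> charts_at M x \<Longrightarrow> v c' \<in> Rn n" "c' \<notin> charts_at M x \<Longrightarrow> v c' = (\<lambda>i. 0)"
      using assms(2) unfolding tangent_space_def by blast+
    then have "v c' i = 0" using False by (cases "c' \<in> charts_at M x") (auto simp: Rn_iff)
    then show ?thesis using False by (auto simp: chart_vec_def)
  qed
qed

lemma chart_vec_cong: "(\<And>i. i < n \<Longrightarrow> \<xi> i = \<eta> i) \<Longrightarrow> chart_vec M c x \<xi> = chart_vec M c x \<eta>"
  by (auto simp: chart_vec_def intro!: ext sum.cong)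

lemma chart_vec_comb: "chart_vec M c x (\<lambda>i. a * \<xi> i + b * \<eta> i) = vcomb a (chart_vec M c x \<xi>) b (chart_vec M c x \<eta>)"
  by (auto simp: chart_vec_def vcomb_def sum_distrib_left sum.distrib[symmetric] algebra_simps intro!: ext)

text \<open>For \<open>j\<close> at least \<open>n\<close> the coordinate vector has no nonzero
  entry below index \<open>n\<close> and is the zero vector, whence the case distinction.\<close>

lemma chart_vec_change:
  assumes "c \<in> charts_at M x" "c' \<in> charts_at M x"
  shows "coord_vec M c' x j = chart_vec M c x (\<lambda>i. if j < n then jacobian c' c x i j else 0)"
proof -
  have "coord_vec M c' x j = chart_vec M c x (coord_vec M c' x j c)"
    using chart_vec_coords[OF assms(1) coord_vec_tangent[OF assms(2)]] by simp
  also have "\<dots> = chart_vec M c x (\<lambda>i. if j < n then jacobian c' c x i j else 0)"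
    by (rule chart_vec_cong) (use assms in \<open>simp add: coord_vec_def chart_vec_def if_distrib[of "\<lambda>z. _ * z"] sum.delta cong: if_cong\<close>)
  finally show ?thesis .
qed

end

section \<open>Cyclic permutations\<close>

abbreviation "swp \<equiv> Transposition.transpose"

text \<open>The cycle on the first \<open>N\<close> indices. Its powers rotate blocks of arguments,
  which is how the factors of a wedge product are exchanged.\<close>

definition cyc :: "nat \<Rightarrow> nat \<Rightarrow> nat"
  where "cyc N i = (if i < N then Suc i mod N else i)"

text \<open>A longer cycle as a transposition after the shorter one makes the sign computable by
  induction.\<close>

lemma cyc_Suc:
  assumes "N > 0"
  shows "cyc (Suc N) = swp 0 N \<circ> cyc N"
proof
  fix i
  consider "Suc i < N" | "Suc i = N" | "i = N" | "i > N" by linarith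
  then show "cyc (Suc N) i = (swp 0 N \<circ> cyc N) i"
    by cases (auto simp: cyc_def transpose_def)
qed

lemma cyc_permutes: "cyc N permutes {..<N}" and sign_cyc: "sign (cyc (Suc N)) = (-1) ^ N"
proof -
  have 1: "cyc (Suc 0) = id" by (auto simp: cyc_def)
  have "cyc (Suc N) permutes {..<Suc N} \<and> sign (cyc (Suc N)) = (-1) ^ N" for N
  proof (induction N)
    case 0
    show ?case unfolding 1 by (rule conjI, rule permutes_id) (simp add: sign_id)
  next
    case (Suc N)
    have p: "cyc (Suc N) permutes {..<Suc (Suc N)}"
      using Suc by (auto intro: permutes_subset)
    have "cyc (Suc (Suc N)) permutes {..<Suc (Suc N)}"
      unfolding cyc_Suc[of "Suc N", simplified] by (intro permutes_compose[OF p] permutes_swap_id) auto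
    moreover have "sign (cyc (Suc (Suc N))) = sign (swp 0 (Suc N)) * sign (cyc (Suc N))"
      unfolding cyc_Suc[of "Suc N", simplified]
      by (rule sign_compose[OF permutation_swap_id permutes_imp_permutation[OF _ p]]) simp
    ultimately show ?case using Suc by (simp add: sign_swap_id)
  qed
  note * = this
  show "sign (cyc (Suc N)) = (-1) ^ N" using * by blast
  show "cyc N permutes {..<N}"
  proof (cases N)
    case 0
    then show ?thesis by (auto simp: cyc_def permutes_def)
  next
    case (Suc N')
    then show ?thesis using *[of N'] by simp
  qed
qed

lemma cyc_pow: "(cyc N ^^ k) i = (if i < N then (i + k) mod N else i)"
  by (induction k) (auto simp: cyc_def mod_Suc_eq)

lemma cyc_pow_permutes: "(cyc N ^^ k) permutes {..<N}"
proof (induction k)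
  case 0
  show ?case unfolding funpow.simps by (rule permutes_id)
next
  case (Suc k)
  show ?case unfolding funpow.simps by (rule permutes_compose[OF Suc cyc_permutes])
qed

text \<open>One rotation of k + l indices has sign (-1)^(k + l - 1), so \<open>k\<close> of them
  give the exponent k (k + l - 1), which has the parity of k l because k (k - 1) is even.\<close>

lemma sign_cyc_pow: "sign (cyc (k + l) ^^ k) = (-1) ^ (k * l)"
proof (cases "k + l")
  case 0
  then show ?thesis by (simp add: id_def[symmetric])
next
  case (Suc N)
  have "sign (cyc (k + l) ^^ j) = (-1) ^ (N * j)" for j
  proof (induction j)
    case (Suc j)
    have "sign (cyc (k + l) ^^ Suc j) = sign (cyc (k + l)) * sign (cyc (k + l) ^^ j)"
      unfolding funpow.simps
      by (rule sign_compose[OF permutes_imp_permutation[OF _ cyc_permutes] permutes_imp_permutation[OF _ cyc_pow_permutes]]) auto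
    also have "\<dots> = (-1) ^ (N * Suc j)" using Suc sign_cyc[of N] \<open>k + l = Suc N\<close> by (simp add: power_add)
    finally show ?case .
  qed (simp add: id_def[symmetric])
  moreover have "even (N * k) \<longleftrightarrow> even (k * l)"
    using Suc by (metis even_Suc even_add even_mult_iff)
  ultimately show ?thesis by (simp add: minus_one_power_iff)
qed

lemma map_upt_shift: "map (\<lambda>i. f (i + k)) [0..<l] = map f [k..<k + l]"
  by (rule nth_equalityI) (auto simp: add.commute)

lemma map_upt_unshift: "map (\<lambda>i. f (i - l)) [l..<l + k] = map f [0..<k]"
  by (rule nth_equalityI) auto

lemma map_upt_congI: "(\<And>i. a \<le> i \<Longrightarrow> i < b \<Longrightarrow> f i = g i) \<Longrightarrow> map f [a..<b] = map g [a..<b]"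
  by auto

section \<open>Alternating forms\<close>

context corner_manifold
begin

abbreviation "TS x \<equiv> tangent_space M x"
definition tuples :: "'m \<Rightarrow> nat \<Rightarrow> 'm tvec list set"
  where "tuples x k = {vs. set vs \<subseteq> TS x \<and> length vs = k}"
abbreviation "AF x k \<equiv> alt_forms M x (int k)"

lemma tuples_iff: "vs \<in> tuples x k \<longleftrightarrow> set vs \<subseteq> TS x \<and> length vs = k"
  by (simp add: tuples_def)

lemma tvec_tuples_int: "tvec_tuples M x (int k) = tuples x k"
  by (auto simp: tvec_tuples_def tuples_def)

lemma tvec_tuples_add: "tvec_tuples M x (int k + int l) = tuples x (k + l)"
  using tvec_tuples_int[of x "k + l"] by simp

lemma alt_lin:
  assumes "\<alpha> \<in> AF x k" "vs \<in> tuples x k" "i < k" "v \<in> TS x" "w \<in> TS x"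
  shows "\<alpha> (vs[i := vcomb a v b w]) = a * \<alpha> (vs[i := v]) + b * \<alpha> (vs[i := w])"
proof -
  have e: "vs[i := z] = take i vs @ [z] @ drop (Suc i) vs" for z
    using assms(2,3) by (simp add: tuples_iff upd_conv_take_nth_drop)
  have "take i vs @ [z] @ drop (Suc i) vs \<in> tuples x k" if "z \<in> TS x" for z
    using assms(2,3) that set_take_subset[of i vs] set_drop_subset[of "Suc i" vs] by (auto simp: tuples_iff)
  then show ?thesis
    using assms(1,4,5) unfolding e alt_forms_def vcomb_def tvec_tuples_int by blast
qed

lemma alt_rep: "\<alpha> \<in> AF x k \<Longrightarrow> vs \<in> tuples x k \<Longrightarrow> i < k \<Longrightarrow> j < k \<Longrightarrow> i \<noteq> j \<Longrightarrow> vs ! i = vs ! j \<Longrightarrow> \<alpha> vs = 0"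
proof -
  assume *: "\<alpha> \<in> AF x k" "vs \<in> tuples x k" "i < k" "j < k" "i \<noteq> j" "vs ! i = vs ! j"
  then have "\<not> distinct vs" by (auto simp: tuples_iff nth_eq_iff_index_eq)
  then show "\<alpha> vs = 0" using *(1,2) unfolding alt_forms_def tvec_tuples_int by blast
qed

lemma alt_ext: "\<alpha> \<in> alt_forms M x k \<Longrightarrow> \<alpha> \<in> extensional (tvec_tuples M x k)"
  by (simp add: alt_forms_def)

text \<open>Recasts the conditions on split lists as conditions on positions, to which
  \<open>list_update\<close> and permutations of indices are adapted.\<close>

lemma alt_formsI:
  assumes "\<alpha> \<in> extensional (tuples x k)"
    and lin: "\<And>vs i v w a b. vs \<in> tuples x k \<Longrightarrow> i < k \<Longrightarrow> v \<in> TS x \<Longrightarrow> w \<in> TS x \<Longrightarrow>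
      \<alpha> (vs[i := vcomb a v b w]) = a * \<alpha> (vs[i := v]) + b * \<alpha> (vs[i := w])"
    and rep: "\<And>vs i j. vs \<in> tuples x k \<Longrightarrow> i < k \<Longrightarrow> j < k \<Longrightarrow> i \<noteq> j \<Longrightarrow> vs ! i = vs ! j \<Longrightarrow> \<alpha> vs = 0"
  shows "\<alpha> \<in> AF x k"
  unfolding alt_forms_def mem_Collect_eq tvec_tuples_int
proof (intro conjI allI impI ballI)
  fix us ws v w a b
  assume v: "us @ [v] @ ws \<in> tuples x k" and w: "us @ [w] @ ws \<in> tuples x k"
  then show "\<alpha> (us @ [\<lambda>c i. a * v c i + b * w c i] @ ws) = a * \<alpha> (us @ [v] @ ws) + b * \<alpha> (us @ [w] @ ws)"
    using lin[OF v, of "length us" v w a b] by (simp add: tuples_iff vcomb_def)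
next
  fix vs assume "vs \<in> tuples x k" "\<not> distinct vs"
  then show "\<alpha> vs = 0" using rep by (fastforce simp: distinct_conv_nth tuples_iff)
qed (rule assms(1))

lemma tuples_upd: "vs \<in> tuples x k \<Longrightarrow> v \<in> TS x \<Longrightarrow> vs[i := v] \<in> tuples x k"
  using set_update_subset_insert[of vs i v] by (auto simp: tuples_iff)

text \<open>Polarization: the sum of the two vectors is inserted in both positions and
  expanded.\<close>

lemma alt_swap:
  assumes \<alpha>: "\<alpha> \<in> AF x k" and vs: "vs \<in> tuples x k" and ij: "i < k" "j < k" "i \<noteq> j"
  shows "\<alpha> (vs[i := vs ! j, j := vs ! i]) = - \<alpha> vs"
proof -
  have l: "length vs = k" using vs by (simp add: tuples_iff)
  have u: "vs ! i \<in> TS x" "vs ! j \<in> TS x" using vs ij by (auto simp: tuples_iff)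
  define s where "s = vcomb 1 (vs ! i) 1 (vs ! j)"
  have s: "s \<in> TS x" unfolding s_def by (rule tangent_vcomb[OF u])
  let ?f = "\<lambda>p q. \<alpha> (vs[i := p, j := q])"
  have z: "?f p p = 0" if "p \<in> TS x" for p
    by (rule alt_rep[OF \<alpha> tuples_upd[OF tuples_upd[OF vs that] that] ij]) (use ij l in auto)
  have 2: "?f p s = ?f p (vs ! i) + ?f p (vs ! j)" if "p \<in> TS x" for p
    unfolding s_def using alt_lin[OF \<alpha> tuples_upd[OF vs that] ij(2) u] by simp
  have 1: "?f s q = ?f (vs ! i) q + ?f (vs ! j) q" if "q \<in> TS x" for q
    unfolding s_def using alt_lin[OF \<alpha> tuples_upd[OF vs that] ij(1) u, where a = 1 and b = 1] ij
    by (simp add: list_update_swap[of i j] del: list_update_id)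
  have "0 = ?f s s" using z[OF s] by simp
  also have "\<dots> = ?f (vs ! i) (vs ! j) + ?f (vs ! j) (vs ! i)"
    unfolding 1[OF s] 2[OF u(1)] 2[OF u(2)] using z[OF u(1)] z[OF u(2)] by simp
  also have "vs[i := vs ! i, j := vs ! j] = vs" by simp
  finally show ?thesis by simp
qed

lemma permute_list_transpose:
  assumes "a < length xs" "b < length xs"
  shows "permute_list (swp a b) xs = xs[a := xs ! b, b := xs ! a]"
  by (rule nth_equalityI) (use assms in \<open>auto simp: permute_list_def transpose_def nth_list_update\<close>)

text \<open>Induction over a factorization into transpositions, each of which contributes a sign by
  \<open>alt_swap\<close>.\<close>

lemma alt_permute:
  assumes \<alpha>: "\<alpha> \<in> AF x k" and vs: "vs \<in> tuples x k" and \<sigma>: "\<sigma> permutes {..<k}"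
  shows "\<alpha> (map (\<lambda>i. vs ! \<sigma> i) [0..<k]) = of_int (sign \<sigma>) * \<alpha> vs"
proof -
  have l: "length vs = k" using vs by (simp add: tuples_iff)
  have "\<alpha> (permute_list \<sigma> vs) = of_int (sign \<sigma>) * \<alpha> vs"
    using finite_lessThan[of k] \<sigma>
  proof (induction rule: permutes_rev_induct)
    case id
    then show ?case by (simp add: permute_list_def l[symmetric] map_nth)
  next
    case (swap a b p)
    have ab: "a < k" "b < k" using swap by auto
    have p: "permute_list p vs \<in> tuples x k"
      using vs set_permute_list[of p vs] swap(4) l by (simp add: tuples_iff)
    have t: "swp a b permutes {..<k}" by (rule permutes_swap_id) (use ab in auto)
    have "permute_list (p \<circ> swp a b) vs = permute_list (swp a b) (permute_list p vs)"
      by (rule permute_list_compose) (use t l in simp)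
    also have "\<alpha> \<dots> = - \<alpha> (permute_list p vs)"
      using alt_swap[OF \<alpha> p ab swap(3)] ab l by (simp add: permute_list_transpose)
    finally have F: "\<alpha> (permute_list (p \<circ> swp a b) vs) = - \<alpha> (permute_list p vs)" .
    have sg: "sign (p \<circ> swp a b) = - sign p"
      using swap(3) sign_compose[OF permutes_imp_permutation[OF _ swap(4)] permutation_swap_id, of a b] by (simp add: sign_swap_id)
    show ?case unfolding F sg using swap(5) by simp
  qed
  then show ?thesis by (simp add: permute_list_def l)
qed

lemma alt_adjacent:
  assumes \<alpha>: "\<alpha> \<in> AF x k" and vs: "us @ [v, w] @ zs \<in> tuples x k"
  shows "\<alpha> (us @ [v, w] @ zs) = - \<alpha> (us @ [w, v] @ zs)"
proof -
  let ?vs = "us @ [w, v] @ zs"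
  have t: "?vs \<in> tuples x k" using vs by (auto simp: tuples_iff)
  have "?vs[length us := ?vs ! Suc (length us), Suc (length us) := ?vs ! length us] = us @ [v, w] @ zs"
    by (simp add: nth_append list_update_append)
  then show ?thesis using alt_swap[OF \<alpha> t, of "length us" "Suc (length us)"] t by (simp add: tuples_iff)
qed

lemma alt_move:
  assumes \<alpha>: "\<alpha> \<in> AF x k"
  shows "us @ [v] @ ws @ zs \<in> tuples x k \<Longrightarrow> \<alpha> (us @ [v] @ ws @ zs) = (-1) ^ length ws * \<alpha> (us @ ws @ [v] @ zs)"
proof (induction ws arbitrary: us)
  case (Cons w ws)
  have t: "us @ [v, w] @ (ws @ zs) \<in> tuples x k" "(us @ [w]) @ [v] @ ws @ zs \<in> tuples x k" using Cons.prems by (auto simp: tuples_iff)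
  show ?case using alt_adjacent[OF \<alpha> t(1)] Cons.IH[OF t(2)] by simp
qed simp

lemma alt_expand:
  assumes \<alpha>: "\<alpha> \<in> AF x k" and c: "c \<in> charts_at M x" and vs: "vs \<in> tuples x k" and i: "i < k"
  shows "\<alpha> (vs[i := chart_vec M c x \<xi>]) = (\<Sum>j<n. \<xi> j * \<alpha> (vs[i := coord_vec M c x j]))"
proof -
  note cv = chart_vec_tangent[OF c]
  \<comment> \<open>The coordinates are switched on one at a time, so that each step is an instance
    of two-term linearity.\<close>
  have "\<alpha> (vs[i := chart_vec M c x (\<lambda>j. if j < m then \<xi> j else 0)]) = (\<Sum>j<m. \<xi> j * \<alpha> (vs[i := coord_vec M c x j]))" for m
  proof (induction m)
    case 0
    \<comment> \<open>The zero vector is written as a combination with zero coefficients, so that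
      linearity applies to it.\<close>
    have "chart_vec M c x (\<lambda>j. 0) = vcomb 0 (chart_vec M c x (\<lambda>j. 0)) 0 (chart_vec M c x (\<lambda>j. 0))"
      by (intro ext) (simp add: vcomb_def chart_vec_def)
    then show ?case using alt_lin[OF \<alpha> vs i cv cv, of 0 "\<lambda>j. 0" 0 "\<lambda>j. 0"] by simp
  next
    case (Suc m)
    have "(\<lambda>j. if j < Suc m then \<xi> j else 0) = (\<lambda>j. 1 * (if j < m then \<xi> j else 0) + \<xi> m * (if j = m then 1 else 0))"
      by (intro ext) (auto simp: less_Suc_eq)
    then have "chart_vec M c x (\<lambda>j. if j < Suc m then \<xi> j else 0) =
       vcomb 1 (chart_vec M c x (\<lambda>j. if j < m then \<xi> j else 0)) (\<xi> m) (coord_vec M c x m)"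
      by (simp only: chart_vec_comb coord_vec_def)
    then show ?case using alt_lin[OF \<alpha> vs i cv coord_vec_tangent[OF c]] Suc by simp
  qed
  moreover have "chart_vec M c x (\<lambda>j. if j < n then \<xi> j else 0) = chart_vec M c x \<xi>"
    by (rule chart_vec_cong) simp
  ultimately show ?thesis by metis
qed

lemma alt_coords:
  assumes "\<alpha> \<in> AF x k" "c \<in> charts_at M x" "vs \<in> tuples x k" "i < k"
  shows "\<alpha> vs = (\<Sum>j<n. (vs ! i) c j * \<alpha> (vs[i := coord_vec M c x j]))"
proof -
  have "vs ! i \<in> TS x" using assms(3,4) by (auto simp: tuples_iff)
  then have "vs[i := chart_vec M c x ((vs ! i) c)] = vs" by (simp add: chart_vec_coords[OF assms(2)])
  then show ?thesis using alt_expand[OF assms, of "(vs ! i) c"] by simp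
qed

section \<open>The wedge product\<close>

abbreviation "pmap vs \<sigma> a b \<equiv> map (\<lambda>i. vs ! \<sigma> i) [a..<b]"
abbreviation "Wd x k l \<equiv> wedge M x (int k) (int l)"

lemma pmap_tuples:
  assumes "vs \<in> tuples x N" "\<sigma> permutes {..<N}" "a \<le> b" "b \<le> N"
  shows "pmap vs \<sigma> a b \<in> tuples x (b - a)"
proof -
  have "vs ! \<sigma> i \<in> TS x" if "i < b" for i
    using that assms permutes_in_image[OF assms(2), of i] by (auto simp: tuples_iff intro: subsetD[OF _ nth_mem])
  then show ?thesis using assms(3) by (auto simp: tuples_iff)
qed

lemma wedge_eq:
  assumes "vs \<in> tuples x (k + l)"
  shows "Wd x k l \<alpha> \<beta> vs = (\<Sum>\<sigma> | \<sigma> permutes {..<k + l}. of_int (sign \<sigma>) *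
         \<alpha> (pmap vs \<sigma> 0 k) * \<beta> (pmap vs \<sigma> k (k + l))) / (fact k * fact l)"
proof -
  have "vs \<in> tvec_tuples M x (int k + int l)" "length vs = k + l"
    using assms by (simp_all add: tvec_tuples_add tuples_iff)
  then show ?thesis by (simp add: wedge_def)
qed

lemma wedge_ext: "wedge M x k l \<alpha> \<beta> \<in> extensional (tvec_tuples M x (k + l))"
  by (simp add: wedge_def)

lemma wedge_neg: "k < 0 \<or> l < 0 \<Longrightarrow> wedge M x k l \<alpha> \<beta> = (\<lambda>vs\<in>tvec_tuples M x (k + l). 0)"
  by (auto simp: wedge_def)

text \<open>Entry \<open>i\<close> is read at the position that \<sigma> sends to \<open>i\<close>;
  an update of it therefore affects a block only if that position lies in the block.\<close>

lemma pmap_upd: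
  assumes vs: "length vs = N" and \<sigma>: "\<sigma> permutes {..<N}" and i: "i < N" and ab: "a \<le> b" "b \<le> N"
  shows "pmap (vs[i := v]) \<sigma> a b = (if a \<le> inv_into UNIV \<sigma> i \<and> inv_into UNIV \<sigma> i < b then (pmap vs \<sigma> a b)[inv_into UNIV \<sigma> i - a := v] else pmap vs \<sigma> a b)"
proof -
  have e: "\<sigma> j = i \<longleftrightarrow> j = inv_into UNIV \<sigma> i" for j using permutes_inverses[OF \<sigma>] by metis
  have m: "\<sigma> j < N" if "j < N" for j using permutes_in_image[OF \<sigma>, of j] that by simp
  define q where "q = inv_into UNIV \<sigma> i"
  show ?thesis unfolding q_def[symmetric]
  proof (rule nth_equalityI)
    fix p assume "p < length (pmap (vs[i := v]) \<sigma> a b)"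
    then have p: "p < b - a" by simp
    then have ap: "a + p < N" using ab by linarith
    from p have "pmap (vs[i := v]) \<sigma> a b ! p = (if a + p = q then v else vs ! \<sigma> (a + p))"
      using m[OF ap] e[of "a + p"] ab vs i by (auto simp: nth_list_update q_def)
    also have "\<dots> = (if a \<le> q \<and> q < b then (pmap vs \<sigma> a b)[q - a := v] else pmap vs \<sigma> a b) ! p"
      using p by (auto simp: nth_list_update)
    finally show "pmap (vs[i := v]) \<sigma> a b ! p = (if a \<le> q \<and> q < b then (pmap vs \<sigma> a b)[q - a := v] else pmap vs \<sigma> a b) ! p" .
  qed simp
qed

text \<open>For linearity, an update touches only one factor of each summand. For repetitions,
  composing every \<sigma> with the transposition of the two positions changes the sign but not the
  arguments, so the sum is its own negative.\<close>

lemma wedge_alt: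
  assumes \<alpha>: "\<alpha> \<in> AF x k" and \<beta>: "\<beta> \<in> AF x l"
  shows "Wd x k l \<alpha> \<beta> \<in> AF x (k + l)"
proof (rule alt_formsI)
  let ?N = "k + l"
  let ?F = "\<lambda>vs \<sigma>. of_int (sign \<sigma>) * \<alpha> (pmap vs \<sigma> 0 k) * \<beta> (pmap vs \<sigma> k ?N) :: real"
  show "Wd x k l \<alpha> \<beta> \<in> extensional (tuples x (k + l))" using wedge_ext[of x "int k" "int l"] by (simp add: tvec_tuples_add)
  fix vs i assume vs: "vs \<in> tuples x ?N" and i: "i < ?N"
  then have l: "length vs = ?N" by (simp add: tuples_iff)
  {
    fix v w a b assume vw: "v \<in> TS x" "w \<in> TS x"
    have "?F (vs[i := vcomb a v b w]) \<sigma> = a * ?F (vs[i := v]) \<sigma> + b * ?F (vs[i := w]) \<sigma>" if \<sigma>: "\<sigma> permutes {..<?N}" for \<sigma>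
    proof -
      have p: "inv_into UNIV \<sigma> i < ?N" using permutes_in_image[OF permutes_inv[OF \<sigma>], of i] i by simp
      have t: "pmap vs \<sigma> 0 k \<in> tuples x k" "pmap vs \<sigma> k ?N \<in> tuples x l"
        using pmap_tuples[OF vs \<sigma>, of 0 k] pmap_tuples[OF vs \<sigma>, of k ?N] by simp_all
      show ?thesis
      proof (cases "inv_into UNIV \<sigma> i < k")
        case True
        then show ?thesis
          using alt_lin[OF \<alpha> t(1) True vw] by (simp add: pmap_upd[OF l \<sigma> i] algebra_simps)
      next
        case False
        then have "inv_into UNIV \<sigma> i - k < l" using p by simp
        then show ?thesis
          using alt_lin[OF \<beta> t(2) _ vw] False p by (simp add: pmap_upd[OF l \<sigma> i] algebra_simps)
      qed
    qed
    then have "sum (?F (vs[i := vcomb a v b w])) {\<sigma>. \<sigma> permutes {..<?N}} =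
       a * sum (?F (vs[i := v])) {\<sigma>. \<sigma> permutes {..<?N}} + b * sum (?F (vs[i := w])) {\<sigma>. \<sigma> permutes {..<?N}}"
      by (simp add: sum_distrib_left sum.distrib[symmetric])
    then show "Wd x k l \<alpha> \<beta> (vs[i := vcomb a v b w]) = a * Wd x k l \<alpha> \<beta> (vs[i := v]) + b * Wd x k l \<alpha> \<beta> (vs[i := w])"
      using vs vw tangent_vcomb[OF vw] by (simp add: wedge_eq tuples_upd add_divide_distrib)
  }
  fix j assume j: "j < ?N" "i \<noteq> j" "vs ! i = vs ! j"
  let ?t = "swp i j"
  have t: "?t permutes {..<?N}" by (rule permutes_swap_id) (use i j in auto)
  have "sum (?F vs) {\<sigma>. \<sigma> permutes {..<?N}} = sum (\<lambda>\<sigma>. ?F vs (?t \<circ> \<sigma>)) {\<sigma>. \<sigma> permutes {..<?N}}"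
    by (rule setum_permutations_compose_left[OF t])
  also have "\<dots> = sum (\<lambda>\<sigma>. - ?F vs \<sigma>) {\<sigma>. \<sigma> permutes {..<?N}}"
  proof (rule sum.cong[OF refl])
    fix \<sigma> assume "\<sigma> \<in> {\<sigma>. \<sigma> permutes {..<?N}}"
    then have "sign (?t \<circ> \<sigma>) = - sign \<sigma>"
      using sign_compose[OF permutation_swap_id permutes_imp_permutation, of "{..<?N}" \<sigma> i j] j by (simp add: sign_swap_id)
    moreover have "vs ! ?t m = vs ! m" for m using j(3) by (cases "m = i"; cases "m = j") simp_all
    ultimately show "?F vs (?t \<circ> \<sigma>) = - ?F vs \<sigma>" by simp
  qed
  finally have "sum (?F vs) {\<sigma>. \<sigma> permutes {..<?N}} = 0" by (simp add: sum_negf)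
  then show "Wd x k l \<alpha> \<beta> vs = 0" using vs by (simp add: wedge_eq)
qed

text \<open>Reindexing the sum by a rotation through \<open>k\<close> places exchanges the blocks of
  the two factors; the sign is that of the rotation.\<close>

lemma wedge_comm:
  assumes vs: "vs \<in> tuples x (k + l)"
  shows "Wd x k l \<alpha> \<beta> vs = (-1) ^ (k * l) * Wd x l k \<beta> \<alpha> vs"
proof -
  let ?N = "k + l"
  let ?r = "cyc ?N ^^ k"
  let ?F = "\<lambda>\<sigma>. of_int (sign \<sigma>) * \<beta> (pmap vs \<sigma> 0 l) * \<alpha> (pmap vs \<sigma> l ?N) :: real"
  have r: "?r permutes {..<?N}" by (rule cyc_pow_permutes)
  have "sum ?F {\<sigma>. \<sigma> permutes {..<?N}} = sum (\<lambda>\<sigma>. ?F (\<sigma> \<circ> ?r)) {\<sigma>. \<sigma> permutes {..<?N}}"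
    by (rule sum_permutations_compose_right[OF r])
  also have "\<dots> = sum (\<lambda>\<sigma>. (-1) ^ (k * l) * (of_int (sign \<sigma>) * \<alpha> (pmap vs \<sigma> 0 k) * \<beta> (pmap vs \<sigma> k ?N))) {\<sigma>. \<sigma> permutes {..<?N}}"
  proof (rule sum.cong[OF refl])
    fix \<sigma> assume "\<sigma> \<in> {\<sigma>. \<sigma> permutes {..<?N}}"
    then have "sign (\<sigma> \<circ> ?r) = sign \<sigma> * (-1) ^ (k * l)"
      using sign_compose[OF permutes_imp_permutation permutes_imp_permutation[OF _ r], of "{..<?N}" \<sigma>] by (simp add: sign_cyc_pow)
    moreover have "pmap vs (\<sigma> \<circ> ?r) 0 l = pmap vs \<sigma> k ?N"
    proof -
      have "pmap vs (\<sigma> \<circ> ?r) 0 l = map (\<lambda>i. vs ! \<sigma> (i + k)) [0..<l]"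
        by (rule map_upt_congI) (simp add: cyc_pow)
      then show ?thesis using map_upt_shift[of "\<lambda>i. vs ! \<sigma> i" k l] by simp
    qed
    moreover have "pmap vs (\<sigma> \<circ> ?r) l ?N = pmap vs \<sigma> 0 k"
    proof -
      have "pmap vs (\<sigma> \<circ> ?r) l ?N = map (\<lambda>i. vs ! \<sigma> (i - l)) [l..<l + k]"
        unfolding add.commute[of k l]
      proof (rule map_upt_congI)
        fix i assume "l \<le> i" "i < l + k"
        then have "(i + k) mod (k + l) = i - l" by (simp add: mod_if)
        then show "vs ! (\<sigma> \<circ> cyc (l + k) ^^ k) i = vs ! \<sigma> (i - l)"
          using \<open>i < l + k\<close> by (simp add: cyc_pow add.commute)
      qed
      then show ?thesis using map_upt_unshift[of "\<lambda>i. vs ! \<sigma> i" l k] by simp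
    qed
    ultimately show "?F (\<sigma> \<circ> ?r) = (-1) ^ (k * l) * (of_int (sign \<sigma>) * \<alpha> (pmap vs \<sigma> 0 k) * \<beta> (pmap vs \<sigma> k ?N))"
      by simp
  qed
  finally have "sum ?F {\<sigma>. \<sigma> permutes {..<?N}} = (-1) ^ (k * l) * sum (\<lambda>\<sigma>. of_int (sign \<sigma>) * \<alpha> (pmap vs \<sigma> 0 k) * \<beta> (pmap vs \<sigma> k ?N)) {\<sigma>. \<sigma> permutes {..<?N}}"
    by (simp only: sum_distrib_left)
  then show ?thesis
    using vs wedge_eq[of vs x l k \<beta> \<alpha>] wedge_eq[OF vs, of \<alpha> \<beta>]
    by (simp add: add.commute[of l k] mult.commute[of "fact l"] power_add[symmetric] mult_2[symmetric] flip: mult.assoc)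
qed

definition triple :: "'m tvec list \<Rightarrow> nat \<Rightarrow> nat \<Rightarrow> nat \<Rightarrow> ('m tvec list \<Rightarrow> real) \<Rightarrow> ('m tvec list \<Rightarrow> real) \<Rightarrow> ('m tvec list \<Rightarrow> real) \<Rightarrow> real"
  where "triple vs k l m \<alpha> \<beta> \<gamma> = (\<Sum>\<sigma> | \<sigma> permutes {..<k + l + m}. of_int (sign \<sigma>) *
         \<alpha> (pmap vs \<sigma> 0 k) * \<beta> (pmap vs \<sigma> k (k + l)) * \<gamma> (pmap vs \<sigma> (k + l) (k + l + m))) / (fact k * fact l * fact m)"

text \<open>Only the bracketing to the left needs a computation: graded commutativity reduces the other one to it,
  up to a cyclic rotation of the three factors.\<close>

lemma wedge_triple:
  assumes vs: "vs \<in> tuples x (k + l + m)"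
  shows "Wd x (k + l) m (Wd x k l \<alpha> \<beta>) \<gamma> vs = triple vs k l m \<alpha> \<beta> \<gamma>"
proof -
  let ?N = "k + l + m" and ?K = "k + l"
  let ?G = "\<lambda>\<sigma>. of_int (sign \<sigma>) * \<alpha> (pmap vs \<sigma> 0 k) * \<beta> (pmap vs \<sigma> k ?K) * \<gamma> (pmap vs \<sigma> ?K ?N) :: real"
  let ?SN = "{\<sigma>. \<sigma> permutes {..<?N}}" and ?SK = "{\<tau>. \<tau> permutes {..<?K}}"
  have inner: "of_int (sign \<sigma>) * Wd x k l \<alpha> \<beta> (pmap vs \<sigma> 0 ?K) * \<gamma> (pmap vs \<sigma> ?K ?N) = (\<Sum>\<tau>\<in>?SK. ?G (\<sigma> \<circ> \<tau>)) / (fact k * fact l)"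
    if \<sigma>: "\<sigma> permutes {..<?N}" for \<sigma>
  proof -
    let ?us = "pmap vs \<sigma> 0 ?K"
    have us: "?us \<in> tuples x ?K" using pmap_tuples[OF vs \<sigma>, of 0 ?K] by simp
    have "of_int (sign \<sigma>) * (of_int (sign \<tau>) * \<alpha> (pmap ?us \<tau> 0 k) * \<beta> (pmap ?us \<tau> k ?K)) * \<gamma> (pmap vs \<sigma> ?K ?N) = ?G (\<sigma> \<circ> \<tau>)"
      if \<tau>: "\<tau> permutes {..<?K}" for \<tau>
    proof -
      have \<tau>l: "\<tau> i < ?K" if "i < ?K" for i using permutes_in_image[OF \<tau>, of i] that by simp
      have 1: "pmap ?us \<tau> 0 k = pmap vs (\<sigma> \<circ> \<tau>) 0 k" "pmap ?us \<tau> k ?K = pmap vs (\<sigma> \<circ> \<tau>) k ?K"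
        by (rule map_upt_congI; use \<tau>l in simp)+
      have 2: "pmap vs \<sigma> ?K ?N = pmap vs (\<sigma> \<circ> \<tau>) ?K ?N"
        by (rule map_upt_congI) (simp add: permutes_not_in[OF \<tau>])
      have 3: "sign (\<sigma> \<circ> \<tau>) = sign \<sigma> * sign \<tau>"
        by (rule sign_compose[OF permutes_imp_permutation[OF _ \<sigma>] permutes_imp_permutation[OF _ \<tau>]]) auto
      show ?thesis unfolding 1 2 3 of_int_mult by (simp only: mult.assoc)
    qed
    then show ?thesis
      unfolding wedge_eq[OF us] by (simp add: sum_distrib_left sum_distrib_right sum_divide_distrib)
  qed
  have "(\<Sum>\<sigma>\<in>?SN. of_int (sign \<sigma>) * Wd x k l \<alpha> \<beta> (pmap vs \<sigma> 0 ?K) * \<gamma> (pmap vs \<sigma> ?K ?N)) =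
     (\<Sum>\<sigma>\<in>?SN. \<Sum>\<tau>\<in>?SK. ?G (\<sigma> \<circ> \<tau>)) / (fact k * fact l)"
    unfolding sum_divide_distrib[of _ ?SN] by (rule sum.cong[OF refl]) (use inner in simp)
  also have "(\<Sum>\<sigma>\<in>?SN. \<Sum>\<tau>\<in>?SK. ?G (\<sigma> \<circ> \<tau>)) = (\<Sum>\<tau>\<in>?SK. \<Sum>\<sigma>\<in>?SN. ?G (\<sigma> \<circ> \<tau>))"
    by (rule sum.swap)
  \<comment> \<open>For fixed \<tau> the map \<sigma> \<mapsto> \<sigma> \<circ> \<tau> permutes the
    index set, so all inner sums coincide; their number (k + l)! cancels the factorial in the outer
    product.\<close>
  also have "\<dots> = (\<Sum>\<tau>\<in>?SK. sum ?G ?SN)"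
  proof (rule sum.cong[OF refl])
    fix \<tau> assume "\<tau> \<in> ?SK"
    then have "\<tau> permutes {..<?N}" by (auto intro: permutes_subset)
    then show "(\<Sum>\<sigma>\<in>?SN. ?G (\<sigma> \<circ> \<tau>)) = sum ?G ?SN" by (rule sum_permutations_compose_right[symmetric])
  qed
  also have "\<dots> = fact ?K * sum ?G ?SN"
    using card_permutations[of "{..<?K}" ?K] by simp
  finally show ?thesis
    unfolding triple_def wedge_eq[OF vs] by (simp add: field_simps)
qed

text \<open>Rotation through \<open>k\<close> places moves the block of \<alpha> from the front to
  the end, past l + m places.\<close>

lemma triple_rotate:
  "triple vs k l m \<alpha> \<beta> \<gamma> = (-1) ^ (k * (l + m)) * triple vs l m k \<beta> \<gamma> \<alpha>"
proof -
  let ?N = "k + l + m"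
  let ?r = "cyc (k + (l + m)) ^^ k"
  let ?F = "\<lambda>\<sigma>. of_int (sign \<sigma>) * \<beta> (pmap vs \<sigma> 0 l) * \<gamma> (pmap vs \<sigma> l (l + m)) * \<alpha> (pmap vs \<sigma> (l + m) (l + m + k)) :: real"
  let ?G = "\<lambda>\<sigma>. of_int (sign \<sigma>) * \<alpha> (pmap vs \<sigma> 0 k) * \<beta> (pmap vs \<sigma> k (k + l)) * \<gamma> (pmap vs \<sigma> (k + l) ?N) :: real"
  have r: "?r permutes {..<?N}" by (subst add.assoc) (rule cyc_pow_permutes)
  have "sum ?F {\<sigma>. \<sigma> permutes {..<?N}} = sum (\<lambda>\<sigma>. ?F (\<sigma> \<circ> ?r)) {\<sigma>. \<sigma> permutes {..<?N}}"
    by (rule sum_permutations_compose_right[OF r])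
  also have "\<dots> = sum (\<lambda>\<sigma>. (-1) ^ (k * (l + m)) * ?G \<sigma>) {\<sigma>. \<sigma> permutes {..<?N}}"
  proof (rule sum.cong[OF refl])
    fix \<sigma> assume "\<sigma> \<in> {\<sigma>. \<sigma> permutes {..<?N}}"
    then have "sign (\<sigma> \<circ> ?r) = sign \<sigma> * (-1) ^ (k * (l + m))"
      using sign_compose[OF permutes_imp_permutation permutes_imp_permutation[OF _ r], of "{..<?N}" \<sigma>] by (simp add: sign_cyc_pow)
    moreover have "pmap vs (\<sigma> \<circ> ?r) 0 l = pmap vs \<sigma> k (k + l)"
    proof -
      have "pmap vs (\<sigma> \<circ> ?r) 0 l = map (\<lambda>i. vs ! \<sigma> (i + k)) [0..<l]"
        by (rule map_upt_congI) (simp add: cyc_pow)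
      then show ?thesis using map_upt_shift[of "\<lambda>i. vs ! \<sigma> i" k l] by simp
    qed
    moreover have "pmap vs (\<sigma> \<circ> ?r) l (l + m) = pmap vs \<sigma> (k + l) ?N"
    proof (rule nth_equalityI)
      fix i assume "i < length (pmap vs (\<sigma> \<circ> ?r) l (l + m))"
      then show "pmap vs (\<sigma> \<circ> ?r) l (l + m) ! i = pmap vs \<sigma> (k + l) ?N ! i"
        by (simp add: cyc_pow add_ac)
    qed simp
    moreover have "pmap vs (\<sigma> \<circ> ?r) (l + m) (l + m + k) = pmap vs \<sigma> 0 k"
    proof -
      have "pmap vs (\<sigma> \<circ> ?r) (l + m) (l + m + k) = map (\<lambda>i. vs ! \<sigma> (i - (l + m))) [l + m..<l + m + k]"
      proof (rule map_upt_congI)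
        fix i assume i: "l + m \<le> i" "i < l + m + k"
        then have "(i + k) mod (k + (l + m)) = i - (l + m)" by (simp add: mod_if)
        then show "vs ! (\<sigma> \<circ> ?r) i = vs ! \<sigma> (i - (l + m))" using i by (simp add: cyc_pow)
      qed
      then show ?thesis using map_upt_unshift[of "\<lambda>i. vs ! \<sigma> i" "l + m" k] by simp
    qed
    ultimately show "?F (\<sigma> \<circ> ?r) = (-1) ^ (k * (l + m)) * ?G \<sigma>" by simp
  qed
  finally have "sum ?F {\<sigma>. \<sigma> permutes {..<?N}} = (-1) ^ (k * (l + m)) * sum ?G {\<sigma>. \<sigma> permutes {..<?N}}"
    by (simp only: sum_distrib_left)
  note S = this
  have e: "l + m + k = ?N" by simp
  have "triple vs l m k \<beta> \<gamma> \<alpha> = (-1) ^ (k * (l + m)) * triple vs k l m \<alpha> \<beta> \<gamma>"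
    using S unfolding triple_def e by (simp add: mult.commute[of "fact k"] mult.assoc)
  moreover have "(-1 :: real) ^ (k * (l + m)) * (-1) ^ (k * (l + m)) = 1" by (simp add: power_add[symmetric] mult_2[symmetric])
  ultimately show ?thesis by (simp flip: mult.assoc)
qed

lemma wedge_assoc:
  assumes vs: "vs \<in> tuples x (k + l + m)"
  shows "Wd x (k + l) m (Wd x k l \<alpha> \<beta>) \<gamma> vs = Wd x k (l + m) \<alpha> (Wd x l m \<beta> \<gamma>) vs"
proof -
  have "Wd x k (l + m) \<alpha> (Wd x l m \<beta> \<gamma>) vs = (-1) ^ (k * (l + m)) * Wd x (l + m) k (Wd x l m \<beta> \<gamma>) \<alpha> vs"
    by (rule wedge_comm) (use vs in \<open>simp add: add.assoc\<close>)
  also have "Wd x (l + m) k (Wd x l m \<beta> \<gamma>) \<alpha> vs = triple vs l m k \<beta> \<gamma> \<alpha>"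
    by (rule wedge_triple) (use vs in \<open>simp add: add_ac\<close>)
  finally show ?thesis using triple_rotate[of vs k l m \<alpha> \<beta> \<gamma>] wedge_triple[OF vs] by simp
qed

text \<open>All permutations contribute the same summand: the sign appears twice, once from the
  definition and once from \<beta>. The l! equal terms cancel the denominator.\<close>

lemma wedge_0:
  assumes \<beta>: "\<beta> \<in> AF x l" and vs: "vs \<in> tuples x l"
  shows "wedge M x 0 (int l) \<alpha> \<beta> vs = \<alpha> [] * \<beta> vs"
proof -
  have "wedge M x 0 (int l) \<alpha> \<beta> vs = (\<Sum>\<sigma> | \<sigma> permutes {..<l}. of_int (sign \<sigma>) * \<alpha> [] * \<beta> (pmap vs \<sigma> 0 l)) / fact l"
    using wedge_eq[of vs x 0 l \<alpha> \<beta>] vs by simp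
  also have "(\<Sum>\<sigma> | \<sigma> permutes {..<l}. of_int (sign \<sigma>) * \<alpha> [] * \<beta> (pmap vs \<sigma> 0 l)) = (\<Sum>\<sigma> | \<sigma> permutes {..<l}. \<alpha> [] * \<beta> vs)"
  proof (rule sum.cong[OF refl])
    fix \<sigma> assume "\<sigma> \<in> {\<sigma>. \<sigma> permutes {..<l}}"
    moreover have "of_int (sign \<sigma>) * of_int (sign \<sigma>) = (1::real)" by (simp flip: of_int_mult)
    ultimately show "of_int (sign \<sigma>) * \<alpha> [] * \<beta> (pmap vs \<sigma> 0 l) = \<alpha> [] * \<beta> vs"
      using alt_permute[OF \<beta> vs, of \<sigma>] by (simp add: mult_ac flip: mult.assoc)
  qed
  finally show ?thesis using card_permutations[of "{..<l}" l] by simp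
qed

text \<open>A permutation of the indices up to \<open>l\<close> is \<open>swp l b \<circ> q\<close>
  with \<open>q\<close> fixing \<open>l\<close>. So \<alpha> receives \<open>vs ! b\<close>, and
  \<beta> absorbs \<open>q\<close> with a sign that meets its own copy and disappears.\<close>

lemma wedge_last:
  assumes \<beta>: "\<beta> \<in> AF x l" and vs: "vs \<in> tuples x (Suc l)"
  shows "Wd x l 1 \<beta> \<alpha> vs = (\<Sum>b<Suc l. (-1) ^ (l - b) * \<beta> (take b vs @ drop (Suc b) vs) * \<alpha> [vs ! b])"
proof -
  have l: "length vs = Suc l" "set vs \<subseteq> TS x" using vs by (auto simp: tuples_iff)
  let ?f = "\<lambda>\<sigma>. of_int (sign \<sigma>) * \<beta> (pmap vs \<sigma> 0 l) * \<alpha> [vs ! \<sigma> l] :: real"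
  have "Wd x l 1 \<beta> \<alpha> vs = sum ?f {\<sigma>. \<sigma> permutes insert l {..<l}} / fact l"
    using wedge_eq[of vs x l 1 \<beta> \<alpha>] vs by (simp add: lessThan_Suc)
  also have "sum ?f {\<sigma>. \<sigma> permutes insert l {..<l}} = (\<Sum>b\<in>insert l {..<l}. \<Sum>q | q permutes {..<l}. ?f (swp l b \<circ> q))"
    by (rule sum_over_permutations_insert) auto
  also have "\<dots> = (\<Sum>b\<in>insert l {..<l}. \<Sum>q | q permutes {..<l}. (-1) ^ (l - b) * \<beta> (take b vs @ drop (Suc b) vs) * \<alpha> [vs ! b])"
  proof (intro sum.cong[OF refl])
    fix b q assume b: "b \<in> insert l {..<l}" and q: "q \<in> {q. q permutes {..<l}}"
    then have q': "q permutes {..<l}" by simp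
    let ?ws = "vs[l := vs ! b, b := vs ! l]"
    have ws: "take l ?ws \<in> tuples x l"
    proof -
      have "set ?ws \<subseteq> TS x" using l b set_update_subset_insert[of "vs[l := vs ! b]" b "vs ! l"] set_update_subset_insert[of vs l "vs ! b"]
        by (auto intro: subsetD[OF l(2) nth_mem])
      then show ?thesis using l(1) set_take_subset[of l ?ws] by (auto simp: tuples_iff)
    qed
    have ql: "q l = l" using permutes_not_in[OF q'] by simp
    have qi: "q i < l" if "i < l" for i using permutes_in_image[OF q', of i] that by simp
    have "pmap vs (swp l b \<circ> q) 0 l = pmap (take l ?ws) q 0 l"
    proof (rule map_upt_congI)
      fix i assume "i < l"
      note q1 = qi[OF this]
      show "vs ! (swp l b \<circ> q) i = take l ?ws ! q i"
      proof (cases "q i = b")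
        case True
        then show ?thesis using q1 l(1) by simp
      next
        case False
        then have "swp l b (q i) = q i" using q1 by (simp add: transpose_def)
        then show ?thesis using q1 False by simp
      qed
    qed
    note pe = this
    have "\<beta> (pmap vs (swp l b \<circ> q) 0 l) = of_int (sign q) * \<beta> (take l ?ws)"
      unfolding pe by (rule alt_permute[OF \<beta> ws q'])
    moreover have "sign (swp l b \<circ> q) = sign (swp l b) * sign q"
      by (rule sign_compose[OF permutation_swap_id permutes_imp_permutation[OF _ q']]) simp
    moreover have "of_int (sign q) * of_int (sign q) = (1::real)" by (simp flip: of_int_mult)
    ultimately have "?f (swp l b \<circ> q) = of_int (sign (swp l b)) * \<beta> (take l ?ws) * \<alpha> [vs ! b]"
      using ql by (simp add: mult_ac flip: mult.assoc)
    \<comment> \<open>The transposition leaves \<open>vs ! l\<close> in place \<open>b\<close>;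
      moving it back to the end passes l - b - 1 entries, which with the sign of the transposition
      gives (-1)^(l - b).\<close>
    also have "of_int (sign (swp l b)) * \<beta> (take l ?ws) = (-1) ^ (l - b) * \<beta> (take b vs @ drop (Suc b) vs)"
    proof (cases "b = l")
      case True
      then show ?thesis using l by simp
    next
      case False
      then have bl: "b < l" using b by simp
      have d: "drop (Suc b) vs = drop (Suc b) (take l vs) @ [vs ! l]"
      proof -
        have "vs = take l vs @ [vs ! l]" using l(1) by (metis lessI take_Suc_conv_app_nth take_all_iff order_refl)
        then have "drop (Suc b) vs = drop (Suc b) (take l vs @ [vs ! l])" by simp
        then show ?thesis using bl l(1) by simp
      qed
      have t: "take l ?ws = take b vs @ [vs ! l] @ drop (Suc b) (take l vs) @ []"
      proof -
        have "take l ?ws = (take l vs)[b := vs ! l]"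
          using l(1) list_update_beyond[of "take l vs" l "vs ! b"] by (simp add: take_update_swap)
        also have "\<dots> = take b (take l vs) @ vs ! l # drop (Suc b) (take l vs)"
          by (rule upd_conv_take_nth_drop) (use bl l(1) in simp)
        finally show ?thesis using bl by (simp add: min_def)
      qed
      have "\<beta> (take l ?ws) = (-1) ^ length (drop (Suc b) (take l vs)) * \<beta> (take b vs @ drop (Suc b) vs)"
        unfolding t d using alt_move[OF \<beta>, of "take b vs" "vs ! l" "drop (Suc b) (take l vs)" "[]"] ws t by simp
      moreover have "l - b = Suc (l - Suc b)" using bl by simp
      ultimately show ?thesis using False l(1) by (simp add: sign_swap_id)
    qed
    finally show "?f (swp l b \<circ> q) = (-1) ^ (l - b) * \<beta> (take b vs @ drop (Suc b) vs) * \<alpha> [vs ! b]" .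
  qed
  also have "\<dots> = fact l * (\<Sum>b<Suc l. (-1) ^ (l - b) * \<beta> (take b vs @ drop (Suc b) vs) * \<alpha> [vs ! b])"
    using card_permutations[of "{..<l}" l] by (simp add: sum_distrib_left lessThan_Suc[symmetric] del: sum.lessThan_Suc)
  finally show ?thesis by simp
qed

text \<open>Commuting the 1-form to the front turns the sign (-1)^(l - b) of
  \<open>wedge_last\<close> into (-1)^b.\<close>

lemma wedge_1:
  assumes \<beta>: "\<beta> \<in> AF x l" and vs: "vs \<in> tuples x (Suc l)"
  shows "Wd x 1 l \<alpha> \<beta> vs = (\<Sum>b<Suc l. (-1) ^ b * \<alpha> [vs ! b] * \<beta> (take b vs @ drop (Suc b) vs))"
proof -
  have "Wd x 1 l \<alpha> \<beta> vs = (-1) ^ (1 * l) * Wd x l 1 \<beta> \<alpha> vs"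
    by (rule wedge_comm) (use vs in simp)
  also have "\<dots> = (\<Sum>b<Suc l. (-1) ^ l * ((-1) ^ (l - b) * \<beta> (take b vs @ drop (Suc b) vs) * \<alpha> [vs ! b]))"
    unfolding wedge_last[OF assms] sum_distrib_left by simp
  also have "\<dots> = (\<Sum>b<Suc l. (-1) ^ b * \<alpha> [vs ! b] * \<beta> (take b vs @ drop (Suc b) vs))"
  proof (rule sum.cong[OF refl])
    fix b assume "b \<in> {..<Suc l}"
    then have "(-1 :: real) ^ l * (-1) ^ (l - b) = (-1) ^ b"
      by (simp add: power_add[symmetric] minus_one_power_iff)
    then show "(-1) ^ l * ((-1) ^ (l - b) * \<beta> (take b vs @ drop (Suc b) vs) * \<alpha> [vs ! b]) = (-1) ^ b * \<alpha> [vs ! b] * \<beta> (take b vs @ drop (Suc b) vs)"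
      by (simp flip: mult.assoc)
  qed
  finally show ?thesis .
qed

end

section \<open>Differential forms in a chart\<close>

context corner_manifold
begin

lemma wedge_sum_l:
  assumes vs: "vs \<in> tuples x (k + l)" and \<gamma>: "\<And>us. us \<in> tuples x k \<Longrightarrow> \<gamma> us = (\<Sum>i\<in>I. a i * \<alpha> i us)"
  shows "Wd x k l \<gamma> \<beta> vs = (\<Sum>i\<in>I. a i * Wd x k l (\<alpha> i) \<beta> vs)"
proof -
  let ?S = "{\<sigma>. \<sigma> permutes {..<k + l}}"
  have "(\<Sum>\<sigma>\<in>?S. of_int (sign \<sigma>) * \<gamma> (pmap vs \<sigma> 0 k) * \<beta> (pmap vs \<sigma> k (k + l))) =
    (\<Sum>\<sigma>\<in>?S. \<Sum>i\<in>I. a i * (of_int (sign \<sigma>) * \<alpha> i (pmap vs \<sigma> 0 k) * \<beta> (pmap vs \<sigma> k (k + l))))"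
  proof (rule sum.cong[OF refl])
    fix \<sigma> assume "\<sigma> \<in> ?S"
    then have "\<gamma> (pmap vs \<sigma> 0 k) = (\<Sum>i\<in>I. a i * \<alpha> i (pmap vs \<sigma> 0 k))"
      using pmap_tuples[OF vs, of \<sigma> 0 k] by (simp add: \<gamma>)
    then show "of_int (sign \<sigma>) * \<gamma> (pmap vs \<sigma> 0 k) * \<beta> (pmap vs \<sigma> k (k + l)) =
      (\<Sum>i\<in>I. a i * (of_int (sign \<sigma>) * \<alpha> i (pmap vs \<sigma> 0 k) * \<beta> (pmap vs \<sigma> k (k + l))))"
      by (simp add: sum_distrib_left sum_distrib_right mult_ac)
  qed
  also have "\<dots> = (\<Sum>i\<in>I. a i * (\<Sum>\<sigma>\<in>?S. of_int (sign \<sigma>) * \<alpha> i (pmap vs \<sigma> 0 k) * \<beta> (pmap vs \<sigma> k (k + l))))"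
    unfolding sum_distrib_left by (rule sum.swap)
  finally show ?thesis unfolding wedge_eq[OF vs] times_divide_eq_right sum_divide_distrib[symmetric] by (rule arg_cong)
qed

lemma wedge_sum_r:
  assumes vs: "vs \<in> tuples x (k + l)" and \<gamma>: "\<And>us. us \<in> tuples x l \<Longrightarrow> \<gamma> us = (\<Sum>i\<in>I. a i * \<beta> i us)"
  shows "Wd x k l \<alpha> \<gamma> vs = (\<Sum>i\<in>I. a i * Wd x k l \<alpha> (\<beta> i) vs)"
proof -
  have vs': "vs \<in> tuples x (l + k)" using vs by (simp add: add.commute)
  have "Wd x k l \<alpha> \<gamma> vs = (-1) ^ (k * l) * (\<Sum>i\<in>I. a i * Wd x l k (\<beta> i) \<alpha> vs)"
    unfolding wedge_comm[OF vs] using wedge_sum_l[OF vs' \<gamma>] by simp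
  also have "\<dots> = (\<Sum>i\<in>I. a i * Wd x k l \<alpha> (\<beta> i) vs)"
    unfolding sum_distrib_left wedge_comm[OF vs] by (simp add: mult_ac)
  finally show ?thesis .
qed

lemma wedge_lin_l:
  assumes "vs \<in> tvec_tuples M x (k + l)" "\<And>us. us \<in> tvec_tuples M x k \<Longrightarrow> \<gamma> us = a * \<alpha> us + b * \<alpha>' us"
  shows "wedge M x k l \<gamma> \<beta> vs = a * wedge M x k l \<alpha> \<beta> vs + b * wedge M x k l \<alpha>' \<beta> vs"
proof (cases "k < 0 \<or> l < 0")
  case True
  then show ?thesis using assms(1) by (simp add: wedge_neg)
next
  case False
  then obtain p q where e: "k = int p" "l = int q" by (metis nonneg_int_cases not_less)
  \<comment> \<open>A combination of two forms is a sum over the booleans.\<close>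
  show ?thesis using wedge_sum_l[of vs x p q \<gamma> "\<lambda>i. if i then a else b" "\<lambda>i. if i then \<alpha> else \<alpha>'" UNIV \<beta>] assms
    by (simp add: e tvec_tuples_int tvec_tuples_add UNIV_bool add.commute)
qed

lemma wedge_lin_r:
  assumes "vs \<in> tvec_tuples M x (k + l)" "\<And>us. us \<in> tvec_tuples M x l \<Longrightarrow> \<gamma> us = a * \<beta> us + b * \<beta>' us"
  shows "wedge M x k l \<alpha> \<gamma> vs = a * wedge M x k l \<alpha> \<beta> vs + b * wedge M x k l \<alpha> \<beta>' vs"
proof (cases "k < 0 \<or> l < 0")
  case True
  then show ?thesis using assms(1) by (simp add: wedge_neg)
next
  case False
  then obtain p q where e: "k = int p" "l = int q" by (metis nonneg_int_cases not_less)
  show ?thesis using wedge_sum_r[of vs x p q \<gamma> "\<lambda>i. if i then a else b" "\<lambda>i. if i then \<beta> else \<beta>'" UNIV \<alpha>] assms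
    by (simp add: e tvec_tuples_int tvec_tuples_add UNIV_bool add.commute)
qed

lemma wedge_cong:
  assumes "\<And>us. us \<in> tuples x k \<Longrightarrow> \<alpha> us = \<alpha>' us" "\<And>us. us \<in> tuples x l \<Longrightarrow> \<beta> us = \<beta>' us"
  shows "Wd x k l \<alpha> \<beta> = Wd x k l \<alpha>' \<beta>'"
proof (rule extensionalityI[OF wedge_ext wedge_ext])
  fix vs assume vs: "vs \<in> tvec_tuples M x (int k + int l)"
  show "Wd x k l \<alpha> \<beta> vs = Wd x k l \<alpha>' \<beta>' vs"
    using wedge_lin_l[OF vs, of \<alpha> 1 \<alpha>' 0 \<alpha>' \<beta>] wedge_lin_r[OF vs, of \<beta> 1 \<beta>' 0 \<beta>' \<alpha>'] assms
    by (simp add: tvec_tuples_int)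
qed

lemma dR_forms_iff: "\<omega> \<in> dR_forms M V k \<longleftrightarrow> \<omega> \<in> extensional V \<and> (\<forall>x\<in>V. \<omega> x \<in> alt_forms M x k) \<and>
    (\<forall>c\<in>atlas M. \<forall>js. int (length js) = k \<longrightarrow> set js \<subseteq> {..<n} \<longrightarrow> sm M c V (\<lambda>x. \<omega> x (map (coord_vec M c x) js)))"
  by (simp add: dR_forms_def sm_def cimg_def)

lemma cimg_Int: "cimg c (fst c \<inter> V) = cimg c V"
  by (auto simp: cimg_def)

lemma alt_sum:
  assumes \<alpha>: "\<And>i. i \<in> I \<Longrightarrow> \<alpha> i \<in> AF x k"
  shows "(\<lambda>vs\<in>tuples x k. \<Sum>i\<in>I. a i * \<alpha> i vs) \<in> AF x k"
proof (rule alt_formsI)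
  fix vs i v w p q assume h: "vs \<in> tuples x k" "i < k" "v \<in> TS x" "w \<in> TS x"
  then have "vs[i := vcomb p v q w] \<in> tuples x k" "vs[i := v] \<in> tuples x k" "vs[i := w] \<in> tuples x k"
    by (simp_all add: tuples_upd tangent_vcomb)
  then show "(\<lambda>vs\<in>tuples x k. \<Sum>i\<in>I. a i * \<alpha> i vs) (vs[i := vcomb p v q w]) =
      p * (\<lambda>vs\<in>tuples x k. \<Sum>i\<in>I. a i * \<alpha> i vs) (vs[i := v]) + q * (\<lambda>vs\<in>tuples x k. \<Sum>i\<in>I. a i * \<alpha> i vs) (vs[i := w])"
    using alt_lin[OF \<alpha> h] by (simp add: sum_distrib_left sum.distrib[symmetric] algebra_simps)
next
  fix vs i j assume "vs \<in> tuples x k" "i < k" "j < k" "i \<noteq> j" "vs ! i = vs ! j"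
  then show "(\<lambda>vs\<in>tuples x k. \<Sum>i\<in>I. a i * \<alpha> i vs) vs = 0" using alt_rep[OF \<alpha>] by (simp add: sum.neutral)
qed simp

end

locale chart_domain = corner_manifold M for M :: "'m mfd" +
  fixes c :: "'m chart" and W :: "'m set"
  assumes c: "c \<in> atlas M" and W: "openin (mtop M) W" and Wc: "W \<subseteq> fst c"
begin

text \<open>Degrees are natural numbers and nothing is asked off \<open>W\<close>, so one \<omega>
  serves as a form on all smaller domains.\<close>

definition lform :: "nat \<Rightarrow> ('m \<Rightarrow> 'm tvec list \<Rightarrow> real) \<Rightarrow> bool"
  where "lform k \<omega> \<longleftrightarrow> (\<forall>x\<in>W. \<omega> x \<in> AF x k) \<and>
    (\<forall>js. length js = k \<longrightarrow> set js \<subseteq> {..<n} \<longrightarrow> sm M c W (\<lambda>x. \<omega> x (map (coord_vec M c x) js)))"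

text \<open>The vector field with constant coordinates that extends \<open>v\<close>.\<close>

abbreviation "frz y v \<equiv> chart_vec M c y (v c)"

section \<open>Fields with constant coordinates and derivatives of coefficients\<close>

lemma at: "x \<in> W \<Longrightarrow> c \<in> charts_at M x"
  using c Wc by (auto simp: charts_at_iff)

lemma at': "x \<in> W \<Longrightarrow> x \<in> fst c"
  using Wc by blast

lemma lform_alt: "lform k \<omega> \<Longrightarrow> x \<in> W \<Longrightarrow> \<omega> x \<in> AF x k"
  by (simp add: lform_def)

text \<open>The vector fields are expanded in coordinate fields one by one; \<open>js\<close>
  collects the indices already expanded, and after the last field only a coefficient of \<omega>
  remains.\<close>

lemma eval_sm:
  assumes \<omega>: "lform k \<omega>"
  shows "length js + length vfs = k \<Longrightarrow> set js \<subseteq> {..<n} \<Longrightarrow>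
    (\<And>v. v \<in> set vfs \<Longrightarrow> (\<forall>x\<in>W. v x \<in> TS x) \<and> (\<forall>i<n. sm M c W (\<lambda>x. v x c i))) \<Longrightarrow>
    sm M c W (\<lambda>x. \<omega> x (map (coord_vec M c x) js @ map (\<lambda>v. v x) vfs))"
proof (induction vfs arbitrary: js)
  case Nil
  then show ?case using \<omega> by (simp add: lform_def)
next
  case (Cons v vfs)
  have v: "v x \<in> TS x" "i < n \<Longrightarrow> sm M c W (\<lambda>x. v x c i)" if "x \<in> W" for x i using Cons.prems(3)[of v] that by auto
  have "sm M c W (\<lambda>x. \<Sum>j<n. v x c j * \<omega> x (map (coord_vec M c x) (js @ [j]) @ map (\<lambda>v. v x) vfs))"
  proof (rule sm_sum[OF c W], rule sm_mult[OF c W])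
    fix j assume j: "j \<in> {..<n}"
    show "sm M c W (\<lambda>x. v x c j)" using Cons.prems(3)[of v] j by simp
    show "sm M c W (\<lambda>x. \<omega> x (map (coord_vec M c x) (js @ [j]) @ map (\<lambda>v. v x) vfs))"
      by (rule Cons.IH) (use Cons.prems j in auto)
  qed
  then show ?case
  proof (rule sm_cong[OF c])
    fix x assume x: "x \<in> W"
    let ?l = "map (coord_vec M c x) js @ map (\<lambda>v. v x) (v # vfs)"
    have "?l \<in> tuples x k"
      using Cons.prems x coord_vec_tangent[OF at[OF x]] by (auto simp: tuples_iff)
    from alt_coords[OF lform_alt[OF \<omega> x] at[OF x] this, of "length js"]
    show "(\<Sum>j<n. v x c j * \<omega> x (map (coord_vec M c x) (js @ [j]) @ map (\<lambda>v. v x) vfs)) = \<omega> x ?l"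
      using Cons.prems(1) by (simp add: list_update_append nth_append)
  qed
qed

lemma frz_tangent: "y \<in> W \<Longrightarrow> frz y v \<in> TS y"
  by (rule chart_vec_tangent[OF at])

lemma frz_self: "x \<in> W \<Longrightarrow> v \<in> TS x \<Longrightarrow> frz x v = v"
  by (rule chart_vec_coords[OF at])

lemma frz_self_map: "x \<in> W \<Longrightarrow> vs \<in> tuples x k \<Longrightarrow> map (frz x) vs = vs"
  by (rule map_idI) (auto simp: tuples_iff frz_self)

lemma frz_coord: "x \<in> W \<Longrightarrow> frz y (coord_vec M c x j) = coord_vec M c y j"
  unfolding coord_vec_def[of M c y] by (rule chart_vec_cong) (simp add: coord_vec_self at)

lemma frz_tuples: "y \<in> W \<Longrightarrow> vs \<in> tuples x k \<Longrightarrow> map (frz y) vs \<in> tuples y k"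
  by (auto simp: tuples_iff frz_tangent)

lemma frz_sm:
  assumes \<omega>: "lform k \<omega>" and vs: "length vs = k"
  shows "sm M c W (\<lambda>y. \<omega> y (map (frz y) vs))"
proof -
  have "sm M c W (\<lambda>x. \<omega> x (map (coord_vec M c x) [] @ map (\<lambda>v. v x) (map (\<lambda>v y. frz y v) vs)))"
  proof (rule eval_sm[OF \<omega>])
    fix u assume "u \<in> set (map (\<lambda>v y. frz y v) vs)"
    then obtain v where u: "u = (\<lambda>y. frz y v)" by auto
    have "sm M c W (\<lambda>x. u x c i)" if "i < n" for i
      by (rule sm_cong[OF c sm_const[OF c W, of "v c i"]]) (simp add: u chart_vec_self at that)
    then show "(\<forall>x\<in>W. u x \<in> TS x) \<and> (\<forall>i<n. sm M c W (\<lambda>x. u x c i))" by (simp add: u frz_tangent)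
  qed (use vs in auto)
  then show ?thesis by (simp add: comp_def)
qed

text \<open>The Lie derivative along the i-th coordinate field: the fields y \<mapsto>
  \<open>frz y v\<close> have constant coordinates and hence commute with it.\<close>

definition pf :: "nat \<Rightarrow> nat \<Rightarrow> ('m \<Rightarrow> 'm tvec list \<Rightarrow> real) \<Rightarrow> 'm \<Rightarrow> 'm tvec list \<Rightarrow> real"
  where "pf k i \<omega> x = (\<lambda>vs\<in>tuples x k. cpd c W i (\<lambda>y. \<omega> y (map (frz y) vs)) x)"

text \<open>Linearity and vanishing on repeated vectors pass under the derivative because v
  \<mapsto> \<open>frz y v\<close> is linear.\<close>

lemma pf_lform:
  assumes \<omega>: "lform k \<omega>" and i: "i < n"
  shows "lform k (pf k i \<omega>)"
  unfolding lform_def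
proof (intro conjI ballI allI impI)
  fix x assume x: "x \<in> W"
  show "pf k i \<omega> x \<in> AF x k"
  proof (rule alt_formsI)
    fix vs m v w a b assume h: "vs \<in> tuples x k" "m < k" "v \<in> TS x" "w \<in> TS x"
    have l: "length vs = k" using h by (simp add: tuples_iff)
    have e: "\<omega> y (map (frz y) (vs[m := vcomb a v b w])) = a * \<omega> y (map (frz y) (vs[m := v])) + b * \<omega> y (map (frz y) (vs[m := w]))"
      if y: "y \<in> W" for y
    proof -
      have "frz y (vcomb a v b w) = vcomb a (frz y v) b (frz y w)"
        unfolding vcomb_def[of a v] by (rule chart_vec_comb)
      then show ?thesis
        using alt_lin[OF lform_alt[OF \<omega> y] frz_tuples[OF y h(1)] h(2) frz_tangent[OF y] frz_tangent[OF y]] by (simp add: map_update)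
    qed
    have "pf k i \<omega> x (vs[m := vcomb a v b w]) =
      cpd c W i (\<lambda>y. a * \<omega> y (map (frz y) (vs[m := v])) + b * \<omega> y (map (frz y) (vs[m := w]))) x"
      using h cpd_cong[OF c e at'[OF x] x, where j = i] by (simp add: pf_def tuples_upd tangent_vcomb)
    also have "\<dots> = a * cpd c W i (\<lambda>y. \<omega> y (map (frz y) (vs[m := v]))) x + b * cpd c W i (\<lambda>y. \<omega> y (map (frz y) (vs[m := w]))) x"
      using l by (simp add: cpd_add[OF c W i at'[OF x] x] cpd_cmult[OF c W i at'[OF x] x] sm_mult[OF c W sm_const[OF c W]] frz_sm[OF \<omega>])
    finally show "pf k i \<omega> x (vs[m := vcomb a v b w]) = a * pf k i \<omega> x (vs[m := v]) + b * pf k i \<omega> x (vs[m := w])"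
      using h by (simp add: pf_def tuples_upd)
  next
    fix vs p q assume h: "vs \<in> tuples x k" "p < k" "q < k" "p \<noteq> q" "vs ! p = vs ! q"
    have "\<omega> y (map (frz y) vs) = 0" if y: "y \<in> W" for y
      using alt_rep[OF lform_alt[OF \<omega> y] frz_tuples[OF y h(1)] h(2-4)] h by (simp add: tuples_iff)
    then have "cpd c W i (\<lambda>y. \<omega> y (map (frz y) vs)) x = cpd c W i (\<lambda>y. 0) x"
      by (intro cpd_cong[OF c _ at'[OF x] x])
    then show "pf k i \<omega> x vs = 0" using h cpd_const[OF c W i at'[OF x] x] by (simp add: pf_def)
  qed (simp add: pf_def)
next
  fix js :: "nat list" assume js: "length js = k" "set js \<subseteq> {..<n}"
  then have s: "sm M c W (\<lambda>y. \<omega> y (map (coord_vec M c y) js))" using \<omega> by (simp add: lform_def)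
  show "sm M c W (\<lambda>x. pf k i \<omega> x (map (coord_vec M c x) js))"
  proof (rule sm_cong[OF c sm_cpd[OF c W s i]])
    fix x assume x: "x \<in> W"
    then have "map (coord_vec M c x) js \<in> tuples x k" using js coord_vec_tangent[OF at] by (auto simp: tuples_iff)
    then show "cpd c W i (\<lambda>y. \<omega> y (map (coord_vec M c y) js)) x = pf k i \<omega> x (map (coord_vec M c x) js)"
      using frz_coord[OF x] by (simp add: pf_def comp_def)
  qed
qed

lemma pf_sum:
  assumes \<omega>: "\<And>m. m \<in> I \<Longrightarrow> lform k (\<omega> m)" and i: "i < n" and x: "x \<in> W" "vs \<in> tuples x k"
    and e: "\<And>y us. y \<in> W \<Longrightarrow> us \<in> tuples y k \<Longrightarrow> \<eta> y us = (\<Sum>m\<in>I. a m * \<omega> m y us)"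
  shows "pf k i \<eta> x vs = (\<Sum>m\<in>I. a m * pf k i (\<omega> m) x vs)"
proof -
  have l: "length vs = k" using x by (simp add: tuples_iff)
  have "cpd c W i (\<lambda>y. \<eta> y (map (frz y) vs)) x = cpd c W i (\<lambda>y. \<Sum>m\<in>I. a m * \<omega> m y (map (frz y) vs)) x"
    by (rule cpd_cong[OF c _ at'[OF x(1)] x(1)]) (use e frz_tuples x in blast)
  also have "\<dots> = (\<Sum>m\<in>I. cpd c W i (\<lambda>y. a m * \<omega> m y (map (frz y) vs)) x)"
    by (rule cpd_sum[OF c W i at'[OF x(1)] x(1)]) (intro sm_mult[OF c W] sm_const[OF c W] frz_sm[OF \<omega> l])
  finally show ?thesis using x by (simp add: pf_def cpd_cmult[OF c W i at'[OF x(1)] x(1) frz_sm[OF \<omega> l]])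
qed

lemma frz_wedge:
  assumes y: "y \<in> W" and vs: "vs \<in> tuples x (k + l)"
  shows "Wd y k l \<alpha> \<beta> (map (frz y) vs) = (\<Sum>\<sigma> | \<sigma> permutes {..<k + l}. (of_int (sign \<sigma>) / (fact k * fact l)) *
         (\<alpha> (map (frz y) (pmap vs \<sigma> 0 k)) * \<beta> (map (frz y) (pmap vs \<sigma> k (k + l)))))"
proof -
  have E: "pmap (map (frz y) vs) \<sigma> p q = map (frz y) (pmap vs \<sigma> p q)" if "\<sigma> \<in> {\<sigma>. \<sigma> permutes {..<k + l}}" "q \<le> k + l" for \<sigma> p q
    using that permutes_in_image[of \<sigma> "{..<k + l}"] vs by (auto simp: tuples_iff)
  show ?thesis
    unfolding wedge_eq[OF frz_tuples[OF y vs]] sum_divide_distrib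
    by (intro sum.cong refl) (simp only: E le_add1 order_refl times_divide_eq_left mult.assoc)
qed

text \<open>The product rule in every summand of the wedge product; no sign arises, since
  \<open>pf\<close> preserves the degree.\<close>

lemma pf_wedge:
  assumes \<alpha>: "lform k \<alpha>" and \<beta>: "lform l \<beta>" and i: "i < n" and x: "x \<in> W" "vs \<in> tuples x (k + l)"
  shows "pf (k + l) i (\<lambda>y. Wd y k l (\<alpha> y) (\<beta> y)) x vs = Wd x k l (pf k i \<alpha> x) (\<beta> x) vs + Wd x k l (\<alpha> x) (pf l i \<beta> x) vs"
proof -
  let ?S = "{\<sigma>. \<sigma> permutes {..<k + l}}"
  let ?s = "\<lambda>\<sigma>. of_int (sign \<sigma>) / (fact k * fact l) :: real"
  let ?u = "\<lambda>\<sigma>. pmap vs \<sigma> 0 k" and ?v = "\<lambda>\<sigma>. pmap vs \<sigma> k (k + l)"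
  let ?a = "\<lambda>\<sigma> y. \<alpha> y (map (frz y) (?u \<sigma>))" and ?b = "\<lambda>\<sigma> y. \<beta> y (map (frz y) (?v \<sigma>))"
  note C = cpd_sum[OF c W i at'[OF x(1)] x(1)] cpd_cmult[OF c W i at'[OF x(1)] x(1)] cpd_mult[OF c W i at'[OF x(1)] x(1)]
  have s: "sm M c W (?a \<sigma>)" "sm M c W (?b \<sigma>)" for \<sigma>
    by (rule frz_sm[OF \<alpha>], simp, rule frz_sm[OF \<beta>], simp)
  have t: "?u \<sigma> \<in> tuples x k" "?v \<sigma> \<in> tuples x l" if "\<sigma> \<in> ?S" for \<sigma>
    using pmap_tuples[OF x(2), of \<sigma> 0 k] pmap_tuples[OF x(2), of \<sigma> k "k + l"] that by auto
  have "cpd c W i (\<lambda>y. Wd y k l (\<alpha> y) (\<beta> y) (map (frz y) vs)) x = cpd c W i (\<lambda>y. \<Sum>\<sigma>\<in>?S. ?s \<sigma> * (?a \<sigma> y * ?b \<sigma> y)) x"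
    by (rule cpd_cong[OF c _ at'[OF x(1)] x(1)]) (simp add: frz_wedge[OF _ x(2)])
  also have "\<dots> = (\<Sum>\<sigma>\<in>?S. ?s \<sigma> * (cpd c W i (?a \<sigma>) x * ?b \<sigma> x + ?a \<sigma> x * cpd c W i (?b \<sigma>) x))"
    by (simp only: C s sm_mult[OF c W] sm_const[OF c W])
  also have "\<dots> = (\<Sum>\<sigma>\<in>?S. ?s \<sigma> * (pf k i \<alpha> x (?u \<sigma>) * \<beta> x (?v \<sigma>) + \<alpha> x (?u \<sigma>) * pf l i \<beta> x (?v \<sigma>)))"
    by (intro sum.cong refl) (simp only: pf_def restrict_apply' t frz_self_map[OF x(1) t(1)] frz_self_map[OF x(1) t(2)])
  finally show ?thesis
    using x unfolding wedge_eq[OF x(2)] by (simp add: pf_def sum_divide_distrib sum.distrib[symmetric] algebra_simps add_divide_distrib)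
qed

text \<open>The constant-coordinate field through a value of such a field is that field again. So
  the iterated derivative is an iterated partial derivative of one function, and
  \<open>cpd_commute\<close> applies.\<close>

lemma pf_commute:
  assumes \<omega>: "lform k \<omega>" and ij: "i < n" "j < n" and x: "x \<in> W" "vs \<in> tuples x k"
  shows "pf k i (pf k j \<omega>) x vs = pf k j (pf k i \<omega>) x vs"
proof -
  have l: "length vs = k" using x by (simp add: tuples_iff)
  have e: "cpd c W i (\<lambda>y. pf k j \<omega> y (map (frz y) vs)) x = cpd c W i (cpd c W j (\<lambda>z. \<omega> z (map (frz z) vs))) x" for i j
  proof (rule cpd_cong[OF c _ at'[OF x(1)] x(1)])
    fix y assume y: "y \<in> W"
    have "frz z (frz y v) = frz z v" for z v
      by (rule chart_vec_cong) (simp add: chart_vec_self at y)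
    then have "map (frz z) (map (frz y) vs) = map (frz z) vs" for z by simp
    then show "pf k j \<omega> y (map (frz y) vs) = cpd c W j (\<lambda>z. \<omega> z (map (frz z) vs)) y"
      using frz_tuples[OF y x(2)] by (simp only: pf_def restrict_apply')
  qed
  show ?thesis using x e[of i j] e[of j i] cpd_commute[OF c W frz_sm[OF \<omega> l] ij at'[OF x(1)] x(1)]
    by (simp add: pf_def[of k i "pf k j \<omega>"] pf_def[of k j "pf k i \<omega>"])
qed

lemma lform_sum:
  assumes "\<And>i. i \<in> I \<Longrightarrow> lform k (\<omega> i)" "\<And>i. i \<in> I \<Longrightarrow> sm M c W (a i)"
  shows "lform k (\<lambda>x. \<lambda>vs\<in>tuples x k. \<Sum>i\<in>I. a i x * \<omega> i x vs)"
  unfolding lform_def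
proof (intro conjI ballI allI impI)
  fix x assume "x \<in> W"
  then show "(\<lambda>vs\<in>tuples x k. \<Sum>i\<in>I. a i x * \<omega> i x vs) \<in> AF x k"
    by (intro alt_sum lform_alt assms)
next
  fix js :: "nat list" assume js: "length js = k" "set js \<subseteq> {..<n}"
  have "sm M c W (\<lambda>x. \<Sum>i\<in>I. a i x * \<omega> i x (map (coord_vec M c x) js))"
    by (rule sm_sum[OF c W], rule sm_mult[OF c W]) (use assms js in \<open>auto simp: lform_def\<close>)
  then show "sm M c W (\<lambda>x. (\<lambda>vs\<in>tuples x k. \<Sum>i\<in>I. a i x * \<omega> i x vs) (map (coord_vec M c x) js))"
    by (rule sm_cong[OF c]) (use js coord_vec_tangent[OF at] in \<open>auto simp: tuples_iff\<close>)
qed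

text \<open>On coordinate fields a shuffled list of arguments is a shuffled list of indices, so each
  coefficient of the product is a combination of products of coefficients.\<close>

lemma lform_wedge:
  assumes \<alpha>: "lform k \<alpha>" and \<beta>: "lform l \<beta>"
  shows "lform (k + l) (\<lambda>x. Wd x k l (\<alpha> x) (\<beta> x))"
  unfolding lform_def
proof (intro conjI ballI allI impI)
  fix x assume "x \<in> W"
  then show "Wd x k l (\<alpha> x) (\<beta> x) \<in> AF x (k + l)" using wedge_alt lform_alt[OF \<alpha>] lform_alt[OF \<beta>] by blast
next
  fix js :: "nat list" assume js: "length js = k + l" "set js \<subseteq> {..<n}"
  let ?S = "{\<sigma>. \<sigma> permutes {..<k + l}}"
  let ?j = "\<lambda>\<sigma> p q. map (\<lambda>i. js ! \<sigma> i) [p..<q]"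
  let ?f = "\<lambda>x. \<Sum>\<sigma>\<in>?S. (of_int (sign \<sigma>) / (fact k * fact l)) *
     (\<alpha> x (map (coord_vec M c x) (?j \<sigma> 0 k)) * \<beta> x (map (coord_vec M c x) (?j \<sigma> k (k + l))))"
  have "sm M c W ?f"
  proof (rule sm_sum[OF c W], rule sm_mult[OF c W sm_const[OF c W]], rule sm_mult[OF c W])
    fix \<sigma> assume "\<sigma> \<in> ?S"
    then have "js ! \<sigma> i < n" if "i < k + l" for i
      using permutes_in_image[of \<sigma> "{..<k + l}" i] that js subsetD[OF js(2) nth_mem] by simp
    then have "set (?j \<sigma> 0 k) \<subseteq> {..<n}" "set (?j \<sigma> k (k + l)) \<subseteq> {..<n}" by auto
    then show "sm M c W (\<lambda>x. \<alpha> x (map (coord_vec M c x) (?j \<sigma> 0 k)))"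
      "sm M c W (\<lambda>x. \<beta> x (map (coord_vec M c x) (?j \<sigma> k (k + l))))"
      using \<alpha>[unfolded lform_def, THEN conjunct2, rule_format, of "?j \<sigma> 0 k"]
        \<beta>[unfolded lform_def, THEN conjunct2, rule_format, of "?j \<sigma> k (k + l)"] by simp_all
  qed
  then show "sm M c W (\<lambda>x. Wd x k l (\<alpha> x) (\<beta> x) (map (coord_vec M c x) js))"
  proof (rule sm_cong[OF c])
    fix x assume x: "x \<in> W"
    let ?cs = "map (coord_vec M c x) js"
    have t: "?cs \<in> tuples x (k + l)" using js coord_vec_tangent[OF at[OF x]] by (auto simp: tuples_iff)
    have E: "pmap ?cs \<sigma> p q = map (coord_vec M c x) (?j \<sigma> p q)" if "\<sigma> \<in> ?S" "q \<le> k + l" for \<sigma> p q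
      using that permutes_in_image[of \<sigma> "{..<k + l}"] js by auto
    show "?f x = Wd x k l (\<alpha> x) (\<beta> x) ?cs"
      unfolding wedge_eq[OF t] sum_divide_distrib
      by (intro sum.cong refl) (simp only: E le_add1 order_refl times_divide_eq_left mult.assoc)
  qed
qed

lemma lform_cong:
  assumes "lform k \<omega>" "\<And>x. x \<in> W \<Longrightarrow> \<omega> x = \<eta> x"
  shows "lform k \<eta>"
  using assms sm_cong[OF c, of W] unfolding lform_def by (metis (mono_tags, lifting))

end

section \<open>The exterior derivative in a chart\<close>

context corner_manifold
begin

lemma tuples_Suc: "vs \<in> tuples x (Suc k) \<Longrightarrow> b < Suc k \<Longrightarrow> vs ! b \<in> TS x \<and> take b vs @ drop (Suc b) vs \<in> tuples x k"
  by (auto simp: tuples_iff dest: in_set_takeD in_set_dropD intro: subsetD[OF _ nth_mem])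

lemma tangent_change:
  "v \<in> TS x \<Longrightarrow> c \<in> charts_at M x \<Longrightarrow> c' \<in> charts_at M x \<Longrightarrow> i < n \<Longrightarrow> v c' i = (\<Sum>j<n. jacobian c c' x i j * v c j)"
  unfolding tangent_space_def by blast

lemma wedge_swap:
  assumes vs: "vs \<in> tuples x (Suc (k + l))"
  shows "Wd x 1 (k + l) \<alpha> (Wd x k l \<beta> \<gamma>) vs = (-1) ^ k * Wd x k (Suc l) \<beta> (Wd x 1 l \<alpha> \<gamma>) vs"
proof -
  have vs': "vs \<in> tuples x (Suc k + l)" using vs by simp
  have "Wd x 1 (k + l) \<alpha> (Wd x k l \<beta> \<gamma>) vs = Wd x (Suc k) l (Wd x 1 k \<alpha> \<beta>) \<gamma> vs"
    using wedge_assoc[of vs x 1 k l \<alpha> \<beta> \<gamma>] vs by simp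
  \<comment> \<open>A sum over one element lets \<open>wedge_sum_l\<close> carry the sign from the
    inner factor to the outside.\<close>
  also have "\<dots> = (\<Sum>i\<in>{()}. (-1) ^ k * Wd x (Suc k) l (Wd x k 1 \<beta> \<alpha>) \<gamma> vs)"
    by (rule wedge_sum_l[OF vs']) (use wedge_comm[of _ x 1 k \<alpha> \<beta>] in simp)
  also have "Wd x (Suc k) l (Wd x k 1 \<beta> \<alpha>) \<gamma> vs = Wd x k (Suc l) \<beta> (Wd x 1 l \<alpha> \<gamma>) vs"
    using wedge_assoc[of vs x k 1 l \<beta> \<alpha> \<gamma>] vs by (simp add: add.commute)
  finally show ?thesis by simp
qed

lemma wedge_zero_l: "vs \<in> tuples x (k + l) \<Longrightarrow> (\<And>us. us \<in> tuples x k \<Longrightarrow> \<alpha> us = 0) \<Longrightarrow> Wd x k l \<alpha> \<beta> vs = 0"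
  using wedge_sum_l[of vs x k l \<alpha> "\<lambda>_. 0" "\<lambda>_. \<alpha>" "{}"] by simp

lemma tuples_1: "vs \<in> tuples x 1 \<longleftrightarrow> (\<exists>v\<in>TS x. vs = [v])"
  by (auto simp: tuples_iff length_Suc_conv)

end

context chart_domain
begin

definition du :: "nat \<Rightarrow> 'm \<Rightarrow> 'm tvec list \<Rightarrow> real"
  where "du i x = (\<lambda>vs\<in>tuples x 1. hd vs c i)"

lemma du_eq: "v \<in> TS x \<Longrightarrow> du i x [v] = v c i"
  by (simp add: du_def tuples_iff)

lemma du_lform:
  assumes i: "i < n"
  shows "lform 1 (du i)"
  unfolding lform_def
proof (intro conjI ballI allI impI)
  fix x assume x: "x \<in> W"
  show "du i x \<in> AF x 1"
  proof (rule alt_formsI)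
    fix vs v w a b and m :: nat assume h: "vs \<in> tuples x 1" "m < 1" "v \<in> TS x" "w \<in> TS x"
    then obtain u where "vs = [u]" "m = 0" unfolding tuples_1 by auto
    then show "du i x (vs[m := vcomb a v b w]) = a * du i x (vs[m := v]) + b * du i x (vs[m := w])"
      using h by (simp add: du_eq tangent_vcomb) (simp add: vcomb_def)
  qed (simp_all add: du_def)
next
  fix js :: "nat list" assume "length js = 1" "set js \<subseteq> {..<n}"
  then obtain j where js: "js = [j]" by (auto simp: length_Suc_conv)
  show "sm M c W (\<lambda>x. du i x (map (coord_vec M c x) js))"
    by (rule sm_cong[OF c sm_const[OF c W, of "if i = j then 1 else 0"]])
      (simp add: js du_eq coord_vec_tangent at coord_vec_self i)
qed

lemma pf_du:
  assumes ij: "i < n" "j < n" and x: "x \<in> W" "vs \<in> tuples x 1"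
  shows "pf 1 i (du j) x vs = 0"
proof -
  obtain v where v: "v \<in> TS x" "vs = [v]" using x(2) unfolding tuples_1 by blast
  have "cpd c W i (\<lambda>y. du j y (map (frz y) vs)) x = cpd c W i (\<lambda>y. v c j) x"
    by (rule cpd_cong[OF c _ at'[OF x(1)] x(1)]) (simp add: v du_eq frz_tangent chart_vec_self at ij)
  then show ?thesis using x cpd_const[OF c W ij(1) at'[OF x(1)] x(1)] by (simp add: pf_def)
qed

definition ed :: "nat \<Rightarrow> ('m \<Rightarrow> 'm tvec list \<Rightarrow> real) \<Rightarrow> 'm \<Rightarrow> 'm tvec list \<Rightarrow> real"
  where "ed k \<omega> x = (\<lambda>vs\<in>tuples x (Suc k). \<Sum>i<n. Wd x 1 k (du i x) (pf k i \<omega> x) vs)"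

lemma ed_lform:
  assumes \<omega>: "lform k \<omega>"
  shows "lform (Suc k) (ed k \<omega>)"
proof -
  have "lform (Suc k) (\<lambda>x. \<lambda>vs\<in>tuples x (Suc k). \<Sum>i\<in>{..<n}. 1 * Wd x 1 k (du i x) (pf k i \<omega> x) vs)"
    using lform_wedge[OF du_lform pf_lform[OF \<omega>]] by (intro lform_sum sm_const[OF c W]) simp
  then show ?thesis by (rule lform_cong) (simp add: ed_def)
qed

lemma ed_sum:
  assumes \<omega>: "\<And>m. m \<in> I \<Longrightarrow> lform k (\<omega> m)" and x: "x \<in> W" "vs \<in> tuples x (Suc k)"
    and e: "\<And>y us. y \<in> W \<Longrightarrow> us \<in> tuples y k \<Longrightarrow> \<eta> y us = (\<Sum>m\<in>I. a m * \<omega> m y us)"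
  shows "ed k \<eta> x vs = (\<Sum>m\<in>I. a m * ed k (\<omega> m) x vs)"
proof -
  have vs: "vs \<in> tuples x (1 + k)" using x by simp
  have "Wd x 1 k (du i x) (pf k i \<eta> x) vs = (\<Sum>m\<in>I. a m * Wd x 1 k (du i x) (pf k i (\<omega> m) x) vs)" if "i < n" for i
    by (rule wedge_sum_r[OF vs]) (rule pf_sum[OF \<omega> that x(1) _ e])
  then have "ed k \<eta> x vs = (\<Sum>i<n. \<Sum>m\<in>I. a m * Wd x 1 k (du i x) (pf k i (\<omega> m) x) vs)" using x by (simp add: ed_def)
  then show ?thesis using x by (simp add: ed_def sum_distrib_left sum.swap[of _ I])
qed

lemma ed_cong:
  assumes "lform k \<omega>" "x \<in> W" "vs \<in> tuples x (Suc k)" "\<And>y us. y \<in> W \<Longrightarrow> us \<in> tuples y k \<Longrightarrow> \<eta> y us = \<omega> y us"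
  shows "ed k \<eta> x vs = ed k \<omega> x vs"
  using ed_sum[of "{()}" k "\<lambda>_. \<omega>" x vs \<eta> "\<lambda>_. 1"] assms by simp

text \<open>For each \<open>i\<close> this is \<open>pf_wedge\<close>; bringing \<open>du i\<close>
  past \<alpha> in the second term produces the sign.\<close>

lemma ed_wedge:
  assumes \<alpha>: "lform k \<alpha>" and \<beta>: "lform l \<beta>" and x: "x \<in> W" "vs \<in> tuples x (Suc (k + l))"
  shows "ed (k + l) (\<lambda>y. Wd y k l (\<alpha> y) (\<beta> y)) x vs =
    Wd x (Suc k) l (ed k \<alpha> x) (\<beta> x) vs + (-1) ^ k * Wd x k (Suc l) (\<alpha> x) (ed l \<beta> x) vs"
proof -
  have vs: "vs \<in> tvec_tuples M x (int 1 + int (k + l))" "vs \<in> tuples x (Suc k + l)" "vs \<in> tuples x (k + Suc l)"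
    unfolding tvec_tuples_add using x by simp_all
  have "Wd x 1 (k + l) (du i x) (pf (k + l) i (\<lambda>y. Wd y k l (\<alpha> y) (\<beta> y)) x) vs =
      1 * Wd x (Suc k) l (Wd x 1 k (du i x) (pf k i \<alpha> x)) (\<beta> x) vs +
      (-1) ^ k * Wd x k (Suc l) (\<alpha> x) (Wd x 1 l (du i x) (pf l i \<beta> x)) vs" if i: "i < n" for i
  proof -
    have "Wd x 1 (k + l) (du i x) (pf (k + l) i (\<lambda>y. Wd y k l (\<alpha> y) (\<beta> y)) x) vs =
      1 * Wd x 1 (k + l) (du i x) (Wd x k l (pf k i \<alpha> x) (\<beta> x)) vs + 1 * Wd x 1 (k + l) (du i x) (Wd x k l (\<alpha> x) (pf l i \<beta> x)) vs"
    proof (rule wedge_lin_r[OF vs(1)])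
      fix us assume "us \<in> tvec_tuples M x (int (k + l))"
      then show "pf (k + l) i (\<lambda>y. Wd y k l (\<alpha> y) (\<beta> y)) x us =
        1 * Wd x k l (pf k i \<alpha> x) (\<beta> x) us + 1 * Wd x k l (\<alpha> x) (pf l i \<beta> x) us"
        unfolding tvec_tuples_int mult_1 by (rule pf_wedge[OF \<alpha> \<beta> i x(1)])
    qed
    moreover have "Wd x 1 (k + l) (du i x) (Wd x k l (pf k i \<alpha> x) (\<beta> x)) vs = Wd x (Suc k) l (Wd x 1 k (du i x) (pf k i \<alpha> x)) (\<beta> x) vs"
      using wedge_assoc[of vs x 1 k l] vs(2) by simp
    ultimately show ?thesis using wedge_swap[OF x(2)] by simp
  qed
  then have "ed (k + l) (\<lambda>y. Wd y k l (\<alpha> y) (\<beta> y)) x vs =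
      (\<Sum>i<n. 1 * Wd x (Suc k) l (Wd x 1 k (du i x) (pf k i \<alpha> x)) (\<beta> x) vs) +
      (-1) ^ k * (\<Sum>i<n. 1 * Wd x k (Suc l) (\<alpha> x) (Wd x 1 l (du i x) (pf l i \<beta> x)) vs)"
    using x(2) by (simp add: ed_def sum.distrib sum_distrib_left)
  also have "(\<Sum>i<n. 1 * Wd x (Suc k) l (Wd x 1 k (du i x) (pf k i \<alpha> x)) (\<beta> x) vs) = Wd x (Suc k) l (ed k \<alpha> x) (\<beta> x) vs"
    by (rule wedge_sum_l[OF vs(2), symmetric]) (simp add: ed_def)
  also have "(\<Sum>i<n. 1 * Wd x k (Suc l) (\<alpha> x) (Wd x 1 l (du i x) (pf l i \<beta> x)) vs) = Wd x k (Suc l) (\<alpha> x) (ed l \<beta> x) vs"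
    by (rule wedge_sum_r[OF vs(3), symmetric]) (simp add: ed_def)
  finally show ?thesis .
qed

lemma ed_ed:
  assumes \<omega>: "lform k \<omega>" and x: "x \<in> W" "vs \<in> tuples x (Suc (Suc k))"
  shows "ed (Suc k) (ed k \<omega>) x vs = 0"
proof -
  have vs: "vs \<in> tuples x (1 + Suc k)" using x by simp
  let ?X = "\<lambda>i j. Wd x 1 (Suc k) (du i x) (Wd x 1 k (du j x) (pf k i (pf k j \<omega>) x)) vs"
  have p: "pf (Suc k) i (ed k \<omega>) x us = (\<Sum>j<n. 1 * Wd x 1 k (du j x) (pf k i (pf k j \<omega>) x) us)"
    if i: "i < n" and us: "us \<in> tuples x (Suc k)" for i us
  proof -
    have "pf (Suc k) i (ed k \<omega>) x us = (\<Sum>j<n. 1 * pf (Suc k) i (\<lambda>y. Wd y 1 k (du j y) (pf k j \<omega> y)) x us)"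
    proof (rule pf_sum[OF _ i x(1) us])
      fix j assume "j \<in> {..<n}"
      then show "lform (Suc k) (\<lambda>y. Wd y 1 k (du j y) (pf k j \<omega> y))"
        using lform_wedge[OF du_lform pf_lform[OF \<omega>]] by simp
    qed (simp add: ed_def)
    also have "\<dots> = (\<Sum>j<n. 1 * Wd x 1 k (du j x) (pf k i (pf k j \<omega>) x) us)"
    proof (rule sum.cong[OF refl])
      fix j assume "j \<in> {..<n}"
      then have j: "j < n" by simp
      have us': "us \<in> tuples x (1 + k)" using us by simp
      \<comment> \<open>The coordinate differentials have constant coefficients, so the term of the
        product rule that differentiates \<open>du j\<close> drops out.\<close>
      have "Wd x 1 k (pf 1 i (du j) x) (pf k j \<omega> x) us = 0"
        by (rule wedge_zero_l[OF us' pf_du[OF i j x(1)]])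
      then show "1 * pf (Suc k) i (\<lambda>y. Wd y 1 k (du j y) (pf k j \<omega> y)) x us = 1 * Wd x 1 k (du j x) (pf k i (pf k j \<omega>) x) us"
        using pf_wedge[OF du_lform[OF j] pf_lform[OF \<omega> j] i x(1) us'] by simp
    qed
    finally show ?thesis .
  qed
  have "Wd x 1 (Suc k) (du i x) (pf (Suc k) i (ed k \<omega>) x) vs = (\<Sum>j<n. 1 * ?X i j)" if "i < n" for i
    by (rule wedge_sum_r[OF vs p[OF that]])
  then have S: "ed (Suc k) (ed k \<omega>) x vs = (\<Sum>i<n. \<Sum>j<n. ?X i j)"
    unfolding ed_def[of "Suc k"] restrict_apply'[OF x(2)] by simp
  have anti: "?X i j = - ?X j i" if ij: "i < n" "j < n" for i j
  proof -
    have "?X i j = - Wd x 1 (Suc k) (du j x) (Wd x 1 k (du i x) (pf k i (pf k j \<omega>) x)) vs"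
      using wedge_swap[of vs x 1 k "du i x" "du j x"] x(2) by simp
    also have "Wd x 1 k (du i x) (pf k i (pf k j \<omega>) x) = Wd x 1 k (du i x) (pf k j (pf k i \<omega>) x)"
      by (rule wedge_cong) (use pf_commute[OF \<omega> ij x(1)] in auto)
    finally show ?thesis .
  qed
  have "(\<Sum>i<n. \<Sum>j<n. ?X i j) = (\<Sum>i<n. \<Sum>j<n. - ?X j i)"
    by (intro sum.cong refl, rule anti) simp_all
  then have "(\<Sum>i<n. \<Sum>j<n. ?X i j) = - (\<Sum>i<n. \<Sum>j<n. ?X j i)" by (simp only: sum_negf)
  also have "(\<Sum>i<n. \<Sum>j<n. ?X j i) = (\<Sum>i<n. \<Sum>j<n. ?X i j)" by (rule sum.swap)
  finally show ?thesis using S by simp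
qed

text \<open>Expanding the wedge with \<open>du i\<close> by \<open>wedge_1\<close> gives the
  coordinate formula through which \<open>dR_diff\<close> is defined.\<close>

lemma ed_eq:
  assumes \<omega>: "lform k \<omega>" and x: "x \<in> W" "vs \<in> tuples x (Suc k)"
  shows "ed k \<omega> x vs = (\<Sum>b<Suc k. (-1) ^ b * (\<Sum>i<n. (vs ! b) c i *
     cpd c W i (\<lambda>y. \<omega> y (map (frz y) (take b vs @ drop (Suc b) vs))) x))"
proof -
  have "ed k \<omega> x vs = (\<Sum>i<n. \<Sum>b<Suc k. (-1) ^ b * du i x [vs ! b] * pf k i \<omega> x (take b vs @ drop (Suc b) vs))"
    using x wedge_1[OF lform_alt[OF pf_lform[OF \<omega>] x(1)] x(2)] by (simp add: ed_def)
  also have "\<dots> = (\<Sum>b<Suc k. \<Sum>i<n. (-1) ^ b * du i x [vs ! b] * pf k i \<omega> x (take b vs @ drop (Suc b) vs))"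
    by (rule sum.swap)
  also have "\<dots> = (\<Sum>b<Suc k. (-1) ^ b * (\<Sum>i<n. (vs ! b) c i *
     cpd c W i (\<lambda>y. \<omega> y (map (frz y) (take b vs @ drop (Suc b) vs))) x))"
  proof (rule sum.cong[OF refl])
    fix b assume "b \<in> {..<Suc k}"
    then have "vs ! b \<in> TS x" "take b vs @ drop (Suc b) vs \<in> tuples x k" using tuples_Suc[OF x(2), of b] by auto
    then show "(\<Sum>i<n. (-1) ^ b * du i x [vs ! b] * pf k i \<omega> x (take b vs @ drop (Suc b) vs)) = (-1) ^ b * (\<Sum>i<n. (vs ! b) c i *
     cpd c W i (\<lambda>y. \<omega> y (map (frz y) (take b vs @ drop (Suc b) vs))) x)"
      by (simp add: du_eq pf_def sum_distrib_left mult.assoc)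
  qed
  finally show ?thesis .
qed

text \<open>Contraction with the i-th coordinate field.\<close>

definition iota :: "nat \<Rightarrow> nat \<Rightarrow> ('m \<Rightarrow> 'm tvec list \<Rightarrow> real) \<Rightarrow> 'm \<Rightarrow> 'm tvec list \<Rightarrow> real"
  where "iota k i \<omega> x = (\<lambda>vs\<in>tuples x k. \<omega> x (coord_vec M c x i # vs))"

lemma iota_lform:
  assumes \<omega>: "lform (Suc k) \<omega>" and i: "i < n"
  shows "lform k (iota k i \<omega>)"
  unfolding lform_def
proof (intro conjI ballI allI impI)
  fix x assume x: "x \<in> W"
  let ?e = "coord_vec M c x i"
  have C: "?e # vs \<in> tuples x (Suc k)" if "vs \<in> tuples x k" for vs
    using that coord_vec_tangent[OF at[OF x]] by (simp add: tuples_iff)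
  note A = lform_alt[OF \<omega> x]
  show "iota k i \<omega> x \<in> AF x k"
  proof (rule alt_formsI)
    fix vs m v w a b assume h: "vs \<in> tuples x k" "m < k" "v \<in> TS x" "w \<in> TS x"
    then show "iota k i \<omega> x (vs[m := vcomb a v b w]) = a * iota k i \<omega> x (vs[m := v]) + b * iota k i \<omega> x (vs[m := w])"
      using alt_lin[OF A C[OF h(1)], of "Suc m" v w a b] by (simp add: iota_def tuples_upd tangent_vcomb)
  next
    fix vs p q assume h: "vs \<in> tuples x k" "p < k" "q < k" "p \<noteq> q" "vs ! p = vs ! q"
    then show "iota k i \<omega> x vs = 0" using alt_rep[OF A C[OF h(1)], of "Suc p" "Suc q"] by (simp add: iota_def)
  qed (simp add: iota_def)
next
  fix js :: "nat list" assume js: "length js = k" "set js \<subseteq> {..<n}"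
  have "sm M c W (\<lambda>x. \<omega> x (map (coord_vec M c x) (i # js)))"
    by (rule \<omega>[unfolded lform_def, THEN conjunct2, rule_format]) (use js i in simp_all)
  then show "sm M c W (\<lambda>x. iota k i \<omega> x (map (coord_vec M c x) js))"
    by (rule sm_cong[OF c]) (use js coord_vec_tangent[OF at] in \<open>auto simp: iota_def tuples_iff\<close>)
qed

text \<open>Each slot \<open>b\<close> contributes \<omega> once: the sum over \<open>i\<close>
  reassembles \<open>vs ! b\<close> from its coordinates in the first slot, and moving it back to
  slot \<open>b\<close> gives a sign that cancels the one from \<open>wedge_1\<close>. There are k +
  1 slots.\<close>

lemma iota_expand:
  assumes \<omega>: "lform (Suc k) \<omega>" and x: "x \<in> W" "vs \<in> tuples x (Suc k)"
  shows "(\<Sum>i<n. Wd x 1 k (du i x) (iota k i \<omega> x) vs) = real (Suc k) * \<omega> x vs"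
proof -
  note A = lform_alt[OF \<omega> x(1)]
  have "(\<Sum>i<n. Wd x 1 k (du i x) (iota k i \<omega> x) vs) =
    (\<Sum>i<n. \<Sum>b<Suc k. (-1) ^ b * du i x [vs ! b] * iota k i \<omega> x (take b vs @ drop (Suc b) vs))"
    using wedge_1[OF lform_alt[OF iota_lform[OF \<omega>] x(1)] x(2)] by simp
  also have "\<dots> = (\<Sum>b<Suc k. \<Sum>i<n. (-1) ^ b * du i x [vs ! b] * iota k i \<omega> x (take b vs @ drop (Suc b) vs))"
    by (rule sum.swap)
  also have "\<dots> = (\<Sum>b<Suc k. \<omega> x vs)"
  proof (rule sum.cong[OF refl])
    fix b assume "b \<in> {..<Suc k}"
    then have b: "b < Suc k" by simp
    let ?t = "take b vs @ drop (Suc b) vs"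
    note t = tuples_Suc[OF x(2) b]
    have v: "vs ! b # ?t \<in> tuples x (Suc k)" using t by (simp add: tuples_iff)
    have "\<omega> x (vs ! b # ?t) = (\<Sum>i<n. (vs ! b) c i * \<omega> x (coord_vec M c x i # ?t))"
      using alt_coords[OF A at[OF x(1)] v, of 0] by simp
    moreover have "\<omega> x (vs ! b # ?t) = (-1) ^ b * \<omega> x vs"
    proof -
      have e: "take b vs @ [vs ! b] @ drop (Suc b) vs = vs" using id_take_nth_drop[of b vs] x(2) b by (simp add: tuples_iff)
      have "\<omega> x ([] @ [vs ! b] @ take b vs @ drop (Suc b) vs) = (-1) ^ length (take b vs) * \<omega> x ([] @ take b vs @ [vs ! b] @ drop (Suc b) vs)"
        by (rule alt_move[OF A]) (use v in simp)
      then show ?thesis using e x(2) b by (simp add: tuples_iff)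
    qed
    moreover have "(-1 :: real) ^ b * (-1) ^ b = 1" by (simp add: power_add[symmetric] mult_2[symmetric])
    ultimately have "(-1) ^ b * (\<Sum>i<n. (vs ! b) c i * \<omega> x (coord_vec M c x i # ?t)) = \<omega> x vs"
      by (metis mult.assoc mult_1)
    then show "(\<Sum>i<n. (-1) ^ b * du i x [vs ! b] * iota k i \<omega> x ?t) = \<omega> x vs"
      using t by (simp add: du_eq iota_def sum_distrib_left mult.assoc)
  qed
  finally show ?thesis by simp
qed

end

section \<open>Independence of the chart\<close>

context corner_manifold
begin

text \<open>The coordinate fields of \<open>c'\<close> have Jacobian entries as coordinates in
  \<open>c\<close>, so \<open>eval_sm\<close> gives smoothness in \<open>c\<close>, and
  \<open>sm_change\<close> carries it to \<open>c'\<close>.\<close>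

lemma lform_change:
  assumes cd: "chart_domain M c W" and cd': "chart_domain M c' W" and \<omega>: "chart_domain.lform M c W k \<omega>"
  shows "chart_domain.lform M c' W k \<omega>"
proof -
  interpret A: chart_domain M c W by fact
  interpret B: chart_domain M c' W by fact
  show ?thesis unfolding B.lform_def
  proof (intro conjI ballI allI impI)
    show "\<omega> x \<in> AF x k" if "x \<in> W" for x by (rule A.lform_alt[OF \<omega> that])
    fix js :: "nat list" assume js: "length js = k" "set js \<subseteq> {..<n}"
    have "sm M c W (\<lambda>x. \<omega> x (map (coord_vec M c x) [] @ map (\<lambda>v. v x) (map (\<lambda>j x. coord_vec M c' x j) js)))"
    proof (rule A.eval_sm[OF \<omega>])
      fix u assume "u \<in> set (map (\<lambda>j x. coord_vec M c' x j) js)"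
      then obtain j where u: "u = (\<lambda>x. coord_vec M c' x j)" "j < n" using js by auto
      have "sm M c W (\<lambda>x. u x c i)" if i: "i < n" for i
      proof (rule sm_cong[OF A.c])
        show "sm M c W (\<lambda>x. jacobian c' c x i j)"
          by (rule sm_change[OF B.c A.c A.W B.Wc sm_mono[OF sm_jacobian[OF B.c A.c i u(2)] A.Wc]])
        show "jacobian c' c x i j = u x c i" if "x \<in> W" for x
          using A.at[OF that] B.at[OF that] i u by (simp add: chart_vec_change chart_vec_self)
      qed
      then show "(\<forall>x\<in>W. u x \<in> TS x) \<and> (\<forall>i<n. sm M c W (\<lambda>x. u x c i))"
        using coord_vec_tangent[OF B.at] by (simp add: u)
    qed (use js in auto)
    then show "sm M c' W (\<lambda>x. \<omega> x (map (coord_vec M c' x) js))"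
      by (intro sm_change[OF A.c B.c A.W A.Wc]) (simp add: comp_def)
  qed
qed

text \<open>The 1-form \<open>du i\<close> of the chart \<open>c\<close> is the exterior derivative,
  computed in \<open>c'\<close>, of the i-th coordinate function of \<open>c\<close>; this is the
  transformation rule of tangent vectors. Then \<open>ed_ed\<close> applies in
  \<open>c'\<close>.\<close>

lemma ed_du:
  assumes cd: "chart_domain M c W" and cd': "chart_domain M c' W" and i: "i < n" and x: "x \<in> W" "vs \<in> tuples x 2"
  shows "chart_domain.ed M c' W 1 (chart_domain.du M c i) x vs = 0"
proof -
  interpret A: chart_domain M c W by fact
  interpret B: chart_domain M c' W by fact
  let ?u = "\<lambda>x. \<lambda>vs\<in>tuples x 0. snd c x i"
  have s: "sm M c' W (\<lambda>x. snd c x i)"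
    by (rule sm_mono[OF sm_trans[OF B.c A.c i] A.Wc])
  have u: "B.lform 0 ?u"
    unfolding B.lform_def
  proof (intro conjI ballI allI impI)
    show "?u x \<in> AF x 0" for x by (rule alt_formsI) auto
    fix js :: "nat list" assume "length js = 0"
    then show "sm M c' W (\<lambda>x. ?u x (map (coord_vec M c' x) js))" by (intro sm_cong[OF B.c s]) (simp add: tuples_iff)
  qed
  have e: "A.du i y us = B.ed 0 ?u y us" if y: "y \<in> W" and us: "us \<in> tuples y 1" for y us
  proof -
    obtain v where v: "v \<in> TS y" "us = [v]" using us unfolding tuples_1 by blast
    have "B.ed 0 ?u y us = (\<Sum>j<n. v c' j * cpd c' W j (\<lambda>z. snd c z i) y)"
      using B.ed_eq[OF u y, of us] us v by (simp add: tuples_iff)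
    also have "\<dots> = (\<Sum>j<n. jacobian c' c y i j * v c' j)"
      by (intro sum.cong refl) (simp add: jacobian_cpd mult.commute cpd_mono[OF B.c chart_open[OF A.c] B.W A.Wc sm_trans[OF B.c A.c i] _ B.at'[OF y] y])
    also have "\<dots> = v c i"
      by (rule tangent_change[OF v(1) B.at[OF y] A.at[OF y] i, symmetric])
    finally show ?thesis using v by (simp add: A.du_eq)
  qed
  have "B.ed 1 (A.du i) x vs = B.ed 1 (B.ed 0 ?u) x vs"
    by (rule B.ed_cong) (use B.ed_lform[OF u] x e in \<open>simp_all add: numeral_2_eq_2\<close>)
  then show ?thesis using B.ed_ed[OF u x(1), of vs] x by (simp add: numeral_2_eq_2)
qed

text \<open>By \<open>iota_expand\<close> and the Leibniz rule the exterior derivative is determined by its values in lower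
  degree, on whatever chart it is computed.\<close>

lemma ed_step:
  assumes cd: "chart_domain M c W" and cd': "chart_domain M c' W" and \<omega>: "chart_domain.lform M c W (Suc k) \<omega>"
    and x: "x \<in> W" "vs \<in> tuples x (Suc (Suc k))"
  shows "chart_domain.ed M c' W (Suc k) \<omega> x vs =
    (\<Sum>i<n. (- 1 / Suc k) * Wd x 1 (Suc k) (chart_domain.du M c i x) (chart_domain.ed M c' W k (chart_domain.iota M c k i \<omega>) x) vs)"
proof -
  interpret A: chart_domain M c W by fact
  interpret B: chart_domain M c' W by fact
  let ?\<beta> = "\<lambda>i. A.iota k i \<omega>"
  have du: "B.lform 1 (A.du i)" and \<beta>: "B.lform k (?\<beta> i)" if "i < n" for i
    using that lform_change[OF cd cd'] A.du_lform A.iota_lform[OF \<omega>] by blast+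
  have "B.ed (Suc k) \<omega> x vs = (\<Sum>i<n. (1 / Suc k) * B.ed (Suc k) (\<lambda>y. Wd y 1 k (A.du i y) (?\<beta> i y)) x vs)"
  proof (rule B.ed_sum[OF _ x])
    fix i assume "i \<in> {..<n}"
    then show "B.lform (Suc k) (\<lambda>y. Wd y 1 k (A.du i y) (?\<beta> i y))" using B.lform_wedge[OF du \<beta>, of i i] by simp
  next
    fix y us assume "y \<in> W" "us \<in> tuples y (Suc k)"
    then show "\<omega> y us = (\<Sum>i<n. 1 / real (Suc k) * Wd y 1 k (A.du i y) (A.iota k i \<omega> y) us)"
      using A.iota_expand[OF \<omega>, of y us] by (simp add: sum_distrib_left[symmetric] sum_divide_distrib[symmetric])
  qed
  also have "\<dots> = (\<Sum>i<n. (- 1 / Suc k) * Wd x 1 (Suc k) (A.du i x) (B.ed k (?\<beta> i) x) vs)"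
  proof (rule sum.cong[OF refl])
    fix i assume "i \<in> {..<n}"
    then have i: "i < n" by simp
    have vs: "vs \<in> tuples x (2 + k)" "vs \<in> tuples x (Suc (1 + k))" using x(2) by simp_all
    have "Wd x 2 k (B.ed 1 (A.du i) x) (?\<beta> i x) vs = 0"
      by (rule wedge_zero_l[OF vs(1) ed_du[OF cd cd' i x(1)]])
    then show "1 / real (Suc k) * B.ed (Suc k) (\<lambda>y. Wd y 1 k (A.du i y) (?\<beta> i y)) x vs =
      - 1 / real (Suc k) * Wd x 1 (Suc k) (A.du i x) (B.ed k (?\<beta> i) x) vs"
      using B.ed_wedge[OF du[OF i] \<beta>[OF i] x(1) vs(2)] by simp
  qed
  finally show ?thesis .
qed

text \<open>In degree 0 the chain rule for functions matches the change of coordinates of the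
  tangent vector. Above that, \<open>ed_step\<close> is used for \<open>ed\<close> of either chart
  with the \<open>du\<close> and \<open>iota\<close> of the first, so that the two sides differ only
  in \<open>ed\<close> of lower degree.\<close>

lemma ed_change:
  assumes cd: "chart_domain M c W" and cd': "chart_domain M c' W"
  shows "chart_domain.lform M c W k \<omega> \<Longrightarrow> x \<in> W \<Longrightarrow> vs \<in> tuples x (Suc k) \<Longrightarrow>
    chart_domain.ed M c W k \<omega> x vs = chart_domain.ed M c' W k \<omega> x vs"
proof (induction k arbitrary: \<omega> x vs)
  case 0
  interpret A: chart_domain M c W by fact
  interpret B: chart_domain M c' W by fact
  have \<omega>: "A.lform 0 \<omega>" "B.lform 0 \<omega>" using 0 lform_change[OF cd cd'] by auto
  obtain v where v: "v \<in> TS x" "vs = [v]" using 0(3) tuples_1[unfolded One_nat_def] by blast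
  have s: "sm M c W (\<lambda>y. \<omega> y [])" "sm M c' W (\<lambda>y. \<omega> y [])"
    using A.frz_sm[OF \<omega>(1), of "[]"] B.frz_sm[OF \<omega>(2), of "[]"] by simp_all
  have "A.ed 0 \<omega> x vs = (\<Sum>j<n. v c j * cpd c W j (\<lambda>y. \<omega> y []) x)"
    using A.ed_eq[OF \<omega>(1) 0(2,3)] v by simp
  also have "\<dots> = (\<Sum>j<n. \<Sum>i<n. v c j * (cpd c' W i (\<lambda>y. \<omega> y []) x * jacobian c c' x i j))"
    using cpd_chain[OF A.c B.c A.W 0(2) A.at'[OF 0(2)] B.at'[OF 0(2)] s] by (simp add: sum_distrib_left)
  also have "\<dots> = (\<Sum>i<n. \<Sum>j<n. v c j * (cpd c' W i (\<lambda>y. \<omega> y []) x * jacobian c c' x i j))"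
    by (rule sum.swap)
  also have "\<dots> = (\<Sum>i<n. v c' i * cpd c' W i (\<lambda>y. \<omega> y []) x)"
  proof (rule sum.cong[OF refl])
    fix i assume "i \<in> {..<n}"
    then have "v c' i = (\<Sum>j<n. jacobian c c' x i j * v c j)"
      using tangent_change[OF v(1) A.at[OF 0(2)] B.at[OF 0(2)]] by simp
    then show "(\<Sum>j<n. v c j * (cpd c' W i (\<lambda>y. \<omega> y []) x * jacobian c c' x i j)) = v c' i * cpd c' W i (\<lambda>y. \<omega> y []) x"
      by (simp add: sum_distrib_left mult_ac)
  qed
  also have "\<dots> = B.ed 0 \<omega> x vs"
    using B.ed_eq[OF \<omega>(2) 0(2,3)] v by simp
  finally show ?case .
next
  case (Suc k)
  interpret A: chart_domain M c W by fact
  interpret B: chart_domain M c' W by fact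
  have "A.ed (Suc k) \<omega> x vs =
    (\<Sum>i<n. (- 1 / Suc k) * Wd x 1 (Suc k) (A.du i x) (A.ed k (A.iota k i \<omega>) x) vs)"
    by (rule ed_step[OF cd cd Suc.prems])
  also have "\<dots> = (\<Sum>i<n. (- 1 / Suc k) * Wd x 1 (Suc k) (A.du i x) (B.ed k (A.iota k i \<omega>) x) vs)"
  proof (rule sum.cong[OF refl])
    fix i assume "i \<in> {..<n}"
    then have "Wd x 1 (Suc k) (A.du i x) (A.ed k (A.iota k i \<omega>) x) = Wd x 1 (Suc k) (A.du i x) (B.ed k (A.iota k i \<omega>) x)"
      using Suc.IH[OF A.iota_lform[OF Suc.prems(1)] Suc.prems(2)] by (intro wedge_cong) auto
    then show "- 1 / real (Suc k) * Wd x 1 (Suc k) (A.du i x) (A.ed k (A.iota k i \<omega>) x) vs =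
      - 1 / real (Suc k) * Wd x 1 (Suc k) (A.du i x) (B.ed k (A.iota k i \<omega>) x) vs" by (rule arg_cong)
  qed
  also have "\<dots> = B.ed (Suc k) \<omega> x vs"
    by (rule ed_step[OF cd cd' Suc.prems, symmetric])
  finally show ?case .
qed

end

section \<open>The de Rham algebra\<close>

context corner_manifold
begin

lemma chart_ex:
  assumes V: "openin T V" and x: "x \<in> V"
  shows "\<exists>c W. chart_domain M c W \<and> x \<in> W \<and> W \<subseteq> V"
proof -
  obtain c where c: "c \<in> atlas M" "x \<in> fst c" using chart_at open_subset[OF V] x by blast
  have "chart_domain M c (fst c \<inter> V)"
    using c V chart_open[OF c(1)] by unfold_locales auto
  then show ?thesis using c x by blast
qed

lemma chart_domain_Int: "chart_domain M c W \<Longrightarrow> c' \<in> atlas M \<Longrightarrow> openin T V \<Longrightarrow> chart_domain M c' (V \<inter> fst c' \<inter> W)"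
  using chart_open[of c'] chart_domain.W[of M c W] by unfold_locales auto

lemma lform_mono:
  assumes "chart_domain M c W" "chart_domain M c W'" "W' \<subseteq> W" "chart_domain.lform M c W k \<omega>"
  shows "chart_domain.lform M c W' k \<omega>"
  using assms sm_mono[of c W _ W'] unfolding chart_domain.lform_def[OF assms(1)] chart_domain.lform_def[OF assms(2)] by blast

lemma ed_mono:
  assumes cd: "chart_domain M c W" and cd': "chart_domain M c W'" and W': "W' \<subseteq> W" and \<omega>: "chart_domain.lform M c W k \<omega>"
    and x: "x \<in> W'" "vs \<in> tuples x (Suc k)"
  shows "chart_domain.ed M c W' k \<omega> x vs = chart_domain.ed M c W k \<omega> x vs"
proof -
  interpret A: chart_domain M c W by fact
  interpret B: chart_domain M c W' by fact
  have "cpd c W' i (\<lambda>y. \<omega> y (map (A.frz y) (take b vs @ drop (Suc b) vs))) x = cpd c W i (\<lambda>y. \<omega> y (map (A.frz y) (take b vs @ drop (Suc b) vs))) x"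
    if "b < Suc k" "i < n" for b i
    using that x tuples_Suc[OF x(2) that(1)]
    by (intro cpd_mono[OF A.c A.W B.W W' A.frz_sm[OF \<omega>] that(2) B.at'[OF x(1)] x(1)]) (simp add: tuples_iff)
  then show ?thesis
    unfolding A.ed_eq[OF \<omega> subsetD[OF W' x(1)] x(2)] B.ed_eq[OF lform_mono[OF cd cd' W' \<omega>] x] by simp
qed

lemma dR_lform:
  assumes "chart_domain M c W" "W \<subseteq> V" "\<omega> \<in> dR_forms M V (int k)"
  shows "chart_domain.lform M c W k \<omega>"
  unfolding chart_domain.lform_def[OF assms(1)]
  using assms chart_domain.c[OF assms(1)] sm_mono[of c V _ W] by (auto simp: dR_forms_iff)

lemma dR_local:
  assumes V: "openin T V" and e: "\<omega> \<in> extensional V"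
    and l: "\<And>c W. chart_domain M c W \<Longrightarrow> W \<subseteq> V \<Longrightarrow> chart_domain.lform M c W k \<omega>"
  shows "\<omega> \<in> dR_forms M V (int k)"
  unfolding dR_forms_iff
proof (intro conjI ballI allI impI)
  fix x assume "x \<in> V"
  then obtain c W where "chart_domain M c W" "x \<in> W" "W \<subseteq> V" using chart_ex[OF V] by blast
  then show "\<omega> x \<in> alt_forms M x (int k)" using chart_domain.lform_alt[OF _ l] by metis
next
  fix c and js :: "nat list" assume c: "c \<in> atlas M" and js: "int (length js) = int k" "set js \<subseteq> {..<n}"
  \<comment> \<open>Smoothness over \<open>V\<close> in the chart \<open>c\<close> sees only
    \<open>fst c \<inter> V\<close>, which is itself a chart domain.\<close>
  have cd: "chart_domain M c (fst c \<inter> V)"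
    using c V chart_open[OF c] by unfold_locales auto
  have "sm M c (fst c \<inter> V) (\<lambda>x. \<omega> x (map (coord_vec M c x) js))"
    using l[OF cd] js unfolding chart_domain.lform_def[OF cd] by simp
  then show "sm M c V (\<lambda>x. \<omega> x (map (coord_vec M c x) js))" by (simp add: sm_def cimg_Int)
qed (rule e)

text \<open>\<open>dR_diff\<close> picks a chart at every point by \<open>SOME\<close>. The
  comparison with a given chart goes through \<open>?W1\<close>, which lies in both chart domains:
  \<open>ed_change\<close> changes the chart there, and \<open>ed_mono\<close> moves between domains
  of one chart.\<close>

lemma dR_diff_local:
  assumes V: "openin T V" and \<omega>: "\<omega> \<in> dR_forms M V (int k)" and cd: "chart_domain M c W" and WV: "W \<subseteq> V"
    and x: "x \<in> W" "vs \<in> tuples x (Suc k)"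
  shows "dR_diff M V (int k) \<omega> x vs = chart_domain.ed M c W k \<omega> x vs"
proof -
  define c0 where "c0 = (SOME c. c \<in> charts_at M x)"
  have c0: "c0 \<in> atlas M" "x \<in> fst c0"
    using someI[of "\<lambda>c. c \<in> charts_at M x" c] chart_domain.at[OF cd x(1)] by (auto simp: c0_def charts_at_iff)
  let ?W0 = "fst c0 \<inter> V" and ?W1 = "V \<inter> fst c0 \<inter> W"
  have cd0: "chart_domain M c0 ?W0" using c0 V chart_open[OF c0(1)] by unfold_locales auto
  have cd1: "chart_domain M c0 ?W1" by (rule chart_domain_Int[OF cd c0(1) V])
  have cd2: "chart_domain M c ?W1"
    using cd1 cd unfolding chart_domain_def chart_domain_axioms_def by auto
  have \<omega>0: "chart_domain.lform M c0 ?W0 k \<omega>" by (rule dR_lform[OF cd0 _ \<omega>]) simp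
  have xV: "x \<in> V" "x \<in> ?W0" "x \<in> ?W1" using x WV c0 by auto
  have vs: "vs \<in> tvec_tuples M x (int k + 1)" using x tvec_tuples_add[of x k 1] by simp
  have "dR_diff M V (int k) \<omega> x vs = chart_domain.ed M c0 ?W0 k \<omega> x vs"
    using xV vs x(2) unfolding chart_domain.ed_eq[OF cd0 \<omega>0 xV(2) x(2)]
    by (simp add: dR_diff_def c0_def[symmetric] cpd_def cimg_Int Let_def tuples_iff) (simp add: cimg_def)
  also have "\<dots> = chart_domain.ed M c0 ?W1 k \<omega> x vs"
    by (rule ed_mono[OF cd0 cd1 _ \<omega>0 xV(3) x(2), symmetric]) auto
  also have "\<dots> = chart_domain.ed M c ?W1 k \<omega> x vs"
    by (rule ed_change[OF cd1 cd2 dR_lform[OF cd1 _ \<omega>] xV(3) x(2)]) auto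
  also have "\<dots> = chart_domain.ed M c W k \<omega> x vs"
    by (rule ed_mono[OF cd cd2 _ dR_lform[OF cd WV \<omega>] xV(3) x(2)]) auto
  finally show ?thesis .
qed

subsection \<open>Negative degrees\<close>

lemma tvec_tuples_neg: "k < 0 \<Longrightarrow> tvec_tuples M x k = {}"
  by (auto simp: tvec_tuples_def)

lemma dR_forms_neg: "k < 0 \<Longrightarrow> \<omega> \<in> dR_forms M V k \<longleftrightarrow> \<omega> = (\<lambda>x\<in>V. \<lambda>_. undefined)"
  by (auto simp: dR_forms_iff alt_forms_def tvec_tuples_neg extensional_def fun_eq_iff)

text \<open>From degree -1 the target has the empty tuple, on which the sum over slots is empty;
  from lower degrees the target has no tuples at all.\<close>

lemma dR_diff_neg: "k < 0 \<Longrightarrow> dR_diff M V k \<omega> = (\<lambda>x\<in>V. \<lambda>vs\<in>tvec_tuples M x (k + 1). 0)"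
  by (auto simp: dR_diff_def tvec_tuples_def Let_def fun_eq_iff restrict_def)

lemma dR_ext: "\<omega> \<in> dR_forms M V k \<Longrightarrow> \<omega> \<in> extensional V"
  "\<omega> \<in> dR_forms M V k \<Longrightarrow> x \<in> V \<Longrightarrow> \<omega> x \<in> extensional (tvec_tuples M x k)"
  by (auto simp: dR_forms_iff intro: alt_ext)

lemma dR_eqI:
  assumes "\<omega> \<in> dR_forms M V k" "\<eta> \<in> dR_forms M V k"
    "\<And>x vs. x \<in> V \<Longrightarrow> vs \<in> tvec_tuples M x k \<Longrightarrow> \<omega> x vs = \<eta> x vs"
  shows "\<omega> = \<eta>"
proof (rule extensionalityI[OF dR_ext(1)[OF assms(1)] dR_ext(1)[OF assms(2)]])
  show "\<omega> x = \<eta> x" if "x \<in> V" for x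
    by (rule extensionalityI[OF dR_ext(2)[OF assms(1) that] dR_ext(2)[OF assms(2) that] assms(3)[OF that]])
qed

subsection \<open>Closure properties\<close>

text \<open>One closure statement whose instances are the zero form, sums, multiples and, through
  the constant -1, negatives.\<close>

lemma dR_sum:
  assumes V: "openin T V" and \<omega>: "\<And>i. i \<in> I \<Longrightarrow> \<omega> i \<in> dR_forms M V k" and a: "\<And>i. i \<in> I \<Longrightarrow> a i \<in> carrier (SF V)"
  shows "(\<lambda>x\<in>V. \<lambda>vs\<in>tvec_tuples M x k. \<Sum>i\<in>I. a i x * \<omega> i x vs) \<in> dR_forms M V k"
proof (cases "k < 0")
  case True
  then show ?thesis by (simp add: dR_forms_neg tvec_tuples_neg restrict_def)
next
  case False
  then obtain p where k: "k = int p" by (metis nonneg_int_cases not_less)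
  show ?thesis unfolding k
  proof (rule dR_local[OF V])
    fix c W assume cd: "chart_domain M c W" and WV: "W \<subseteq> V"
    interpret A: chart_domain M c W by fact
    have "A.lform p (\<lambda>x. \<lambda>vs\<in>tuples x p. \<Sum>i\<in>I. a i x * \<omega> i x vs)"
      using \<omega> a dR_lform[OF cd WV] sm_mono[OF _ WV] A.c by (intro A.lform_sum) (auto simp: k SF_carrier)
    then show "A.lform p (\<lambda>x\<in>V. \<lambda>vs\<in>tvec_tuples M x (int p). \<Sum>i\<in>I. a i x * \<omega> i x vs)"
      by (rule A.lform_cong) (use WV in \<open>auto simp: tvec_tuples_int\<close>)
  qed simp
qed

lemma SF_const: "openin T V \<Longrightarrow> (\<lambda>x\<in>V. r) \<in> carrier (SF V)"
  by (auto simp: SF_carrier intro!: sm_cong[OF _ sm_const[of _ V r]])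

lemma dR_zero: "openin T V \<Longrightarrow> (\<lambda>x\<in>V. \<lambda>vs\<in>tvec_tuples M x k. 0) \<in> dR_forms M V k"
  using dR_sum[of V "{}" "\<lambda>_. undefined"] by simp

lemma dR_smult:
  assumes V: "openin T V" and u: "u \<in> carrier (SF V)" and \<omega>: "\<omega> \<in> dR_forms M V k"
  shows "(\<lambda>x\<in>V. \<lambda>vs\<in>tvec_tuples M x k. u x * \<omega> x vs) \<in> dR_forms M V k"
  using dR_sum[OF V, of "{()}" "\<lambda>_. \<omega>" k "\<lambda>_. u"] u \<omega> by simp

lemma dR_add:
  assumes V: "openin T V" and \<omega>: "\<omega> \<in> dR_forms M V k" "\<eta> \<in> dR_forms M V k"
  shows "(\<lambda>x\<in>V. \<lambda>vs\<in>tvec_tuples M x k. \<omega> x vs + \<eta> x vs) \<in> dR_forms M V k"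
proof -
  have "(\<lambda>x\<in>V. \<lambda>vs\<in>tvec_tuples M x k. \<Sum>i\<in>UNIV. (\<lambda>x\<in>V. 1) x * (if i then \<omega> else \<eta>) x vs) \<in> dR_forms M V k"
    by (rule dR_sum[OF V, of UNIV "\<lambda>i. if i then \<omega> else \<eta>" k "\<lambda>_. \<lambda>x\<in>V. 1"]) (use \<omega> SF_const[OF V, of 1] in simp_all)
  also have "(\<lambda>x\<in>V. \<lambda>vs\<in>tvec_tuples M x k. \<Sum>i\<in>UNIV. (\<lambda>x\<in>V. 1) x * (if i then \<omega> else \<eta>) x vs) =
      (\<lambda>x\<in>V. \<lambda>vs\<in>tvec_tuples M x k. \<omega> x vs + \<eta> x vs)"
    by (intro restrict_ext) (simp add: UNIV_bool add.commute)
  finally show ?thesis .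
qed

lemma dR_neg:
  assumes V: "openin T V" and \<omega>: "\<omega> \<in> dR_forms M V k"
  shows "(\<lambda>x\<in>V. \<lambda>vs\<in>tvec_tuples M x k. - \<omega> x vs) \<in> dR_forms M V k"
  using dR_smult[OF V SF_const[OF V, of "-1"] \<omega>] by (simp cong: restrict_cong)

lemma dR_wedge:
  assumes V: "openin T V" and \<omega>: "\<omega> \<in> dR_forms M V k" and \<eta>: "\<eta> \<in> dR_forms M V l"
  shows "(\<lambda>x\<in>V. wedge M x k l (\<omega> x) (\<eta> x)) \<in> dR_forms M V (k + l)"
proof (cases "k < 0 \<or> l < 0")
  case True
  then show ?thesis using dR_zero[OF V, of "k + l"] by (simp add: wedge_neg)
next
  case False
  then obtain p q where k: "k = int p" "l = int q" by (metis nonneg_int_cases not_less)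
  show ?thesis unfolding k of_nat_add[symmetric]
  proof (rule dR_local[OF V])
    fix c W assume cd: "chart_domain M c W" and WV: "W \<subseteq> V"
    interpret A: chart_domain M c W by fact
    show "A.lform (p + q) (\<lambda>x\<in>V. Wd x p q (\<omega> x) (\<eta> x))"
      by (rule A.lform_cong[OF A.lform_wedge[OF dR_lform[OF cd WV \<omega>[unfolded k]] dR_lform[OF cd WV \<eta>[unfolded k]]]]) (use WV in auto)
  qed simp
qed

lemma dR_diff_ed:
  assumes V: "openin T V" and \<omega>: "\<omega> \<in> dR_forms M V (int k)" and cd: "chart_domain M c W" and WV: "W \<subseteq> V" and x: "x \<in> W"
  shows "dR_diff M V (int k) \<omega> x = chart_domain.ed M c W k \<omega> x"
proof (rule extensionalityI[of _ "tuples x (Suc k)"])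
  show "dR_diff M V (int k) \<omega> x \<in> extensional (tuples x (Suc k))"
    using x WV tvec_tuples_add[of x k 1] by (auto simp: dR_diff_def)
  show "chart_domain.ed M c W k \<omega> x \<in> extensional (tuples x (Suc k))"
    by (simp add: chart_domain.ed_def[OF cd])
qed (rule dR_diff_local[OF V \<omega> cd WV x])

lemma dR_diff_closed:
  assumes V: "openin T V" and \<omega>: "\<omega> \<in> dR_forms M V k"
  shows "dR_diff M V k \<omega> \<in> dR_forms M V (k + 1)"
proof (cases "k < 0")
  case True
  then show ?thesis using dR_zero[OF V] by (simp add: dR_diff_neg)
next
  case False
  then obtain p where k: "k = int p" by (metis nonneg_int_cases not_less)
  have "dR_diff M V (int p) \<omega> \<in> dR_forms M V (int (Suc p))"
  proof (rule dR_local[OF V])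
    fix c W assume cd: "chart_domain M c W" and WV: "W \<subseteq> V"
    interpret A: chart_domain M c W by fact
    show "A.lform (Suc p) (dR_diff M V (int p) \<omega>)"
      by (rule A.lform_cong[OF A.ed_lform[OF dR_lform[OF cd WV \<omega>[unfolded k]]]])
        (rule dR_diff_ed[OF V \<omega>[unfolded k] cd WV, symmetric])
  qed (simp add: dR_diff_def)
  then show ?thesis by (simp add: k add.commute)
qed

subsection \<open>The algebra structure\<close>

abbreviation "DM V k \<equiv> gmod (algs (deRham M) V) k"
abbreviation "DW V \<equiv> gmult (algs (deRham M) V)"

lemma deRham_simps [simp]:
  "carrier (DM V k) = dR_forms M V k"
  "\<zero>\<^bsub>DM V k\<^esub> = (\<lambda>x\<in>V. \<lambda>vs\<in>tvec_tuples M x k. 0)"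
  "\<omega> \<oplus>\<^bsub>DM V k\<^esub> \<eta> = (\<lambda>x\<in>V. \<lambda>vs\<in>tvec_tuples M x k. \<omega> x vs + \<eta> x vs)"
  "u \<odot>\<^bsub>DM V k\<^esub> \<omega> = (\<lambda>x\<in>V. \<lambda>vs\<in>tvec_tuples M x k. u x * \<omega> x vs)"
  "DW V k l \<omega> \<eta> = (\<lambda>x\<in>V. wedge M x k l (\<omega> x) (\<eta> x))"
  "gdiff (algs (deRham M) V) = dR_diff M V"
  "ares (deRham M) U V k \<omega> = restrict \<omega> V"
  by (simp_all add: deRham_def)

lemma DM_module:
  assumes V: "openin T V"
  shows "Module.module (alg (SF V)) (DM V k)"
proof (rule moduleI)
  show "cring (alg (SF V))" by (rule cring_alg[OF is_cinf_ring_SF[OF V]])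
  show "abelian_group (DM V k)"
  proof (rule abelian_groupI)
    fix \<omega> assume \<omega>: "\<omega> \<in> carrier (DM V k)"
    show "\<zero>\<^bsub>DM V k\<^esub> \<oplus>\<^bsub>DM V k\<^esub> \<omega> = \<omega>"
      by (rule dR_eqI[of _ V k]) (use \<omega> dR_add[OF V dR_zero[OF V], of \<omega> k] in simp_all)
    show "\<exists>\<eta>\<in>carrier (DM V k). \<eta> \<oplus>\<^bsub>DM V k\<^esub> \<omega> = \<zero>\<^bsub>DM V k\<^esub>"
      by (rule bexI[of _ "\<lambda>x\<in>V. \<lambda>vs\<in>tvec_tuples M x k. - \<omega> x vs"])
        (use \<omega> dR_neg[OF V] in \<open>simp_all cong: restrict_cong\<close>)
  qed (use dR_zero[OF V] dR_add[OF V] in \<open>simp_all add: add_ac cong: restrict_cong\<close>)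
next
  fix \<omega> assume \<omega>: "\<omega> \<in> carrier (DM V k)"
  show "\<one>\<^bsub>alg (SF V)\<^esub> \<odot>\<^bsub>DM V k\<^esub> \<omega> = \<omega>"
    by (rule dR_eqI[of _ V k]) (use \<omega> dR_smult[OF V SF_const[OF V]] in \<open>simp_all add: alg_SF_simps del: alg_simps\<close>)
qed (use dR_smult[OF V] in \<open>simp_all add: alg_SF_simps algebra_simps del: alg_simps cong: restrict_cong\<close>)

lemma DM_gsign:
  assumes V: "openin T V" and \<omega>: "\<omega> \<in> dR_forms M V k" and x: "x \<in> V" "vs \<in> tvec_tuples M x k"
  shows "gsign (DM V k) j \<omega> x vs = (if even j then 1 else - 1) * \<omega> x vs"
proof -
  interpret Module.module "alg (SF V)" "DM V k" by (rule DM_module[OF V])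
  have "\<ominus>\<^bsub>DM V k\<^esub> \<omega> = (\<lambda>x\<in>V. \<lambda>vs\<in>tvec_tuples M x k. - \<omega> x vs)"
    by (rule M.minus_equality) (use \<omega> dR_neg[OF V] in \<open>simp_all cong: restrict_cong\<close>)
  then show ?thesis using x by (simp add: gsign_def)
qed

lemma DM_finsum:
  assumes V: "openin T V" and x: "x \<in> V" "vs \<in> tvec_tuples M x k"
  shows "finite I \<Longrightarrow> (\<And>i. i \<in> I \<Longrightarrow> \<omega> i \<in> dR_forms M V k) \<Longrightarrow> finsum (DM V k) \<omega> I x vs = (\<Sum>i\<in>I. \<omega> i x vs)"
proof (induction I rule: finite_induct)
  interpret Module.module "alg (SF V)" "DM V k" by (rule DM_module[OF V])
  case empty
  then show ?case using x by simp
next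
  interpret Module.module "alg (SF V)" "DM V k" by (rule DM_module[OF V])
  case (insert i I)
  then show ?case using x by (subst M.finsum_insert) auto
qed

lemma wedge_zero_int:
  assumes "vs \<in> tvec_tuples M x (k + l)"
  shows "(\<And>us. us \<in> tvec_tuples M x k \<Longrightarrow> \<alpha> us = 0) \<Longrightarrow> wedge M x k l \<alpha> \<beta> vs = 0"
    and "(\<And>us. us \<in> tvec_tuples M x l \<Longrightarrow> \<beta> us = 0) \<Longrightarrow> wedge M x k l \<alpha> \<beta> vs = 0"
  using wedge_lin_l[OF assms, of \<alpha> 0 \<alpha> 0 \<alpha> \<beta>] wedge_lin_r[OF assms, of \<beta> 0 \<beta> 0 \<beta> \<alpha>] by auto

text \<open>A negative degree makes a product the zero form by definition: either the outer product,
  or an inner one which then annihilates the outer.\<close>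

lemma wedge_assoc_int:
  assumes vs: "vs \<in> tvec_tuples M x (k + l + m)"
  shows "wedge M x (k + l) m (wedge M x k l \<alpha> \<beta>) \<gamma> vs = wedge M x k (l + m) \<alpha> (wedge M x l m \<beta> \<gamma>) vs"
proof (cases "k < 0 \<or> l < 0 \<or> m < 0")
  case True
  have vs': "vs \<in> tvec_tuples M x (k + (l + m))" using vs by (simp add: add.assoc)
  consider "m < 0" | "k < 0" | "l < 0" "\<not> k < 0" "\<not> m < 0" using True by blast
  then show ?thesis
  proof cases
    case 1
    then have "wedge M x k (l + m) \<alpha> (wedge M x l m \<beta> \<gamma>) vs = 0"
      by (intro wedge_zero_int(2)[OF vs']) (simp add: wedge_neg)
    then show ?thesis using 1 vs by (simp add: wedge_neg)
  next
    case 2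
    then have "wedge M x (k + l) m (wedge M x k l \<alpha> \<beta>) \<gamma> vs = 0"
      by (intro wedge_zero_int(1)[OF vs]) (simp add: wedge_neg)
    then show ?thesis using 2 vs' by (simp add: wedge_neg)
  next
    case 3
    then have "wedge M x (k + l) m (wedge M x k l \<alpha> \<beta>) \<gamma> vs = 0" "wedge M x k (l + m) \<alpha> (wedge M x l m \<beta> \<gamma>) vs = 0"
      by (intro wedge_zero_int(1)[OF vs] wedge_zero_int(2)[OF vs'], simp add: wedge_neg)+
    then show ?thesis by simp
  qed
next
  case False
  then obtain p q r where k: "k = int p" "l = int q" "m = int r" by (metis nonneg_int_cases not_less)
  show ?thesis using wedge_assoc[of vs x p q r \<alpha> \<beta> \<gamma>] vs tvec_tuples_int[of x "p + q + r"] by (simp add: k)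
qed

lemma wedge_comm_int:
  assumes vs: "vs \<in> tvec_tuples M x (k + l)"
  shows "wedge M x k l \<alpha> \<beta> vs = (if even (k * l) then 1 else - 1) * wedge M x l k \<beta> \<alpha> vs"
proof (cases "k < 0 \<or> l < 0")
  case True
  then show ?thesis using vs wedge_neg[of k l x \<alpha> \<beta>] wedge_neg[of l k x \<beta> \<alpha>] by (auto simp: add.commute)
next
  case False
  then obtain p q where k: "k = int p" "l = int q" by (metis nonneg_int_cases not_less)
  have "vs \<in> tuples x (p + q)" using vs tvec_tuples_add[of x p q] by (simp add: k)
  from wedge_comm[OF this, of \<alpha> \<beta>] show ?thesis by (simp add: k minus_one_power_iff)
qed

lemma wedge_ops:
  assumes "vs \<in> tvec_tuples M x (k + l)"
  shows "wedge M x k l (\<lambda>vs\<in>tvec_tuples M x k. \<alpha> vs + \<alpha>' vs) \<beta> vs = wedge M x k l \<alpha> \<beta> vs + wedge M x k l \<alpha>' \<beta> vs"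
    and "wedge M x k l \<alpha> (\<lambda>vs\<in>tvec_tuples M x l. \<beta> vs + \<beta>' vs) vs = wedge M x k l \<alpha> \<beta> vs + wedge M x k l \<alpha> \<beta>' vs"
    and "wedge M x k l (\<lambda>vs\<in>tvec_tuples M x k. a * \<alpha> vs) \<beta> vs = a * wedge M x k l \<alpha> \<beta> vs"
    and "wedge M x k l \<alpha> (\<lambda>vs\<in>tvec_tuples M x l. a * \<beta> vs) vs = a * wedge M x k l \<alpha> \<beta> vs"
  using wedge_lin_l[OF assms, of "\<lambda>vs\<in>tvec_tuples M x k. \<alpha> vs + \<alpha>' vs" 1 \<alpha> 1 \<alpha>' \<beta>]
    wedge_lin_r[OF assms, of "\<lambda>vs\<in>tvec_tuples M x l. \<beta> vs + \<beta>' vs" 1 \<beta> 1 \<beta>' \<alpha>]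
    wedge_lin_l[OF assms, of "\<lambda>vs\<in>tvec_tuples M x k. a * \<alpha> vs" a \<alpha> 0 \<alpha> \<beta>]
    wedge_lin_r[OF assms, of "\<lambda>vs\<in>tvec_tuples M x l. a * \<beta> vs" a \<beta> 0 \<beta> \<alpha>] by simp_all

lemma DM_eqI:
  "\<omega> \<in> carrier (DM V k) \<Longrightarrow> \<eta> \<in> carrier (DM V k) \<Longrightarrow>
    (\<And>x vs. x \<in> V \<Longrightarrow> vs \<in> tvec_tuples M x k \<Longrightarrow> \<omega> x vs = \<eta> x vs) \<Longrightarrow> \<omega> = \<eta>"
  using dR_eqI[of \<omega> V k \<eta>] by simp

lemma DM_closed:
  assumes V: "openin T V" and "\<omega> \<in> carrier (DM V k)"
  shows "\<eta> \<in> carrier (DM V l) \<Longrightarrow> k + l = m \<Longrightarrow> DW V k l \<omega> \<eta> \<in> carrier (DM V m)"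
    and "\<eta> \<in> carrier (DM V k) \<Longrightarrow> \<omega> \<oplus>\<^bsub>DM V k\<^esub> \<eta> \<in> carrier (DM V k)"
    and "u \<in> carrier (alg (SF V)) \<Longrightarrow> u \<odot>\<^bsub>DM V k\<^esub> \<omega> \<in> carrier (DM V k)"
    and "dR_diff M V k \<omega> \<in> carrier (DM V (k + 1))"
  using assms dR_wedge[OF V] dR_add[OF V] dR_smult[OF V] dR_diff_closed[OF V] by (auto simp: alg_SF_simps simp del: alg_simps)

lemma deRham_cga:
  assumes V: "openin T V"
  shows "cga (SF V) (algs (deRham M) V)"
  unfolding cga_iff
proof (intro conjI allI ballI)
  note C = DM_closed[OF V]
  show "graded_algebra (alg (SF V)) (algs (deRham M) V)"
  proof (intro graded_algebra.intro DM_module[OF V], goal_cases)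
    case (1 k l \<omega> \<eta>)
    then show ?case by (intro C(1) refl)
  next
    case (2 k l \<omega> \<omega>' \<eta>)
    then show ?case by (intro DM_eqI[of _ V "k + l"] C refl) (simp_all add: wedge_ops)
  next
    case (3 k l \<omega> \<eta> \<eta>')
    then show ?case by (intro DM_eqI[of _ V "k + l"] C refl) (simp_all add: wedge_ops)
  next
    case (4 k l u \<omega> \<eta>)
    then show ?case by (intro DM_eqI[of _ V "k + l"] C refl) (simp_all add: wedge_ops)
  next
    case (5 k l u \<omega> \<eta>)
    then show ?case by (intro DM_eqI[of _ V "k + l"] C refl) (simp_all add: wedge_ops)
  next
    case (6 k l m \<omega> \<eta> \<zeta>)
    then show ?case by (intro DM_eqI[of _ V "k + l + m"] C refl) (simp_all add: wedge_assoc_int)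
  qed
  fix k l \<omega> \<eta> assume \<omega>: "\<omega> \<in> carrier (DM V k)" and \<eta>: "\<eta> \<in> carrier (DM V l)"
  have c: "DW V l k \<eta> \<omega> \<in> carrier (DM V (k + l))" by (rule C(1)[OF \<eta> \<omega>]) simp
  show "DW V k l \<omega> \<eta> = gsign (DM V (k + l)) (k * l) (DW V l k \<eta> \<omega>)"
  proof (intro DM_eqI[of _ V "k + l"] C(1)[OF \<omega> \<eta>] gsign_closed[OF DM_module[OF V] c] refl, goal_cases)
    case (1 x vs)
    show ?case unfolding DM_gsign[OF V c[unfolded deRham_simps(1)] 1] using 1 wedge_comm_int[OF 1(2)] by simp
  qed
qed

text \<open>Splits off the negative degrees and otherwise supplies a chart domain around x in which
  \<open>dR_diff_local\<close> can be used.\<close>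

lemma dR_diff_cases:
  assumes V: "openin T V" and x: "x \<in> V" and vs: "vs \<in> tvec_tuples M x (k + 1)"
    and neg: "k < 0 \<Longrightarrow> P"
    and loc: "\<And>p c W. k = int p \<Longrightarrow> chart_domain M c W \<Longrightarrow> x \<in> W \<Longrightarrow> W \<subseteq> V \<Longrightarrow> vs \<in> tuples x (Suc p) \<Longrightarrow> P"
  shows P
proof (cases "k < 0")
  case False
  then obtain p where k: "k = int p" by (metis nonneg_int_cases not_less)
  obtain c W where "chart_domain M c W" "x \<in> W" "W \<subseteq> V" using chart_ex[OF V x] by blast
  moreover have "vs \<in> tuples x (Suc p)" using vs tvec_tuples_add[of x p 1] by (simp add: k)
  ultimately show ?thesis using loc k by blast
qed (rule neg)

text \<open>The combination is given pointwise, so that a single statement yields additivity,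
  linearity over constants and, with both coefficients 0, the derivative of the zero form.\<close>

lemma dR_diff_lin:
  assumes V: "openin T V" and \<omega>: "\<omega> \<in> dR_forms M V k" "\<eta> \<in> dR_forms M V k" "\<zeta> \<in> dR_forms M V k"
    and e: "\<And>x vs. x \<in> V \<Longrightarrow> vs \<in> tvec_tuples M x k \<Longrightarrow> \<zeta> x vs = a * \<omega> x vs + b * \<eta> x vs"
    and x: "x \<in> V" "vs \<in> tvec_tuples M x (k + 1)"
  shows "dR_diff M V k \<zeta> x vs = a * dR_diff M V k \<omega> x vs + b * dR_diff M V k \<eta> x vs"
proof (rule dR_diff_cases[OF V x])
  fix p c W assume k: "k = int p" and cd: "chart_domain M c W" and W: "x \<in> W" "W \<subseteq> V" and vs: "vs \<in> tuples x (Suc p)"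
  interpret A: chart_domain M c W by fact
  note L = dR_diff_local[OF V _ cd W(2,1) vs]
  have "A.ed p \<zeta> x vs = (\<Sum>i\<in>UNIV. (if i then a else b) * A.ed p (if i then \<omega> else \<eta>) x vs)"
    by (rule A.ed_sum[OF _ W(1) vs])
      (use \<omega> e dR_lform[OF cd W(2)] W in \<open>auto simp: k UNIV_bool tvec_tuples_int\<close>)
  then show ?thesis using \<omega> by (simp add: k L UNIV_bool)
qed (use x in \<open>simp add: dR_diff_neg\<close>)

lemma dR_diff_mult:
  assumes V: "openin T V" and \<omega>: "\<omega> \<in> dR_forms M V k" and \<eta>: "\<eta> \<in> dR_forms M V l"
    and x: "x \<in> V" "vs \<in> tvec_tuples M x (k + l + 1)"
  shows "dR_diff M V (k + l) (\<lambda>x\<in>V. wedge M x k l (\<omega> x) (\<eta> x)) x vs =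
    wedge M x (k + 1) l (dR_diff M V k \<omega> x) (\<eta> x) vs +
    (if even k then 1 else - 1) * wedge M x k (l + 1) (\<omega> x) (dR_diff M V l \<eta> x) vs"
proof (cases "k < 0 \<or> l < 0")
  case True
  have vs: "vs \<in> tvec_tuples M x (k + 1 + l)" "vs \<in> tvec_tuples M x (k + (l + 1))" using x(2) by (simp_all add: ac_simps)
  have z: "(\<lambda>x\<in>V. wedge M x k l (\<omega> x) (\<eta> x)) = (\<lambda>x\<in>V. \<lambda>vs\<in>tvec_tuples M x (k + l). 0)"
    using True by (simp add: wedge_neg)
  have "dR_diff M V (k + l) (\<lambda>x\<in>V. \<lambda>vs\<in>tvec_tuples M x (k + l). 0) x vs = 0"
    using dR_diff_lin[OF V dR_zero[OF V] dR_zero[OF V] dR_zero[OF V], of "k + l" 0 0 x vs] x by simp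
  \<comment> \<open>For k = -1 the first factor has degree 0 and the product is not zero by
    definition; but that factor is 0 by \<open>dR_diff_neg\<close>.\<close>
  moreover have "wedge M x (k + 1) l (dR_diff M V k \<omega> x) (\<eta> x) vs = 0"
  proof (cases "k < 0")
    case True
    then show ?thesis using x by (intro wedge_zero_int(1)[OF vs(1)]) (simp add: dR_diff_neg)
  next
    case False
    then show ?thesis using True vs by (simp add: wedge_neg)
  qed
  moreover have "wedge M x k (l + 1) (\<omega> x) (dR_diff M V l \<eta> x) vs = 0"
  proof (cases "l < 0")
    case True
    then show ?thesis using x by (intro wedge_zero_int(2)[OF vs(2)]) (simp add: dR_diff_neg)
  next
    case False
    then show ?thesis using True vs by (simp add: wedge_neg)
  qed
  ultimately show ?thesis by (simp add: z)
next
  case False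
  then obtain p q where k: "k = int p" "l = int q" by (metis nonneg_int_cases not_less)
  obtain c W where cd: "chart_domain M c W" and W: "x \<in> W" "W \<subseteq> V" using chart_ex[OF V x(1)] by blast
  interpret A: chart_domain M c W by fact
  have vs: "vs \<in> tuples x (Suc (p + q))" using x(2) tvec_tuples_add[of x "p + q" 1] by (simp add: k)
  note l\<omega> = dR_lform[OF cd W(2) \<omega>[unfolded k]] and l\<eta> = dR_lform[OF cd W(2) \<eta>[unfolded k]]
  have "dR_diff M V (int (p + q)) (\<lambda>x\<in>V. wedge M x k l (\<omega> x) (\<eta> x)) x vs = A.ed (p + q) (\<lambda>x\<in>V. wedge M x k l (\<omega> x) (\<eta> x)) x vs"
    by (rule dR_diff_local[OF V _ cd W(2,1) vs]) (use dR_wedge[OF V \<omega> \<eta>] k in simp)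
  also have "\<dots> = A.ed (p + q) (\<lambda>y. Wd y p q (\<omega> y) (\<eta> y)) x vs"
    by (rule A.ed_cong[OF A.lform_wedge[OF l\<omega> l\<eta>] W(1) vs]) (use W k in auto)
  also have "\<dots> = Wd x (Suc p) q (A.ed p \<omega> x) (\<eta> x) vs + (-1) ^ p * Wd x p (Suc q) (\<omega> x) (A.ed q \<eta> x) vs"
    by (rule A.ed_wedge[OF l\<omega> l\<eta> W(1) vs])
  finally show ?thesis
    using dR_diff_ed[OF V \<omega>[unfolded k] cd W(2,1)] dR_diff_ed[OF V \<eta>[unfolded k] cd W(2,1)]
    by (simp add: k minus_one_power_iff add.commute)
qed

lemma dR_diff_diff:
  assumes V: "openin T V" and \<omega>: "\<omega> \<in> dR_forms M V k" and x: "x \<in> V" "vs \<in> tvec_tuples M x (k + 2)"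
  shows "dR_diff M V (k + 1) (dR_diff M V k \<omega>) x vs = 0"
proof -
  have x': "vs \<in> tvec_tuples M x (k + 1 + 1)" using x(2) by (simp add: add.assoc)
  show ?thesis
  proof (cases "k < 0")
    case True
    then show ?thesis
      using dR_diff_lin[OF V dR_zero[OF V] dR_zero[OF V] dR_zero[OF V], of "k + 1" 0 0 x vs] x(1) x' by (simp add: dR_diff_neg)
  next
    case False
    then obtain p where k: "k = int p" by (metis nonneg_int_cases not_less)
    obtain c W where cd: "chart_domain M c W" and W: "x \<in> W" "W \<subseteq> V" using chart_ex[OF V x(1)] by blast
    interpret A: chart_domain M c W by fact
    have vs: "vs \<in> tuples x (Suc (Suc p))" using x(2) tvec_tuples_add[of x p 2] by (simp add: k)
    note l\<omega> = dR_lform[OF cd W(2) \<omega>[unfolded k]]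
    have "dR_diff M V (int (Suc p)) (dR_diff M V k \<omega>) x vs = A.ed (Suc p) (dR_diff M V k \<omega>) x vs"
      by (rule dR_diff_local[OF V _ cd W(2,1) vs]) (use dR_diff_closed[OF V \<omega>] k in \<open>simp add: add.commute\<close>)
    also have "\<dots> = A.ed (Suc p) (A.ed p \<omega>) x vs"
      by (rule A.ed_cong[OF A.ed_lform[OF l\<omega>] W(1) vs]) (simp add: k dR_diff_ed[OF V \<omega>[unfolded k] cd W(2)])
    finally show ?thesis using A.ed_ed[OF l\<omega> W(1) vs] by (simp add: k add.commute)
  qed
qed

lemma is_cdga_deRham:
  assumes V: "openin T V"
  shows "is_cdga (SF V) (algs (deRham M) V)"
proof -
  note C = DM_closed[OF V]
  have r: "cconst (SF V) r \<in> carrier (alg (SF V))" for r using SF_const[OF V, of r] by (simp add: alg_SF_simps del: alg_simps)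
  have "differential (SF V) (algs (deRham M) V) (dR_diff M V)"
    unfolding differential_def
  proof (intro conjI allI ballI funcsetI C(4), goal_cases)
    case (2 k \<omega> \<eta>)
    show ?case
    proof (intro DM_eqI[of _ V "k + 1"] C 2, goal_cases)
      case (1 x vs)
      then show ?case
        using dR_diff_lin[OF V _ _ _ _ 1, of \<omega> \<eta> "\<omega> \<oplus>\<^bsub>DM V k\<^esub> \<eta>" 1 1] 2 C(2)[OF 2] by simp
    qed
  next
    case (3 k r \<omega>)
    show ?case
    proof (intro DM_eqI[of _ V "k + 1"] C 3 r, goal_cases)
      case (1 x vs)
      then show ?case
        using dR_diff_lin[OF V _ _ _ _ 1, of \<omega> \<omega> "cconst (SF V) r \<odot>\<^bsub>DM V k\<^esub> \<omega>" r 0] 3 C(3)[OF 3 r[of r]] by (simp add: alg_SF_simps)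
    qed
  next
    case (4 k l \<omega> \<eta>)
    have c: "DW V k (l + 1) \<omega> (dR_diff M V l \<eta>) \<in> carrier (DM V (k + l + 1))"
      by (rule C(1)[OF 4(1) C(4)[OF 4(2)]]) simp
    show ?case
    proof (intro DM_eqI[of _ V "k + l + 1"] C 4 gsign_closed[OF DM_module[OF V] c], goal_cases)
      case (3 x vs)
      show ?case
        using dR_diff_mult[OF V _ _ 3, of \<omega> \<eta>] 4 3 DM_gsign[OF V c[unfolded deRham_simps(1)] 3, of k] by simp
    qed simp_all
  next
    case (5 k \<omega>)
    have "dR_diff M V (k + 1) (dR_diff M V k \<omega>) \<in> carrier (DM V (k + 2))"
      using C(4)[OF C(4)[OF 5]] by (simp add: add.assoc)
    then show ?case
      using dR_diff_diff[OF V, of \<omega> k] dR_zero[OF V, of "k + 2"] 5 by (intro DM_eqI[of _ V "k + 2"]) simp_all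
  qed
  then show ?thesis using deRham_cga[OF V] by (simp add: is_cdga_def)
qed

subsection \<open>Restriction and functions\<close>

lemma dR_restrict:
  assumes V: "V' \<subseteq> V" and \<omega>: "\<omega> \<in> dR_forms M V k"
  shows "restrict \<omega> V' \<in> dR_forms M V' k"
  unfolding dR_forms_iff
proof (intro conjI ballI allI impI)
  fix c and js :: "nat list" assume "c \<in> atlas M" "int (length js) = k" "set js \<subseteq> {..<n}"
  then show "sm M c V' (\<lambda>x. restrict \<omega> V' x (map (coord_vec M c x) js))"
    using \<omega> by (intro sm_cong[OF _ sm_mono[OF _ V]]) (auto simp: dR_forms_iff)
qed (use assms in \<open>auto simp: dR_forms_iff\<close>)

text \<open>Both derivatives are computed in a chart domain inside \<open>V'\<close>, on which the
  two forms coincide.\<close>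

lemma dR_diff_restrict:
  assumes o: "openin T V" "openin T V'" and V: "V' \<subseteq> V" and \<omega>: "\<omega> \<in> dR_forms M V k"
  shows "dR_diff M V' k (restrict \<omega> V') = restrict (dR_diff M V k \<omega>) V'"
proof (rule dR_eqI[OF dR_diff_closed[OF o(2) dR_restrict[OF V \<omega>]] dR_restrict[OF V dR_diff_closed[OF o(1) \<omega>]]])
  fix x vs assume x: "x \<in> V'" "vs \<in> tvec_tuples M x (k + 1)"
  show "dR_diff M V' k (restrict \<omega> V') x vs = restrict (dR_diff M V k \<omega>) V' x vs"
  proof (rule dR_diff_cases[OF o(2) x])
    assume "k < 0"
    then show ?thesis using x V by (auto simp: dR_diff_neg)
  next
    fix p c W assume k: "k = int p" and cd: "chart_domain M c W" and W: "x \<in> W" "W \<subseteq> V'" and vs: "vs \<in> tuples x (Suc p)"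
    have WV: "W \<subseteq> V" using W V by blast
    have "chart_domain.ed M c W p (restrict \<omega> V') x vs = chart_domain.ed M c W p \<omega> x vs"
      by (rule chart_domain.ed_cong[OF cd dR_lform[OF cd WV \<omega>[unfolded k]] W(1) vs]) (use W in auto)
    then show ?thesis
      using x dR_diff_local[OF o(2) dR_restrict[OF V \<omega>, unfolded k] cd W(2,1) vs] dR_diff_local[OF o(1) \<omega>[unfolded k] cd WV W(1) vs]
      by (simp add: k)
  qed
qed

lemma tuples_0: "vs \<in> tvec_tuples M x 0 \<longleftrightarrow> vs = []"
  by (auto simp: tvec_tuples_def)

lemma dR_fun_closed:
  assumes V: "openin T V" and u: "u \<in> carrier (SF V)"
  shows "dR_fun M V u \<in> dR_forms M V 0"
proof -
  have "dR_fun M V u \<in> dR_forms M V (int 0)"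
  proof (rule dR_local[OF V])
    fix c W assume cd: "chart_domain M c W" and WV: "W \<subseteq> V"
    interpret A: chart_domain M c W by fact
    show "A.lform 0 (dR_fun M V u)"
      unfolding A.lform_def
    proof (intro conjI ballI allI impI)
      show "dR_fun M V u x \<in> AF x 0" if "x \<in> W" for x
        by (rule alt_formsI) (use that WV in \<open>auto simp: dR_fun_def tuples_iff tvec_tuples_def\<close>)
      fix js :: "nat list" assume "length js = 0"
      then show "sm M c W (\<lambda>x. dR_fun M V u x (map (coord_vec M c x) js))"
        using u WV A.c by (intro sm_cong[OF A.c sm_mono[OF _ WV], of u]) (auto simp: SF_carrier dR_fun_def tuples_0)
    qed
  qed (simp add: dR_fun_def)
  then show ?thesis by simp
qed

lemma dR_fun_mult:
  assumes V: "openin T V" and u: "u \<in> carrier (SF V)" and \<omega>: "\<omega> \<in> dR_forms M V k"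
  shows "DW V 0 k (dR_fun M V u) \<omega> = u \<odot>\<^bsub>DM V k\<^esub> \<omega>"
proof (rule dR_eqI)
  show "DW V 0 k (dR_fun M V u) \<omega> \<in> dR_forms M V k"
    using dR_wedge[OF V dR_fun_closed[OF V u] \<omega>] by simp
  show "u \<odot>\<^bsub>DM V k\<^esub> \<omega> \<in> dR_forms M V k" using dR_smult[OF V u \<omega>] by simp
  fix x vs assume x: "x \<in> V" "vs \<in> tvec_tuples M x k"
  \<comment> \<open>A tuple exists only in nonnegative degree.\<close>
  then obtain p where k: "k = int p" by (auto simp: tvec_tuples_def)
  have "\<omega> x \<in> AF x p" using \<omega> x by (simp add: dR_forms_iff k)
  from wedge_0[OF this, of vs "dR_fun M V u x"] show "DW V 0 k (dR_fun M V u) \<omega> x vs = (u \<odot>\<^bsub>DM V k\<^esub> \<omega>) x vs"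
    using x by (simp add: k dR_fun_def tuples_0 tvec_tuples_int)
qed

text \<open>Graded commutativity makes the square its own negative, and the values are real
  numbers.\<close>

lemma dR_one_sq:
  assumes V: "openin T V" and \<omega>: "\<omega> \<in> dR_forms M V 1"
  shows "DW V 1 1 \<omega> \<omega> = \<zero>\<^bsub>DM V 2\<^esub>"
proof (rule dR_eqI)
  show "DW V 1 1 \<omega> \<omega> \<in> dR_forms M V 2" using dR_wedge[OF V \<omega> \<omega>] by simp
  show "\<zero>\<^bsub>DM V 2\<^esub> \<in> dR_forms M V 2" using dR_zero[OF V] by simp
  fix x vs assume x: "x \<in> V" "vs \<in> tvec_tuples M x 2"
  then show "DW V 1 1 \<omega> \<omega> x vs = \<zero>\<^bsub>DM V 2\<^esub> x vs"
    using wedge_comm_int[of vs x 1 1 "\<omega> x" "\<omega> x"] by simp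
qed

lemma dR_diff_fun:
  assumes V: "openin T V" and u: "u \<in> carrier (SF V)" and cd: "chart_domain M c W" and W: "x \<in> W" "W \<subseteq> V" and v: "v \<in> TS x"
  shows "dR_diff M V 0 (dR_fun M V u) x [v] = (\<Sum>i<n. v c i * cpd c W i u x)"
proof -
  interpret A: chart_domain M c W by fact
  have d: "dR_fun M V u \<in> dR_forms M V (int 0)" using dR_fun_closed[OF V u] by simp
  have vs: "[v] \<in> tuples x (Suc 0)" using v by (simp add: tuples_iff)
  have "cpd c W i (\<lambda>y. dR_fun M V u y []) x = cpd c W i u x" for i
    by (rule cpd_cong[OF A.c _ A.at'[OF W(1)] W(1)]) (use W in \<open>auto simp: dR_fun_def tuples_0\<close>)
  then show ?thesis
    using dR_diff_local[OF V d cd W(2,1) vs] A.ed_eq[OF dR_lform[OF cd W(2) d] W(1) vs] by simp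
qed

text \<open>Evaluated on a tangent vector in a chart, the derivation rule is the chain rule
  \<open>cpd_tuple\<close> for \<open>h\<close> after the tuple of functions.\<close>

lemma dR_fun_derivation:
  assumes V: "openin T V"
  shows "cinf_derivation (SF V) (DM V 1) (\<lambda>u. dR_diff M V 0 (dR_fun M V u))"
  unfolding cinf_derivation_def
proof (intro conjI allI impI)
  have c: "u \<in> carrier (SF V) \<Longrightarrow> dR_diff M V 0 (dR_fun M V u) \<in> dR_forms M V 1" for u
    using dR_diff_closed[OF V dR_fun_closed[OF V]] by simp
  then show "(\<lambda>u. dR_diff M V 0 (dR_fun M V u)) \<in> carrier (SF V) \<rightarrow> carrier (DM V 1)" by simp
  interpret R: Module.module "alg (SF V)" "DM V 1" by (rule DM_module[OF V])
  fix us :: "('m \<Rightarrow> real) list" and h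
  assume "us \<noteq> []" and us: "set us \<subseteq> carrier (SF V)" and h: "h \<in> Cinf (length us)"
  let ?m = "length us"
  let ?d = "\<lambda>u. dR_diff M V 0 (dR_fun M V u)"
  let ?s = "\<lambda>i. cop (SF V) (pd (Rn ?m) i h) us \<odot>\<^bsub>DM V 1\<^esub> ?d (us ! i)"
  have ui: "us ! i \<in> carrier (SF V)" if "i < ?m" for i using us that by auto
  note cl = is_cinf_ring_SF[OF V, unfolded is_cinf_ring_def, THEN conjunct2, THEN conjunct1, rule_format]
  have s: "?s i \<in> dR_forms M V 1" if "i \<in> {..<?m}" for i
    using that dR_smult[OF V cl[OF us Cinf_pd[OF h]] c[OF ui]] by simp
  show "?d (cop (SF V) h us) = (\<Oplus>\<^bsub>DM V 1\<^esub>i\<in>{..<?m}. ?s i)"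
  proof (rule dR_eqI[OF c[OF cl[OF us h]]])
    show "(\<Oplus>\<^bsub>DM V 1\<^esub>i\<in>{..<?m}. ?s i) \<in> dR_forms M V 1"
      using R.M.finsum_closed[of ?s "{..<?m}"] s by (simp only: deRham_simps(1)) blast
    fix x vs assume x: "x \<in> V" "vs \<in> tvec_tuples M x 1"
    obtain v where v: "v \<in> TS x" "vs = [v]" using x(2) tuples_1[of vs x] tvec_tuples_int[of x 1] by auto
    obtain c W where cd: "chart_domain M c W" and W: "x \<in> W" "W \<subseteq> V" using chart_ex[OF V x(1)] by blast
    interpret A: chart_domain M c W by fact
    have e: "cpd c W j (cop (SF V) h us) x = (\<Sum>i<?m. pd (Rn ?m) i h (tuple ?m (\<lambda>i. us ! i) x) * cpd c W j (us ! i) x)" if j: "j < n" for j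
    proof -
      have "cpd c W j (cop (SF V) h us) x = cpd c W j (\<lambda>x. h (tuple ?m (\<lambda>i. us ! i) x)) x"
        by (rule cpd_cong[OF A.c _ A.at'[OF W(1)] W(1)]) (use W in \<open>auto simp: SF_cop\<close>)
      also have "\<dots> = (\<Sum>i<?m. pd (Rn ?m) i h (tuple ?m (\<lambda>i. us ! i) x) * cpd c W j (us ! i) x)"
        by (rule cpd_tuple[OF A.c A.W j A.at'[OF W(1)] W(1) corner_open_Rn smooth_on_Cinf[OF h subset_refl]])
          (use ui sm_mono[OF _ W(2)] A.c in \<open>auto simp: SF_carrier\<close>)
      finally show ?thesis .
    qed
    have "?d (cop (SF V) h us) x vs = (\<Sum>j<n. v c j * (\<Sum>i<?m. pd (Rn ?m) i h (tuple ?m (\<lambda>i. us ! i) x) * cpd c W j (us ! i) x))"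
      unfolding v(2) dR_diff_fun[OF V cl[OF us h] cd W v(1)] by (simp add: e)
    also have "\<dots> = (\<Sum>j<n. \<Sum>i<?m. v c j * (pd (Rn ?m) i h (tuple ?m (\<lambda>i. us ! i) x) * cpd c W j (us ! i) x))"
      by (simp only: sum_distrib_left)
    also have "\<dots> = (\<Sum>i<?m. \<Sum>j<n. v c j * (pd (Rn ?m) i h (tuple ?m (\<lambda>i. us ! i) x) * cpd c W j (us ! i) x))"
      by (rule sum.swap)
    also have "\<dots> = (\<Sum>i<?m. ?s i x vs)"
    proof (rule sum.cong[OF refl])
      fix i assume "i \<in> {..<?m}"
      then have "?d (us ! i) x vs = (\<Sum>j<n. v c j * cpd c W j (us ! i) x)"
        unfolding v(2) by (intro dR_diff_fun[OF V ui cd W v(1)]) simp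
      then show "(\<Sum>j<n. v c j * (pd (Rn ?m) i h (tuple ?m (\<lambda>i. us ! i) x) * cpd c W j (us ! i) x)) = ?s i x vs"
        using x by (simp add: SF_cop sum_distrib_left mult_ac)
    qed
    finally show "?d (cop (SF V) h us) x vs = (\<Oplus>\<^bsub>DM V 1\<^esub>i\<in>{..<?m}. ?s i) x vs"
      using DM_finsum[OF V x, of "{..<?m}" ?s] s by simp
  qed
qed

end

section \<open>The induced map\<close>

context corner_manifold
begin

text \<open>Smoothness of forms is a local condition; through this the map assembled from germs
  takes its values in forms.\<close>

lemma dR_glue:
  assumes V: "openin T V" and e: "\<omega> \<in> extensional V"
    and l: "\<And>x. x \<in> V \<Longrightarrow> \<exists>W. openin T W \<and> x \<in> W \<and> W \<subseteq> V \<and> restrict \<omega> W \<in> dR_forms M W k"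
  shows "\<omega> \<in> dR_forms M V k"
  unfolding dR_forms_iff
proof (intro conjI ballI allI impI)
  fix x assume "x \<in> V"
  then obtain W where "x \<in> W" "restrict \<omega> W \<in> dR_forms M W k" using l by blast
  then show "\<omega> x \<in> alt_forms M x k" by (force simp: dR_forms_iff)
next
  fix c and js :: "nat list" assume c: "c \<in> atlas M" and js: "int (length js) = k" "set js \<subseteq> {..<n}"
  show "sm M c V (\<lambda>x. \<omega> x (map (coord_vec M c x) js))"
  proof (rule sm_local[OF c V])
    fix x assume "x \<in> V"
    then obtain W where W: "openin T W" "x \<in> W" "W \<subseteq> V" "restrict \<omega> W \<in> dR_forms M W k" using l by blast
    then have "sm M c W (\<lambda>x. restrict \<omega> W x (map (coord_vec M c x) js))" using c js by (simp add: dR_forms_iff)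
    then have "sm M c (V \<inter> W) (\<lambda>x. restrict \<omega> W x (map (coord_vec M c x) js))" using W(3) by (simp add: Int_absorb1)
    then have "sm M c (V \<inter> W) (\<lambda>x. \<omega> x (map (coord_vec M c x) js))" by (rule sm_cong[OF c]) simp
    then show "\<exists>W. openin T W \<and> x \<in> W \<and> sm M c (V \<inter> W) (\<lambda>x. \<omega> x (map (coord_vec M c x) js))" using W by blast
  qed
qed (rule e)

end

lemma forms_presheaf_simps [simp]:
  "algs (forms_presheaf B) U = forms (rings B U)"
  "ares (forms_presheaf B) U V = forms_map (rings B U) (rings B V) (rres B U V)"
  by (simp_all add: forms_presheaf_def)

locale cinf_ringed_map = corner_manifold M for M :: "'m mfd" +
  fixes N :: "'x topology" and B :: "('x, 'b) cinf_presheaf" and f :: "'m \<Rightarrow> 'x" and fs :: "'x set \<Rightarrow> 'b \<Rightarrow> 'm \<Rightarrow> real"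
  assumes sheaf: "is_cinf_sheaf N B" and map: "cinf_ringed_space_map (mtop M) (smooth_functions M) N B f fs"
begin

sublocale PF: presheaf_of_cdgas N B "forms_presheaf B"
  by (rule presheaf_of_cdgas_forms[OF sheaf])

abbreviation "RA U \<equiv> alg (rings B U)"
abbreviation "pre U \<equiv> preimage T f U"
abbreviation "Om U \<equiv> algs (Omega N B) U"
abbreviation "rdR U \<equiv> restrict_scalars (fs U) (algs (deRham M) (pre U))"
abbreviation "Lm U k \<equiv> gmod (ext_algebra (RA U) (kaehler (rings B U))) k"
abbreviation "wm U k l \<equiv> gmult (ext_algebra (RA U) (kaehler (rings B U))) k l"
abbreviation "dl U b \<equiv> form1 (rings B U) (kaehler_d (rings B U) b)"
abbreviation "DF V u \<equiv> dR_fun M V u"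

section \<open>The comparison map over one open set\<close>

lemma pre_open: "openin N U \<Longrightarrow> openin T (pre U)"
  using map openin_continuous_map_preimage[of T N f U] by (simp add: cinf_ringed_space_map_def preimage_def)

lemma pre_mono: "V \<subseteq> U \<Longrightarrow> pre V \<subseteq> pre U"
  by (auto simp: preimage_def)

lemma fs_map: "openin N U \<Longrightarrow> cinf_map (rings B U) (SF (pre U)) (fs U)"
  using map by (simp add: cinf_ringed_space_map_def)

lemma fs_res: "openin N U \<Longrightarrow> openin N V \<Longrightarrow> V \<subseteq> U \<Longrightarrow> b \<in> carrier (rings B U) \<Longrightarrow> fs V (rres B U V b) = restrict (fs U b) (pre V)"
  using map by (simp add: cinf_ringed_space_map_def smooth_functions_def)

lemma fs_closed: "openin N U \<Longrightarrow> b \<in> carrier (rings B U) \<Longrightarrow> fs U b \<in> carrier (SF (pre U))"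
  by (rule cinf_map_closed[OF fs_map])

lemma cdga_rdR: "openin N U \<Longrightarrow> is_cdga (rings B U) (rdR U)"
  by (rule is_cdga_restrict_scalars[OF PF.rings fs_map is_cdga_deRham[OF pre_open]])

lemma cinf_forms_B: "openin N U \<Longrightarrow> cinf_forms (rings B U)"
  by (rule cinf_forms.intro) (rule PF.rings)

lemma forms_to_deRham:
  assumes U: "openin N U"
  shows "\<exists>F. (\<forall>k. linear_map (RA U) (Lm U k) (gmod (rdR U) k) (F k)) \<and>
    (\<forall>k l. \<forall>x\<in>carrier (Lm U k). \<forall>y\<in>carrier (Lm U l). F (k + l) (wm U k l x y) = gmult (rdR U) k l (F k x) (F l y)) \<and>
    (\<forall>b\<in>carrier (rings B U). F 0 (form0 (rings B U) b) = DF (pre U) (fs U b)) \<and>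
    (\<forall>b\<in>carrier (rings B U). F 1 (dl U b) = dR_diff M (pre U) 0 (DF (pre U) (fs U b)))"
proof -
  let ?C = "rings B U" and ?V = "pre U"
  interpret C: cinf_forms ?C by (rule cinf_forms_B[OF U])
  note V = pre_open[OF U]
  have A: "graded_algebra (alg ?C) (rdR U)" using cdga_rdR[OF U] unfolding is_cdga_def cga_iff by blast
  interpret A: graded_algebra "alg ?C" "rdR U" by (rule A)
  let ?X = "\<lambda>b. dR_diff M ?V 0 (DF ?V (fs U b))"
  \<comment> \<open>The constant function 1 is the left unit that \<open>ext_universal\<close> asks
    for.\<close>
  let ?e = "DF ?V (\<lambda>x\<in>?V. 1)"
  have e: "?e \<in> carrier (gmod (rdR U) 0)" using dR_fun_closed[OF V SF_const[OF V]] by simp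
  have unit: "gmult (rdR U) 0 k ?e x = x" if x: "x \<in> carrier (gmod (rdR U) k)" for k x
  proof -
    have x': "x \<in> dR_forms M ?V k" using x by simp
    have "gmult (algs (deRham M) ?V) 0 k ?e x = \<one>\<^bsub>alg (SF ?V)\<^esub> \<odot>\<^bsub>DM ?V k\<^esub> x"
      unfolding dR_fun_mult[OF V SF_const[OF V] x'] alg_SF_simps(3) ..
    also have "\<dots> = x" by (rule Module.module.smult_one[OF DM_module[OF V]]) (use x' in simp)
    finally show ?thesis unfolding restrict_scalars_simps .
  qed
  have "cinf_derivation ?C (gmod (rdR U) 1) ?X"
    unfolding restrict_scalars_simps
    by (rule derivation_pullback[OF PF.rings[OF U] is_cinf_ring_SF[OF V] fs_map[OF U] DM_module[OF V] dR_fun_derivation[OF V]])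
  then obtain \<psi> where \<psi>: "linear_map (alg ?C) (kaehler ?C) (gmod (rdR U) 1) \<psi>" "\<And>b. b \<in> carrier ?C \<Longrightarrow> \<psi> (kaehler_d ?C b) = ?X b"
    using kaehler_universal[OF PF.rings[OF U] A.gmod_module] by blast
  have sq: "gmult (rdR U) 1 1 (\<psi> m) (\<psi> m) = \<zero>\<^bsub>gmod (rdR U) 2\<^esub>" if "m \<in> carrier (kaehler ?C)" for m
    using dR_one_sq[OF V, of "\<psi> m"] linear_map_simps(1)[OF \<psi>(1) that] by simp
  obtain F where F: "\<And>k. linear_map (alg ?C) (Lm U k) (gmod (rdR U) k) (F k)"
    "\<And>k l x y. x \<in> carrier (Lm U k) \<Longrightarrow> y \<in> carrier (Lm U l) \<Longrightarrow> F (k + l) (wm U k l x y) = gmult (rdR U) k l (F k x) (F l y)"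
    "F 0 C.one0 = ?e" "\<And>m. m \<in> carrier (kaehler ?C) \<Longrightarrow> F 1 (ext_word (alg ?C) (kaehler ?C) 1 [m]) = gmult (rdR U) 1 0 (\<psi> m) ?e"
    using C.ext_universal[OF A e unit \<psi>(1) sq] by blast
  have "F 0 (form0 ?C b) = DF ?V (fs U b)" if b: "b \<in> carrier ?C" for b
  proof -
    have "F 0 (form0 ?C b) = b \<odot>\<^bsub>gmod (rdR U) 0\<^esub> ?e"
      unfolding C.form0_eq[OF b] F(3)[symmetric] by (rule linear_map_simps(3)[OF F(1)]) (use b in \<open>simp_all add: C.cC\<close>)
    \<comment> \<open>The scalar \<open>b\<close> acts through \<open>fs U b\<close>, here on the
      constant 1.\<close>
    also have "\<dots> = DF ?V (fs U b)" by (auto simp: dR_fun_def fun_eq_iff restrict_def)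
    finally show ?thesis .
  qed
  moreover have "F 1 (dl U b) = ?X b" if b: "b \<in> carrier ?C" for b
  proof -
    have m: "kaehler_d ?C b \<in> carrier (kaehler ?C)"
      by (rule derivation_closed[OF module_kaehler[OF PF.rings[OF U]] PF.rings[OF U] kaehler_d_derivation[OF PF.rings[OF U]] b])
    have Xb: "?X b \<in> carrier (gmod (rdR U) 1)" using linear_map_simps(1)[OF \<psi>(1) m] \<psi>(2)[OF b] by simp
    have "F 1 (dl U b) = gmult (rdR U) 1 0 (?X b) ?e" unfolding C.form1_eq F(4)[OF m] \<psi>(2)[OF b] ..
    \<comment> \<open>\<open>?e\<close> is known as a unit on the left; commutativity in degrees 1
      and 0, which carries no sign, moves it there.\<close>
    also have "\<dots> = gsign (gmod (rdR U) (1 + 0)) (1 * 0) (gmult (rdR U) 0 1 ?e (?X b))"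
      using cdga_rdR[OF U, unfolded is_cdga_def cga_iff] Xb e by blast
    also have "\<dots> = ?X b" unfolding unit[OF Xb] by (simp add: gsign_def)
    finally show ?thesis .
  qed
  ultimately show ?thesis using F(1,2) by (intro exI[of _ F]) blast
qed

text \<open>Although chosen by \<open>SOME\<close>, the map is determined on all forms over
  \<open>U\<close>, being linear, multiplicative and prescribed on b and db.\<close>

definition Fm :: "'x set \<Rightarrow> int \<Rightarrow> 'b kform \<Rightarrow> 'm \<Rightarrow> 'm tvec list \<Rightarrow> real"
  where "Fm U = (SOME F. (\<forall>k. linear_map (RA U) (Lm U k) (gmod (rdR U) k) (F k)) \<and>
    (\<forall>k l. \<forall>x\<in>carrier (Lm U k). \<forall>y\<in>carrier (Lm U l). F (k + l) (wm U k l x y) = gmult (rdR U) k l (F k x) (F l y)) \<and>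
    (\<forall>b\<in>carrier (rings B U). F 0 (form0 (rings B U) b) = DF (pre U) (fs U b)) \<and>
    (\<forall>b\<in>carrier (rings B U). F 1 (dl U b) = dR_diff M (pre U) 0 (DF (pre U) (fs U b))))"

lemma
  assumes U: "openin N U"
  shows Fm_linear: "linear_map (RA U) (Lm U k) (gmod (rdR U) k) (Fm U k)"
    and Fm_mult: "x \<in> carrier (Lm U k) \<Longrightarrow> y \<in> carrier (Lm U l) \<Longrightarrow> Fm U (k + l) (wm U k l x y) = gmult (rdR U) k l (Fm U k x) (Fm U l y)"
    and Fm_form0: "b \<in> carrier (rings B U) \<Longrightarrow> Fm U 0 (form0 (rings B U) b) = DF (pre U) (fs U b)"
    and Fm_dl: "b \<in> carrier (rings B U) \<Longrightarrow> Fm U 1 (dl U b) = dR_diff M (pre U) 0 (DF (pre U) (fs U b))"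
  using someI_ex[OF forms_to_deRham[OF U], folded Fm_def] by blast+

lemma rdR_module: "openin N U \<Longrightarrow> Module.module (RA U) (gmod (rdR U) k)"
  using cdga_rdR[of U] graded_algebra.gmod_module unfolding is_cdga_def cga_iff by blast

lemma Lm_module: "openin N U \<Longrightarrow> Module.module (RA U) (Lm U k)"
  by (rule exterior.Lam_module[OF exterior.intro[OF module_kaehler[OF PF.rings]]])

lemma Fm_closed: "openin N U \<Longrightarrow> x \<in> carrier (Lm U k) \<Longrightarrow> Fm U k x \<in> carrier (gmod (rdR U) k)"
  by (rule linear_map_simps(1)[OF Fm_linear])

lemma Fm_zero: "openin N U \<Longrightarrow> Fm U k \<zero>\<^bsub>Lm U k\<^esub> = \<zero>\<^bsub>gmod (rdR U) k\<^esub>"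
  by (rule linear_map_zero[OF Lm_module rdR_module Fm_linear])

lemma Fm_add: "openin N U \<Longrightarrow> x \<in> carrier (Lm U k) \<Longrightarrow> y \<in> carrier (Lm U k) \<Longrightarrow>
    Fm U k (x \<oplus>\<^bsub>Lm U k\<^esub> y) = Fm U k x \<oplus>\<^bsub>gmod (rdR U) k\<^esub> Fm U k y"
  by (rule linear_map_simps(2)[OF Fm_linear])

text \<open>On b the claim is the prescribed value of \<open>Fm\<close> on db, on db it is d d = 0
  on both sides; the Leibniz rules propagate it to products.\<close>

lemma Fm_diff:
  assumes U: "openin N U" and x: "x \<in> carrier (Lm U k)"
  shows "Fm U (k + 1) (form_d (rings B U) k x) = gdiff (rdR U) k (Fm U k x)"
proof -
  interpret C: cinf_forms "rings B U" by (rule cinf_forms_B[OF U])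
  note d = C.form_d_differential
  have d': "differential (rings B U) (rdR U) (gdiff (rdR U))" and g: "graded_algebra (RA U) (rdR U)"
    using cdga_rdR[OF U] unfolding is_cdga_def cga_iff by blast+
  show ?thesis using x
  proof (induction rule: C.forms_induct)
    case (zero k)
    show ?case
      unfolding diff_zero[OF d Lm_module[OF U]] Fm_zero[OF U] diff_zero[OF d' rdR_module[OF U]] ..
  next
    case (add k x y)
    show ?case
      unfolding diff_add[OF d add(1,2)] Fm_add[OF U add(1,2)] Fm_add[OF U diff_closed[OF d add(1)] diff_closed[OF d add(2)]]
        diff_add[OF d' Fm_closed[OF U add(1)] Fm_closed[OF U add(2)]] add(3,4) ..
  next
    case (mult k l x y)
    have 1: "wm U (k + 1) l (form_d (rings B U) k x) y \<in> carrier (Lm U (k + l + 1))"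
      by (rule C.wclosed[OF diff_closed[OF d mult(1)] mult(2)]) simp
    have 2: "wm U k (l + 1) x (form_d (rings B U) l y) \<in> carrier (Lm U (k + l + 1))"
      by (rule C.wclosed[OF mult(1) diff_closed[OF d mult(2)]]) simp
    have e1: "Fm U (k + l + 1) (wm U (k + 1) l (form_d (rings B U) k x) y) = gmult (rdR U) (k + 1) l (gdiff (rdR U) k (Fm U k x)) (Fm U l y)"
      using Fm_mult[OF U diff_closed[OF d mult(1)] mult(2)] mult(3) by (simp only: ac_simps)
    have e2: "Fm U (k + l + 1) (wm U k (l + 1) x (form_d (rings B U) l y)) = gmult (rdR U) k (l + 1) (Fm U k x) (gdiff (rdR U) l (Fm U l y))"
      using Fm_mult[OF U mult(1) diff_closed[OF d mult(2)]] mult(4) by (simp only: ac_simps)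
    show ?case
      unfolding diff_mult[OF d mult(1,2)] Fm_mult[OF U mult(1,2)] diff_mult[OF d' Fm_closed[OF U mult(1)] Fm_closed[OF U mult(2)]]
        Fm_add[OF U 1 gsign_closed[OF Lm_module[OF U] 2]] e1
        linear_map_gsign_commute[OF Lm_module[OF U] rdR_module[OF U] Fm_linear[OF U] 2] e2 ..
  next
    case (form0 b)
    show ?case using C.form_d_form0[OF form0] Fm_dl[OF U form0] Fm_form0[OF U form0] by simp
  next
    case (form1 b)
    have "DF (pre U) (fs U b) \<in> carrier (gmod (rdR U) 0)"
      using dR_fun_closed[OF pre_open[OF U] fs_closed[OF U form1]] by simp
    from diff_diff[OF d' this] show ?case
      using C.form_d_dl[OF form1] Fm_dl[OF U form1] Fm_zero[OF U, of 2] by simp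
  qed
qed

text \<open>The functions b are settled by \<open>fs_res\<close> and their differentials by
  \<open>dR_diff_restrict\<close>; all other forms follow by \<open>forms_induct\<close>.\<close>

lemma Fm_restrict:
  assumes o: "openin N U" "openin N V" and VU: "V \<subseteq> U" and x: "x \<in> carrier (Lm U k)"
  shows "Fm V k (forms_map (rings B U) (rings B V) (rres B U V) k x) = restrict (Fm U k x) (pre V)"
proof -
  interpret H: cinf_hom "rings B U" "rings B V" "rres B U V"
    by unfold_locales (use o VU PF.rings PF.rres_map in auto)
  note p = pre_mono[OF VU]
  show ?thesis using x
  proof (induction rule: H.FC.forms_induct)
    case (zero k)
    show ?case using p Fm_zero[OF o(1), of k] Fm_zero[OF o(2), of k] by (auto simp: H.FM_zero fun_eq_iff restrict_def)
  next
    case (add k x y)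
    have "Fm V k (H.FM k (x \<oplus>\<^bsub>Lm U k\<^esub> y)) = Fm V k (H.FM k x) \<oplus>\<^bsub>gmod (rdR V) k\<^esub> Fm V k (H.FM k y)"
      unfolding H.FM_add[OF add(1,2)] by (rule Fm_add[OF o(2) H.FM_closed[OF add(1)] H.FM_closed[OF add(2)]])
    then show ?case using p Fm_add[OF o(1) add(1,2)] by (auto simp: add(3,4) fun_eq_iff restrict_def)
  next
    case (mult k l x y)
    have "Fm V (k + l) (H.FM (k + l) (wm U k l x y)) = gmult (rdR V) k l (Fm V k (H.FM k x)) (Fm V l (H.FM l y))"
      unfolding H.FM_mult[OF mult(1,2)] by (rule Fm_mult[OF o(2) H.FM_closed[OF mult(1)] H.FM_closed[OF mult(2)]])
    then show ?case using p Fm_mult[OF o(1) mult(1,2)] by (auto simp: mult(3,4) fun_eq_iff restrict_def)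
  next
    case (form0 b)
    have "Fm V 0 (form0 (rings B V) (rres B U V b)) = DF (pre V) (restrict (fs U b) (pre V))"
      using Fm_form0[OF o(2) cinf_map_closed[OF H.cinf_map form0]] fs_res[OF o VU form0] by simp
    then show ?case using p Fm_form0[OF o(1) form0] by (auto simp: H.FM_form0[OF form0] dR_fun_def fun_eq_iff restrict_def)
  next
    case (form1 b)
    have r: "DF (pre V) (restrict (fs U b) (pre V)) = restrict (DF (pre U) (fs U b)) (pre V)"
      using p by (auto simp: dR_fun_def fun_eq_iff restrict_def)
    have "Fm V 1 (dl V (rres B U V b)) = dR_diff M (pre V) 0 (DF (pre V) (restrict (fs U b) (pre V)))"
      using Fm_dl[OF o(2) cinf_map_closed[OF H.cinf_map form1]] fs_res[OF o VU form1] by simp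
    also have "\<dots> = restrict (dR_diff M (pre U) 0 (DF (pre U) (fs U b))) (pre V)"
      unfolding r by (rule dR_diff_restrict[OF pre_open[OF o(1)] pre_open[OF o(2)] p dR_fun_closed[OF pre_open[OF o(1)] fs_closed[OF o(1) form1]]])
    finally show ?case unfolding H.FM_dl[OF form1] Fm_dl[OF o(1) form1] .
  qed
qed

subsection \<open>Passage to germs\<close>

text \<open>The value at p is that of the image of any section representing \<sigma> near
  \<open>f p\<close>; \<open>Fm_germ\<close> shows that the choice is immaterial.\<close>

definition G :: "'x set \<Rightarrow> int \<Rightarrow> ('x \<Rightarrow> ('x set \<times> 'b kform) set) \<Rightarrow> 'm \<Rightarrow> 'm tvec list \<Rightarrow> real"
  where "G U k \<sigma> = (\<lambda>p\<in>pre U. let r = (SOME r. f p \<in> fst r \<and> PF.lrep k \<sigma> (fst r) (snd r)) in Fm (fst r) k (snd r) p)"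

lemma pre_iff: "p \<in> pre U \<longleftrightarrow> p \<in> topspace T \<and> f p \<in> U"
  by (simp add: preimage_def)

text \<open>Two representatives have the same germ at \<open>f p\<close>, so they agree on a smaller
  \<open>W\<close>, and \<open>Fm_restrict\<close> compares their images over the preimage of
  \<open>W\<close>, which contains p.\<close>

lemma Fm_germ:
  assumes 1: "PF.lrep k \<sigma> U s" "f p \<in> U" and 2: "PF.lrep k \<sigma> V t" "f p \<in> V" and p: "p \<in> topspace T"
  shows "Fm U k s p = Fm V k t p"
proof -
  note l = 1(1)[unfolded PF.lrep_def] 2(1)[unfolded PF.lrep_def]
  have "(V, t) \<in> germ N (degree_presheaf (forms_presheaf B) k) (f p) V t"
    by (rule germ_self) (use l 2(2) in auto)
  also have "\<dots> = germ N (degree_presheaf (forms_presheaf B) k) (f p) U s" using l 1(2) 2(2) by metis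
  finally obtain W where W: "openin N W" "f p \<in> W" "W \<subseteq> U" "W \<subseteq> V"
      and e: "forms_map (rings B U) (rings B W) (rres B U W) k s = forms_map (rings B V) (rings B W) (rres B V W) k t"
    unfolding germ_mem by auto
  have "restrict (Fm U k s) (pre W) = restrict (Fm V k t) (pre W)"
    using Fm_restrict[of U W s k] Fm_restrict[of V W t k] l W e by simp
  moreover have "p \<in> pre W" using p W by (simp add: pre_iff)
  ultimately show ?thesis by (metis restrict_apply')
qed

lemma G_lrep:
  assumes "PF.lrep k \<sigma> V s" "p \<in> pre U" "f p \<in> V"
  shows "G U k \<sigma> p = Fm V k s p"
proof -
  let ?P = "\<lambda>r. f p \<in> fst r \<and> PF.lrep k \<sigma> (fst r) (snd r)"
  have "?P (SOME r. ?P r)" by (rule someI[of ?P "(V, s)"]) (use assms in simp)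
  then have "Fm (fst (SOME r. ?P r)) k (snd (SOME r. ?P r)) p = Fm V k s p"
    using assms by (intro Fm_germ) (auto simp: pre_iff)
  then show ?thesis unfolding G_def Let_def restrict_apply'[OF assms(2)] .
qed

lemma G_ext: "G U k \<sigma> \<in> extensional (pre U)"
  by (simp add: G_def)

lemma G_restrict_lrep:
  assumes "PF.lrep k \<sigma> V s" "V \<subseteq> U"
  shows "restrict (G U k \<sigma>) (pre V) = Fm V k s"
proof (rule extensionalityI[of _ "pre V"])
  show "Fm V k s \<in> extensional (pre V)"
    using Fm_closed[of V s k] assms(1) dR_ext(1)[of "Fm V k s" "pre V" k] by (simp add: PF.lrep_def)
  show "restrict (G U k \<sigma>) (pre V) p = Fm V k s p" if "p \<in> pre V" for p
    using that assms G_lrep[OF assms(1), of p U] by (auto simp: pre_iff)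
qed simp

abbreviation "OM U k \<equiv> gmod (Om U) k"

text \<open>Near each p the family is the image of one section by \<open>G_restrict_lrep\<close>, so
  \<open>dR_glue\<close> applies.\<close>

lemma G_closed:
  assumes U: "openin N U" and \<sigma>: "\<sigma> \<in> carrier (OM U k)"
  shows "G U k \<sigma> \<in> dR_forms M (pre U) k"
proof (rule dR_glue[OF pre_open[OF U] G_ext])
  fix p assume "p \<in> pre U"
  then obtain V s where V: "f p \<in> V" "V \<subseteq> U" "PF.lrep k \<sigma> V s" and p: "p \<in> topspace T"
    using PF.SM_rep[OF \<sigma>[unfolded Omega_def], of "f p"] by (auto simp: pre_iff)
  have o: "openin N V" "s \<in> carrier (Lm V k)" using V(3) by (auto simp: PF.lrep_def)
  have "restrict (G U k \<sigma>) (pre V) \<in> dR_forms M (pre V) k"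
    unfolding G_restrict_lrep[OF V(3,2)] using Fm_closed[OF o] by simp
  then show "\<exists>V'. openin T V' \<and> p \<in> V' \<and> V' \<subseteq> pre U \<and> restrict (G U k \<sigma>) V' \<in> dR_forms M V' k"
    using pre_open[OF o(1)] pre_mono[OF V(2)] V(1) p by (auto simp: pre_iff)
qed

text \<open>Every law is checked at a point p with all operands represented over one neighbourhood
  of \<open>f p\<close>, where it is the corresponding law for \<open>Fm\<close>.\<close>

lemma G_map:
  assumes U: "openin N U"
  shows "cdga_map (rings B U) (Om U) (rdR U) (G U)"
  unfolding cdga_map_def
proof (intro conjI allI ballI, goal_cases)
  note r2 = PF.SM_rep2[folded Omega_def] and r1 = PF.SM_rep[folded Omega_def]
  { case 1 show ?case unfolding Omega_def by (rule PF.is_cdga_sheafify[OF U]) }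
  { case 2 show ?case by (rule cdga_rdR[OF U]) }
  { case 3 show ?case using G_closed[OF U] by simp }
  { case (4 k \<sigma> \<tau>)
    show ?case
    proof (rule extensionalityI[OF G_ext])
      fix p assume p: "p \<in> pre U"
      then obtain V s t where V: "openin N V" "f p \<in> V" "V \<subseteq> U" and st: "PF.lrep k \<sigma> V s" "PF.lrep k \<tau> V t"
        using r2[OF 4, of "f p"] by (auto simp: pre_iff)
      have c: "s \<in> carrier (Lm V k)" "t \<in> carrier (Lm V k)" using st by (auto simp: PF.lrep_def)
      have "PF.lrep k (\<sigma> \<oplus>\<^bsub>OM U k\<^esub> \<tau>) V (s \<oplus>\<^bsub>Lm V k\<^esub> t)"
        using PF.lrep_add[OF V(3) st] by (simp add: Omega_def)
      from G_lrep[OF this p V(2)] show "G U k (\<sigma> \<oplus>\<^bsub>OM U k\<^esub> \<tau>) p = (G U k \<sigma> \<oplus>\<^bsub>gmod (rdR U) k\<^esub> G U k \<tau>) p"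
        using p V Fm_add[OF V(1) c] G_lrep[OF st(1) p V(2)] G_lrep[OF st(2) p V(2)] by (simp add: pre_iff)
    qed simp }
  { case (5 k b \<sigma>)
    show ?case
    proof (rule extensionalityI[OF G_ext])
      fix p assume p: "p \<in> pre U"
      then obtain V s where V: "f p \<in> V" "V \<subseteq> U" and s: "PF.lrep k \<sigma> V s"
        using r1[OF 5(2), of "f p"] by (auto simp: pre_iff)
      have c: "openin N V" "s \<in> carrier (Lm V k)" using s by (auto simp: PF.lrep_def)
      let ?b = "rres B U V b"
      have b': "?b \<in> carrier (rings B V)" by (rule cinf_map_closed[OF PF.rres_map[OF U c(1) V(2)] 5(1)])
      have "PF.lrep k (b \<odot>\<^bsub>OM U k\<^esub> \<sigma>) V (?b \<odot>\<^bsub>Lm V k\<^esub> s)"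
        using PF.lrep_smult[OF U V(2) s 5(1)] by (simp add: Omega_def)
      from G_lrep[OF this p V(1)] show "G U k (b \<odot>\<^bsub>OM U k\<^esub> \<sigma>) p = (b \<odot>\<^bsub>gmod (rdR U) k\<^esub> G U k \<sigma>) p"
        using p V linear_map_simps(3)[OF Fm_linear[OF c(1)], of ?b s k] b' c G_lrep[OF s p V(1)] fs_res[OF U c(1) V(2) 5(1)]
        by (simp add: pre_iff alg_simps)
    qed simp }
  { case (6 k l \<sigma> \<tau>)
    show ?case
    proof (rule extensionalityI[OF G_ext])
      fix p assume p: "p \<in> pre U"
      then obtain V s t where V: "openin N V" "f p \<in> V" "V \<subseteq> U" and st: "PF.lrep k \<sigma> V s" "PF.lrep l \<tau> V t"
        using r2[OF 6, of "f p"] by (auto simp: pre_iff)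
      have c: "s \<in> carrier (Lm V k)" "t \<in> carrier (Lm V l)" using st by (auto simp: PF.lrep_def)
      have "PF.lrep (k + l) (gmult (Om U) k l \<sigma> \<tau>) V (wm V k l s t)"
        using PF.lrep_mult[OF V(3) st] by (simp add: Omega_def)
      from G_lrep[OF this p V(2)] show "G U (k + l) (gmult (Om U) k l \<sigma> \<tau>) p = gmult (rdR U) k l (G U k \<sigma>) (G U l \<tau>) p"
        using p V Fm_mult[OF V(1) c] G_lrep[OF st(1) p V(2)] G_lrep[OF st(2) p V(2)] by (simp add: pre_iff)
    qed simp }
  case (7 k \<sigma>)
  show ?case
  proof (rule extensionalityI[OF G_ext])
    show "gdiff (rdR U) k (G U k \<sigma>) \<in> extensional (pre U)" by (simp add: dR_diff_def)
    fix p assume p: "p \<in> pre U"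
    then obtain V s where V: "f p \<in> V" "V \<subseteq> U" and s: "PF.lrep k \<sigma> V s"
      using r1[OF 7, of "f p"] by (auto simp: pre_iff)
    have c: "openin N V" "s \<in> carrier (Lm V k)" using s by (auto simp: PF.lrep_def)
    have "PF.lrep (k + 1) (gdiff (Om U) k \<sigma>) V (form_d (rings B V) k s)"
      using PF.lrep_diff[OF V(2) s] by (simp add: Omega_def)
    \<comment> \<open>The exterior derivative at p depends on more than the value of the form at p;
      so it is computed from the restriction to the preimage of \<open>V\<close>, where the form is
      a single value of \<open>Fm V k\<close>.\<close>
    from G_lrep[OF this p V(1)] have "G U (k + 1) (gdiff (Om U) k \<sigma>) p = dR_diff M (pre V) k (restrict (G U k \<sigma>) (pre V)) p"
      unfolding G_restrict_lrep[OF s V(2)] Fm_diff[OF c] by simp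
    then show "G U (k + 1) (gdiff (Om U) k \<sigma>) p = gdiff (rdR U) k (G U k \<sigma>) p"
      unfolding dR_diff_restrict[OF pre_open[OF U] pre_open[OF c(1)] pre_mono[OF V(2)] G_closed[OF U 7]] using p V by (simp add: pre_iff)
  qed
qed

text \<open>A representative over \<open>W\<close>, restricted to \<open>W \<inter> V\<close>,
  represents both \<sigma> and its restriction to \<open>V\<close>.\<close>

lemma G_restrict:
  assumes o: "openin N U" "openin N V" and VU: "V \<subseteq> U" and \<sigma>: "\<sigma> \<in> carrier (OM U k)"
  shows "G V k (restrict \<sigma> V) = restrict (G U k \<sigma>) (pre V)"
proof (rule extensionalityI[OF G_ext])
  fix p assume p: "p \<in> pre V"
  then obtain W s where W: "f p \<in> W" "W \<subseteq> U" and s: "PF.lrep k \<sigma> W s"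
    using PF.SM_rep[OF \<sigma>[unfolded Omega_def], of "f p"] VU by (auto simp: pre_iff)
  have oW: "openin N (W \<inter> V)" using s o by (auto simp: PF.lrep_def)
  let ?s = "ares (forms_presheaf B) W (W \<inter> V) k s"
  have l: "PF.lrep k \<sigma> (W \<inter> V) ?s" by (rule PF.lrep_restrict[OF s oW]) simp
  then have l': "PF.lrep k (restrict \<sigma> V) (W \<inter> V) ?s" unfolding PF.lrep_def by auto
  have fp: "f p \<in> W \<inter> V" and pU: "p \<in> pre U" using p W VU by (auto simp: pre_iff)
  show "G V k (restrict \<sigma> V) p = restrict (G U k \<sigma>) (pre V) p"
    using p G_lrep[OF l' p fp] G_lrep[OF l pU fp] by simp
qed simp

lemma G_fun:
  assumes U: "openin N U" and b: "b \<in> carrier (rings B U)"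
  shows "G U 0 (Omega_fun N B U b) = DF (pre U) (fs U b)"
proof (rule extensionalityI[OF G_ext])
  have "PF.lrep 0 (Omega_fun N B U b) U (form0 (rings B U) b)"
    using U cinf_forms.form0_closed[OF cinf_forms_B[OF U] b] by (simp add: PF.lrep_def Omega_fun_def)
  then show "G U 0 (Omega_fun N B U b) p = DF (pre U) (fs U b) p" if "p \<in> pre U" for p
    using G_lrep[of 0 _ U _ p U] that Fm_form0[OF U b] by (simp add: pre_iff)
qed (simp add: dR_fun_def)

end

theorem corollary5p10:
  fixes M :: "'m mfd"
    and N :: "'n topology"
    and B :: "('n, 'b) cinf_presheaf"
    and f :: "'m \<Rightarrow> 'n"
    and fs :: "'n set \<Rightarrow> 'b \<Rightarrow> 'm \<Rightarrow> real"
  assumes "manifold_with_corners M"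
    and "local_cinf_ringed_space N B"
    and "cinf_ringed_space_map (mtop M) (smooth_functions M) N B f fs"
  shows "\<exists>fstar. cdga_map (rings B (topspace N))
      (algs (Omega N B) (topspace N))
      (restrict_scalars (fs (topspace N)) (algs (deRham M) (topspace (mtop M))))
      fstar \<and>
    induced_on_forms M N B f fs fstar"
proof -
  interpret cinf_ringed_map M N B f fs
    by unfold_locales (use assms in \<open>auto simp: local_cinf_ringed_space_def\<close>)
  \<comment> \<open>Continuous maps take the whole space into the whole space, so the global
    component of the push-forward lives on all of M.\<close>
  have top: "preimage (mtop M) f (topspace N) = topspace (mtop M)"
    using assms(3) by (auto simp: preimage_def cinf_ringed_space_map_def continuous_map_def)
  have "cdga_presheaf_map N B (Omega N B) (push_cdga (mtop M) f fs (deRham M)) G"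
    unfolding cdga_presheaf_map_def
  proof (intro conjI allI ballI impI)
    show "cdga_map (rings B U) (Om U) (algs (push_cdga T f fs (deRham M)) U) (G U)" if "openin N U" for U
      using G_map[OF that] by (simp add: push_cdga_def)
    fix U V k \<omega> assume "\<omega> \<in> carrier (OM U k)" "openin N U" "openin N V" "V \<subseteq> U"
    then show "G V k (ares (Omega N B) U V k \<omega>) = ares (push_cdga T f fs (deRham M)) U V k (G U k \<omega>)"
      using G_restrict[of U V \<omega> k] by (simp add: push_cdga_def Omega_def sheafify_def)
  qed
  then have "induced_on_forms M N B f fs (G (topspace N))"
    unfolding induced_on_forms_def using G_fun by blast
  then show ?thesis using G_map[of "topspace N"] top by (intro exI[of _ "G (topspace N)"]) simp
qed

end
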